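(* Let $\gamma>0$, $\mu>0$ and $1<p<5$ (with $\alpha>0$, $\beta>0$). Then the set $\mathcal M_{\gamma,\mu}$ is $H^1(\mathbb R;\mathbb C^3)$-stable for the flow generated by the system $$\begin{cases} i\partial_tu_1+\partial_x^2u_1+\beta|u_1|^{p-1}u_1=-\alpha u_3\overline{u_2},\\ i\partial_tu_2+\partial_x^2u_2+\beta|u_2|^{p-1}u_2=-\alpha u_3\overline{u_1},\\ i\partial_tu_3+\partial_x^2u_3+\beta|u_3|^{p-1}u_3=-\alpha u_1u_2,\end{cases}\qquad (x,t)\in\mathbb R^2,$$ in the following sense: for arbitrary $\epsilon>0$ there exists $\delta>0$ such that, if $\vec u_0\in H^1(\mathbb R;\mathbb C^3)$ satisfies $$\inf_{\vec\varphi\in\mathcal M_{\gamma,\mu}}\|\vec u_0-\vec\varphi\|_{H^1(\mathbb R;\mathbb C^3)}<\delta,$$ then the solution $\vec u(x,t)$ of the system with initial data $\vec u(x,0)=\vec u_0$ satisfies $$\inf_{\vec\varphi\in\mathcal M_{\gamma,\mu}}\|\vec u(\cdot,t)-\vec\varphi\|_{H^1(\mathbb R;\mathbb C^3)}<\epsilon\qquad\text{for all }t\ge0.$$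
   Context: Fix $\alpha>0$, $\beta>0$. $H^1(\mathbb R;\mathbb C^3)$ is the product of three copies of the Sobolev space $H^1(\mathbb R,\mathbb C)$; write $\vec u=(u_1,u_2,u_3)$. Define $$E(\vec u)=\sum_{i=1}^3\Big\{\frac12\int_{\mathbb R}|\partial_xu_i|^2dx-\frac{\beta}{p+1}\int_{\mathbb R}|u_i|^{p+1}dx\Big\}-\alpha\,\mathrm{Re}\int_{\mathbb R}u_1u_2\overline{u_3}\,dx ,$$ $$Q_1(\vec u)=\|u_1\|_{L^2}^2+\|u_3\|_{L^2}^2,\qquad Q_2(\vec u)=\|u_2\|_{L^2}^2+\|u_3\|_{L^2}^2.$$ For $\gamma,\mu>0$ let $J(\gamma,\mu)=\inf\{E(\vec u):\vec u\in H^1(\mathbb R;\mathbb C^3),\ Q_1(\vec u)=\gamma,\ Q_2(\vec u)=\mu\}$ and let $\mathcal M_{\gamma,\mu}$ be the set of all $\vec u\in H^1(\mathbb R;\mathbb C^3)$ with $Q_1(\vec u)=\gamma$, $Q_2(\vec u)=\mu$ and $E(\vec u)=J(\gamma,\mu)$. Known well-posedness facts: for $1<p<5$ and every $\vec u_0\in H^1(\mathbb R;\mathbb C^3)$ the system has a unique global solution $\vec u\in C([0,\infty),H^1(\mathbb R;\mathbb C^3))$ with $\vec u(0)=\vec u_0$, and $E(\vec u(t))=E(\vec u_0)$, $Q_1(\vec u(t))=Q_1(\vec u_0)$, $Q_2(\vec u(t))=Q_2(\vec u_0)$ for all $t\ge0$; "the solution" refers to this one. *)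

theory Defs
  imports "HOL-Analysis.Analysis"
begin

definition L2 :: "(real \<Rightarrow> complex) \<Rightarrow> bool" where
  "L2 f \<longleftrightarrow> f \<in> borel_measurable lborel \<and> integrable lborel (\<lambda>x. (cmod (f x))\<^sup>2)"

text \<open>Infinitely differentiable functions with compact support.  Real-valued test functions
  suffice, also for testing complex-valued functions.\<close>

definition test_function :: "(real \<Rightarrow> real) \<Rightarrow> bool" where
  "test_function \<phi> \<longleftrightarrow>
     (\<forall>n x. (deriv ^^ n) \<phi> field_differentiable (at x)) \<and> (\<exists>R. \<forall>x. R < \<bar>x\<bar> \<longrightarrow> \<phi> x = 0)"

definition pairing :: "(real \<Rightarrow> complex) \<Rightarrow> (real \<Rightarrow> real) \<Rightarrow> complex" where
  "pairing f \<phi> = (\<integral>x. f x * complex_of_real (\<phi> x) \<partial>lborel)"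

text \<open>Meant for \<^term>\<open>f\<close> and \<^term>\<open>g\<close> in \<^const>\<open>L2\<close>, for which both pairings are
  convergent integrals.\<close>

definition has_weak_deriv :: "(real \<Rightarrow> complex) \<Rightarrow> (real \<Rightarrow> complex) \<Rightarrow> bool" where
  "has_weak_deriv f g \<longleftrightarrow>
     (\<forall>\<phi>. test_function \<phi> \<longrightarrow> pairing f (deriv \<phi>) = - pairing g \<phi>)"

text \<open>Elements of Lebesgue and Sobolev spaces are represented by functions, not by classes
  modulo null sets; equality of elements is therefore equality almost everywhere.\<close>

definition H1 :: "(real \<Rightarrow> complex) set" where
  "H1 = {f. L2 f \<and> (\<exists>g. L2 g \<and> has_weak_deriv f g)}"

text \<open>Determined up to a null set, for \<^term>\<open>f \<in> H1\<close>.\<close>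

definition weak_deriv :: "(real \<Rightarrow> complex) \<Rightarrow> real \<Rightarrow> complex" where
  "weak_deriv f = (SOME g. L2 g \<and> has_weak_deriv f g)"

definition L2_sq :: "(real \<Rightarrow> complex) \<Rightarrow> real" where
  "L2_sq f = (\<integral>x. (cmod (f x))\<^sup>2 \<partial>lborel)"

text \<open>A triple is a vector of three functions, with components \<open>u $ 1\<close>, \<open>u $ 2\<close>, \<open>u $ 3\<close>.\<close>

type_synonym triple = "(real \<Rightarrow> complex) ^ 3"

definition H1_3 :: "triple set" where
  "H1_3 = {u. \<forall>i. u $ i \<in> H1}"

definition H1_3_norm :: "triple \<Rightarrow> real" where
  "H1_3_norm u = sqrt (\<Sum>i\<in>UNIV. L2_sq (u $ i) + L2_sq (weak_deriv (u $ i)))"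

definition ae_eq :: "triple \<Rightarrow> triple \<Rightarrow> bool" where
  "ae_eq u v \<longleftrightarrow> (\<forall>i. AE x in lborel. (u $ i) x = (v $ i) x)"

definition energy :: "real \<Rightarrow> real \<Rightarrow> real \<Rightarrow> triple \<Rightarrow> real" where
  "energy \<alpha> \<beta> p u =
     (\<Sum>i\<in>UNIV. 1/2 * L2_sq (weak_deriv (u $ i))
               - \<beta> / (p + 1) * (\<integral>x. cmod ((u $ i) x) powr (p + 1) \<partial>lborel))
     - \<alpha> * Re (\<integral>x. (u $ 1) x * (u $ 2) x * cnj ((u $ 3) x) \<partial>lborel)"

definition Q1 :: "triple \<Rightarrow> real" where
  "Q1 u = L2_sq (u $ 1) + L2_sq (u $ 3)"

definition Q2 :: "triple \<Rightarrow> real" where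
  "Q2 u = L2_sq (u $ 2) + L2_sq (u $ 3)"

definition admissible :: "real \<Rightarrow> real \<Rightarrow> triple set" where
  "admissible \<gamma> \<mu> = {u \<in> H1_3. Q1 u = \<gamma> \<and> Q2 u = \<mu>}"

text \<open>A real infimum: for \<open>1 < p < 5\<close> the energy is bounded below on the constraint set.\<close>

definition J :: "real \<Rightarrow> real \<Rightarrow> real \<Rightarrow> real \<Rightarrow> real \<Rightarrow> real" where
  "J \<alpha> \<beta> p \<gamma> \<mu> = (INF u\<in>admissible \<gamma> \<mu>. energy \<alpha> \<beta> p u)"

definition minimizers :: "real \<Rightarrow> real \<Rightarrow> real \<Rightarrow> real \<Rightarrow> real \<Rightarrow> triple set" where
  "minimizers \<alpha> \<beta> p \<gamma> \<mu> = {u \<in> admissible \<gamma> \<mu>. energy \<alpha> \<beta> p u = J \<alpha> \<beta> p \<gamma> \<mu>}"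

text \<open>Taken in \<^typ>\<open>ennreal\<close>, so that the distance to the empty set is infinite.\<close>

definition H1_3_dist :: "triple \<Rightarrow> triple set \<Rightarrow> ennreal" where
  "H1_3_dist u M = (INF \<phi>\<in>M. ennreal (H1_3_norm (u - \<phi>)))"

text \<open>The equation \<open>i \<partial>\<^sub>t v + \<partial>\<^sub>x\<^sup>2 v + \<beta> |v|\<^sup>p\<^sup>-\<^sup>1 v = F\<close> at every time \<open>t \<ge> 0\<close>
  (one-sided in time at \<open>t = 0\<close>), in the sense of distributions in \<open>x\<close>.\<close>

definition nls_equation ::
    "real \<Rightarrow> real \<Rightarrow> (real \<Rightarrow> real \<Rightarrow> complex) \<Rightarrow> (real \<Rightarrow> real \<Rightarrow> complex) \<Rightarrow> bool" where
  "nls_equation \<beta> p v F \<longleftrightarrow>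
     (\<forall>\<phi> t. test_function \<phi> \<longrightarrow> 0 \<le> t \<longrightarrow>
        (\<exists>D. ((\<lambda>s. pairing (v s) \<phi>) has_vector_derivative D) (at t within {0..}) \<and>
             \<i> * D + pairing (v t) (deriv (deriv \<phi>))
               + pairing (\<lambda>x. of_real (\<beta> * cmod (v t x) powr (p - 1)) * v t x) \<phi>
             = pairing (F t) \<phi>))"

definition solves_system :: "real \<Rightarrow> real \<Rightarrow> real \<Rightarrow> (real \<Rightarrow> triple) \<Rightarrow> bool" where
  "solves_system \<alpha> \<beta> p u \<longleftrightarrow>
     nls_equation \<beta> p (\<lambda>t. u t $ 1) (\<lambda>t x. - of_real \<alpha> * (u t $ 3) x * cnj ((u t $ 2) x)) \<and>
     nls_equation \<beta> p (\<lambda>t. u t $ 2) (\<lambda>t x. - of_real \<alpha> * (u t $ 3) x * cnj ((u t $ 1) x)) \<and>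
     nls_equation \<beta> p (\<lambda>t. u t $ 3) (\<lambda>t x. - of_real \<alpha> * (u t $ 1) x * (u t $ 2) x)"

definition continuous_into_H1_3 :: "(real \<Rightarrow> triple) \<Rightarrow> bool" where
  "continuous_into_H1_3 u \<longleftrightarrow>
     (\<forall>t\<ge>0. u t \<in> H1_3 \<and> ((\<lambda>s. H1_3_norm (u s - u t)) \<longlongrightarrow> 0) (at t within {0..}))"

text \<open>\<open>u t\<close> is the state at time \<open>t\<close>; values at negative times are irrelevant.\<close>

definition global_solution ::
    "real \<Rightarrow> real \<Rightarrow> real \<Rightarrow> triple \<Rightarrow> (real \<Rightarrow> triple) \<Rightarrow> bool" where
  "global_solution \<alpha> \<beta> p u0 u \<longleftrightarrow>
     continuous_into_H1_3 u \<and> solves_system \<alpha> \<beta> p u \<and> ae_eq (u 0) u0"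

text \<open>Existence, uniqueness and conservation laws for the Cauchy problem in \<^const>\<open>H1_3\<close>,
  a classical fact for \<open>1 < p < 5\<close>.\<close>

definition globally_well_posed :: "real \<Rightarrow> real \<Rightarrow> real \<Rightarrow> bool" where
  "globally_well_posed \<alpha> \<beta> p \<longleftrightarrow>
     (\<forall>u0\<in>H1_3. \<exists>u. global_solution \<alpha> \<beta> p u0 u \<and>
        (\<forall>v. global_solution \<alpha> \<beta> p u0 v \<longrightarrow> (\<forall>t\<ge>0. ae_eq (v t) (u t))) \<and>
        (\<forall>t\<ge>0. energy \<alpha> \<beta> p (u t) = energy \<alpha> \<beta> p u0 \<and> Q1 (u t) = Q1 u0 \<and> Q2 (u t) = Q2 u0))"

end

theory Submission
  imports Defs "HOL-Complex_Analysis.Great_Picard"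
begin

text \<open>Minimizing sequences are compact up to translation, and stability follows by contradiction from
  the conservation laws.  Compactness: vanishing would force a nonnegative limit energy, but the
  infimum is negative.  If a sequence splits into a profile \<open>v\<close> and a remainder, a second profile \<open>w\<close>
  can be taken to be a minimizer for the remaining masses, and the infimum is additive for this
  splitting.  Both may be replaced by their moduli.  The energy is submodular,
  \<open>E (v \<or> w) + E (v \<and> w) \<le> E v + E w\<close>, and the masses satisfy the same relation with equality, so the
  maximum of \<open>v\<close> with any translate of \<open>w\<close> is again a minimizer.  Testing with tents shows that
  minimizers have second differences of order \<open>h\<^sup>2\<close>, whereas a maximum taken across a transversal
  crossing has a convex kink.
  When the two profiles share neither of the first two components, moving mass \<open>\<kappa>\<^sup>2\<close> into the third
  component gains energy of order \<open>\<kappa>\<close>.\<close>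

section \<open>Square integrable functions on the line\<close>

text \<open>The obstacle is strict subadditivity: with two independent masses and terms of different
  homogeneity, no single scaling compares a split state with an unsplit one. The second profile may
  itself carry only part of the remaining masses; subadditivity absorbs what is left over. The bound
  on second differences depends only on norm bounds and on a lower bound for the first mass, so one
  constant serves the maxima with all translates. The kink argument avoids derivatives. Align, at a
  level c, the first point where one profile reaches c with the last point where the other one has
  this value. The bounds of order C h^2 for both profiles and for the maximum imply that the first
  profile, at distance h to the left, is still at least c - 3 C h^2. Covering a fixed distance takes
  about 1/h such steps and loses only O(h), so the profile could not decay at minus infinity.
  Neither an Euler-Lagrange equation nor regularity theory enters.\<close>

definition sq_int :: "(real \<Rightarrow> 'a::euclidean_space) \<Rightarrow> bool" where
  "sq_int f \<longleftrightarrow> f \<in> borel_measurable borel \<and> integrable lborel (\<lambda>x. (norm (f x))\<^sup>2)"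

definition sqn :: "(real \<Rightarrow> 'a::euclidean_space) \<Rightarrow> real" where
  "sqn f = (\<integral>x. (norm (f x))\<^sup>2 \<partial>lborel)"

lemma sq_int_meas[measurable_dest]: "sq_int f \<Longrightarrow> f \<in> borel_measurable borel"
  and sq_int_integrable: "sq_int f \<Longrightarrow> integrable lborel (\<lambda>x. (norm (f x))\<^sup>2)"
  by (auto simp: sq_int_def)

lemma sqn_nonneg[simp]: "0 \<le> sqn f"
  by (simp add: sqn_def)

lemma sq_int_bound:
  assumes "f \<in> borel_measurable borel" "integrable lborel k" "\<And>x. (norm (f x))\<^sup>2 \<le> k x"
  shows "sq_int f"
  unfolding sq_int_def
proof
  show "integrable lborel (\<lambda>x. (norm (f x))\<^sup>2)"
    by (rule Bochner_Integration.integrable_bound[OF assms(2)])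
       (use assms(1,3) in \<open>auto intro!: AE_I2 order.trans[OF assms(3)]\<close>)
qed fact

lemma sq_int_zero[simp]: "sq_int (\<lambda>x. 0)"
  by (simp add: sq_int_def)

lemma sqn_zero[simp]: "sqn (\<lambda>x. 0) = 0"
  by (simp add: sqn_def)

lemma sq_int_norm_mult:
  assumes "sq_int f" "sq_int g"
  shows "integrable lborel (\<lambda>x. norm (f x) * norm (g x))"
proof (rule Bochner_Integration.integrable_bound[OF Bochner_Integration.integrable_add[OF sq_int_integrable[OF assms(1)] sq_int_integrable[OF assms(2)]]])
  show "(\<lambda>x. norm (f x) * norm (g x)) \<in> borel_measurable lborel"
    using assms[THEN sq_int_meas] by measurable
  show "AE x in lborel. norm (norm (f x) * norm (g x)) \<le> norm ((norm (f x))\<^sup>2 + (norm (g x))\<^sup>2)"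
  proof (rule AE_I2)
    fix x
    have "0 \<le> (norm (f x) - norm (g x))\<^sup>2" by simp
    then have "2 * (norm (f x) * norm (g x)) \<le> (norm (f x))\<^sup>2 + (norm (g x))\<^sup>2"
      by (simp add: power2_eq_square algebra_simps)
    moreover have "0 \<le> norm (f x) * norm (g x)" by simp
    ultimately show "norm (norm (f x) * norm (g x)) \<le> norm ((norm (f x))\<^sup>2 + (norm (g x))\<^sup>2)"
      unfolding real_norm_def by linarith
  qed
qed

lemma sq_int_inner:
  assumes "sq_int f" "sq_int g"
  shows "integrable lborel (\<lambda>x. f x \<bullet> g x)"
  by (rule Bochner_Integration.integrable_bound[OF sq_int_norm_mult[OF assms]])
     (use assms[THEN sq_int_meas] in \<open>auto intro!: AE_I2 Cauchy_Schwarz_ineq2\<close>)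

lemma sq_int_scaleR: "sq_int f \<Longrightarrow> sq_int (\<lambda>x. c *\<^sub>R f x)"
  by (auto simp: sq_int_def power_mult_distrib)

lemma sqn_scaleR: "sqn (\<lambda>x. c *\<^sub>R f x) = c\<^sup>2 * sqn f"
  by (simp add: sqn_def power_mult_distrib)

lemma sq_int_add:
  assumes "sq_int f" "sq_int g"
  shows "sq_int (\<lambda>x. f x + g x)"
proof (rule sq_int_bound)
  show "(\<lambda>x. f x + g x) \<in> borel_measurable borel"
    using assms[THEN sq_int_meas] by measurable
  show "integrable lborel (\<lambda>x. (norm (f x))\<^sup>2 + 2 * (f x \<bullet> g x) + (norm (g x))\<^sup>2)"
    by (intro Bochner_Integration.integrable_add integrable_mult_right sq_int_inner sq_int_integrable assms)
  show "(norm (f x + g x))\<^sup>2 \<le> (norm (f x))\<^sup>2 + 2 * (f x \<bullet> g x) + (norm (g x))\<^sup>2" for x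
    by (simp add: power2_norm_eq_inner algebra_simps inner_commute)
qed

lemma sq_int_minus: "sq_int f \<Longrightarrow> sq_int (\<lambda>x. - f x)"
  using sq_int_scaleR[of f "-1"] by simp

lemma sq_int_diff:
  assumes "sq_int f" "sq_int g"
  shows "sq_int (\<lambda>x. f x - g x)"
  using sq_int_add[OF assms(1) sq_int_minus[OF assms(2)]] by simp

lemma sqn_add:
  assumes "sq_int f" "sq_int g"
  shows "sqn (\<lambda>x. f x + g x) = sqn f + 2 * (\<integral>x. f x \<bullet> g x \<partial>lborel) + sqn g"
proof -
  have "sqn (\<lambda>x. f x + g x) = (\<integral>x. (norm (f x))\<^sup>2 + 2 * (f x \<bullet> g x) + (norm (g x))\<^sup>2 \<partial>lborel)"
    unfolding sqn_def
    by (rule Bochner_Integration.integral_cong) (auto simp: power2_norm_eq_inner algebra_simps inner_commute)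
  also have "\<dots> = sqn f + 2 * (\<integral>x. f x \<bullet> g x \<partial>lborel) + sqn g"
    unfolding sqn_def using assms by (simp add: sq_int_inner sq_int_integrable)
  finally show ?thesis .
qed

lemma sqn_diff:
  assumes "sq_int f" "sq_int g"
  shows "sqn (\<lambda>x. f x - g x) = sqn f - 2 * (\<integral>x. f x \<bullet> g x \<partial>lborel) + sqn g"
  using sqn_add[OF assms(1) sq_int_minus[OF assms(2)]]
  by (simp add: sqn_def)

text \<open>A quadratic without sign change has nonpositive discriminant: evaluate at the vertex
  c/a, or, if it degenerates to an affine function, at a point where it would be negative.\<close>

lemma quadratic_nonneg_imp:
  fixes a b c :: real
  assumes q: "\<And>t. 0 \<le> t\<^sup>2 * a - 2 * t * c + b" and a: "0 \<le> a"
  shows "c\<^sup>2 \<le> a * b"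
proof (cases "a = 0")
  case True
  have "c = 0"
  proof (rule ccontr)
    assume "c \<noteq> 0"
    \<comment> \<open>This point gives the affine function the value -1.\<close>
    then show False using q[of "(b + 1) / (2 * c)"] True by simp
  qed
  then show ?thesis using True by simp
next
  case False
  then have p: "a > 0" using a by simp
  have "0 \<le> (c / a)\<^sup>2 * a - 2 * (c / a) * c + b" by (rule q)
  also have "\<dots> = (a * b - c\<^sup>2) / a" using p by (simp add: field_simps power2_eq_square)
  finally show ?thesis using p by (simp add: zero_le_divide_iff)
qed

lemma cauchy_schwarz_norm:
  assumes "sq_int f" "sq_int g"
  shows "(\<integral>x. norm (f x) * norm (g x) \<partial>lborel) \<le> sqrt (sqn f) * sqrt (sqn g)"
proof -
  let ?I = "\<integral>x. norm (f x) * norm (g x) \<partial>lborel"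
  have q: "0 \<le> t\<^sup>2 * sqn f - 2 * t * ?I + sqn g" for t
  proof -
    have "0 \<le> (\<integral>x. (t * norm (f x) - norm (g x))\<^sup>2 \<partial>lborel)" by simp
    also have "\<dots> = (\<integral>x. t\<^sup>2 * (norm (f x))\<^sup>2 - 2 * t * (norm (f x) * norm (g x)) + (norm (g x))\<^sup>2 \<partial>lborel)"
      by (rule Bochner_Integration.integral_cong) (auto simp: power2_eq_square algebra_simps)
    also have "\<dots> = t\<^sup>2 * sqn f - 2 * t * ?I + sqn g"
      unfolding sqn_def using assms by (simp add: sq_int_norm_mult sq_int_integrable)
    finally show ?thesis .
  qed
  have I0: "0 \<le> ?I" by simp
  have "?I\<^sup>2 \<le> sqn f * sqn g" by (rule quadratic_nonneg_imp[OF q sqn_nonneg])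
  then have "sqrt (?I\<^sup>2) \<le> sqrt (sqn f * sqn g)" by (rule real_sqrt_le_mono)
  then show ?thesis using I0 by (simp add: real_sqrt_mult)
qed

lemma cauchy_schwarz_inner:
  assumes "sq_int f" "sq_int g"
  shows "\<bar>\<integral>x. f x \<bullet> g x \<partial>lborel\<bar> \<le> sqrt (sqn f) * sqrt (sqn g)"
proof -
  have "\<bar>\<integral>x. f x \<bullet> g x \<partial>lborel\<bar> \<le> (\<integral>x. \<bar>f x \<bullet> g x\<bar> \<partial>lborel)"
    using integral_abs_bound by blast
  also have "\<dots> \<le> (\<integral>x. norm (f x) * norm (g x) \<partial>lborel)"
    by (rule integral_mono) (auto intro!: sq_int_norm_mult sq_int_inner assms integrable_abs Cauchy_Schwarz_ineq2)
  finally show ?thesis using cauchy_schwarz_norm[OF assms] by linarith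
qed

lemma sqrt_sqn_add:
  assumes "sq_int f" "sq_int g"
  shows "sqrt (sqn (\<lambda>x. f x + g x)) \<le> sqrt (sqn f) + sqrt (sqn g)"
proof (rule real_le_lsqrt)
  show "sqn (\<lambda>x. f x + g x) \<le> (sqrt (sqn f) + sqrt (sqn g))\<^sup>2"
    using cauchy_schwarz_inner[OF assms] unfolding sqn_add[OF assms]
    by (simp add: power2_sum)
qed (auto simp: add_nonneg_nonneg)

lemma sqrt_sqn_diff:
  assumes "sq_int f" "sq_int g"
  shows "sqrt (sqn (\<lambda>x. f x - g x)) \<le> sqrt (sqn f) + sqrt (sqn g)"
  using sqrt_sqn_add[OF assms(1) sq_int_minus[OF assms(2)]] by (simp add: sqn_def)

lemma sqn_add_le:
  assumes "sq_int f" "sq_int g"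
  shows "sqn (\<lambda>x. f x + g x) \<le> 2 * sqn f + 2 * sqn g"
proof -
  have "0 \<le> sqn (\<lambda>x. f x - g x)" by simp
  then show ?thesis unfolding sqn_add[OF assms] sqn_diff[OF assms] by linarith
qed

lemma sqn_diff_le:
  assumes "sq_int f" "sq_int g"
  shows "sqn (\<lambda>x. f x - g x) \<le> 2 * sqn f + 2 * sqn g"
proof -
  have "0 \<le> sqn (\<lambda>x. f x + g x)" by simp
  then show ?thesis unfolding sqn_add[OF assms] sqn_diff[OF assms] by linarith
qed

lemma sq_int_indicator:
  assumes "sq_int f" "A \<in> sets borel"
  shows "sq_int (\<lambda>x. indicator A x *\<^sub>R f x)"
proof (rule sq_int_bound[OF _ sq_int_integrable[OF assms(1)]])
  show "(\<lambda>x. indicator A x *\<^sub>R f x) \<in> borel_measurable borel"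
    using sq_int_meas[OF assms(1)] assms(2) by measurable
qed (auto simp: indicator_def)

lemma sqn_indicator_le:
  assumes "sq_int f" "A \<in> sets borel"
  shows "sqn (\<lambda>x. indicator A x *\<^sub>R f x) \<le> sqn f"
  unfolding sqn_def
proof (rule integral_mono)
  show "integrable lborel (\<lambda>x. (norm (indicat_real A x *\<^sub>R f x))\<^sup>2)"
    by (rule sq_int_integrable[OF sq_int_indicator[OF assms]])
  show "integrable lborel (\<lambda>x. (norm (f x))\<^sup>2)"
    by (rule sq_int_integrable[OF assms(1)])
  show "(norm (indicat_real A x *\<^sub>R f x))\<^sup>2 \<le> (norm (f x))\<^sup>2" for x
    by (cases "x \<in> A") simp_all
qed

lemma sqn_cong_AE:
  assumes "f \<in> borel_measurable borel" "g \<in> borel_measurable borel" "AE x in lborel. f x = g x"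
  shows "sqn f = sqn g"
  unfolding sqn_def using assms by (intro integral_cong_AE) auto

text \<open>Fatou's lemma for squared norms; square integrability of the limit is part of the
  conclusion. The bound is demanded only eventually because the completeness proof has it only from
  some index on.\<close>

lemma fatou_sqn:
  fixes f :: "nat \<Rightarrow> real \<Rightarrow> 'a::euclidean_space"
  assumes f: "\<And>n. sq_int (f n)" and g: "g \<in> borel_measurable borel"
    and lim: "AE x in lborel. (\<lambda>n. f n x) \<longlonglongrightarrow> g x"
    and K: "\<forall>\<^sub>F n in sequentially. sqn (f n) \<le> K"
  shows "sq_int g" "sqn g \<le> K"
proof -
  have Kp: "0 \<le> K"
  proof -
    obtain n where "sqn (f n) \<le> K" using eventually_happens'[OF sequentially_bot K] by blast
    then show ?thesis using sqn_nonneg[of "f n"] by linarith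
  qed
  have fm[measurable]: "f n \<in> borel_measurable borel" for n using f by (rule sq_int_meas)
  have nn: "(\<integral>\<^sup>+x. ennreal ((norm (f n x))\<^sup>2) \<partial>lborel) = ennreal (sqn (f n))" for n
    unfolding sqn_def using sq_int_integrable[OF f] by (intro nn_integral_eq_integral) auto
  have "(\<integral>\<^sup>+x. ennreal ((norm (g x))\<^sup>2) \<partial>lborel) = (\<integral>\<^sup>+x. liminf (\<lambda>n. ennreal ((norm (f n x))\<^sup>2)) \<partial>lborel)"
  proof (rule nn_integral_cong_AE)
    show "AE x in lborel. ennreal ((norm (g x))\<^sup>2) = liminf (\<lambda>n. ennreal ((norm (f n x))\<^sup>2))"
      using lim
    proof eventually_elim
      case (elim x)
      have "(\<lambda>n. ennreal ((norm (f n x))\<^sup>2)) \<longlonglongrightarrow> ennreal ((norm (g x))\<^sup>2)"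
        by (intro tendsto_ennrealI tendsto_intros elim)
      from lim_imp_Liminf[OF sequentially_bot this] show ?case by (rule sym)
    qed
  qed
  also have "\<dots> \<le> liminf (\<lambda>n. \<integral>\<^sup>+x. ennreal ((norm (f n x))\<^sup>2) \<partial>lborel)"
    by (rule nn_integral_liminf) measurable
  also have "\<dots> = liminf (\<lambda>n. ennreal (sqn (f n)))" by (simp add: nn)
  also have "\<dots> \<le> ennreal K"
    by (rule Liminf_le[OF sequentially_bot eventually_mono[OF K ennreal_leI]])
  finally have fin: "(\<integral>\<^sup>+x. ennreal ((norm (g x))\<^sup>2) \<partial>lborel) \<le> ennreal K" .
  have int: "integrable lborel (\<lambda>x. (norm (g x))\<^sup>2)"
  proof (rule integrableI_nonneg)
    show "(\<lambda>x. (norm (g x))\<^sup>2) \<in> borel_measurable lborel" using g by measurable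
    show "(\<integral>\<^sup>+x. ennreal ((norm (g x))\<^sup>2) \<partial>lborel) < \<infinity>"
      using fin by (simp add: order.strict_trans1)
  qed auto
  then show "sq_int g" using g by (simp add: sq_int_def)
  have "(\<integral>\<^sup>+x. ennreal ((norm (g x))\<^sup>2) \<partial>lborel) = ennreal (sqn g)"
    unfolding sqn_def using int by (intro nn_integral_eq_integral) auto
  then show "sqn g \<le> K" using fin Kp by (simp add: ennreal_le_iff)
qed

section \<open>Completeness and convergence of integrals\<close>

text \<open>Riesz-Fischer: a fast subsequence has summable increments at almost every point, and
  Fatou's lemma upgrades the pointwise limit to a limit in norm.\<close>

lemma L2_complete:
  fixes f :: "nat \<Rightarrow> real \<Rightarrow> 'a::euclidean_space"
  assumes f: "\<And>n. sq_int (f n)"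
    and cau: "\<And>e. e > 0 \<Longrightarrow> \<exists>N. \<forall>m\<ge>N. \<forall>n\<ge>N. sqn (\<lambda>x. f m x - f n x) \<le> e"
  obtains g where "sq_int g" "(\<lambda>n. sqn (\<lambda>x. f n x - g x)) \<longlonglongrightarrow> 0"
proof -
  have "\<exists>N. \<forall>m\<ge>N. \<forall>n\<ge>N. sqn (\<lambda>x. f m x - f n x) \<le> (1/8)^k" for k :: nat
    by (rule cau) simp
  then obtain N where N: "\<And>k m n. m \<ge> N k \<Longrightarrow> n \<ge> N k \<Longrightarrow> sqn (\<lambda>x. f m x - f n x) \<le> (1/8)^k"
    by metis
  \<comment> \<open>Adding up all thresholds so far, plus k, gives an increasing index above both N
    k and k without a recursive choice.\<close>
  define r where "r k = (\<Sum>i\<le>k. N i) + k" for k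
  have rN: "r k \<ge> N k" for k
    unfolding r_def by (simp add: member_le_sum trans_le_add1)
  have rk: "r k \<ge> k" for k by (simp add: r_def)
  have rmono: "r (Suc k) \<ge> r k" for k by (simp add: r_def)
  define d where "d k x = f (r (Suc k)) x - f (r k) x" for k x
  have dsq: "sq_int (d k)" for k unfolding d_def by (intro sq_int_diff f)
  have dn: "sqn (d k) \<le> (1/8)^k" for k
    unfolding d_def using N[of k "r (Suc k)" "r k"] rN[of k] rmono[of k] by simp
  have meas[measurable]: "d k \<in> borel_measurable borel" for k using dsq by (rule sq_int_meas)
  have fmeas[measurable]: "f k \<in> borel_measurable borel" for k using f by (rule sq_int_meas)
  \<comment> \<open>Squared norms of at most 8^-k leave room for the weight 4^k. Wherever the
    weighted series is finite, the increments are bounded by a multiple of 2^-k, hence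
    summable.\<close>
  define S where "S x = (\<Sum>k. ennreal (4^k * (norm (d k x))\<^sup>2))" for x
  have "(\<integral>\<^sup>+x. S x \<partial>lborel) = (\<Sum>k. \<integral>\<^sup>+x. ennreal (4^k * (norm (d k x))\<^sup>2) \<partial>lborel)"
    unfolding S_def by (rule nn_integral_suminf) measurable
  also have "\<dots> = (\<Sum>k. ennreal (4^k * sqn (d k)))"
  proof (rule suminf_cong)
    fix k
    show "(\<integral>\<^sup>+x. ennreal (4^k * (norm (d k x))\<^sup>2) \<partial>lborel) = ennreal (4^k * sqn (d k))"
      unfolding sqn_def using sq_int_integrable[OF dsq] by (subst nn_integral_eq_integral) auto
  qed
  also have "\<dots> \<le> (\<Sum>k. ennreal ((1/2)^k))"
  proof (rule suminf_le)
    fix k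
    have "4^k * sqn (d k) \<le> 4^k * (1/8)^k" using dn[of k] by (intro mult_left_mono) auto
    also have "\<dots> = (1/2::real)^k" by (simp add: power_mult_distrib[symmetric])
    finally show "ennreal (4^k * sqn (d k)) \<le> ennreal ((1/2)^k)" by (rule ennreal_leI)
  qed auto
  also have "\<dots> < \<infinity>"
    by (subst suminf_ennreal2) (auto simp: summable_geometric)
  finally have "(\<integral>\<^sup>+x. S x \<partial>lborel) \<noteq> \<infinity>" by simp
  then have AES: "AE x in lborel. S x \<noteq> \<infinity>"
    by (intro nn_integral_PInf_AE) (auto simp: S_def)
  have conv: "convergent (\<lambda>k. f (r k) x)" if "S x \<noteq> \<infinity>" for x
  proof -
    have "summable (\<lambda>k. 4^k * (norm (d k x))\<^sup>2)"
      using that unfolding S_def by (intro summable_suminf_not_top) auto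
    then have "(\<lambda>k. 4^k * (norm (d k x))\<^sup>2) \<longlonglongrightarrow> 0" by (rule summable_LIMSEQ_zero)
    then have "Bseq (\<lambda>k. 4^k * (norm (d k x))\<^sup>2)" by (intro convergent_imp_Bseq) (auto simp: convergent_def)
    then obtain C where C: "\<And>k. norm (4^k * (norm (d k x))\<^sup>2) \<le> C" "C > 0" by (auto simp: Bseq_def)
    have "norm (d k x) \<le> sqrt C * (1 / 2)^k" for k
    proof -
      define b :: real where "b = 4 ^ k"
      have b: "b > 0" by (simp add: b_def)
      have "b * (norm (d k x))\<^sup>2 \<le> C" using C(1)[of k] by (simp add: b_def)
      then have "(norm (d k x))\<^sup>2 \<le> C / b" using b by (simp add: pos_le_divide_eq mult.commute)
      then have "norm (d k x) \<le> sqrt (C / b)" by (rule real_le_rsqrt)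
      also have "sqrt (C / b) = sqrt C / 2^k"
        by (simp add: b_def real_sqrt_divide real_sqrt_power)
      also have "\<dots> = sqrt C * (1 / 2)^k"
        by (simp add: power_divide)
      finally show ?thesis .
    qed
    then have "summable (\<lambda>k. d k x)"
    proof (rule summable_comparison_test'[where g="\<lambda>k. sqrt C * (1 / 2)^k" and N=0, rotated])
      show "summable (\<lambda>k. sqrt C * (1 / 2)^k)" by (rule summable_mult[OF summable_geometric]) simp
    qed
    then have "convergent (\<lambda>n. \<Sum>k<n. d k x)" by (simp add: summable_iff_convergent)
    moreover have "(\<Sum>k<n. d k x) = f (r n) x - f (r 0) x" for n
      unfolding d_def by (rule sum_lessThan_telescope)
    ultimately have "convergent (\<lambda>n. f (r n) x - f (r 0) x)" by simp
    from convergent_add[OF this convergent_const[of "f (r 0) x"]] show ?thesis by simp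
  qed
  define g where "g x = lim (\<lambda>k. f (r k) x)" for x
  have gm[measurable]: "g \<in> borel_measurable borel"
    unfolding g_def by measurable
  have AEg: "AE x in lborel. (\<lambda>k. f (r k) x) \<longlonglongrightarrow> g x"
    using AES
  proof eventually_elim
    case (elim x)
    from conv[OF elim] show ?case unfolding g_def convergent_LIMSEQ_iff .
  qed
  \<comment> \<open>Fatou's lemma in the second index, along the subsequence, turns a Cauchy bound
    into a bound on the distance to the limit.\<close>
  have key: "sq_int (\<lambda>x. f n x - g x) \<and> sqn (\<lambda>x. f n x - g x) \<le> e"
    if "\<forall>m\<ge>M. \<forall>n\<ge>M. sqn (\<lambda>x. f m x - f n x) \<le> e" "n \<ge> M" for n M e
  proof -
    have 1: "AE x in lborel. (\<lambda>k. f n x - f (r k) x) \<longlonglongrightarrow> f n x - g x"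
      using AEg by eventually_elim (intro tendsto_intros)
    have 2: "\<forall>\<^sub>F k in sequentially. sqn (\<lambda>x. f n x - f (r k) x) \<le> e"
      using eventually_ge_at_top[of M]
    proof eventually_elim
      case (elim k)
      then have "r k \<ge> M" using rk[of k] by linarith
      then show ?case using that by blast
    qed
    show ?thesis
      using fatou_sqn[of "\<lambda>k x. f n x - f (r k) x", OF sq_int_diff[OF f f] _ 1 2] by simp
  qed
  obtain M1 where "\<forall>m\<ge>M1. \<forall>n\<ge>M1. sqn (\<lambda>x. f m x - f n x) \<le> 1" using cau[of 1] by auto
  from key[OF this order.refl] have "sq_int (\<lambda>x. f M1 x - g x)" by simp
  from sq_int_diff[OF f[of M1] this] have "sq_int g" by simp
  moreover have "(\<lambda>n. sqn (\<lambda>x. f n x - g x)) \<longlonglongrightarrow> 0"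
  proof (rule LIMSEQ_I)
    fix e :: real assume "e > 0"
    then obtain M where M: "\<forall>m\<ge>M. \<forall>n\<ge>M. sqn (\<lambda>x. f m x - f n x) \<le> e/2"
      using cau[of "e/2"] by auto
    have "norm (sqn (\<lambda>x. f n x - g x) - 0) < e" if "n \<ge> M" for n
      using key[OF M that] \<open>e > 0\<close> by simp
    then show "\<exists>no. \<forall>n\<ge>no. norm (sqn (\<lambda>x. f n x - g x) - 0) < e" by blast
  qed
  ultimately show thesis by (rule that)
qed

lemma sqn_tendsto_inner:
  fixes f :: "nat \<Rightarrow> real \<Rightarrow> 'a::euclidean_space"
  assumes "\<And>n. sq_int (f n)" "sq_int g" "sq_int h" "(\<lambda>n. sqn (\<lambda>x. f n x - g x)) \<longlonglongrightarrow> 0"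
  shows "(\<lambda>n. \<integral>x. f n x \<bullet> h x \<partial>lborel) \<longlonglongrightarrow> (\<integral>x. g x \<bullet> h x \<partial>lborel)"
proof (rule LIM_zero_cancel, rule Lim_null_comparison)
  show "\<forall>\<^sub>F n in sequentially. norm ((\<integral>x. f n x \<bullet> h x \<partial>lborel) - (\<integral>x. g x \<bullet> h x \<partial>lborel))
      \<le> sqrt (sqn (\<lambda>x. f n x - g x)) * sqrt (sqn h)"
  proof (rule always_eventually, rule allI)
    fix n
    have "(\<integral>x. f n x \<bullet> h x \<partial>lborel) - (\<integral>x. g x \<bullet> h x \<partial>lborel) = (\<integral>x. (f n x - g x) \<bullet> h x \<partial>lborel)"
      using assms by (simp add: inner_diff_left sq_int_inner)
    then show "norm ((\<integral>x. f n x \<bullet> h x \<partial>lborel) - (\<integral>x. g x \<bullet> h x \<partial>lborel))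
      \<le> sqrt (sqn (\<lambda>x. f n x - g x)) * sqrt (sqn h)"
      using cauchy_schwarz_inner[OF sq_int_diff[OF assms(1)[of n] assms(2)] assms(3)] by simp
  qed
  have "(\<lambda>n. sqrt (sqn (\<lambda>x. f n x - g x)) * sqrt (sqn h)) \<longlonglongrightarrow> sqrt 0 * sqrt (sqn h)"
    by (intro tendsto_intros assms)
  then show "(\<lambda>n. sqrt (sqn (\<lambda>x. f n x - g x)) * sqrt (sqn h)) \<longlonglongrightarrow> 0" by simp
qed

text \<open>The truncation uses half-open intervals with integer ends because these are unions of
  dyadic cells of every level.\<close>

lemma truncated_integral_tendsto:
  fixes f :: "real \<Rightarrow> 'a::{banach, second_countable_topology}"
  assumes "integrable lborel f"
  shows "(\<lambda>M. LINT s:{- real M..<real M}|lborel. f s) \<longlonglongrightarrow> (\<integral>s. f s \<partial>lborel)"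
  unfolding set_lebesgue_integral_def
proof (rule integral_dominated_convergence[where w="\<lambda>s. norm (f s)"])
  show "AE x in lborel. (\<lambda>i. indicat_real {- real i..<real i} x *\<^sub>R f x) \<longlonglongrightarrow> f x"
  proof (rule AE_I2, rule tendsto_eventually)
    fix x :: real
    show "\<forall>\<^sub>F i in sequentially. indicat_real {- real i..<real i} x *\<^sub>R f x = f x"
      using eventually_gt_at_top[of "nat \<lceil>\<bar>x\<bar>\<rceil>"]
    proof eventually_elim
      case (elim i)
      then have "\<bar>x\<bar> < real i" by linarith
      then show ?case by (auto simp: indicator_def)
    qed
  qed
qed (use assms in \<open>auto simp: indicator_def\<close>)

lemma sq_int_set_integrable:
  assumes "sq_int f" "A \<in> sets borel" "emeasure lborel A < \<infinity>"
  shows "set_integrable lborel A f"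
  unfolding set_integrable_def
proof (rule Bochner_Integration.integrable_bound)
  show "integrable lborel (\<lambda>x. indicator A x + (norm (f x))\<^sup>2)"
    using assms by (auto intro!: sq_int_integrable)
  show "(\<lambda>x. indicat_real A x *\<^sub>R f x) \<in> borel_measurable lborel"
    using sq_int_meas[OF assms(1)] assms(2) by measurable
  have "t \<le> 1 + t\<^sup>2" for t :: real
    using zero_le_power2[of "t - 1/2"] by (simp add: power2_eq_square algebra_simps)
  then show "AE x in lborel. norm (indicat_real A x *\<^sub>R f x) \<le> norm (indicat_real A x + (norm (f x))\<^sup>2)"
    by (intro AE_I2) (auto simp: indicator_def)
qed

text \<open>Cauchy-Schwarz against the indicator of A. The right-hand side keeps the restriction to
  A, so that the estimates over many disjoint cells can be added.\<close>

lemma set_integral_norm_le: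
  assumes "sq_int f" "A \<in> sets borel" "emeasure lborel A < \<infinity>"
  shows "(norm (LINT s:A|lborel. f s))\<^sup>2 \<le> measure lborel A * sqn (\<lambda>x. indicator A x *\<^sub>R f x)"
proof -
  have ind: "sq_int (indicator A :: real \<Rightarrow> real)"
  proof -
    have "(\<lambda>x. (norm (indicat_real A x))\<^sup>2) = indicat_real A" by (auto simp: indicator_def)
    then show ?thesis using assms unfolding sq_int_def by simp
  qed
  have indn: "sqn (indicator A :: real \<Rightarrow> real) = measure lborel A"
  proof -
    have "(\<lambda>x. (norm (indicat_real A x))\<^sup>2) = indicat_real A" by (auto simp: indicator_def)
    then show ?thesis using assms unfolding sqn_def by simp
  qed
  have "norm (LINT s:A|lborel. f s) \<le> (\<integral>x. norm (indicator A x *\<^sub>R f x) \<partial>lborel)"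
    unfolding set_lebesgue_integral_def by (rule integral_norm_bound)
  also have "\<dots> = (\<integral>x. norm (indicat_real A x) * norm (indicator A x *\<^sub>R f x) \<partial>lborel)"
    by (rule Bochner_Integration.integral_cong) (auto simp: indicator_def)
  also have "\<dots> \<le> sqrt (sqn (indicator A :: real \<Rightarrow> real)) * sqrt (sqn (\<lambda>x. indicator A x *\<^sub>R f x))"
    by (rule cauchy_schwarz_norm[OF ind sq_int_indicator[OF assms(1,2)]])
  finally have "(norm (LINT s:A|lborel. f s))\<^sup>2 \<le> (sqrt (measure lborel A) * sqrt (sqn (\<lambda>x. indicator A x *\<^sub>R f x)))\<^sup>2"
    unfolding indn by (rule power_mono) simp
  then show ?thesis by (simp add: power_mult_distrib)
qed

section \<open>Sobolev functions as primitives\<close>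

text \<open>\<open>u\<close> is the continuous representative of a Sobolev function and \<open>g\<close> its weak derivative.\<close>

definition H1_pair :: "(real \<Rightarrow> 'a::euclidean_space) \<Rightarrow> (real \<Rightarrow> 'a) \<Rightarrow> bool" where
  "H1_pair u g \<longleftrightarrow> sq_int u \<and> sq_int g \<and> (\<forall>x y. x \<le> y \<longrightarrow> u y - u x = (LINT s:{x..y}|lborel. g s))"

lemma sq_int_interval_integrable:
  assumes "sq_int f"
  shows "set_integrable lborel {x..y} f" "set_integrable lborel {x..<y} f"
proof -
  have "emeasure lborel {x..y} < \<infinity>" "emeasure lborel {x..<y} < \<infinity>"
    by (cases "x \<le> y"; simp)+
  then show "set_integrable lborel {x..y} f" "set_integrable lborel {x..<y} f"
    by (auto intro!: sq_int_set_integrable assms)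
qed

lemma H1_pairD:
  assumes "H1_pair u g"
  shows "sq_int u" "sq_int g" "\<And>x y. x \<le> y \<Longrightarrow> u y - u x = (LINT s:{x..y}|lborel. g s)"
  using assms by (auto simp: H1_pair_def)

lemma H1_pair_zero: "H1_pair (\<lambda>x. 0) (\<lambda>x. 0)"
  by (simp add: H1_pair_def)

lemma H1_pair_scaleR: "H1_pair u g \<Longrightarrow> H1_pair (\<lambda>x. c *\<^sub>R u x) (\<lambda>x. c *\<^sub>R g x)"
  by (auto simp: H1_pair_def sq_int_scaleR simp flip: scaleR_diff_right)

lemma H1_pair_add:
  assumes "H1_pair u g" "H1_pair v h"
  shows "H1_pair (\<lambda>x. u x + v x) (\<lambda>x. g x + h x)"
  unfolding H1_pair_def
proof (intro conjI allI impI)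
  fix x y :: real assume "x \<le> y"
  then show "u y + v y - (u x + v x) = (LINT s:{x..y}|lborel. g s + h s)"
    using H1_pairD(3)[OF assms(1), of x y] H1_pairD(3)[OF assms(2), of x y]
    by (subst set_integral_add) (auto intro!: sq_int_interval_integrable H1_pairD(2)[OF assms(1)] H1_pairD(2)[OF assms(2)] simp: algebra_simps)
qed (use assms in \<open>auto intro: sq_int_add dest: H1_pairD\<close>)

lemma H1_pair_diff:
  assumes "H1_pair u g" "H1_pair v h"
  shows "H1_pair (\<lambda>x. u x - v x) (\<lambda>x. g x - h x)"
  using H1_pair_add[OF assms(1) H1_pair_scaleR[OF assms(2), of "-1"]] by simp

text \<open>Covers coordinate projections, coordinate embeddings, real parts and the inclusion of
  the reals into the complex numbers.\<close>

lemma H1_pair_bounded_linear: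
  assumes "H1_pair u g" "bounded_linear T"
  shows "H1_pair (\<lambda>x. T (u x)) (\<lambda>x. T (g x))"
proof -
  obtain B where B0: "0 \<le> B \<and> (\<forall>x. norm (T x) \<le> norm x * B)"
    using bounded_linear.nonneg_bounded[OF assms(2)] by (rule exE)
  then have B: "\<And>x. norm (T x) \<le> norm x * B" "B \<ge> 0" by simp_all
  have cont: "continuous_on UNIV T" by (rule linear_continuous_on[OF assms(2)])
  have sq: "sq_int (\<lambda>x. T (f x))" if "sq_int f" for f
  proof (rule sq_int_bound)
    show "(\<lambda>x. T (f x)) \<in> borel_measurable borel"
      using borel_measurable_continuous_on[OF cont sq_int_meas[OF that]] .
    show "integrable lborel (\<lambda>x. B\<^sup>2 * (norm (f x))\<^sup>2)" using sq_int_integrable[OF that] by simp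
    show "(norm (T (f x)))\<^sup>2 \<le> B\<^sup>2 * (norm (f x))\<^sup>2" for x
      using power_mono[OF B(1)[of "f x"], of 2] by (simp add: power_mult_distrib mult.commute)
  qed
  show ?thesis
    unfolding H1_pair_def
  proof (intro conjI allI impI sq H1_pairD(1,2)[OF assms(1)])
    fix x y :: real assume "x \<le> y"
    have "T (u y) - T (u x) = T (u y - u x)" using assms(2) by (simp add: linear_diff bounded_linear.linear)
    also have "\<dots> = T (LINT s:{x..y}|lborel. g s)" using H1_pairD(3)[OF assms(1) \<open>x \<le> y\<close>] by simp
    also have "\<dots> = (LINT s|lborel. T (indicat_real {x..y} s *\<^sub>R g s))"
      unfolding set_lebesgue_integral_def
      using integral_bounded_linear[OF assms(2), of lborel "\<lambda>s. indicat_real {x..y} s *\<^sub>R g s"]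
        sq_int_interval_integrable(1)[OF H1_pairD(2)[OF assms(1)], of x y]
      by (simp only: set_integrable_def)
    also have "\<dots> = (LINT s:{x..y}|lborel. T (g s))"
      unfolding set_lebesgue_integral_def
      using assms(2) by (simp add: linear_scale bounded_linear.linear)
    finally show "T (u y) - T (u x) = (LINT s:{x..y}|lborel. T (g s))" .
  qed
qed

section \<open>Translations, Hoelder continuity, pointwise bounds\<close>

lemma integral_translate:
  fixes f :: "real \<Rightarrow> 'b::{banach, second_countable_topology}"
  shows "(\<integral>x. f (x + c) \<partial>lborel) = (\<integral>x. f x \<partial>lborel)"
  using lborel_integral_real_affine[of 1 f c] by (simp add: add.commute)

lemma integrable_translate:
  fixes f :: "real \<Rightarrow> 'b::{banach, second_countable_topology}"
  shows "integrable lborel f \<Longrightarrow> integrable lborel (\<lambda>x. f (x + c))"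
  using lborel_integrable_real_affine[of f 1 c] by (simp add: add.commute)

lemma sq_int_translate: "sq_int f \<Longrightarrow> sq_int (\<lambda>x. f (x + c))"
  unfolding sq_int_def using integrable_translate[of "\<lambda>x. (norm (f x))\<^sup>2" c]
  by (auto intro: measurable_compose[rotated])

lemma sqn_translate: "sqn (\<lambda>x. f (x + c)) = sqn f"
  unfolding sqn_def by (rule integral_translate)

lemma H1_pair_translate:
  assumes "H1_pair u g"
  shows "H1_pair (\<lambda>x. u (x + c)) (\<lambda>x. g (x + c))"
  unfolding H1_pair_def
proof (intro conjI allI impI)
  fix x y :: real assume "x \<le> y"
  then have "u (y + c) - u (x + c) = (LINT s:{x+c..y+c}|lborel. g s)"
    using H1_pairD(3)[OF assms] by simp
  also have "\<dots> = (LINT s|lborel. indicat_real {x+c..y+c} (s + c) *\<^sub>R g (s + c))"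
    unfolding set_lebesgue_integral_def by (rule integral_translate[symmetric])
  also have "\<dots> = (LINT s:{x..y}|lborel. g (s + c))"
    unfolding set_lebesgue_integral_def
    by (rule Bochner_Integration.integral_cong) (auto simp: indicator_def)
  finally show "u (y + c) - u (x + c) = (LINT s:{x..y}|lborel. g (s + c))" .
qed (use assms in \<open>auto intro: sq_int_translate dest: H1_pairD\<close>)

lemma H1_pair_increment:
  assumes "H1_pair u g" "x \<le> y"
  shows "(norm (u y - u x))\<^sup>2 \<le> (y - x) * sqn (\<lambda>s. indicator {x..y} s *\<^sub>R g s)"
  using set_integral_norm_le[OF H1_pairD(2)[OF assms(1)], of "{x..y}"] H1_pairD(3)[OF assms] assms(2)
  by simp

lemma H1_pair_holder:
  assumes "H1_pair u g"
  shows "norm (u y - u x) \<le> sqrt (\<bar>y - x\<bar> * sqn g)"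
proof -
  have *: "norm (u y - u x) \<le> sqrt (\<bar>y - x\<bar> * sqn g)" if "x \<le> y" for x y
  proof (rule real_le_rsqrt)
    have "(norm (u y - u x))\<^sup>2 \<le> (y - x) * sqn (\<lambda>s. indicator {x..y} s *\<^sub>R g s)"
      by (rule H1_pair_increment[OF assms that])
    also have "\<dots> \<le> (y - x) * sqn g"
      using that by (intro mult_left_mono sqn_indicator_le H1_pairD(2)[OF assms]) auto
    finally show "(norm (u y - u x))\<^sup>2 \<le> \<bar>y - x\<bar> * sqn g" using that by simp
  qed
  show ?thesis
    using *[of x y] *[of y x] by (cases "x \<le> y") (auto simp: norm_minus_commute abs_minus_commute)
qed

lemma holder_imp_continuous:
  fixes u :: "real \<Rightarrow> 'a::real_normed_vector"
  assumes "\<And>x y. norm (u y - u x) \<le> sqrt (\<bar>y - x\<bar> * K)"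
  shows "isCont u x"
  unfolding isCont_def
proof (rule LIM_zero_cancel, rule Lim_null_comparison[OF always_eventually], rule allI)
  show "norm (u y - u x) \<le> sqrt (\<bar>y - x\<bar> * K)" for y by (rule assms)
  have "((\<lambda>y. sqrt (\<bar>y - x\<bar> * K)) \<longlongrightarrow> sqrt (\<bar>x - x\<bar> * K)) (at x)" by (intro tendsto_intros)
  then show "((\<lambda>y. sqrt (\<bar>y - x\<bar> * K)) \<longlongrightarrow> 0) (at x)" by simp
qed

lemma H1_pair_isCont: "H1_pair u g \<Longrightarrow> isCont u x"
  by (rule holder_imp_continuous[OF H1_pair_holder])

text \<open>Average |u(x)|^2 \<le> 2 |u(y)|^2 + 2 |u(y) - u(x)|^2 over y in an interval of length L.
  The free length matters: L = 1 gives decay at infinity, a balanced L gives the interpolation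
  inequality, and L near 0 shows that zero mass forces zero values.\<close>

lemma H1_pair_pointwise:
  assumes "H1_pair u g" "L > 0"
  shows "(norm (u x))\<^sup>2 \<le> 2 / L * sqn (\<lambda>s. indicator {x..x+L} s *\<^sub>R u s)
            + 2 * L * sqn (\<lambda>s. indicator {x..x+L} s *\<^sub>R g s)"
proof -
  let ?G = "sqn (\<lambda>s. indicator {x..x+L} s *\<^sub>R g s)"
  let ?U = "sqn (\<lambda>s. indicator {x..x+L} s *\<^sub>R u s)"
  note u = H1_pairD(1)[OF assms(1)] and g = H1_pairD(2)[OF assms(1)]
  have pt: "(norm (u x))\<^sup>2 \<le> 2 * (norm (u y))\<^sup>2 + 2 * L * ?G" if "y \<in> {x..x+L}" for y
  proof -
    have "(norm (u y - u x))\<^sup>2 \<le> (y - x) * sqn (\<lambda>s. indicator {x..y} s *\<^sub>R g s)"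
      by (rule H1_pair_increment[OF assms(1)]) (use that in auto)
    also have "\<dots> \<le> L * ?G"
    proof (rule mult_mono)
      have "sqn (\<lambda>s. indicator {x..y} s *\<^sub>R (indicator {x..x+L} s *\<^sub>R g s)) \<le> ?G"
        by (intro sqn_indicator_le sq_int_indicator g) auto
      also have "(\<lambda>s. indicat_real {x..y} s *\<^sub>R (indicator {x..x+L} s *\<^sub>R g s)) = (\<lambda>s. indicator {x..y} s *\<^sub>R g s)"
        using that by (auto simp: indicator_def fun_eq_iff)
      finally show "sqn (\<lambda>s. indicator {x..y} s *\<^sub>R g s) \<le> ?G" .
    qed (use that assms(2) in auto)
    finally have 1: "(norm (u y - u x))\<^sup>2 \<le> L * ?G" .
    have "norm (u x) \<le> norm (u y) + norm (u y - u x)" by norm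
    then have "(norm (u x))\<^sup>2 \<le> (norm (u y) + norm (u y - u x))\<^sup>2" by (rule power_mono) simp
    also have "\<dots> \<le> 2 * (norm (u y))\<^sup>2 + 2 * (norm (u y - u x))\<^sup>2"
      using zero_le_power2[of "norm (u y) - norm (u y - u x)"]
      unfolding power2_sum power2_diff by linarith
    finally show ?thesis using 1 by linarith
  qed
  have iu: "integrable lborel (\<lambda>s. indicat_real {x..x+L} s * (norm (u s))\<^sup>2)"
    using integrable_mult_indicator[OF _ sq_int_integrable[OF u], of "{x..x+L}"] by simp
  have "L * (norm (u x))\<^sup>2 = (\<integral>s. indicat_real {x..x+L} s * (norm (u x))\<^sup>2 \<partial>lborel)"
    using assms(2) by simp
  also have "\<dots> \<le> (\<integral>s. 2 * (indicat_real {x..x+L} s * (norm (u s))\<^sup>2) + 2 * L * ?G * indicat_real {x..x+L} s \<partial>lborel)"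
  proof (rule integral_mono)
    show "integrable lborel (\<lambda>s. 2 * (indicat_real {x..x+L} s * (norm (u s))\<^sup>2) + 2 * L * ?G * indicat_real {x..x+L} s)"
      using assms(2) by (intro Bochner_Integration.integrable_add integrable_mult_right iu integrable_real_indicator) auto
    show "integrable lborel (\<lambda>s. indicat_real {x..x+L} s * (norm (u x))\<^sup>2)"
      using assms(2) by (intro integrable_mult_left integrable_real_indicator) auto
    show "indicat_real {x..x+L} s * (norm (u x))\<^sup>2
        \<le> 2 * (indicat_real {x..x+L} s * (norm (u s))\<^sup>2) + 2 * L * ?G * indicat_real {x..x+L} s" for s
      using pt[of s] by (cases "s \<in> {x..x+L}") simp_all
  qed
  also have "\<dots> = 2 * (\<integral>s. indicat_real {x..x+L} s * (norm (u s))\<^sup>2 \<partial>lborel) + 2 * L * ?G * L"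
  proof -
    have ii: "integrable lborel (indicat_real {x..x+L})"
      using assms(2) by (intro integrable_real_indicator) auto
    have im: "integral\<^sup>L lborel (indicat_real {x..x+L}) = L" using assms(2) by simp
    show ?thesis
      by (subst Bochner_Integration.integral_add)
         (simp_all only: integrable_mult_right[OF iu] integrable_mult_right[OF ii]
            integral_mult_right_zero im)
  qed
  also have "(\<integral>s. indicat_real {x..x+L} s * (norm (u s))\<^sup>2 \<partial>lborel) = ?U"
    unfolding sqn_def by (rule Bochner_Integration.integral_cong) (auto simp: indicator_def)
  also have "2 * ?U + 2 * L * ?G * L = L * (2 / L * ?U + 2 * L * ?G)"
    using assms(2) by (simp add: field_simps)
  finally have "L * (norm (u x))\<^sup>2 \<le> L * (2 / L * ?U + 2 * L * ?G)" .
  then show ?thesis using assms(2) by simp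
qed

lemma H1_pair_sup_bound:
  assumes "H1_pair u g" "L > 0"
  shows "(norm (u x))\<^sup>2 \<le> 2 / L * sqn u + 2 * L * sqn g"
proof -
  have "(norm (u x))\<^sup>2 \<le> 2 / L * sqn (\<lambda>s. indicator {x..x+L} s *\<^sub>R u s)
            + 2 * L * sqn (\<lambda>s. indicator {x..x+L} s *\<^sub>R g s)" by (rule H1_pair_pointwise[OF assms])
  also have "\<dots> \<le> 2 / L * sqn u + 2 * L * sqn g"
    using assms(2) by (intro add_mono mult_left_mono sqn_indicator_le H1_pairD[OF assms(1)]) auto
  finally show ?thesis .
qed

lemma H1_pair_bdd:
  assumes "H1_pair u g" "sqn u \<le> K" "sqn g \<le> K"
  shows "norm (u x) \<le> 2 * sqrt K"
proof -
  have "0 \<le> K" using assms(2) sqn_nonneg order.trans by blast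
  moreover have "(norm (u x))\<^sup>2 \<le> 4 * K" using H1_pair_sup_bound[OF assms(1), of 1 x] assms by simp
  then have "norm (u x) \<le> sqrt (4 * K)" using real_le_rsqrt by blast
  ultimately show ?thesis by (simp add: real_sqrt_mult)
qed

text \<open>The unit intervals starting at z n leave every bounded set, so the local norms in the
  pointwise bound vanish by dominated convergence.\<close>

lemma H1_pair_tendsto_zero:
  assumes "H1_pair u g" "\<And>M. \<forall>\<^sub>F n in sequentially. \<bar>z n\<bar> \<ge> (M::real)"
  shows "(\<lambda>n. u (z n)) \<longlonglongrightarrow> 0"
proof -
  have *: "(\<lambda>n. sqn (\<lambda>s. indicator {z n..z n+1} s *\<^sub>R f s)) \<longlonglongrightarrow> 0" if f: "sq_int f" for f :: "real \<Rightarrow> 'a"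
  proof -
    have "(\<lambda>n. \<integral>s. (norm (indicat_real {z n..z n+1} s *\<^sub>R f s))\<^sup>2 \<partial>lborel) \<longlonglongrightarrow> (\<integral>s. 0 \<partial>(lborel :: real measure))"
    proof (rule integral_dominated_convergence[where w="\<lambda>s. (norm (f s))\<^sup>2"])
      show "AE s in lborel. (\<lambda>n. (norm (indicat_real {z n..z n+1} s *\<^sub>R f s))\<^sup>2) \<longlonglongrightarrow> 0"
      proof (rule AE_I2, rule tendsto_eventually)
        fix s
        show "\<forall>\<^sub>F n in sequentially. (norm (indicat_real {z n..z n+1} s *\<^sub>R f s))\<^sup>2 = 0"
          using assms(2)[of "\<bar>s\<bar> + 2"] by eventually_elim (auto simp: indicator_def)
      qed
      show "(\<lambda>s. (norm (indicat_real {z n..z n+1} s *\<^sub>R f s))\<^sup>2) \<in> borel_measurable lborel" for n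
        using sq_int_meas[OF f] by measurable
    qed (use f in \<open>auto intro!: sq_int_integrable AE_I2 simp: indicator_def\<close>)
    then show ?thesis by (simp add: sqn_def)
  qed
  have "(\<lambda>n. 2 / 1 * sqn (\<lambda>s. indicator {z n..z n+1} s *\<^sub>R u s) + 2 * 1 * sqn (\<lambda>s. indicator {z n..z n+1} s *\<^sub>R g s)) \<longlonglongrightarrow> 2 / 1 * 0 + 2 * 1 * 0"
    by (intro tendsto_intros * H1_pairD[OF assms(1)])
  then have "(\<lambda>n. 2 / 1 * sqn (\<lambda>s. indicator {z n..z n+1} s *\<^sub>R u s) + 2 * 1 * sqn (\<lambda>s. indicator {z n..z n+1} s *\<^sub>R g s)) \<longlonglongrightarrow> 0"
    by simp
  then have "(\<lambda>n. (norm (u (z n)))\<^sup>2) \<longlonglongrightarrow> 0"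
    by (rule Lim_null_comparison[rotated]) (use H1_pair_pointwise[OF assms(1), of 1] in \<open>auto intro!: always_eventually\<close>)
  then have "(\<lambda>n. sqrt ((norm (u (z n)))\<^sup>2)) \<longlonglongrightarrow> sqrt 0" by (rule tendsto_real_sqrt)
  then show ?thesis by (simp add: tendsto_norm_zero_iff)
qed

text \<open>Compact intervals form an intersection-stable generator of the Borel sets, so by
  Dynkin's argument the integral of f vanishes over every Borel set; a function with this property
  is zero almost everywhere. The cut-off to [-M, M] supplies global integrability.\<close>

lemma AE_zero_of_interval_integrals:
  fixes f :: "real \<Rightarrow> 'a::euclidean_space"
  assumes int: "\<And>x y. set_integrable lborel {x..y} f"
    and zero: "\<And>x y. x \<le> y \<Longrightarrow> (LINT s:{x..y}|lborel. f s) = 0"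
  shows "AE x in lborel. f x = 0"
proof -
  have "AE x in lborel. x \<in> {- real M..real M} \<longrightarrow> f x = 0" for M :: nat
  proof -
    let ?I = "{- real M..real M}"
    let ?f = "\<lambda>x. indicat_real ?I x *\<^sub>R f x"
    have fi: "integrable lborel ?f" using int[of "- real M" "real M"] by (simp add: set_integrable_def)
    have A: "(LINT s:A|lborel. ?f s) = 0" if "A \<in> sets lborel" for A
    proof -
      have 1: "A \<in> sigma_sets UNIV (range (\<lambda>(a::real, b). {a..b}))"
        using that borel_eq_atLeastAtMost by (metis sets_lborel sets_measure_of top_greatest Pow_UNIV)
      have 2: "Int_stable (range (\<lambda>(a::real, b). {a..b}))"
        unfolding Int_stable_def by (auto simp: image_iff)
      have 3: "range (\<lambda>(a::real, b). {a..b}) \<subseteq> Pow UNIV" by auto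
      from 2 3 1 show ?thesis
      proof (induct rule: sigma_sets_induct_disjoint)
        case (basic A)
        then obtain a b where ab: "A = {a..b}" by auto
        show ?case
        proof (cases "max a (- real M) \<le> min b (real M)")
          case True
          have "(LINT s:A|lborel. ?f s) = (LINT s:{max a (- real M)..min b (real M)}|lborel. f s)"
            unfolding set_lebesgue_integral_def ab
            by (rule Bochner_Integration.integral_cong) (auto simp: indicator_def)
          then show ?thesis using zero[OF True] by simp
        next
          case False
          then have "(\<lambda>s. indicat_real A s *\<^sub>R ?f s) = (\<lambda>s. 0)"
            unfolding ab by (auto simp: indicator_def fun_eq_iff)
          then show ?thesis by (simp add: set_lebesgue_integral_def)
        qed
      next
        case empty
        show ?case by (simp add: set_lebesgue_integral_def)
      next
        case (compl A)
        have Am: "A \<in> sets borel"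
          using compl(1) borel_eq_atLeastAtMost by (metis sets_measure_of top_greatest Pow_UNIV)
        have "(LINT s:UNIV - A|lborel. ?f s) = (\<integral>s. ?f s - indicat_real A s *\<^sub>R ?f s \<partial>lborel)"
          unfolding set_lebesgue_integral_def
          by (rule Bochner_Integration.integral_cong) (auto simp: indicator_def)
        also have "\<dots> = (\<integral>s. ?f s \<partial>lborel) - (LINT s:A|lborel. ?f s)"
          unfolding set_lebesgue_integral_def
          by (intro Bochner_Integration.integral_diff fi integrable_mult_indicator) (simp_all add: Am)
        also have "\<dots> = 0" using compl(2) zero[of "- real M" "real M"] by (simp add: set_lebesgue_integral_def)
        finally show ?case .
      next
        case (union A)
        have Am: "A i \<in> sets borel" for i
          using union(2) borel_eq_atLeastAtMost by (metis UNIV_I image_subset_iff sets_measure_of top_greatest Pow_UNIV)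
        have un: "set_integrable lborel (\<Union>i. A i) ?f"
          unfolding set_integrable_def by (rule integrable_mult_indicator[OF _ fi]) (auto simp: Am)
        have "(\<lambda>i. LINT s:A i|lborel. ?f s) sums (LINT s:(\<Union>i. A i)|lborel. ?f s)"
        proof -
          have "(LINT s:(\<Union>i. A i)|lborel. ?f s) = (\<Sum>i. LINT s:A i|lborel. ?f s)"
            using union(1) by (intro lebesgue_integral_countable_add) 
              (auto simp: Am disjoint_family_on_def un)
          then show ?thesis using union(3) by simp
        qed
        moreover have "(\<lambda>i. LINT s:A i|lborel. ?f s) = (\<lambda>i. 0)" using union(3) by simp
        ultimately show ?case by (metis sums_unique suminf_zero)
      qed
    qed
    have "AE x in lborel. ?f x = 0" by (rule sigma_finite_measure.density_zero[OF sigma_finite_lborel fi A])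
    then show ?thesis by eventually_elim (auto simp: indicator_def split: if_splits)
  qed
  then have "AE x in lborel. \<forall>M. x \<in> {- real M..real M} \<longrightarrow> f x = 0" by (intro AE_all_countable[THEN iffD2] allI)
  then show ?thesis
  proof eventually_elim
    case (elim x)
    obtain M where "\<bar>x\<bar> \<le> real M" using real_arch_simple by blast
    then show ?case using elim by (auto simp: abs_le_iff)
  qed
qed

text \<open>Allows a derivative produced by a limit process to be identified with the one already at
  hand.\<close>

lemma H1_pair_unique:
  assumes "H1_pair u g" "H1_pair u h"
  shows "AE x in lborel. g x = h x"
proof -
  have *: "H1_pair (\<lambda>x. u x - u x) (\<lambda>x. g x - h x)" by (rule H1_pair_diff[OF assms])
  have "AE x in lborel. g x - h x = 0"
  proof (rule AE_zero_of_interval_integrals)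
    show "set_integrable lborel {x..y} (\<lambda>x. g x - h x)" for x y
      by (rule sq_int_interval_integrable[OF H1_pairD(2)[OF *]])
    show "(LINT s:{x..y}|lborel. g s - h s) = 0" if "x \<le> y" for x y
      using H1_pairD(3)[OF * that] by simp
  qed
  then show ?thesis by simp
qed

section \<open>Dyadic difference quotients\<close>

definition dyadic :: "nat \<Rightarrow> int \<Rightarrow> real" where
  "dyadic n k = real_of_int k / 2 ^ n"

definition dincr :: "(real \<Rightarrow> 'a::euclidean_space) \<Rightarrow> nat \<Rightarrow> int \<Rightarrow> 'a" where
  "dincr a n k = a (dyadic n (k + 1)) - a (dyadic n k)"

definition dquot :: "(real \<Rightarrow> 'a::euclidean_space) \<Rightarrow> nat \<Rightarrow> real \<Rightarrow> 'a" where
  "dquot a n x = 2 ^ n *\<^sub>R dincr a n \<lfloor>2 ^ n * x\<rfloor>"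

text \<open>The sums of |increment|^2 / (mesh width) over finite stretches of dyadic grids. This
  condition survives pointwise limits and composition with contractions, which a statement about
  derivatives does not do visibly.\<close>

definition dyadic_bound :: "real \<Rightarrow> (real \<Rightarrow> 'a::euclidean_space) \<Rightarrow> bool" where
  "dyadic_bound K a \<longleftrightarrow> (\<forall>n i j. (\<Sum>k\<in>{i..<j}. 2 ^ n * (norm (dincr a n k))\<^sup>2) \<le> K)"

lemma dyadic_mono: "i \<le> j \<Longrightarrow> dyadic n i \<le> dyadic n j"
  by (simp add: dyadic_def divide_right_mono)

lemma dyadic_refine: "n \<le> m \<Longrightarrow> dyadic n k = dyadic m (k * 2 ^ (m - n))"
proof -
  assume "n \<le> m"
  then have "(2::real) ^ m = 2 ^ (m - n) * 2 ^ n" by (simp flip: power_add)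
  then show ?thesis by (simp add: dyadic_def)
qed

lemma dyadic_nat: "dyadic n (int M * 2 ^ n) = real M" "dyadic n (- (int M * 2 ^ n)) = - real M"
  by (simp_all add: dyadic_def)

lemma dyadic_floor_tendsto: "(\<lambda>n. dyadic n \<lfloor>2 ^ n * x\<rfloor>) \<longlonglongrightarrow> x"
proof (rule LIM_zero_cancel, rule Lim_null_comparison[OF always_eventually], rule allI)
  fix n
  have "\<bar>real_of_int \<lfloor>2 ^ n * x\<rfloor> - 2 ^ n * x\<bar> \<le> 1" by linarith
  then have "\<bar>real_of_int \<lfloor>2 ^ n * x\<rfloor> - 2 ^ n * x\<bar> / 2 ^ n \<le> 1 / 2 ^ n" by (simp add: divide_right_mono)
  also have "\<bar>real_of_int \<lfloor>2 ^ n * x\<rfloor> - 2 ^ n * x\<bar> / 2 ^ n = \<bar>(real_of_int \<lfloor>2 ^ n * x\<rfloor> - 2 ^ n * x) / 2 ^ n\<bar>"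
    by (simp add: abs_divide)
  also have "(real_of_int \<lfloor>2 ^ n * x\<rfloor> - 2 ^ n * x) / 2 ^ n = dyadic n \<lfloor>2 ^ n * x\<rfloor> - x"
    by (simp add: dyadic_def diff_divide_distrib)
  finally show "norm (dyadic n \<lfloor>2 ^ n * x\<rfloor> - x) \<le> (1 / 2) ^ n" by (simp add: power_one_over)
next
  show "(\<lambda>n. (1 / 2 :: real) ^ n) \<longlonglongrightarrow> 0" by (rule LIMSEQ_power_zero) simp
qed

lemma dyadic_cell_floor:
  assumes "x \<in> {dyadic n k..<dyadic n (k + 1)}"
  shows "\<lfloor>2 ^ n * x\<rfloor> = k"
proof (rule floor_unique)
  show "real_of_int k \<le> 2 ^ n * x" using assms by (simp add: dyadic_def field_simps)
  show "2 ^ n * x < real_of_int k + 1" using assms by (simp add: dyadic_def field_simps)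
qed

lemma dquot_cell: "x \<in> {dyadic n k..<dyadic n (k + 1)} \<Longrightarrow> dquot a n x = 2 ^ n *\<^sub>R dincr a n k"
  by (simp add: dquot_def dyadic_cell_floor)

lemma dquot_measurable[measurable]: "dquot a n \<in> borel_measurable borel"
proof -
  have "(\<lambda>x::real. \<lfloor>2 ^ n * x\<rfloor>) \<in> measurable borel (count_space UNIV)" by measurable
  from measurable_compose[OF this, of "\<lambda>k. 2 ^ n *\<^sub>R dincr a n k" borel]
  show ?thesis by (simp add: dquot_def[abs_def])
qed

lemma dyadic_cell_length: "dyadic n (k + 1) - dyadic n k = 1 / 2 ^ n"
  by (simp add: dyadic_def add_divide_distrib)

lemma dyadic_split:
  assumes "i \<le> j"
  shows "{dyadic n i..<dyadic n (j + 1)} = {dyadic n i..<dyadic n j} \<union> {dyadic n j..<dyadic n (j + 1)}"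
  using dyadic_mono[OF assms, of n] dyadic_mono[of j "j+1" n] by auto

lemma dquot_set_integrable: "set_integrable lborel {dyadic n i..<dyadic n j} (dquot a n)"
proof (cases "i \<le> j")
  case True
  then show ?thesis
  proof (induct j rule: int_ge_induct)
    case base
    show ?case by (simp add: set_integrable_def)
  next
    case (step j)
    have "set_integrable lborel {dyadic n j..<dyadic n (j + 1)} (dquot a n)
        \<longleftrightarrow> set_integrable lborel {dyadic n j..<dyadic n (j + 1)} (\<lambda>x. 2 ^ n *\<^sub>R dincr a n j)"
      unfolding set_integrable_def
      by (rule Bochner_Integration.integrable_cong) (auto simp: dquot_cell indicator_def)
    also have "\<dots>" unfolding set_integrable_def
      by (intro integrable_scaleR_left integrable_real_indicator) (auto simp: dyadic_mono)
    finally show ?case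
      unfolding dyadic_split[OF step(1)] by (intro set_integrable_Un step) auto
  qed
next
  case False
  then have "{dyadic n i..<dyadic n j} = {}" using dyadic_mono[of j i n] by auto
  then show ?thesis by (simp add: set_integrable_def)
qed

text \<open>The same identity serves twice: for a derivative and for a finer difference quotient.\<close>

lemma integral_inner_dquot:
  assumes f: "\<And>k. set_integrable lborel {dyadic n k..<dyadic n (k + 1)} f"
    and cell: "\<And>k. (LINT s:{dyadic n k..<dyadic n (k + 1)}|lborel. f s) = dincr a n k"
    and ij: "i \<le> j"
  shows "set_integrable lborel {dyadic n i..<dyadic n j} (\<lambda>s. f s \<bullet> dquot b n s)"
    "(LINT s:{dyadic n i..<dyadic n j}|lborel. f s \<bullet> dquot b n s)
       = (\<Sum>k\<in>{i..<j}. 2 ^ n * (dincr a n k \<bullet> dincr b n k))"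
proof -
  have "set_integrable lborel {dyadic n i..<dyadic n j} (\<lambda>s. f s \<bullet> dquot b n s) \<and>
    (LINT s:{dyadic n i..<dyadic n j}|lborel. f s \<bullet> dquot b n s)
       = (\<Sum>k\<in>{i..<j}. 2 ^ n * (dincr a n k \<bullet> dincr b n k))"
    using ij
  proof (induct j rule: int_ge_induct)
    case base
    show ?case by (simp add: set_integrable_def set_lebesgue_integral_def)
  next
    case (step j)
    let ?C = "{dyadic n j..<dyadic n (j + 1)}" and ?c = "2 ^ n *\<^sub>R dincr b n j"
    have eq: "indicat_real ?C s *\<^sub>R (f s \<bullet> dquot b n s) = (indicat_real ?C s *\<^sub>R f s) \<bullet> ?c" for s
      by (auto simp: dquot_cell indicator_def)
    have fi: "integrable lborel (\<lambda>s. indicat_real ?C s *\<^sub>R f s)" using f by (simp add: set_integrable_def)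
    have i1: "set_integrable lborel ?C (\<lambda>s. f s \<bullet> dquot b n s)"
      unfolding set_integrable_def eq using fi by (rule integrable_inner_left)
    have i2: "(LINT s:?C|lborel. f s \<bullet> dquot b n s) = 2 ^ n * (dincr a n j \<bullet> dincr b n j)"
      unfolding set_lebesgue_integral_def eq using integral_inner_left[OF fi, of ?c] cell[of j]
      by (simp add: set_lebesgue_integral_def)
    have s: "{i..<j + 1} = insert j {i..<j}" using step(1) by auto
    have u: "set_integrable lborel {dyadic n i..<dyadic n (j + 1)} (\<lambda>s. f s \<bullet> dquot b n s)"
      unfolding dyadic_split[OF step(1)] by (intro set_integrable_Un i1 conjunct1[OF step(2)]) auto
    have "(LINT s:{dyadic n i..<dyadic n (j + 1)}|lborel. f s \<bullet> dquot b n s)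
      = (LINT s:{dyadic n i..<dyadic n j}|lborel. f s \<bullet> dquot b n s) + (LINT s:?C|lborel. f s \<bullet> dquot b n s)"
      unfolding dyadic_split[OF step(1)]
      by (intro set_integral_Un i1 conjunct1[OF step(2)]) auto
    then show ?case unfolding i2 s using u step(2) by simp
  qed
  then show "set_integrable lborel {dyadic n i..<dyadic n j} (\<lambda>s. f s \<bullet> dquot b n s)"
    "(LINT s:{dyadic n i..<dyadic n j}|lborel. f s \<bullet> dquot b n s)
       = (\<Sum>k\<in>{i..<j}. 2 ^ n * (dincr a n k \<bullet> dincr b n k))" by auto
qed

lemma dquot_integral:
  assumes "i \<le> j"
  shows "(LINT s:{dyadic n i..<dyadic n j}|lborel. dquot a n s) = a (dyadic n j) - a (dyadic n i)"
  using assms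
proof (induct j rule: int_ge_induct)
  case base
  show ?case by (simp add: set_lebesgue_integral_def)
next
  case (step j)
  let ?C = "{dyadic n j..<dyadic n (j + 1)}"
  have "(LINT s:?C|lborel. dquot a n s) = (LINT s:?C|lborel. 2 ^ n *\<^sub>R dincr a n j)"
    by (rule set_lebesgue_integral_cong) (auto simp: dquot_cell)
  also have "\<dots> = measure lborel ?C *\<^sub>R (2 ^ n *\<^sub>R dincr a n j)"
    by (rule set_integral_const) (auto simp: dyadic_mono)
  also have "\<dots> = dincr a n j" by (simp add: dyadic_mono dyadic_cell_length)
  finally have 1: "(LINT s:?C|lborel. dquot a n s) = dincr a n j" .
  have "(LINT s:{dyadic n i..<dyadic n (j + 1)}|lborel. dquot a n s)
      = (LINT s:{dyadic n i..<dyadic n j}|lborel. dquot a n s) + (LINT s:?C|lborel. dquot a n s)"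
    unfolding dyadic_split[OF step(1)]
    by (intro set_integral_Un dquot_set_integrable) auto
  then show ?case using 1 step by (simp add: dincr_def)
qed

lemma dquot_refined_cell:
  assumes "n \<le> m"
  shows "set_integrable lborel {dyadic n k..<dyadic n (k + 1)} (dquot a m)"
    "(LINT s:{dyadic n k..<dyadic n (k + 1)}|lborel. dquot a m s) = dincr a n k"
  unfolding dyadic_refine[OF assms] dincr_def
  by (rule dquot_set_integrable, rule dquot_integral) (simp add: mult_right_mono)

lemma dquot_inner_integral:
  assumes "n \<le> m" "i \<le> j"
  shows "set_integrable lborel {dyadic n i..<dyadic n j} (\<lambda>s. dquot a m s \<bullet> dquot b n s)"
    "(LINT s:{dyadic n i..<dyadic n j}|lborel. dquot a m s \<bullet> dquot b n s)
       = (\<Sum>k\<in>{i..<j}. 2 ^ n * (dincr a n k \<bullet> dincr b n k))"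
  using integral_inner_dquot[of n "dquot a m" a, OF dquot_refined_cell[OF assms(1)] assms(2)] by auto

text \<open>Over [-M, M) the squared quotient integrates to exactly one of the bounded dyadic sums;
  Fatou's lemma lets M tend to infinity.\<close>

lemma dquot_sq_int:
  assumes "dyadic_bound K a"
  shows "sq_int (dquot a n)" "sqn (dquot a n) \<le> K"
proof -
  let ?f = "\<lambda>M s. indicat_real {- real M..<real M} s *\<^sub>R dquot a n s"
  have M: "{- real M..<real M} = {dyadic n (- (int M * 2 ^ n))..<dyadic n (int M * 2 ^ n)}" for M
    by (simp add: dyadic_nat)
  have ij: "- (int M * 2 ^ n) \<le> int M * 2 ^ n" for M by (rule order.trans[of _ 0]) auto
  have eq: "(norm (?f M s))\<^sup>2 = indicat_real {- real M..<real M} s *\<^sub>R (dquot a n s \<bullet> dquot a n s)" for M s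
    by (auto simp: indicator_def power2_norm_eq_inner)
  have sq: "sq_int (?f M)" for M
    unfolding sq_int_def eq
    using dquot_inner_integral(1)[OF order.refl ij, of n M a a]
    by (auto simp: M[symmetric] set_integrable_def)
  have n: "sqn (?f M) \<le> K" for M
  proof -
    have "sqn (?f M) = (\<Sum>k\<in>{- (int M * 2 ^ n)..<int M * 2 ^ n}. 2 ^ n * (dincr a n k \<bullet> dincr a n k))"
      unfolding sqn_def eq using dquot_inner_integral(2)[OF order.refl ij, of n M a a]
      by (simp add: M[symmetric] set_lebesgue_integral_def)
    also have "\<dots> \<le> K" using assms by (simp add: dyadic_bound_def power2_norm_eq_inner)
    finally show ?thesis .
  qed
  have lim: "AE x in lborel. (\<lambda>M. ?f M x) \<longlonglongrightarrow> dquot a n x"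
  proof (rule AE_I2, rule tendsto_eventually)
    fix x :: real
    show "\<forall>\<^sub>F M in sequentially. ?f M x = dquot a n x"
      using eventually_gt_at_top[of "nat \<lceil>\<bar>x\<bar>\<rceil>"]
    proof eventually_elim
      case (elim M)
      then have "\<bar>x\<bar> < real M" by linarith
      then show ?case by (auto simp: indicator_def)
    qed
  qed
  show "sq_int (dquot a n)" "sqn (dquot a n) \<le> K"
    using fatou_sqn[OF sq dquot_measurable lim always_eventually[OF allI[OF n]]] by auto
qed

text \<open>The coarser quotient is the conditional expectation of the finer one.\<close>

lemma dquot_orthogonal:
  assumes "dyadic_bound K a" "n \<le> m"
  shows "(\<integral>s. dquot a m s \<bullet> dquot a n s \<partial>lborel) = sqn (dquot a n)"
proof -
  have M: "{- real M..<real M} = {dyadic n (- (int M * 2 ^ n))..<dyadic n (int M * 2 ^ n)}" for M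
    by (simp add: dyadic_nat)
  have ij: "- (int M * 2 ^ n) \<le> int M * 2 ^ n" for M by (rule order.trans[of _ 0]) auto
  have eq: "(LINT s:{- real M..<real M}|lborel. dquot a m s \<bullet> dquot a n s) = (LINT s:{- real M..<real M}|lborel. dquot a n s \<bullet> dquot a n s)" for M
    unfolding M dquot_inner_integral(2)[OF assms(2) ij] dquot_inner_integral(2)[OF order.refl ij] ..
  have "(\<lambda>M. LINT s:{- real M..<real M}|lborel. dquot a l s \<bullet> dquot a n s) \<longlonglongrightarrow> (\<integral>s. dquot a l s \<bullet> dquot a n s \<partial>lborel)" for l
    by (intro truncated_integral_tendsto sq_int_inner dquot_sq_int[OF assms(1)])
  note lim = this[of m, unfolded eq] this[of n]
  have "(\<integral>s. dquot a m s \<bullet> dquot a n s \<partial>lborel) = (\<integral>s. dquot a n s \<bullet> dquot a n s \<partial>lborel)"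
    by (rule LIMSEQ_unique[OF lim])
  then show ?thesis by (simp add: sqn_def power2_norm_eq_inner)
qed

text \<open>Due to F. Riesz, here with dyadic partitions only.  It replaces weak compactness in the Sobolev
  space and shows at once that moduli of Sobolev functions are Sobolev functions.\<close>

lemma riesz_dyadic:
  fixes a :: "real \<Rightarrow> 'a::euclidean_space"
  assumes D: "dyadic_bound K a" and cont: "\<And>x. isCont a x" and sq: "sq_int a"
  obtains g where "H1_pair a g" "sqn g \<le> K" "(\<lambda>n. sqn (\<lambda>x. dquot a n x - g x)) \<longlonglongrightarrow> 0"
proof -
  note dq = dquot_sq_int[OF D]
  \<comment> \<open>Pythagoras: by orthogonality the squared norms increase with n, they are bounded
    by K, and their differences are the squared distances. Hence the quotients are Cauchy.\<close>
  have diff: "sqn (\<lambda>x. dquot a m x - dquot a n x) = sqn (dquot a m) - sqn (dquot a n)" if "n \<le> m" for n m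
    using dquot_orthogonal[OF D that] sqn_diff[OF dq(1) dq(1), of m n] by simp
  have inc: "incseq (\<lambda>n. sqn (dquot a n))"
  proof (rule incseq_SucI)
    fix n show "sqn (dquot a n) \<le> sqn (dquot a (Suc n))"
      using diff[of n "Suc n"] sqn_nonneg[of "\<lambda>x. dquot a (Suc n) x - dquot a n x"] by simp
  qed
  have "convergent (\<lambda>n. sqn (dquot a n))"
    using incseq_convergent[OF inc] dq(2) unfolding convergent_def by blast
  then have Cau: "Cauchy (\<lambda>n. sqn (dquot a n))" by (rule convergent_Cauchy)
  obtain g where g: "sq_int g" "(\<lambda>n. sqn (\<lambda>x. dquot a n x - g x)) \<longlonglongrightarrow> 0"
  proof (rule L2_complete[OF dq(1)])
    fix e :: real assume "e > 0"
    then obtain N where N: "\<And>m n. m \<ge> N \<Longrightarrow> n \<ge> N \<Longrightarrow> dist (sqn (dquot a m)) (sqn (dquot a n)) < e"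
      using Cau unfolding Cauchy_def by blast
    have "sqn (\<lambda>x. dquot a m x - dquot a n x) \<le> e" if "m \<ge> N" "n \<ge> N" for m n
    proof (cases "n \<le> m")
      case True
      then show ?thesis using diff[OF True] N[OF that] by (simp add: dist_real_def)
    next
      case False
      then have "sqn (\<lambda>x. dquot a n x - dquot a m x) \<le> e"
        using diff[of m n] N[OF that] by (simp add: dist_real_def)
      then show ?thesis by (simp add: sqn_def norm_minus_commute)
    qed
    then show "\<exists>N. \<forall>m\<ge>N. \<forall>n\<ge>N. sqn (\<lambda>x. dquot a m x - dquot a n x) \<le> e" by blast
  qed
  \<comment> \<open>Polarization: twice the inner product of quotient and g is the sum of their
    squared norms minus the squared distance. In the limit this reads |g|^2 \<le> (K + |g|^2) / 2
    for the norm.\<close>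
  have gK: "sqn g \<le> K"
  proof -
    have "(\<lambda>n. \<integral>x. dquot a n x \<bullet> g x \<partial>lborel) \<longlonglongrightarrow> (\<integral>x. g x \<bullet> g x \<partial>lborel)"
      by (rule sqn_tendsto_inner[OF dq(1) g(1) g(1) g(2)])
    moreover have "(\<integral>x. dquot a n x \<bullet> g x \<partial>lborel) = (sqn (dquot a n) + sqn g - sqn (\<lambda>x. dquot a n x - g x)) / 2" for n
      using sqn_diff[OF dq(1)[of n] g(1)] by simp
    ultimately have l1: "(\<lambda>n. (sqn (dquot a n) + sqn g - sqn (\<lambda>x. dquot a n x - g x)) / 2) \<longlonglongrightarrow> sqn g"
      by (simp add: sqn_def power2_norm_eq_inner)
    have l2: "(\<lambda>n. (K + sqn g - sqn (\<lambda>x. dquot a n x - g x)) / 2) \<longlonglongrightarrow> (K + sqn g - 0) / 2"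
      by (intro tendsto_intros g(2)) simp
    have l3: "(sqn (dquot a n) + sqn g - sqn (\<lambda>x. dquot a n x - g x)) / 2 \<le> (K + sqn g - sqn (\<lambda>x. dquot a n x - g x)) / 2" for n
      using dq(2)[of n] by simp
    have "sqn g \<le> (K + sqn g - 0) / 2" by (rule LIMSEQ_le[OF l1 l2]) (use l3 in blast)
    then show ?thesis by simp
  qed
  \<comment> \<open>Between grid points of level l all finer quotients have the same integral,
    namely the increment of a, so the limit g has it too.\<close>
  have dy: "a (dyadic l j) - a (dyadic l i) = (LINT s:{dyadic l i..<dyadic l j}|lborel. g s)" if "i \<le> j" for l i j
  proof -
    let ?I = "{dyadic l i..<dyadic l j}"
    have int: "(LINT s:?I|lborel. dquot a n s) = a (dyadic l j) - a (dyadic l i)" if "l \<le> n" for n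
      unfolding dyadic_refine[OF that] by (rule dquot_integral) (simp add: \<open>i \<le> j\<close> mult_right_mono)
    have bd: "norm ((a (dyadic l j) - a (dyadic l i)) - (LINT s:?I|lborel. g s))
        \<le> sqrt (measure lborel ?I * sqn (\<lambda>x. dquot a n x - g x))" if "l \<le> n" for n
    proof (rule real_le_rsqrt)
      have "(a (dyadic l j) - a (dyadic l i)) - (LINT s:?I|lborel. g s) = (LINT s:?I|lborel. dquot a n s - g s)"
        unfolding int[OF that, symmetric]
        by (rule set_integral_diff(2)[symmetric]) (intro sq_int_interval_integrable dq g)+
      then have "(norm ((a (dyadic l j) - a (dyadic l i)) - (LINT s:?I|lborel. g s)))\<^sup>2
        \<le> measure lborel ?I * sqn (\<lambda>x. indicator ?I x *\<^sub>R (dquot a n x - g x))"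
        using set_integral_norm_le[OF sq_int_diff[OF dq(1)[of n] g(1)], of ?I] dyadic_mono[OF \<open>i \<le> j\<close>, of l]
        by simp
      also have "\<dots> \<le> measure lborel ?I * sqn (\<lambda>x. dquot a n x - g x)"
        by (intro mult_left_mono sqn_indicator_le sq_int_diff dq g) auto
      finally show "(norm ((a (dyadic l j) - a (dyadic l i)) - (LINT s:?I|lborel. g s)))\<^sup>2
        \<le> measure lborel ?I * sqn (\<lambda>x. dquot a n x - g x)" .
    qed
    have "(\<lambda>n. sqrt (measure lborel ?I * sqn (\<lambda>x. dquot a n x - g x))) \<longlonglongrightarrow> sqrt (measure lborel ?I * 0)"
      by (intro tendsto_intros g)
    then have "norm ((a (dyadic l j) - a (dyadic l i)) - (LINT s:?I|lborel. g s)) \<le> sqrt (measure lborel ?I * 0)"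
      by (rule LIMSEQ_le_const) (use bd in blast)
    then show ?thesis by simp
  qed
  have gint: "set_integrable lborel {x..y} g" for x y by (rule sq_int_interval_integrable[OF g(1)])
  have ico: "(LINT s:{x..<y}|lborel. g s) = (LINT s:{x..y}|lborel. g s)" for x y :: real
    by (rule set_integral_cong_set)
       (use g sq_int_meas in \<open>auto simp: set_borel_measurable_def intro!: AE_I'[of "{y}"] borel_measurable_indicator\<close>)
  \<comment> \<open>Arbitrary endpoints are approximated by dyadic ones; here the continuity of a
    enters.\<close>
  have "a y - a x = (LINT s:{x..y}|lborel. g s)" if "x \<le> y" for x y
  proof -
    let ?x = "\<lambda>n. dyadic n \<lfloor>2 ^ n * x\<rfloor>" and ?y = "\<lambda>n. dyadic n \<lfloor>2 ^ n * y\<rfloor>"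
    have "(\<lambda>n. a (?y n) - a (?x n)) \<longlonglongrightarrow> a y - a x"
      by (intro tendsto_diff isCont_tendsto_compose[OF cont] dyadic_floor_tendsto)
    moreover have "a (?y n) - a (?x n) = (LINT s:{?x n..<?y n}|lborel. g s)" for n
      by (rule dy) (simp add: floor_mono that)
    moreover have "(\<lambda>n. LINT s:{?x n..<?y n}|lborel. g s) \<longlonglongrightarrow> (LINT s:{x..y}|lborel. g s)"
    proof -
      define c where "c = min x y - 1"
      have le: "x - 1 \<le> ?x n \<and> ?x n \<le> x \<and> ?x n \<le> ?y n \<and> ?y n \<le> y" for n
      proof -
        have "2 ^ n * x - 1 \<le> real_of_int \<lfloor>2 ^ n * x\<rfloor>" by linarith
        moreover have "2 ^ n * (x - 1) \<le> 2 ^ n * x - 1" by (simp add: algebra_simps)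
        ultimately have "2 ^ n * (x - 1) \<le> real_of_int \<lfloor>2 ^ n * x\<rfloor>" by linarith
        then have "(x - 1) * 2 ^ n \<le> real_of_int \<lfloor>2 ^ n * x\<rfloor>" by (simp only: mult.commute)
        then have "x - 1 \<le> ?x n" unfolding dyadic_def by (subst pos_le_divide_eq) simp_all
        moreover have "?x n \<le> x" "?y n \<le> y" unfolding dyadic_def by (simp_all add: pos_divide_le_eq mult.commute)
        moreover have "?x n \<le> ?y n" by (intro dyadic_mono floor_mono) (simp add: that)
        ultimately show ?thesis by blast
      qed
      have "(\<lambda>n. \<integral>s. indicat_real {?x n..<?y n} s *\<^sub>R g s \<partial>lborel) \<longlonglongrightarrow> (\<integral>s. indicat_real {x..y} s *\<^sub>R g s \<partial>lborel)"
      proof (rule integral_dominated_convergence[where w="\<lambda>s. norm (indicat_real {x - 1..y} s *\<^sub>R g s)"])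
        show "(\<lambda>s. indicat_real {?x n..<?y n} s *\<^sub>R g s) \<in> borel_measurable lborel" for n
          using sq_int_meas[OF g(1)] by measurable
        show "(\<lambda>s. indicat_real {x..y} s *\<^sub>R g s) \<in> borel_measurable lborel"
          using sq_int_meas[OF g(1)] by measurable
        show "integrable lborel (\<lambda>s. norm (indicat_real {x - 1..y} s *\<^sub>R g s))"
          using gint[of "x - 1" y] unfolding set_integrable_def by (rule integrable_norm)
        show "AE s in lborel. norm (indicat_real {?x n..<?y n} s *\<^sub>R g s) \<le> norm (indicat_real {x - 1..y} s *\<^sub>R g s)" for n
          using le[of n] by (intro AE_I2) (auto simp: indicator_def)
        have "AE s in lborel. s \<noteq> x \<and> s \<noteq> y"
          using AE_lborel_singleton[of x] AE_lborel_singleton[of y] by eventually_elim auto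
        then show "AE s in lborel. (\<lambda>n. indicat_real {?x n..<?y n} s *\<^sub>R g s) \<longlonglongrightarrow> indicat_real {x..y} s *\<^sub>R g s"
        proof eventually_elim
          case (elim s)
          have "\<forall>\<^sub>F n in sequentially. indicat_real {?x n..<?y n} s = indicat_real {x..y} s"
          proof -
            consider "s < x" | "x < s" "s < y" | "y < s" using elim by linarith
            then show ?thesis
            proof cases
              case 1
              from order_tendstoD(1)[OF dyadic_floor_tendsto 1] show ?thesis
                by eventually_elim (use 1 in \<open>auto simp: indicator_def\<close>)
            next
              case 2
              from order_tendstoD(1)[OF dyadic_floor_tendsto 2(2)] show ?thesis
              proof eventually_elim
                case (elim n) then show ?case using le[of n] 2 by (auto simp: indicator_def)
              qed
            next
              case 3
              show ?thesis
              proof (rule always_eventually, rule allI)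
                fix n show "indicat_real {?x n..<?y n} s = indicat_real {x..y} s"
                  using le[of n] 3 by (auto simp: indicator_def)
              qed
            qed
          qed
          then have "\<forall>\<^sub>F n in sequentially. indicat_real {?x n..<?y n} s *\<^sub>R g s = indicat_real {x..y} s *\<^sub>R g s"
            by eventually_elim simp
          then show ?case by (rule tendsto_eventually)
        qed
      qed
      then show ?thesis by (simp add: set_lebesgue_integral_def)
    qed
    ultimately show ?thesis using LIMSEQ_unique by fastforce
  qed
  then have "H1_pair a g" using sq g(1) by (simp add: H1_pair_def)
  then show thesis using gK g(2) that by blast
qed

section \<open>Compactness in the Sobolev space\<close>

lemma H1_pair_dyadic_cell:
  assumes "H1_pair u g"
  shows "set_integrable lborel {x..<y} g" "x \<le> y \<Longrightarrow> (LINT s:{x..<y}|lborel. g s) = u y - u x"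
proof -
  note g = H1_pairD(2)[OF assms]
  show "set_integrable lborel {x..<y} g" by (rule sq_int_interval_integrable[OF g])
  assume "x \<le> y"
  have "(LINT s:{x..<y}|lborel. g s) = (LINT s:{x..y}|lborel. g s)"
    by (rule set_integral_cong_set)
       (use g sq_int_meas in \<open>auto simp: set_borel_measurable_def intro!: AE_I'[of "{y}"] borel_measurable_indicator\<close>)
  then show "(LINT s:{x..<y}|lborel. g s) = u y - u x" using H1_pairD(3)[OF assms \<open>x \<le> y\<close>] by simp
qed

text \<open>The converse of the Riesz criterion: Cauchy-Schwarz on each cell, then addition over the
  cells.\<close>

lemma H1_pair_dyadic_bound:
  assumes "H1_pair u g"
  shows "dyadic_bound (sqn g) u"
  unfolding dyadic_bound_def
proof (intro allI)
  fix n :: nat and i j :: int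
  note g = H1_pairD(2)[OF assms]
  show "(\<Sum>k\<in>{i..<j}. 2 ^ n * (norm (dincr u n k))\<^sup>2) \<le> sqn g"
  proof (cases "i \<le> j")
    case True
    have cell: "2 ^ n * (norm (dincr u n k))\<^sup>2 \<le> (LINT s:{dyadic n k..<dyadic n (k + 1)}|lborel. (norm (g s))\<^sup>2)" for k
    proof -
      let ?C = "{dyadic n k..<dyadic n (k + 1)}"
      have "(norm (LINT s:?C|lborel. g s))\<^sup>2 \<le> measure lborel ?C * sqn (\<lambda>x. indicator ?C x *\<^sub>R g x)"
        by (rule set_integral_norm_le[OF g]) (auto simp: dyadic_mono)
      also have "(LINT s:?C|lborel. g s) = dincr u n k"
        unfolding dincr_def by (rule H1_pair_dyadic_cell(2)[OF assms dyadic_mono]) simp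
      also have "measure lborel ?C = 1 / 2 ^ n" by (simp add: dyadic_mono dyadic_cell_length)
      also have "sqn (\<lambda>x. indicator ?C x *\<^sub>R g x) = (LINT s:?C|lborel. (norm (g s))\<^sup>2)"
        unfolding sqn_def set_lebesgue_integral_def
        by (rule Bochner_Integration.integral_cong) (auto simp: indicator_def)
      finally show ?thesis by (simp add: field_simps)
    qed
    have si: "set_integrable lborel {x..<y} (\<lambda>s. (norm (g s))\<^sup>2)" for x y
      unfolding set_integrable_def by (rule integrable_mult_indicator[OF _ sq_int_integrable[OF g]]) auto
    have "(\<Sum>k\<in>{i..<j}. 2 ^ n * (norm (dincr u n k))\<^sup>2) \<le> (LINT s:{dyadic n i..<dyadic n j}|lborel. (norm (g s))\<^sup>2)"
      using True
    proof (induct j rule: int_ge_induct)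
      case base
      show ?case by (simp add: set_lebesgue_integral_def)
    next
      case (step j)
      have s: "{i..<j + 1} = insert j {i..<j}" using step(1) by auto
      have "(LINT s:{dyadic n i..<dyadic n (j + 1)}|lborel. (norm (g s))\<^sup>2)
        = (LINT s:{dyadic n i..<dyadic n j}|lborel. (norm (g s))\<^sup>2)
          + (LINT s:{dyadic n j..<dyadic n (j + 1)}|lborel. (norm (g s))\<^sup>2)"
        unfolding dyadic_split[OF step(1)] by (intro set_integral_Un si) auto
      then show ?case unfolding s using step(2) cell[of j] by simp
    qed
    also have "\<dots> \<le> sqn g"
      unfolding sqn_def set_lebesgue_integral_def
    proof (rule integral_mono)
      show "integrable lborel (\<lambda>x. indicat_real {dyadic n i..<dyadic n j} x *\<^sub>R (norm (g x))\<^sup>2)"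
        using si by (simp add: set_integrable_def)
      show "integrable lborel (\<lambda>x. (norm (g x))\<^sup>2)" by (rule sq_int_integrable[OF g])
    qed (auto simp: indicator_def)
    finally show ?thesis .
  qed simp
qed

text \<open>Weak convergence of derivatives without weak compactness. The test function h is itself
  a derivative, hence a norm limit of dyadic quotients of v. After truncation only finitely many
  increments of d n are left, and these tend to zero pointwise.\<close>

lemma weak_convergence:
  fixes d k :: "nat \<Rightarrow> real \<Rightarrow> 'a::euclidean_space"
  assumes d: "\<And>n. H1_pair (d n) (k n)" and K: "\<And>n. sqn (k n) \<le> K"
    and lim: "\<And>x. (\<lambda>n. d n x) \<longlonglongrightarrow> 0" and v: "H1_pair v h"
  shows "(\<lambda>n. \<integral>x. k n x \<bullet> h x \<partial>lborel) \<longlonglongrightarrow> 0"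
proof (rule LIMSEQ_I)
  fix e :: real assume e: "e > 0"
  have K0: "0 \<le> K" using K[of 0] sqn_nonneg[of "k 0"] by linarith
  note D = H1_pair_dyadic_bound[OF v]
  obtain h' where h': "H1_pair v h'" "(\<lambda>n. sqn (\<lambda>x. dquot v n x - h' x)) \<longlonglongrightarrow> 0"
    using riesz_dyadic[OF D H1_pair_isCont[OF v] H1_pairD(1)[OF v]] by blast
  note kq = H1_pairD(2)[OF d] and hq = H1_pairD(2)[OF v] and hq' = H1_pairD(2)[OF h'(1)]
  \<comment> \<open>The criterion returns some derivative of v as the limit of the quotients;
    uniqueness identifies it with the given h.\<close>
  have AEh: "AE x in lborel. h x = h' x" by (rule H1_pair_unique[OF v h'(1)])
  have eqh: "(\<integral>x. k n x \<bullet> h x \<partial>lborel) = (\<integral>x. k n x \<bullet> h' x \<partial>lborel)" for n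
    by (rule integral_cong_AE) (use AEh sq_int_meas[OF kq] sq_int_meas[OF hq] sq_int_meas[OF hq'] in auto)
  note dq = dquot_sq_int[OF D]
  have l1: "(\<lambda>n. sqrt K * sqrt (sqn (\<lambda>x. dquot v n x - h' x))) \<longlonglongrightarrow> sqrt K * sqrt 0"
    by (intro tendsto_intros h'(2))
  from order_tendstoD(2)[OF l1, of "e/3"] e
  obtain N where N: "sqrt K * sqrt (sqn (\<lambda>x. dquot v N x - h' x)) < e/3"
    by (auto simp: eventually_sequentially)
  let ?t = "\<lambda>M x. indicat_real {- real M..<real M} x *\<^sub>R dquot v N x"
  have tq: "sq_int (?t M)" for M by (intro sq_int_indicator dq) auto
  have l2: "(\<lambda>M. sqn (\<lambda>x. dquot v N x - ?t M x)) \<longlonglongrightarrow> 0"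
  proof -
    have "(\<lambda>M. LINT s:{- real M..<real M}|lborel. dquot v N s \<bullet> dquot v N s) \<longlonglongrightarrow> (\<integral>s. dquot v N s \<bullet> dquot v N s \<partial>lborel)"
      by (intro truncated_integral_tendsto sq_int_inner dq)
    from tendsto_diff[OF tendsto_const[of "\<integral>s. dquot v N s \<bullet> dquot v N s \<partial>lborel"] this]
    have "(\<lambda>M. (\<integral>s. dquot v N s \<bullet> dquot v N s \<partial>lborel) - (LINT s:{- real M..<real M}|lborel. dquot v N s \<bullet> dquot v N s)) \<longlonglongrightarrow> 0"
      by simp
    moreover have "sqn (\<lambda>x. dquot v N x - ?t M x) = (\<integral>s. dquot v N s \<bullet> dquot v N s \<partial>lborel) - (LINT s:{- real M..<real M}|lborel. dquot v N s \<bullet> dquot v N s)" for M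
    proof -
      have "sqn (\<lambda>x. dquot v N x - ?t M x) = (\<integral>s. dquot v N s \<bullet> dquot v N s - indicat_real {- real M..<real M} s *\<^sub>R (dquot v N s \<bullet> dquot v N s) \<partial>lborel)"
        unfolding sqn_def by (rule Bochner_Integration.integral_cong) (auto simp: indicator_def power2_norm_eq_inner)
      also have "\<dots> = (\<integral>s. dquot v N s \<bullet> dquot v N s \<partial>lborel) - (LINT s:{- real M..<real M}|lborel. dquot v N s \<bullet> dquot v N s)"
        unfolding set_lebesgue_integral_def
        by (intro Bochner_Integration.integral_diff integrable_mult_indicator sq_int_inner dq) auto
      finally show ?thesis .
    qed
    ultimately show ?thesis by simp
  qed
  have l2': "(\<lambda>M. sqrt K * sqrt (sqn (\<lambda>x. dquot v N x - ?t M x))) \<longlonglongrightarrow> sqrt K * sqrt 0"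
    by (intro tendsto_intros l2)
  from order_tendstoD(2)[OF l2', of "e/3"] e
  obtain M where M: "sqrt K * sqrt (sqn (\<lambda>x. dquot v N x - ?t M x)) < e/3"
    by (auto simp: eventually_sequentially)
  let ?i = "- (int M * 2 ^ N)" and ?j = "int M * 2 ^ N"
  have ij: "?i \<le> ?j" by (rule order.trans[of _ 0]) auto
  \<comment> \<open>Against a step function on finitely many dyadic cells the integral sees only
    increments of d n over these cells.\<close>
  have fin: "(\<integral>x. k n x \<bullet> ?t M x \<partial>lborel) = (\<Sum>l\<in>{?i..<?j}. 2 ^ N * (dincr (d n) N l \<bullet> dincr v N l))" for n
  proof -
    have "(\<integral>x. k n x \<bullet> ?t M x \<partial>lborel) = (LINT s:{dyadic N ?i..<dyadic N ?j}|lborel. k n s \<bullet> dquot v N s)"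
      unfolding set_lebesgue_integral_def by (rule Bochner_Integration.integral_cong) (auto simp: dyadic_nat)
    also have "\<dots> = (\<Sum>l\<in>{?i..<?j}. 2 ^ N * (dincr (d n) N l \<bullet> dincr v N l))"
    proof (rule integral_inner_dquot(2)[OF _ _ ij])
      show "set_integrable lborel {dyadic N l..<dyadic N (l + 1)} (k n)" for l
        by (rule H1_pair_dyadic_cell[OF d])
      show "(LINT s:{dyadic N l..<dyadic N (l + 1)}|lborel. k n s) = dincr (d n) N l" for l
        unfolding dincr_def by (rule H1_pair_dyadic_cell(2)[OF d dyadic_mono]) simp
    qed
    finally show ?thesis .
  qed
  have "(\<lambda>n. \<Sum>l\<in>{?i..<?j}. 2 ^ N * (dincr (d n) N l \<bullet> dincr v N l)) \<longlonglongrightarrow> (\<Sum>l\<in>{?i..<?j}. 2 ^ N * ((0 - 0) \<bullet> dincr v N l))"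
    unfolding dincr_def by (intro tendsto_intros lim)
  then have "(\<lambda>n. \<integral>x. k n x \<bullet> ?t M x \<partial>lborel) \<longlonglongrightarrow> 0" unfolding fin by simp
  from LIMSEQ_D[OF this, of "e/3"] e
  obtain n0 where n0: "\<And>n. n \<ge> n0 \<Longrightarrow> \<bar>\<integral>x. k n x \<bullet> ?t M x \<partial>lborel\<bar> < e/3" by auto
  have "norm ((\<integral>x. k n x \<bullet> h x \<partial>lborel) - 0) < e" if "n \<ge> n0" for n
  proof -
    have "(\<integral>x. k n x \<bullet> h' x \<partial>lborel) = (\<integral>x. k n x \<bullet> ?t M x + (k n x \<bullet> (dquot v N x - ?t M x) - k n x \<bullet> (dquot v N x - h' x)) \<partial>lborel)"
      by (rule Bochner_Integration.integral_cong) (auto simp: inner_diff_right)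
    also have "\<dots> = (\<integral>x. k n x \<bullet> ?t M x \<partial>lborel) + ((\<integral>x. k n x \<bullet> (dquot v N x - ?t M x) \<partial>lborel) - (\<integral>x. k n x \<bullet> (dquot v N x - h' x) \<partial>lborel))"
    proof -
      have i1: "integrable lborel (\<lambda>x. k n x \<bullet> ?t M x)" by (rule sq_int_inner[OF kq tq])
      have i2: "integrable lborel (\<lambda>x. k n x \<bullet> (dquot v N x - ?t M x))" by (rule sq_int_inner[OF kq sq_int_diff[OF dq(1) tq]])
      have i3: "integrable lborel (\<lambda>x. k n x \<bullet> (dquot v N x - h' x))" by (rule sq_int_inner[OF kq sq_int_diff[OF dq(1) hq']])
      show ?thesis
        unfolding Bochner_Integration.integral_add[OF i1 Bochner_Integration.integrable_diff[OF i2 i3]]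
          Bochner_Integration.integral_diff[OF i2 i3] ..
    qed
    finally have e1: "(\<integral>x. k n x \<bullet> h x \<partial>lborel) = (\<integral>x. k n x \<bullet> ?t M x \<partial>lborel) + ((\<integral>x. k n x \<bullet> (dquot v N x - ?t M x) \<partial>lborel) - (\<integral>x. k n x \<bullet> (dquot v N x - h' x) \<partial>lborel))"
      unfolding eqh .
    have cs: "\<bar>\<integral>x. k n x \<bullet> f x \<partial>lborel\<bar> \<le> sqrt K * sqrt (sqn f)" if "sq_int f" for f
      using cauchy_schwarz_inner[OF kq that, of n] mult_right_mono[OF real_sqrt_le_mono[OF K[of n]], of "sqrt (sqn f)"]
      by simp
    have "\<bar>\<integral>x. k n x \<bullet> (dquot v N x - ?t M x) \<partial>lborel\<bar> < e/3"
      using cs[OF sq_int_diff[OF dq(1) tq], of N M] M by linarith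
    moreover have "\<bar>\<integral>x. k n x \<bullet> (dquot v N x - h' x) \<partial>lborel\<bar> < e/3"
      using cs[OF sq_int_diff[OF dq(1) hq'], of N] N by linarith
    ultimately show ?thesis unfolding e1 using n0[OF that] by simp
  qed
  then show "\<exists>no. \<forall>n\<ge>no. norm ((\<integral>x. k n x \<bullet> h x \<partial>lborel) - 0) < e" by blast
qed

text \<open>Diagonal extraction on the rationals, extended to all points by the common Hoelder
  bound. The limit is a Sobolev function because the dyadic bound passes to pointwise
  limits.\<close>

theorem H1_pair_subsequence:
  fixes u g :: "nat \<Rightarrow> real \<Rightarrow> 'a::euclidean_space"
  assumes u: "\<And>n. H1_pair (u n) (g n)" and K: "\<And>n. sqn (u n) \<le> K" "\<And>n. sqn (g n) \<le> K"
  obtains r v h where "strict_mono (r :: nat \<Rightarrow> nat)" "H1_pair v h" "\<And>x. (\<lambda>n. u (r n) x) \<longlonglongrightarrow> v x"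
    "sqn v \<le> K" "sqn h \<le> K"
proof -
  obtain r where r: "strict_mono (r :: nat \<Rightarrow> nat)" and rc: "\<And>x. x \<in> \<rat> \<Longrightarrow> \<exists>l. (\<lambda>n. u (r n) x) \<longlonglongrightarrow> l"
    using function_convergent_subsequence[OF countable_rat, of u "2 * sqrt K"] H1_pair_bdd[OF u K] by blast
  have K0: "0 \<le> K" using K(1)[of 0] sqn_nonneg[of "u 0"] by linarith
  have hol: "norm (u n y - u n x) \<le> sqrt (\<bar>y - x\<bar> * K)" for n x y
    by (rule order.trans[OF H1_pair_holder[OF u]]) (intro real_sqrt_le_mono mult_left_mono K, simp)
  have "\<exists>l. (\<lambda>n. u (r n) x) \<longlonglongrightarrow> l" for x
  proof -
    have "Cauchy (\<lambda>n. u (r n) x)"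
    proof (rule metric_CauchyI)
      fix e :: real assume e: "e > 0"
      \<comment> \<open>Over a distance below this \<delta> the Hoelder bound sqrt(\<delta> K) is at
        most e/3; the 1 avoids division by zero.\<close>
      define \<delta> where "\<delta> = (e / 3)\<^sup>2 / (K + 1)"
      have \<delta>: "\<delta> > 0" using e K0 by (simp add: \<delta>_def)
      obtain q where q: "q \<in> \<rat>" "x < q" "q < x + \<delta>" using Rats_dense_in_real[of x "x + \<delta>"] \<delta> by auto
      have "\<bar>x - q\<bar> * K \<le> (e/3)\<^sup>2"
      proof -
        have "\<bar>x - q\<bar> * K \<le> \<delta> * (K + 1)" using q K0 by (intro mult_mono) auto
        then show ?thesis using K0 by (simp add: \<delta>_def)
      qed
      then have sq: "sqrt (\<bar>x - q\<bar> * K) \<le> e/3" using e by (intro real_le_lsqrt) auto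
      from rc[OF q(1)] have "Cauchy (\<lambda>n. u (r n) q)" using LIMSEQ_imp_Cauchy by blast
      from metric_CauchyD[OF this, of "e/3"] e obtain N where
        N: "\<And>m n. m \<ge> N \<Longrightarrow> n \<ge> N \<Longrightarrow> dist (u (r m) q) (u (r n) q) < e/3" by auto
      have "dist (u (r m) x) (u (r n) x) < e" if "m \<ge> N" "n \<ge> N" for m n
      proof -
        have "norm (u (r m) x - u (r m) q) \<le> e/3" "norm (u (r n) x - u (r n) q) \<le> e/3"
          using order.trans[OF hol sq] by auto
        then show ?thesis using N[OF that] by norm
      qed
      then show "\<exists>M. \<forall>m\<ge>M. \<forall>n\<ge>M. dist (u (r m) x) (u (r n) x) < e" by blast
    qed
    then show ?thesis using Cauchy_convergent_iff convergent_def by blast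
  qed
  then obtain v where v: "\<And>x. (\<lambda>n. u (r n) x) \<longlonglongrightarrow> v x" by metis
  have hv: "norm (v y - v x) \<le> sqrt (\<bar>y - x\<bar> * K)" for x y
  proof (rule LIMSEQ_le_const2)
    show "(\<lambda>n. norm (u (r n) y - u (r n) x)) \<longlonglongrightarrow> norm (v y - v x)" by (intro tendsto_intros v)
  qed (use hol in blast)
  have cont: "isCont v x" for x by (rule holder_imp_continuous[OF hv])
  have vm: "v \<in> borel_measurable borel"
    by (rule borel_measurable_continuous_onI) (simp add: continuous_at_imp_continuous_on cont)
  have vs: "sq_int v" "sqn v \<le> K"
    using fatou_sqn[of "\<lambda>n. u (r n)" v K] H1_pairD(1)[OF u] vm v K by auto
  have D: "dyadic_bound K v"
    unfolding dyadic_bound_def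
  proof (intro allI)
    fix n i j
    show "(\<Sum>k\<in>{i..<j}. 2 ^ n * (norm (dincr v n k))\<^sup>2) \<le> K"
    proof (rule LIMSEQ_le_const2)
      show "(\<lambda>m. \<Sum>k\<in>{i..<j}. 2 ^ n * (norm (dincr (u (r m)) n k))\<^sup>2) \<longlonglongrightarrow> (\<Sum>k\<in>{i..<j}. 2 ^ n * (norm (dincr v n k))\<^sup>2)"
        unfolding dincr_def by (intro tendsto_intros v)
      have "(\<Sum>k\<in>{i..<j}. 2 ^ n * (norm (dincr (u (r m)) n k))\<^sup>2) \<le> K" for m
        using H1_pair_dyadic_bound[OF u[of "r m"]] K(2)[of "r m"] order.trans unfolding dyadic_bound_def by blast
      then show "\<exists>N. \<forall>m\<ge>N. (\<Sum>k\<in>{i..<j}. 2 ^ n * (norm (dincr (u (r m)) n k))\<^sup>2) \<le> K" by blast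
    qed
  qed
  obtain h where "H1_pair v h" "sqn h \<le> K" using riesz_dyadic[OF D cont vs(1)] by blast
  then show thesis using that r v vs(2) by blast
qed

text \<open>On a bounded interval the uniform sup bound is an integrable majorant. On the whole line
  the statement would fail, as mass may escape to infinity.\<close>

lemma local_sqn_tendsto:
  fixes d k :: "nat \<Rightarrow> real \<Rightarrow> 'a::euclidean_space"
  assumes d: "\<And>n. H1_pair (d n) (k n)" and K: "\<And>n. sqn (d n) \<le> K" "\<And>n. sqn (k n) \<le> K"
    and lim: "\<And>x. (\<lambda>n. d n x) \<longlonglongrightarrow> 0"
  shows "(\<lambda>n. sqn (\<lambda>x. indicat_real {- R..R} x *\<^sub>R d n x)) \<longlonglongrightarrow> 0"
proof -
  have "(\<lambda>n. \<integral>x. (norm (indicat_real {- R..R} x *\<^sub>R d n x))\<^sup>2 \<partial>lborel) \<longlonglongrightarrow> (\<integral>x. 0 \<partial>(lborel :: real measure))"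
  proof (rule integral_dominated_convergence[where w="\<lambda>x. (2 * sqrt K)\<^sup>2 * indicat_real {- R..R} x"])
    have "emeasure lborel {- R..R} < \<infinity>" by (cases "- R \<le> R") auto
    then show "integrable lborel (\<lambda>x. (2 * sqrt K)\<^sup>2 * indicat_real {- R..R} x)"
      by (intro integrable_mult_right integrable_real_indicator) auto
    show "(\<lambda>x. (norm (indicat_real {- R..R} x *\<^sub>R d n x))\<^sup>2) \<in> borel_measurable lborel" for n
      using sq_int_meas[OF H1_pairD(1)[OF d[of n]]] by measurable
    show "AE x in lborel. (\<lambda>n. (norm (indicat_real {- R..R} x *\<^sub>R d n x))\<^sup>2) \<longlonglongrightarrow> 0"
    proof (rule AE_I2)
      fix x
      have "(\<lambda>n. (norm (indicat_real {- R..R} x *\<^sub>R d n x))\<^sup>2) \<longlonglongrightarrow> (norm (indicat_real {- R..R} x *\<^sub>R (0::'a)))\<^sup>2"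
        by (intro tendsto_intros lim)
      then show "(\<lambda>n. (norm (indicat_real {- R..R} x *\<^sub>R d n x))\<^sup>2) \<longlonglongrightarrow> 0" by simp
    qed
    show "AE x in lborel. norm ((norm (indicat_real {- R..R} x *\<^sub>R d n x))\<^sup>2) \<le> (2 * sqrt K)\<^sup>2 * indicat_real {- R..R} x" for n
    proof (rule AE_I2)
      fix x
      have "(norm (d n x))\<^sup>2 \<le> (2 * sqrt K)\<^sup>2" by (rule power_mono[OF H1_pair_bdd[OF d K]]) simp
      then show "norm ((norm (indicat_real {- R..R} x *\<^sub>R d n x))\<^sup>2) \<le> (2 * sqrt K)\<^sup>2 * indicat_real {- R..R} x"
        by (cases "x \<in> {- R..R}") simp_all
    qed
  qed auto
  then show ?thesis by (simp add: sqn_def)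
qed

lemma tail_sqn_small:
  assumes "sq_int f" "e > 0"
  obtains R where "sqn (\<lambda>x. f x - indicat_real {- R..R} x *\<^sub>R f x) < e"
proof -
  have "(\<lambda>n. \<integral>x. (norm (f x - indicat_real {- real n..real n} x *\<^sub>R f x))\<^sup>2 \<partial>lborel) \<longlonglongrightarrow> (\<integral>x. 0 \<partial>(lborel :: real measure))"
  proof (rule integral_dominated_convergence[where w="\<lambda>x. (norm (f x))\<^sup>2"])
    show "AE x in lborel. (\<lambda>n. (norm (f x - indicat_real {- real n..real n} x *\<^sub>R f x))\<^sup>2) \<longlonglongrightarrow> 0"
    proof (rule AE_I2, rule tendsto_eventually)
      fix x :: real
      show "\<forall>\<^sub>F n in sequentially. (norm (f x - indicat_real {- real n..real n} x *\<^sub>R f x))\<^sup>2 = 0"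
        using eventually_gt_at_top[of "nat \<lceil>\<bar>x\<bar>\<rceil>"]
      proof eventually_elim
        case (elim n)
        then have "\<bar>x\<bar> < real n" by linarith
        then show ?case by (auto simp: indicator_def)
      qed
    qed
    show "(\<lambda>x. (norm (f x - indicat_real {- real n..real n} x *\<^sub>R f x))\<^sup>2) \<in> borel_measurable lborel" for n
      using sq_int_meas[OF assms(1)] by measurable
    show "integrable lborel (\<lambda>x. (norm (f x))\<^sup>2)" by (rule sq_int_integrable[OF assms(1)])
  qed (auto simp: indicator_def)
  then have "(\<lambda>n. sqn (\<lambda>x. f x - indicat_real {- real n..real n} x *\<^sub>R f x)) \<longlonglongrightarrow> 0" by (simp add: sqn_def)
  from order_tendstoD(2)[OF this assms(2)] show thesis
    using that by (auto simp: eventually_sequentially)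
qed

section \<open>The energy functional\<close>

lemma norm_vec3_sq: "(norm (z :: complex ^ 3))\<^sup>2 = (cmod (z $ 1))\<^sup>2 + (cmod (z $ 2))\<^sup>2 + (cmod (z $ 3))\<^sup>2"
  by (simp add: norm_vec_def L2_set_def sum_3)

lemma vec_nth_measurable[measurable]: "(\<lambda>z::complex^3. z $ i) \<in> borel_measurable borel"
  by (intro borel_measurable_continuous_onI continuous_intros)

lemma sq_int_nth:
  assumes "sq_int (u :: real \<Rightarrow> complex ^ 3)"
  shows "sq_int (\<lambda>x. u x $ i)"
proof (rule sq_int_bound[OF _ sq_int_integrable[OF assms]])
  show "(\<lambda>x. u x $ i) \<in> borel_measurable borel" using sq_int_meas[OF assms] by measurable
  show "(cmod (u x $ i))\<^sup>2 \<le> (norm (u x))\<^sup>2" for x by (intro power_mono Finite_Cartesian_Product.norm_nth_le) auto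
qed

lemma sqn_components:
  assumes "sq_int (u :: real \<Rightarrow> complex ^ 3)"
  shows "sqn u = sqn (\<lambda>x. u x $ 1) + sqn (\<lambda>x. u x $ 2) + sqn (\<lambda>x. u x $ 3)"
  unfolding sqn_def norm_vec3_sq using sq_int_integrable[OF sq_int_nth[OF assms]] by simp

lemma H1_pair_nth: "H1_pair (u :: real \<Rightarrow> complex ^ 3) g \<Longrightarrow> H1_pair (\<lambda>x. u x $ i) (\<lambda>x. g x $ i)"
  by (rule H1_pair_bounded_linear[OF _ bounded_linear_vec_nth])

lemma sqn_nth_le:
  assumes "sq_int (u :: real \<Rightarrow> complex ^ 3)"
  shows "sqn (\<lambda>x. u x $ i) \<le> sqn u"
  unfolding sqn_def
  by (rule integral_mono[OF sq_int_integrable[OF sq_int_nth[OF assms]] sq_int_integrable[OF assms]])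
     (auto intro: power_mono Finite_Cartesian_Product.norm_nth_le)

definition mass1 :: "(real \<Rightarrow> complex ^ 3) \<Rightarrow> real" where
  "mass1 u = sqn (\<lambda>x. u x $ 1) + sqn (\<lambda>x. u x $ 3)"

definition mass2 :: "(real \<Rightarrow> complex ^ 3) \<Rightarrow> real" where
  "mass2 u = sqn (\<lambda>x. u x $ 2) + sqn (\<lambda>x. u x $ 3)"

lemma mass_nonneg[simp]: "0 \<le> mass1 u" "0 \<le> mass2 u"
  by (simp_all add: mass1_def mass2_def)

lemma sqn_le_mass: "sq_int u \<Longrightarrow> sqn u \<le> mass1 u + mass2 u"
  by (simp add: sqn_components mass1_def mass2_def)

text \<open>Cut the test function f: on a large interval d n tends to zero in norm, and outside it f
  is small while the norms of d n stay bounded.\<close>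

lemma weak_L2:
  fixes d k :: "nat \<Rightarrow> real \<Rightarrow> 'a::euclidean_space"
  assumes d: "\<And>n. H1_pair (d n) (k n)" and K: "\<And>n. sqn (d n) \<le> K" "\<And>n. sqn (k n) \<le> K"
    and lim: "\<And>x. (\<lambda>n. d n x) \<longlonglongrightarrow> 0" and f: "sq_int f"
  shows "(\<lambda>n. \<integral>x. d n x \<bullet> f x \<partial>lborel) \<longlonglongrightarrow> 0"
proof (rule LIMSEQ_I)
  fix e :: real assume e: "e > 0"
  have K0: "0 \<le> K" using K(1)[of 0] sqn_nonneg[of "d 0"] by linarith
  note dq = H1_pairD(1)[OF d]
  define \<delta> where "\<delta> = (e/2)\<^sup>2 / (K + 1)"
  have \<delta>: "\<delta> > 0" using e K0 by (simp add: \<delta>_def)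
  obtain R where R: "sqn (\<lambda>x. f x - indicat_real {- R..R} x *\<^sub>R f x) < \<delta>"
    using tail_sqn_small[OF f \<delta>] by blast
  let ?A = "indicat_real {- R..R}"
  have fA: "sq_int (\<lambda>x. f x - ?A x *\<^sub>R f x)" by (intro sq_int_diff f sq_int_indicator) auto
  have dA: "sq_int (\<lambda>x. ?A x *\<^sub>R d n x)" for n by (intro dq sq_int_indicator) auto
  have "(\<lambda>n. sqrt (sqn (\<lambda>x. ?A x *\<^sub>R d n x)) * sqrt (sqn f)) \<longlonglongrightarrow> sqrt 0 * sqrt (sqn f)"
    by (intro tendsto_intros local_sqn_tendsto[OF d K lim])
  from order_tendstoD(2)[OF this, of "e/2"] e
  obtain N where N: "\<And>n. n \<ge> N \<Longrightarrow> sqrt (sqn (\<lambda>x. ?A x *\<^sub>R d n x)) * sqrt (sqn f) < e/2"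
    by (auto simp: eventually_sequentially)
  have "norm ((\<integral>x. d n x \<bullet> f x \<partial>lborel) - 0) < e" if "n \<ge> N" for n
  proof -
    have "(\<integral>x. d n x \<bullet> f x \<partial>lborel) = (\<integral>x. (?A x *\<^sub>R d n x) \<bullet> f x + d n x \<bullet> (f x - ?A x *\<^sub>R f x) \<partial>lborel)"
      by (rule Bochner_Integration.integral_cong) (auto simp: inner_diff_right)
    also have "\<dots> = (\<integral>x. (?A x *\<^sub>R d n x) \<bullet> f x \<partial>lborel) + (\<integral>x. d n x \<bullet> (f x - ?A x *\<^sub>R f x) \<partial>lborel)"
      by (rule Bochner_Integration.integral_add[OF sq_int_inner[OF dA f] sq_int_inner[OF dq fA]])
    finally have eq: "(\<integral>x. d n x \<bullet> f x \<partial>lborel) = \<dots>" .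
    have "\<bar>\<integral>x. d n x \<bullet> (f x - ?A x *\<^sub>R f x) \<partial>lborel\<bar> \<le> sqrt (sqn (d n)) * sqrt (sqn (\<lambda>x. f x - ?A x *\<^sub>R f x))"
      by (rule cauchy_schwarz_inner[OF dq fA])
    also have "\<dots> \<le> sqrt K * sqrt \<delta>"
      using K(1)[of n] R K0 by (intro mult_mono real_sqrt_le_mono) auto
    also have "\<dots> \<le> e/2"
    proof -
      have "K * \<delta> \<le> (K + 1) * \<delta>" using \<delta> by (intro mult_right_mono) auto
      also have "\<dots> = (e/2)\<^sup>2" using K0 by (simp add: \<delta>_def)
      finally have "sqrt (K * \<delta>) \<le> e/2" using e by (intro real_le_lsqrt) auto
      then show ?thesis by (simp add: real_sqrt_mult)
    qed
    finally have 1: "\<bar>\<integral>x. d n x \<bullet> (f x - ?A x *\<^sub>R f x) \<partial>lborel\<bar> \<le> e/2" .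
    have "\<bar>\<integral>x. (?A x *\<^sub>R d n x) \<bullet> f x \<partial>lborel\<bar> < e/2"
      using cauchy_schwarz_inner[OF dA f, of n] N[OF that] by linarith
    then show ?thesis unfolding eq using 1 by simp
  qed
  then show "\<exists>no. \<forall>n\<ge>no. norm ((\<integral>x. d n x \<bullet> f x \<partial>lborel) - 0) < e" by blast
qed

text \<open>Hilbert space identity: |u|^2 - |u - f|^2 equals |f|^2 plus twice the inner product of u
  - f with f. The latter vanishes in the limit if u n - f tends weakly to zero.\<close>

lemma sqn_splitting:
  fixes u :: "nat \<Rightarrow> real \<Rightarrow> 'a::euclidean_space"
  assumes "\<And>n. sq_int (u n)" "sq_int f" "(\<lambda>n. \<integral>x. (u n x - f x) \<bullet> f x \<partial>lborel) \<longlonglongrightarrow> 0"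
  shows "(\<lambda>n. sqn (u n) - sqn (\<lambda>x. u n x - f x)) \<longlonglongrightarrow> sqn f"
proof -
  have "sqn (u n) - sqn (\<lambda>x. u n x - f x) = 2 * (\<integral>x. (u n x - f x) \<bullet> f x \<partial>lborel) + sqn f" for n
    using sqn_add[OF sq_int_diff[OF assms(1)[of n] assms(2)] assms(2)] by simp
  moreover have "(\<lambda>n. 2 * (\<integral>x. (u n x - f x) \<bullet> f x \<partial>lborel) + sqn f) \<longlonglongrightarrow> 2 * 0 + sqn f"
    by (intro tendsto_intros assms)
  ultimately show ?thesis by simp
qed

section \<open>The energy density and its integral\<close>

locale three_wave =
  fixes \<alpha> \<beta> p :: real
  assumes \<alpha>: "\<alpha> > 0" and \<beta>: "\<beta> > 0" and p1: "1 < p" and p5: "p < 5"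
begin

definition F :: "complex ^ 3 \<Rightarrow> real" where
  "F z = \<beta> / (p + 1) * (\<Sum>i\<in>UNIV. cmod (z $ i) powr (p + 1)) + \<alpha> * Re (z $ 1 * z $ 2 * cnj (z $ 3))"

definition potential :: "(real \<Rightarrow> complex ^ 3) \<Rightarrow> real" where
  "potential u = (\<integral>x. F (u x) \<partial>lborel)"

text \<open>The derivative is a separate argument, which makes limits and algebraic combinations
  explicit. For a pair satisfying \<open>H1_pair\<close> it is determined almost everywhere by the
  function.\<close>

definition E :: "(real \<Rightarrow> complex ^ 3) \<Rightarrow> (real \<Rightarrow> complex ^ 3) \<Rightarrow> real" where
  "E u g = 1/2 * sqn g - potential u"

text \<open>Lipschitz-type constant of the energy density on the ball of radius K; the factors 3
  count the components and the three factors of the coupling. It tends to 0 with K because p > 1,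
  which is why flat functions have negligible potential.\<close>

definition lip :: "real \<Rightarrow> real" where
  "lip K = 3 * \<beta> * K powr (p - 1) + 3 * \<alpha> * K"

lemma lip_nonneg: "0 \<le> K \<Longrightarrow> 0 \<le> lip K"
  using \<alpha> \<beta> by (simp add: lip_def)

lemma F_zero[simp]: "F 0 = 0"
  by (simp add: F_def)

lemma F_measurable[measurable]: "F \<in> borel_measurable borel"
proof -
  have [measurable]: "(\<lambda>z::complex^3. cnj (z $ i)) \<in> borel_measurable borel" for i
    by (intro borel_measurable_continuous_onI continuous_intros)
  show ?thesis unfolding F_def[abs_def] by measurable
qed

text \<open>Mean value theorem. The last factor t is kept separate from K, so that the estimate is
  quadratic in the size of the arguments and can be integrated against square integrable
  functions.\<close>

lemma powr_diff_bound:
  fixes s t K :: real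
  assumes "0 \<le> s" "s \<le> t" "t \<le> K"
  shows "0 \<le> t powr (p + 1) - s powr (p + 1)"
    "t powr (p + 1) - s powr (p + 1) \<le> (p + 1) * K powr (p - 1) * (t - s) * t"
proof -
  show "0 \<le> t powr (p + 1) - s powr (p + 1)" using assms p1 by (simp add: powr_mono2)
  have base: "z powr p * (t - s) \<le> K powr (p - 1) * (t - s) * t" if "0 \<le> z" "z \<le> t" for z
  proof (cases "z = 0")
    case True
    then show ?thesis using assms by simp
  next
    case False
    then have "z powr p = z powr (p - 1) * z" using that by (simp add: powr_diff)
    also have "\<dots> \<le> K powr (p - 1) * t" using that assms p1 by (intro mult_mono powr_mono2) auto
    finally have "z powr p * (t - s) \<le> K powr (p - 1) * t * (t - s)"
      using assms by (intro mult_right_mono) auto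
    then show ?thesis by (simp add: mult_ac)
  qed
  show "t powr (p + 1) - s powr (p + 1) \<le> (p + 1) * K powr (p - 1) * (t - s) * t"
  proof (cases "s = 0 \<or> s = t")
    case True
    then show ?thesis
    proof
      assume s: "s = 0"
      show ?thesis
      proof (cases "t = 0")
        case False
        then have "t powr (p + 1) = t powr p * t" using assms by (simp add: powr_add)
        then have "t powr (p + 1) \<le> 1 * (K powr (p - 1) * t * t)" using base[of t] assms s by simp
        also have "\<dots> \<le> (p + 1) * (K powr (p - 1) * t * t)" using assms s p1 by (intro mult_right_mono) auto
        finally show ?thesis using s by (simp add: mult.assoc)
      qed (use s in simp)
    qed simp
  next
    case False
    then have "0 < s" "s < t" using assms by auto
    have "\<exists>z. s < z \<and> z < t \<and> t powr (p + 1) - s powr (p + 1) = (t - s) * ((p + 1) * z powr (p + 1 - 1))"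
    proof (rule MVT2[OF \<open>s < t\<close>])
      fix x assume "s \<le> x"
      then show "((\<lambda>a. a powr (p + 1)) has_real_derivative (p + 1) * x powr (p + 1 - 1)) (at x)"
        using \<open>0 < s\<close> by (intro has_real_derivative_powr) simp
    qed
    then obtain z where z: "s < z" "z < t" "t powr (p + 1) - s powr (p + 1) = (t - s) * ((p + 1) * z powr p)" by auto
    have "(p + 1) * (z powr p * (t - s)) \<le> (p + 1) * (K powr (p - 1) * (t - s) * t)"
      using base[of z] z \<open>0 < s\<close> p1 by (intro mult_left_mono) auto
    then show ?thesis using z(3) by (simp add: mult.commute mult.left_commute)
  qed
qed

text \<open>The powers are treated componentwise and the coupling by telescoping the product,
  changing one factor at a time. Only the surplus factors are estimated by K.\<close>

lemma F_lipschitz: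
  assumes "norm a \<le> K" "norm b \<le> K"
  shows "\<bar>F a - F b\<bar> \<le> lip K * (norm (a - b) * (norm a + norm b))"
proof -
  let ?D = "norm (a - b) * (norm a + norm b)"
  have K0: "0 \<le> K" using assms(1) norm_ge_zero order.trans by blast
  have D0: "0 \<le> ?D" by simp
  have ai: "cmod (a $ i) \<le> norm a" "cmod (b $ i) \<le> norm b" "cmod (a $ i - b $ i) \<le> norm (a - b)" for i
    using Finite_Cartesian_Product.norm_nth_le[of a i] Finite_Cartesian_Product.norm_nth_le[of b i] Finite_Cartesian_Product.norm_nth_le[of "a - b" i] by auto
  have pw: "\<bar>cmod (a $ i) powr (p + 1) - cmod (b $ i) powr (p + 1)\<bar> \<le> (p + 1) * K powr (p - 1) * ?D" for i
  proof -
    have *: "\<bar>t powr (p + 1) - s powr (p + 1)\<bar> \<le> (p + 1) * K powr (p - 1) * ?D"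
      if "0 \<le> s" "s \<le> t" "t \<le> K" "t - s \<le> norm (a - b)" "t \<le> norm a + norm b" for s t
    proof -
      have "\<bar>t powr (p + 1) - s powr (p + 1)\<bar> \<le> (p + 1) * K powr (p - 1) * ((t - s) * t)"
        using powr_diff_bound[OF that(1-3)] by (simp add: mult.assoc)
      also have "\<dots> \<le> (p + 1) * K powr (p - 1) * ?D"
        using that p1 by (intro mult_left_mono mult_mono) auto
      finally show ?thesis .
    qed
    have tri: "\<bar>cmod (a $ i) - cmod (b $ i)\<bar> \<le> norm (a - b)"
      using norm_triangle_ineq3[of "a $ i" "b $ i"] ai(3)[of i] by linarith
    note ng = norm_ge_zero[of a] norm_ge_zero[of b] norm_ge_zero[of "a $ i"] norm_ge_zero[of "b $ i"]
    show ?thesis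
    proof (cases "cmod (a $ i) \<le> cmod (b $ i)")
      case True
      have "\<bar>cmod (b $ i) powr (p + 1) - cmod (a $ i) powr (p + 1)\<bar> \<le> (p + 1) * K powr (p - 1) * ?D"
        using True tri ai[of i] assms ng by (intro *) linarith+
      then show ?thesis by (simp add: abs_minus_commute)
    next
      case False
      then show ?thesis
        using tri ai[of i] assms ng by (intro *) linarith+
    qed
  qed
  have tri: "\<bar>Re (a $ 1 * a $ 2 * cnj (a $ 3)) - Re (b $ 1 * b $ 2 * cnj (b $ 3))\<bar> \<le> 3 * K * ?D"
  proof -
    have "a $ 1 * a $ 2 * cnj (a $ 3) - b $ 1 * b $ 2 * cnj (b $ 3)
      = (a $ 1 - b $ 1) * (a $ 2 * cnj (a $ 3)) + b $ 1 * ((a $ 2 - b $ 2) * cnj (a $ 3)) + b $ 1 * (b $ 2 * cnj (a $ 3 - b $ 3))"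
      by (simp add: algebra_simps)
    then have "cmod (a $ 1 * a $ 2 * cnj (a $ 3) - b $ 1 * b $ 2 * cnj (b $ 3))
      \<le> cmod (a $ 1 - b $ 1) * (cmod (a $ 2) * cmod (a $ 3)) + cmod (b $ 1) * (cmod (a $ 2 - b $ 2) * cmod (a $ 3))
        + cmod (b $ 1) * (cmod (b $ 2) * cmod (a $ 3 - b $ 3))"
    proof -
      have t: "cmod (x + y + z) \<le> cmod x + cmod y + cmod z" for x y z
        using norm_triangle_ineq[of "x + y" z] norm_triangle_ineq[of x y] by linarith
      assume eq: "a $ 1 * a $ 2 * cnj (a $ 3) - b $ 1 * b $ 2 * cnj (b $ 3)
      = (a $ 1 - b $ 1) * (a $ 2 * cnj (a $ 3)) + b $ 1 * ((a $ 2 - b $ 2) * cnj (a $ 3)) + b $ 1 * (b $ 2 * cnj (a $ 3 - b $ 3))"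
      show ?thesis unfolding eq by (rule order.trans[OF t]) (simp only: norm_mult complex_mod_cnj order_refl)
    qed
    also have "\<dots> \<le> norm (a - b) * (K * norm a) + K * (norm (a - b) * norm a) + K * (norm b * norm (a - b))"
      using ai assms K0 order.trans[OF ai(1) assms(1)] order.trans[OF ai(2) assms(2)]
      by (intro add_mono mult_mono) auto
    also have "\<dots> \<le> 3 * K * ?D"
    proof -
      have "0 \<le> K * (norm (a - b) * norm a)" "0 \<le> K * (norm (a - b) * norm b)" using K0 by auto
      then show ?thesis by (simp add: algebra_simps)
    qed
    finally have "cmod (a $ 1 * a $ 2 * cnj (a $ 3) - b $ 1 * b $ 2 * cnj (b $ 3)) \<le> 3 * K * ?D" .
    moreover have "\<bar>Re (a $ 1 * a $ 2 * cnj (a $ 3)) - Re (b $ 1 * b $ 2 * cnj (b $ 3))\<bar> \<le> cmod (a $ 1 * a $ 2 * cnj (a $ 3) - b $ 1 * b $ 2 * cnj (b $ 3))"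
      using abs_Re_le_cmod[of "a $ 1 * a $ 2 * cnj (a $ 3) - b $ 1 * b $ 2 * cnj (b $ 3)"] by simp
    ultimately show ?thesis by linarith
  qed
  have "\<bar>(\<Sum>i\<in>UNIV. cmod (a $ i) powr (p + 1)) - (\<Sum>i\<in>UNIV. cmod (b $ i) powr (p + 1))\<bar>
     \<le> (\<Sum>i\<in>(UNIV::3 set). (p + 1) * K powr (p - 1) * ?D)"
    unfolding sum_subtractf[symmetric] by (rule order.trans[OF sum_abs sum_mono[OF pw]])
  also have "\<dots> = 3 * ((p + 1) * K powr (p - 1) * ?D)" by simp
  finally have sm: "\<bar>(\<Sum>i\<in>UNIV. cmod (a $ i) powr (p + 1)) - (\<Sum>i\<in>UNIV. cmod (b $ i) powr (p + 1))\<bar>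
     \<le> 3 * ((p + 1) * K powr (p - 1) * ?D)" .
  have "F a - F b = \<beta> / (p + 1) * ((\<Sum>i\<in>UNIV. cmod (a $ i) powr (p + 1)) - (\<Sum>i\<in>UNIV. cmod (b $ i) powr (p + 1)))
     + \<alpha> * (Re (a $ 1 * a $ 2 * cnj (a $ 3)) - Re (b $ 1 * b $ 2 * cnj (b $ 3)))"
    unfolding F_def by (simp only: right_diff_distrib)
  then have "\<bar>F a - F b\<bar> \<le> \<beta> / (p + 1) * \<bar>(\<Sum>i\<in>UNIV. cmod (a $ i) powr (p + 1)) - (\<Sum>i\<in>UNIV. cmod (b $ i) powr (p + 1))\<bar>
     + \<alpha> * \<bar>Re (a $ 1 * a $ 2 * cnj (a $ 3)) - Re (b $ 1 * b $ 2 * cnj (b $ 3))\<bar>"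
  proof -
    have gen: "\<bar>c * x + d * y\<bar> \<le> c * \<bar>x\<bar> + d * \<bar>y\<bar>" if "0 \<le> c" "0 \<le> d" for c d x y :: real
      using abs_triangle_ineq[of "c * x" "d * y"] that by (simp add: abs_mult)
    assume eq: "F a - F b = \<beta> / (p + 1) * ((\<Sum>i\<in>UNIV. cmod (a $ i) powr (p + 1)) - (\<Sum>i\<in>UNIV. cmod (b $ i) powr (p + 1)))
     + \<alpha> * (Re (a $ 1 * a $ 2 * cnj (a $ 3)) - Re (b $ 1 * b $ 2 * cnj (b $ 3)))"
    show ?thesis unfolding eq by (rule gen) (use \<alpha> \<beta> p1 in auto)
  qed
  also have "\<dots> \<le> \<beta> / (p + 1) * (3 * ((p + 1) * K powr (p - 1) * ?D)) + \<alpha> * (3 * K * ?D)"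
    using \<alpha> \<beta> p1 by (intro add_mono mult_left_mono sm tri) auto
  also have "\<beta> / (p + 1) * (3 * ((p + 1) * K powr (p - 1) * ?D)) = 3 * \<beta> * K powr (p - 1) * ?D"
    using p1 by (simp add: field_simps)
  finally show ?thesis by (simp add: lip_def distrib_right mult.assoc)
qed

lemma F_bound: "norm a \<le> K \<Longrightarrow> \<bar>F a\<bar> \<le> lip K * (norm a)\<^sup>2"
  using F_lipschitz[of a K 0] order.trans[of 0 "norm a" K] by (simp add: power2_eq_square)

text \<open>The growth in |z| is displayed exactly, since coercivity depends on the exponents p - 1
  and 1 and not only on boundedness.\<close>

lemma F_upper: "F z \<le> (\<beta> * norm z powr (p - 1) + \<alpha> * norm z) * (norm z)\<^sup>2"
proof -
  have c: "cmod (z $ i) powr (p + 1) \<le> norm z powr (p - 1) * (cmod (z $ i))\<^sup>2" for i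
  proof (cases "z $ i = 0")
    case False
    then have "cmod (z $ i) powr (p + 1) = cmod (z $ i) powr (p - 1) * (cmod (z $ i))\<^sup>2"
      using powr_add[of "cmod (z $ i)" "p - 1" 2] by (simp add: powr_numeral add.commute)
    also have "\<dots> \<le> norm z powr (p - 1) * (cmod (z $ i))\<^sup>2"
      using p1 by (intro mult_right_mono powr_mono2 Finite_Cartesian_Product.norm_nth_le) auto
    finally show ?thesis .
  qed simp
  have "(\<Sum>i\<in>UNIV. cmod (z $ i) powr (p + 1)) \<le> (\<Sum>i\<in>UNIV. norm z powr (p - 1) * (cmod (z $ i))\<^sup>2)"
    by (rule sum_mono[OF c])
  also have "\<dots> = norm z powr (p - 1) * (norm z)\<^sup>2"
    unfolding norm_vec3_sq by (simp add: sum_3 distrib_left)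
  finally have s: "(\<Sum>i\<in>UNIV. cmod (z $ i) powr (p + 1)) \<le> norm z powr (p - 1) * (norm z)\<^sup>2" .
  have "\<beta> / (p + 1) * (\<Sum>i\<in>UNIV. cmod (z $ i) powr (p + 1)) \<le> \<beta> * (norm z powr (p - 1) * (norm z)\<^sup>2)"
    using p1 \<beta> by (intro mult_mono s) (auto simp: divide_le_eq intro!: sum_nonneg)
  moreover have "Re (z $ 1 * z $ 2 * cnj (z $ 3)) \<le> norm z * (norm z)\<^sup>2"
  proof -
    have "Re (z $ 1 * z $ 2 * cnj (z $ 3)) \<le> cmod (z $ 1) * cmod (z $ 2) * cmod (z $ 3)"
      by (metis complex_Re_le_cmod complex_mod_cnj norm_mult)
    also have "\<dots> \<le> norm z * norm z * norm z" by (intro mult_mono Finite_Cartesian_Product.norm_nth_le) auto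
    finally show ?thesis by (simp add: power2_eq_square mult.assoc)
  qed
  then have "\<alpha> * Re (z $ 1 * z $ 2 * cnj (z $ 3)) \<le> \<alpha> * (norm z * (norm z)\<^sup>2)"
    using \<alpha> by simp
  ultimately show ?thesis unfolding F_def by (simp add: algebra_simps)
qed

lemma F_integrable:
  assumes "sq_int u" "\<And>x. norm (u x) \<le> K"
  shows "integrable lborel (\<lambda>x. F (u x))"
proof (rule Bochner_Integration.integrable_bound)
  show "integrable lborel (\<lambda>x. lip K * (norm (u x))\<^sup>2)" using sq_int_integrable[OF assms(1)] by simp
  show "(\<lambda>x. F (u x)) \<in> borel_measurable lborel" using sq_int_meas[OF assms(1)] by measurable
  have "0 \<le> K" using assms(2) norm_ge_zero order.trans by blast
  then show "AE x in lborel. norm (F (u x)) \<le> norm (lip K * (norm (u x))\<^sup>2)"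
    using F_bound[OF assms(2)] lip_nonneg by (intro AE_I2) (auto simp: abs_mult)
qed

lemma potential_lipschitz:
  assumes "sq_int u" "sq_int v" "\<And>x. norm (u x) \<le> K" "\<And>x. norm (v x) \<le> K"
  shows "\<bar>potential u - potential v\<bar> \<le> lip K * (sqrt (sqn (\<lambda>x. u x - v x)) * (sqrt (sqn u) + sqrt (sqn v)))"
proof -
  note i = F_integrable[OF assms(1,3)] F_integrable[OF assms(2,4)]
  note d = sq_int_diff[OF assms(1,2)]
  have K: "0 \<le> K" using assms(3) norm_ge_zero order.trans by blast
  have iu: "integrable lborel (\<lambda>x. norm (u x - v x) * norm (u x))" by (rule sq_int_norm_mult[OF d assms(1)])
  have iv: "integrable lborel (\<lambda>x. norm (u x - v x) * norm (v x))" by (rule sq_int_norm_mult[OF d assms(2)])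
  have "potential u - potential v = (\<integral>x. F (u x) - F (v x) \<partial>lborel)"
    unfolding potential_def using i by simp
  then have "\<bar>potential u - potential v\<bar> \<le> (\<integral>x. \<bar>F (u x) - F (v x)\<bar> \<partial>lborel)"
    using integral_abs_bound by metis
  also have "\<dots> \<le> (\<integral>x. lip K * (norm (u x - v x) * norm (u x) + norm (u x - v x) * norm (v x)) \<partial>lborel)"
  proof (rule integral_mono)
    show "integrable lborel (\<lambda>x. \<bar>F (u x) - F (v x)\<bar>)" using i by (intro integrable_abs Bochner_Integration.integrable_diff)
    show "integrable lborel (\<lambda>x. lip K * (norm (u x - v x) * norm (u x) + norm (u x - v x) * norm (v x)))"
      by (intro integrable_mult_right Bochner_Integration.integrable_add iu iv)
    show "\<bar>F (u x) - F (v x)\<bar> \<le> lip K * (norm (u x - v x) * norm (u x) + norm (u x - v x) * norm (v x))" for x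
      using F_lipschitz[OF assms(3,4)] by (simp add: distrib_left)
  qed
  also have "\<dots> = lip K * ((\<integral>x. norm (u x - v x) * norm (u x) \<partial>lborel) + (\<integral>x. norm (u x - v x) * norm (v x) \<partial>lborel))"
    using iu iv by simp
  also have "\<dots> \<le> lip K * (sqrt (sqn (\<lambda>x. u x - v x)) * sqrt (sqn u) + sqrt (sqn (\<lambda>x. u x - v x)) * sqrt (sqn v))"
    by (intro mult_left_mono add_mono cauchy_schwarz_norm assms d lip_nonneg K)
  finally show ?thesis by (simp add: distrib_left)
qed

lemma potential_bound:
  assumes "sq_int u" "\<And>x. norm (u x) \<le> K"
  shows "\<bar>potential u\<bar> \<le> lip K * sqn u"
proof -
  have "0 \<le> K" using assms(2) norm_ge_zero order.trans by blast
  then have "\<bar>potential u\<bar> \<le> lip K * (sqrt (sqn u) * sqrt (sqn u))"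
    using potential_lipschitz[OF assms(1) sq_int_zero assms(2), of] by (simp add: potential_def)
  then show ?thesis by simp
qed

text \<open>The density acts pointwise and vanishes at zero, so the potential is additive over
  complementary sets.\<close>

lemma potential_split:
  assumes "sq_int u" "\<And>x. norm (u x) \<le> K" "A \<in> sets borel"
  shows "potential u = potential (\<lambda>x. indicator A x *\<^sub>R u x) + potential (\<lambda>x. u x - indicator A x *\<^sub>R u x)"
proof -
  have K0: "0 \<le> K" using assms(2) norm_ge_zero order.trans by blast
  have "potential u = (\<integral>x. F (indicator A x *\<^sub>R u x) + F (u x - indicator A x *\<^sub>R u x) \<partial>lborel)"
    unfolding potential_def by (rule Bochner_Integration.integral_cong) (auto simp: indicator_def)
  also have "\<dots> = potential (\<lambda>x. indicator A x *\<^sub>R u x) + potential (\<lambda>x. u x - indicator A x *\<^sub>R u x)"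
    unfolding potential_def
  proof (rule Bochner_Integration.integral_add)
    show "integrable lborel (\<lambda>x. F (indicator A x *\<^sub>R u x))"
      by (rule F_integrable[of _ K, OF sq_int_indicator[OF assms(1,3)]])
         (use assms(2) K0 in \<open>simp add: indicator_def\<close>)
    show "integrable lborel (\<lambda>x. F (u x - indicator A x *\<^sub>R u x))"
      by (rule F_integrable[of _ K, OF sq_int_diff[OF assms(1) sq_int_indicator[OF assms(1,3)]]])
         (use assms(2) K0 in \<open>simp add: indicator_def\<close>)
  qed
  finally show ?thesis .
qed

end

section \<open>Tents and wide bumps\<close>

definition tent :: "real \<Rightarrow> real \<Rightarrow> real \<Rightarrow> real" where
  "tent h c x = max 0 (h - \<bar>x - c\<bar>)"

definition tent' :: "real \<Rightarrow> real \<Rightarrow> real \<Rightarrow> real" where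
  "tent' h c x = indicator {c - h..c} x - indicator {c..c + h} x"

lemma tent_bounds: "0 \<le> tent h c x" "h \<ge> 0 \<Longrightarrow> tent h c x \<le> h"
  "h \<ge> 0 \<Longrightarrow> tent h c x \<le> h * indicator {c - h..c + h} x"
  by (auto simp: tent_def indicator_def)

lemma tent_measurable[measurable]: "tent h c \<in> borel_measurable borel" "tent' h c \<in> borel_measurable borel"
  unfolding tent_def[abs_def] tent'_def[abs_def] by measurable

lemma integrable_indicator_Icc: "integrable lborel (indicat_real {a..b::real})"
proof -
  have "emeasure lborel {a..b} < \<infinity>" by (cases "a \<le> b") auto
  then show ?thesis by (intro integrable_real_indicator) auto
qed

lemma interval_indicator_integral:
  "(LINT s:{x..y}|lborel. indicat_real {a..b} s) = max 0 (min y b - max x a)"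
proof -
  have "(LINT s:{x..y}|lborel. indicat_real {a..b} s) = integral\<^sup>L lborel (indicat_real ({x..y} \<inter> {a..b}))"
    unfolding set_lebesgue_integral_def by (rule Bochner_Integration.integral_cong) (auto simp: indicator_def)
  also have "{x..y} \<inter> {a..b} = {max x a..min y b}" by auto
  also have "integral\<^sup>L lborel (indicat_real {max x a..min y b}) = max 0 (min y b - max x a)"
    by (cases "max x a \<le> min y b") auto
  finally show ?thesis .
qed

lemma tent_sq_int: "h \<ge> 0 \<Longrightarrow> sq_int (tent h c)"
proof (rule sq_int_bound[OF tent_measurable(1)])
  assume h: "h \<ge> 0"
  show "integrable lborel (\<lambda>x. h\<^sup>2 * indicat_real {c - h..c + h} x)"
    by (intro integrable_mult_right integrable_indicator_Icc)
  show "(norm (tent h c x))\<^sup>2 \<le> h\<^sup>2 * indicat_real {c - h..c + h} x" for x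
    using power_mono[OF tent_bounds(3)[OF h] tent_bounds(1), of c x 2] tent_bounds(1)[of h c x]
    by (auto simp: indicator_def)
qed

lemma tent_sqn_upper: "h \<ge> 0 \<Longrightarrow> sqn (tent h c) \<le> 2 * h ^ 3"
proof -
  assume h: "h \<ge> 0"
  have "sqn (tent h c) \<le> (\<integral>x. h\<^sup>2 * indicat_real {c - h..c + h} x \<partial>lborel)"
    unfolding sqn_def
  proof (rule integral_mono[OF sq_int_integrable[OF tent_sq_int[OF h]]])
    show "integrable lborel (\<lambda>x. h\<^sup>2 * indicat_real {c - h..c + h} x)"
      by (intro integrable_mult_right integrable_indicator_Icc)
    show "(norm (tent h c x))\<^sup>2 \<le> h\<^sup>2 * indicat_real {c - h..c + h} x" for x
      using power_mono[OF tent_bounds(3)[OF h] tent_bounds(1), of c x 2] tent_bounds(1)[of h c x]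
      by (auto simp: indicator_def)
  qed
  also have "\<dots> = h\<^sup>2 * (2 * h)" using h by simp
  finally show ?thesis by (simp add: power2_eq_square power3_eq_cube)
qed

lemma tent_sqn_lower: "h \<ge> 0 \<Longrightarrow> h ^ 3 / 4 \<le> sqn (tent h c)"
proof -
  assume h: "h \<ge> 0"
  have "(\<integral>x. (h/2)\<^sup>2 * indicat_real {c - h/2..c + h/2} x \<partial>lborel) \<le> sqn (tent h c)"
    unfolding sqn_def
  proof (rule integral_mono[OF _ sq_int_integrable[OF tent_sq_int[OF h]]])
    show "integrable lborel (\<lambda>x. (h/2)\<^sup>2 * indicat_real {c - h/2..c + h/2} x)"
      by (intro integrable_mult_right integrable_indicator_Icc)
    fix x
    show "(h/2)\<^sup>2 * indicat_real {c - h/2..c + h/2} x \<le> (norm (tent h c x))\<^sup>2"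
    proof (cases "x \<in> {c - h/2..c + h/2}")
      case True
      then have "\<bar>x - c\<bar> \<le> h/2" unfolding atLeastAtMost_iff by linarith
      then have "h/2 \<le> tent h c x" unfolding tent_def by (intro max.coboundedI2) linarith
      then have "(h/2)\<^sup>2 \<le> (tent h c x)\<^sup>2" using h by (intro power_mono) auto
      then show ?thesis using True by simp
    qed simp
  qed
  also have "(\<integral>x. (h/2)\<^sup>2 * indicat_real {c - h/2..c + h/2} x \<partial>lborel) = (h/2)\<^sup>2 * h" using h by simp
  also have "(h/2)\<^sup>2 * h = h ^ 3 / 4" by (simp add: power2_eq_square power3_eq_cube)
  finally show ?thesis .
qed

lemma tent'_sq_le: "(norm (tent' h c x))\<^sup>2 \<le> indicat_real {c - h..c} x + indicat_real {c..c + h} x"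
  by (auto simp: tent'_def indicator_def)

lemma tent'_sq_int: "sq_int (tent' h c)"
  by (rule sq_int_bound[OF tent_measurable(2) _ tent'_sq_le])
     (intro Bochner_Integration.integrable_add integrable_indicator_Icc)

lemma tent'_sqn: "h \<ge> 0 \<Longrightarrow> sqn (tent' h c) \<le> 2 * h"
proof -
  assume h: "h \<ge> 0"
  have "sqn (tent' h c) \<le> (\<integral>x. indicat_real {c - h..c} x + indicat_real {c..c + h} x \<partial>lborel)"
    unfolding sqn_def
    by (rule integral_mono[OF sq_int_integrable[OF tent'_sq_int] _ tent'_sq_le])
       (intro Bochner_Integration.integrable_add integrable_indicator_Icc)
  also have "\<dots> = 2 * h"
    using h by (subst Bochner_Integration.integral_add) (auto intro: integrable_indicator_Icc)
  finally show ?thesis .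
qed

lemma tent_H1_pair: "h \<ge> 0 \<Longrightarrow> H1_pair (tent h c) (tent' h c)"
  unfolding H1_pair_def
proof (intro conjI allI impI tent_sq_int tent'_sq_int)
  fix x y :: real assume h: "h \<ge> 0" and xy: "x \<le> y"
  have i: "set_integrable lborel {x..y} (indicat_real {a..b})" for a b
    unfolding set_integrable_def
    by (rule integrable_mult_indicator[OF _ integrable_indicator_Icc]) auto
  have "(LINT s:{x..y}|lborel. tent' h c s)
    = max 0 (min y c - max x (c - h)) - max 0 (min y (c + h) - max x c)"
    unfolding tent'_def set_integral_diff(2)[OF i i] interval_indicator_integral ..
  also have "\<dots> = tent h c y - tent h c x"
    using h xy unfolding tent_def by (auto simp: max_def min_def abs_if)
  finally show "tent h c y - tent h c x = (LINT s:{x..y}|lborel. tent' h c s)" ..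
qed

text \<open>A tent of half-width L normalized in L^2. For large L its height is of order L^(-1/2)
  and the squared norm of its derivative of order L^(-2), so it carries mass at almost no
  cost.\<close>

definition bump :: "real \<Rightarrow> real \<Rightarrow> real" where
  "bump L x = (1 / sqrt (sqn (tent L 0))) *\<^sub>R tent L 0 x"

definition bump' :: "real \<Rightarrow> real \<Rightarrow> real" where
  "bump' L x = (1 / sqrt (sqn (tent L 0))) *\<^sub>R tent' L 0 x"

lemma tent_sqn_pos: "L > 0 \<Longrightarrow> sqn (tent L 0) > 0"
proof -
  assume L: "L > 0"
  then have "0 < L ^ 3 / 4" by simp
  also have "\<dots> \<le> sqn (tent L 0)" using L by (intro tent_sqn_lower) simp
  finally show ?thesis .
qed

lemma bump_H1_pair: "L > 0 \<Longrightarrow> H1_pair (bump L) (bump' L)"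
  unfolding bump_def[abs_def] bump'_def[abs_def] by (intro H1_pair_scaleR tent_H1_pair) simp

lemma bump_sqn: "L > 0 \<Longrightarrow> sqn (bump L) = 1"
  unfolding bump_def[abs_def] sqn_scaleR using tent_sqn_pos[of L] by (simp add: power_divide)

lemma bump'_sqn: "L > 0 \<Longrightarrow> sqn (bump' L) \<le> 8 / L\<^sup>2"
proof -
  assume L: "L > 0"
  have "sqn (bump' L) = sqn (tent' L 0) / sqn (tent L 0)"
    unfolding bump'_def[abs_def] sqn_scaleR using tent_sqn_pos[OF L] by (simp add: power_divide)
  also have "\<dots> \<le> (2 * L) / (L ^ 3 / 4)"
    using tent'_sqn[of L 0] tent_sqn_lower[of L 0] L by (intro frac_le) auto
  also have "\<dots> = 8 / L\<^sup>2" using L by (simp add: field_simps power2_eq_square power3_eq_cube)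
  finally show ?thesis .
qed

lemma bump_nonneg: "0 \<le> bump L x"
  by (simp add: bump_def tent_bounds)

lemma bump_upper: "L > 0 \<Longrightarrow> bump L x \<le> 2 / sqrt L"
proof -
  assume L: "L > 0"
  have "bump L x \<le> L / sqrt (sqn (tent L 0))"
    using tent_bounds(2)[of L 0 x] L by (simp add: bump_def divide_right_mono)
  also have "\<dots> \<le> L / sqrt (L ^ 3 / 4)"
    using tent_sqn_lower[of L 0] L by (intro divide_left_mono real_sqrt_le_mono mult_pos_pos) (auto simp: tent_sqn_pos)
  also have "sqrt (L ^ 3 / 4) = L * sqrt L / 2"
    using L by (simp add: real_sqrt_divide power3_eq_cube real_sqrt_mult)
  also have "L / (L * sqrt L / 2) = 2 / sqrt L" using L by simp
  finally show ?thesis .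
qed

lemma bump_lower: "L > 0 \<Longrightarrow> \<bar>x\<bar> \<le> L/2 \<Longrightarrow> 1 / (4 * sqrt L) \<le> bump L x"
proof -
  assume L: "L > 0" and x: "\<bar>x\<bar> \<le> L/2"
  have "sqrt (sqn (tent L 0)) \<le> sqrt (2 * L ^ 3)" using tent_sqn_upper[of L 0] L by simp
  \<comment> \<open>Replacing 2 by the perfect square 4 makes the root explicit and accounts for the
    4 in the claim.\<close>
  also have "\<dots> \<le> sqrt (4 * L ^ 3)" using L by simp
  also have "\<dots> = 2 * L * sqrt L" using L by (simp add: power3_eq_cube real_sqrt_mult)
  finally have s: "sqrt (sqn (tent L 0)) \<le> 2 * L * sqrt L" .
  have "1 / (4 * sqrt L) = (L/2) / (2 * L * sqrt L)" using L by simp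
  also have "\<dots> \<le> tent L 0 x / sqrt (sqn (tent L 0))"
    using s x L tent_sqn_pos[OF L] by (intro frac_le) (auto simp: tent_def)
  finally show ?thesis by (simp add: bump_def)
qed

section \<open>Vectors from components\<close>

lemma bounded_linear_axis: "bounded_linear (axis i :: complex \<Rightarrow> complex ^ 3)"
  by (intro linear_conv_bounded_linear[THEN iffD1] linearI) (auto simp: vec_eq_iff axis_def)

abbreviation vec3 :: "complex \<Rightarrow> complex \<Rightarrow> complex \<Rightarrow> complex ^ 3" where
  "vec3 a b c \<equiv> vector [a, b, c]"

lemma vec3_axis: "vec3 a b c = axis 1 a + axis 2 b + axis 3 c"
  by (simp add: vec_eq_iff axis_def forall_3)

lemma H1_pair_vec3:
  assumes "H1_pair a a'" "H1_pair b b'" "H1_pair c c'"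
  shows "H1_pair (\<lambda>x. vec3 (a x) (b x) (c x)) (\<lambda>x. vec3 (a' x) (b' x) (c' x))"
  unfolding vec3_axis
  by (intro H1_pair_add H1_pair_bounded_linear[OF assms(1) bounded_linear_axis]
     H1_pair_bounded_linear[OF assms(2) bounded_linear_axis] H1_pair_bounded_linear[OF assms(3) bounded_linear_axis])

lemma H1_pair_of_real: "H1_pair a a' \<Longrightarrow> H1_pair (\<lambda>x. complex_of_real (a x)) (\<lambda>x. complex_of_real (a' x))"
  by (rule H1_pair_bounded_linear[OF _ bounded_linear_of_real])

lemma sqn_of_real: "sqn (\<lambda>x. complex_of_real (a x)) = sqn a"
  by (simp add: sqn_def)

section \<open>The variational problem\<close>

context three_wave
begin

text \<open>Masses and gradient split because the difference u n - v tends weakly to zero. For the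
  potential the line is cut at a large radius: inside, u n is close to v and the difference is close
  to zero; outside, v is small and u n is close to the difference.\<close>

lemma brezis_lieb:
  assumes u: "\<And>n. H1_pair (u n) (g n)" and v: "H1_pair v h"
    and K: "\<And>n. sqn (u n) \<le> K" "\<And>n. sqn (g n) \<le> K"
    and lim: "\<And>x. (\<lambda>n. u n x) \<longlonglongrightarrow> v x"
  shows "(\<lambda>n. E (u n) (g n) - E (\<lambda>x. u n x - v x) (\<lambda>x. g n x - h x)) \<longlonglongrightarrow> E v h"
    "(\<lambda>n. mass1 (u n) - mass1 (\<lambda>x. u n x - v x)) \<longlonglongrightarrow> mass1 v"
    "(\<lambda>n. mass2 (u n) - mass2 (\<lambda>x. u n x - v x)) \<longlonglongrightarrow> mass2 v"
proof -
  define K' where "K' = 2 * K + 2 * sqn v + 2 * sqn h"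
  have K0: "0 \<le> K" using K(1)[of 0] sqn_nonneg[of "u 0"] by linarith
  note uq = H1_pairD(1)[OF u] and gq = H1_pairD(2)[OF u] and vq = H1_pairD(1)[OF v] and hq = H1_pairD(2)[OF v]
  have d: "H1_pair (\<lambda>x. u n x - v x) (\<lambda>x. g n x - h x)" for n by (rule H1_pair_diff[OF u v])
  have dK: "sqn (\<lambda>x. u n x - v x) \<le> K'" "sqn (\<lambda>x. g n x - h x) \<le> K'" for n
    using sqn_diff_le[OF uq[of n] vq] sqn_diff_le[OF gq[of n] hq] K[of n] sqn_nonneg[of v] sqn_nonneg[of h]
    unfolding K'_def by linarith+
  have uK: "sqn (u n) \<le> K'" "sqn (g n) \<le> K'" for n
    using K[of n] K0 sqn_nonneg[of v] sqn_nonneg[of h] unfolding K'_def by linarith+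
  have vK: "sqn v \<le> K'" "sqn h \<le> K'"
    using K0 sqn_nonneg[of v] sqn_nonneg[of h] unfolding K'_def by linarith+
  have K'0: "0 \<le> K'" using vK(1) sqn_nonneg[of v] by linarith
  have dlim: "(\<lambda>n. u n x - v x) \<longlonglongrightarrow> 0" for x using tendsto_diff[OF lim[of x] tendsto_const[of "v x"]] by simp
  have G: "(\<lambda>n. sqn (g n) - sqn (\<lambda>x. g n x - h x)) \<longlonglongrightarrow> sqn h"
    by (rule sqn_splitting[OF gq hq weak_convergence[OF d dK(2) dlim v]])
  have comp: "(\<lambda>n. sqn (\<lambda>x. u n x $ i) - sqn (\<lambda>x. (u n x - v x) $ i)) \<longlonglongrightarrow> sqn (\<lambda>x. v x $ i)" for i
  proof -
    have "(\<lambda>n. \<integral>x. (u n x - v x) $ i \<bullet> v x $ i \<partial>lborel) \<longlonglongrightarrow> 0"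
    proof (rule weak_L2[where K=K'])
      show "H1_pair (\<lambda>x. (u n x - v x) $ i) (\<lambda>x. (g n x - h x) $ i)" for n by (rule H1_pair_nth[OF d])
      show "sqn (\<lambda>x. (u n x - v x) $ i) \<le> K'" for n
        using sqn_nth_le[OF H1_pairD(1)[OF d], of n i] dK(1)[of n] by linarith
      show "sqn (\<lambda>x. (g n x - h x) $ i) \<le> K'" for n
        using sqn_nth_le[OF H1_pairD(2)[OF d], of n i] dK(2)[of n] by linarith
      show "(\<lambda>n. (u n x - v x) $ i) \<longlonglongrightarrow> 0" for x using tendsto_vec_nth[OF dlim[of x], of i] by simp
    qed (rule sq_int_nth[OF vq])
    then show ?thesis
      using sqn_splitting[of "\<lambda>n x. u n x $ i" "\<lambda>x. v x $ i", OF sq_int_nth[OF uq] sq_int_nth[OF vq]] by simp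
  qed
  show "(\<lambda>n. mass1 (u n) - mass1 (\<lambda>x. u n x - v x)) \<longlonglongrightarrow> mass1 v"
    using tendsto_add[OF comp[of 1] comp[of 3]] unfolding mass1_def by (simp add: algebra_simps)
  show "(\<lambda>n. mass2 (u n) - mass2 (\<lambda>x. u n x - v x)) \<longlonglongrightarrow> mass2 v"
    using tendsto_add[OF comp[of 2] comp[of 3]] unfolding mass2_def by (simp add: algebra_simps)
  define S where "S = 2 * sqrt K'"
  have S0: "0 \<le> S" using vK(1) sqn_nonneg[of v] unfolding S_def by (intro mult_nonneg_nonneg real_sqrt_ge_zero) linarith+
  have bd: "norm (u n x) \<le> S" "norm (v x) \<le> S" "norm (u n x - v x) \<le> S" for n x
    unfolding S_def by (rule H1_pair_bdd[OF u uK] H1_pair_bdd[OF v vK] H1_pair_bdd[OF d dK])+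
  have pot: "(\<lambda>n. potential (u n) - potential (\<lambda>x. u n x - v x)) \<longlonglongrightarrow> potential v"
  proof (rule LIMSEQ_I)
    fix e :: real assume e: "e > 0"
    \<comment> \<open>C covers the Lipschitz estimate for two bounded functions as well as the
      potential of a single small one, and the 1 makes it positive. With C \<eta> \<le> e/8 the four
      errors below add up to at most e/2.\<close>
    define C where "C = lip S * (4 * sqrt K') + lip S + 1"
    have C: "C > 0" using lip_nonneg[OF S0] K'0 unfolding C_def
      by (intro add_nonneg_pos add_nonneg_nonneg mult_nonneg_nonneg) auto
    define \<eta> where "\<eta> = min 1 (e / (8 * C))"
    have \<eta>: "0 < \<eta>" "\<eta> \<le> 1" "C * \<eta> \<le> e / 8" using e C by (auto simp: \<eta>_def min_def field_simps)
    obtain R where R: "sqn (\<lambda>x. v x - indicat_real {- R..R} x *\<^sub>R v x) < \<eta>\<^sup>2"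
      using tail_sqn_small[OF vq, of "\<eta>\<^sup>2"] \<eta> by auto
    let ?A = "indicat_real {- R..R}"
    have ind: "sq_int (\<lambda>x. ?A x *\<^sub>R f x)" if "sq_int f" for f :: "real \<Rightarrow> complex^3"
      by (rule sq_int_indicator[OF that]) auto
    have outq: "sq_int (\<lambda>x. f x - ?A x *\<^sub>R f x)" if "sq_int f" for f :: "real \<Rightarrow> complex^3"
      by (intro sq_int_diff ind that)
    have indn: "sqn (\<lambda>x. ?A x *\<^sub>R f x) \<le> sqn f" if "sq_int f" for f :: "real \<Rightarrow> complex^3"
      by (rule sqn_indicator_le[OF that]) auto
    have outn: "sqn (\<lambda>x. f x - ?A x *\<^sub>R f x) \<le> sqn f" if "sq_int f" for f :: "real \<Rightarrow> complex^3"
    proof -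
      have "(\<lambda>x. f x - ?A x *\<^sub>R f x) = (\<lambda>x. indicator (- {- R..R}) x *\<^sub>R f x)" by (auto simp: indicator_def)
      then show ?thesis using sqn_indicator_le[OF that, of "- {- R..R}"] by simp
    qed
    have indb: "norm (?A x *\<^sub>R z) \<le> S" "norm (z - ?A x *\<^sub>R z) \<le> S" if "norm z \<le> S" for x and z :: "complex^3"
      using that S0 by (simp_all add: indicator_def)
    have l0: "(\<lambda>n. sqn (\<lambda>x. ?A x *\<^sub>R (u n x - v x))) \<longlonglongrightarrow> 0" by (rule local_sqn_tendsto[OF d dK dlim])
    have "0 < \<eta>\<^sup>2" using \<eta> by simp
    from order_tendstoD(2)[OF l0 this]
    obtain N where N: "\<And>n. n \<ge> N \<Longrightarrow> sqn (\<lambda>x. ?A x *\<^sub>R (u n x - v x)) < \<eta>\<^sup>2" by (auto simp: eventually_sequentially)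
    have "norm (potential (u n) - potential (\<lambda>x. u n x - v x) - potential v) < e" if "n \<ge> N" for n
    proof -
      let ?d = "\<lambda>x. u n x - v x"
      note dq = H1_pairD(1)[OF d[of n]]
      have sA: "sqrt (sqn (\<lambda>x. ?A x *\<^sub>R ?d x)) \<le> \<eta>" using N[OF that] \<eta> by (intro real_le_lsqrt) auto
      have sB: "sqrt (sqn (\<lambda>x. v x - ?A x *\<^sub>R v x)) \<le> \<eta>" using R \<eta> by (intro real_le_lsqrt) auto
      have sK: "sqrt (sqn f) \<le> sqrt K'" if "sqn f \<le> K'" for f :: "real \<Rightarrow> complex^3" using that by simp
      have L: "\<bar>potential a - potential b\<bar> \<le> C * \<eta>"
        if "sq_int a" "sq_int b" "\<And>x. norm (a x) \<le> S" "\<And>x. norm (b x) \<le> S" "sqn a \<le> K'" "sqn b \<le> K'"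
          "sqrt (sqn (\<lambda>x. a x - b x)) \<le> \<eta>" for a b
      proof -
        have "\<bar>potential a - potential b\<bar> \<le> lip S * (sqrt (sqn (\<lambda>x. a x - b x)) * (sqrt (sqn a) + sqrt (sqn b)))"
          by (rule potential_lipschitz[OF that(1-4)])
        also have "\<dots> \<le> lip S * (\<eta> * (sqrt K' + sqrt K'))"
          using that \<eta>(1) lip_nonneg[OF S0] sK by (intro mult_left_mono mult_mono add_mono) auto
        also have "\<dots> = lip S * (2 * sqrt K') * \<eta>" by simp
        also have "\<dots> \<le> C * \<eta>"
          using \<eta>(1) lip_nonneg[OF S0] K'0 unfolding C_def
          by (intro mult_right_mono) (simp_all add: mult_nonneg_nonneg)
        finally show ?thesis .
      qed
      have B: "\<bar>potential a\<bar> \<le> C * \<eta>" if "sq_int a" "\<And>x. norm (a x) \<le> S" "sqrt (sqn a) \<le> \<eta>" for a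
      proof -
        have "sqn a \<le> \<eta>\<^sup>2" using that(3) power_mono[OF that(3), of 2] by simp
        also have "\<eta>\<^sup>2 \<le> \<eta>" using \<eta> by (simp add: power2_eq_square mult_left_le)
        finally have "lip S * sqn a \<le> lip S * \<eta>" using lip_nonneg[OF S0] by (rule mult_left_mono)
        also have "\<dots> \<le> C * \<eta>"
          using \<eta>(1) lip_nonneg[OF S0] K'0 unfolding C_def
          by (intro mult_right_mono) (simp_all add: mult_nonneg_nonneg)
        finally show ?thesis using potential_bound[OF that(1,2)] by linarith
      qed
      have 1: "\<bar>potential (\<lambda>x. ?A x *\<^sub>R u n x) - potential (\<lambda>x. ?A x *\<^sub>R v x)\<bar> \<le> C * \<eta>"
      proof (rule L)
        show "sqn (\<lambda>x. ?A x *\<^sub>R u n x) \<le> K'" "sqn (\<lambda>x. ?A x *\<^sub>R v x) \<le> K'"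
          using indn[OF uq[of n]] indn[OF vq] uK(1)[of n] vK(1) by linarith+
        show "sqrt (sqn (\<lambda>x. ?A x *\<^sub>R u n x - ?A x *\<^sub>R v x)) \<le> \<eta>" using sA by (simp add: scaleR_diff_right)
      qed (intro ind uq vq indb bd)+
      have 2: "\<bar>potential (\<lambda>x. ?A x *\<^sub>R ?d x)\<bar> \<le> C * \<eta>"
        by (rule B[OF ind[OF dq] indb(1)[OF bd(3)] sA])
      have 3: "\<bar>potential (\<lambda>x. u n x - ?A x *\<^sub>R u n x) - potential (\<lambda>x. ?d x - ?A x *\<^sub>R ?d x)\<bar> \<le> C * \<eta>"
      proof (rule L)
        show "sqn (\<lambda>x. u n x - ?A x *\<^sub>R u n x) \<le> K'" "sqn (\<lambda>x. ?d x - ?A x *\<^sub>R ?d x) \<le> K'"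
          using outn[OF uq[of n]] outn[OF dq] uK(1)[of n] dK(1)[of n] by linarith+
        have "(\<lambda>x. (u n x - ?A x *\<^sub>R u n x) - (?d x - ?A x *\<^sub>R ?d x)) = (\<lambda>x. v x - ?A x *\<^sub>R v x)"
          by (simp add: scaleR_diff_right)
        then show "sqrt (sqn (\<lambda>x. (u n x - ?A x *\<^sub>R u n x) - (?d x - ?A x *\<^sub>R ?d x))) \<le> \<eta>" using sB by simp
      qed (intro outq uq dq indb bd)+
      have 4: "\<bar>potential (\<lambda>x. v x - ?A x *\<^sub>R v x)\<bar> \<le> C * \<eta>"
        by (rule B[OF outq[OF vq] indb(2)[OF bd(2)] sB])
      have sp: "potential f = potential (\<lambda>x. ?A x *\<^sub>R f x) + potential (\<lambda>x. f x - ?A x *\<^sub>R f x)"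
        if "sq_int f" "\<And>x. norm (f x) \<le> S" for f
        by (rule potential_split[OF that]) auto
      show ?thesis
        using 1 2 3 4 sp[OF uq bd(1), of n] sp[OF vq bd(2)] sp[OF dq bd(3)] \<eta>(3) e
        unfolding real_norm_def abs_le_iff abs_less_iff by linarith
    qed
    then show "\<exists>no. \<forall>n\<ge>no. norm (potential (u n) - potential (\<lambda>x. u n x - v x) - potential v) < e" by blast
  qed
  have "(\<lambda>n. 1/2 * (sqn (g n) - sqn (\<lambda>x. g n x - h x)) - (potential (u n) - potential (\<lambda>x. u n x - v x)))
     \<longlonglongrightarrow> 1/2 * sqn h - potential v"
    by (intro tendsto_intros G pot)
  then show "(\<lambda>n. E (u n) (g n) - E (\<lambda>x. u n x - v x) (\<lambda>x. g n x - h x)) \<longlonglongrightarrow> E v h"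
    unfolding E_def by (simp add: algebra_simps)
qed

section \<open>Coercivity and boundedness from below\<close>

text \<open>Choose L = sqrt(M/G) in the sup bound, which balances its two terms. The result is the
  one-dimensional Gagliardo-Nirenberg inequality for the maximum norm.\<close>

lemma sup_bound_quarter:
  assumes "H1_pair u g" "sqn u \<le> M" "sqn g \<le> G" "M > 0" "G > 0"
  shows "norm (u x) \<le> 2 * (M * G) powr (1/4)"
proof -
  define m q where "m = sqrt M" and "q = sqrt G"
  have mq: "m > 0" "q > 0" "M = m * m" "G = q * q" using assms(4,5) by (auto simp: m_def q_def)
  have "(norm (u x))\<^sup>2 \<le> 2 / (m / q) * sqn u + 2 * (m / q) * sqn g"
    by (rule H1_pair_sup_bound[OF assms(1)]) (simp add: mq)
  also have "\<dots> \<le> 2 / (m / q) * M + 2 * (m / q) * G"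
    using mq assms(2,3) by (intro add_mono mult_left_mono) auto
  also have "\<dots> = 4 * (m * q)" unfolding mq(3,4) using mq(1,2) by (simp add: field_simps)
  also have "m * q = sqrt (M * G)" by (simp add: m_def q_def real_sqrt_mult)
  finally have "norm (u x) \<le> sqrt (4 * sqrt (M * G))" by (rule real_le_rsqrt)
  also have "\<dots> = 2 * sqrt (sqrt (M * G))" by (simp add: real_sqrt_mult)
  also have "sqrt (sqrt (M * G)) = (M * G) powr (1/4)"
    using assms(4,5) by (simp add: powr_half_sqrt[symmetric] powr_powr)
  finally show ?thesis .
qed

lemma potential_upper:
  assumes "sq_int u" "\<And>x. norm (u x) \<le> S"
  shows "potential u \<le> (\<beta> * S powr (p - 1) + \<alpha> * S) * sqn u"
proof -
  have "potential u \<le> (\<integral>x. (\<beta> * S powr (p - 1) + \<alpha> * S) * (norm (u x))\<^sup>2 \<partial>lborel)"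
    unfolding potential_def
  proof (rule integral_mono[OF F_integrable[OF assms]])
    show "integrable lborel (\<lambda>x. (\<beta> * S powr (p - 1) + \<alpha> * S) * (norm (u x))\<^sup>2)"
      using sq_int_integrable[OF assms(1)] by simp
    fix x
    have "F (u x) \<le> (\<beta> * norm (u x) powr (p - 1) + \<alpha> * norm (u x)) * (norm (u x))\<^sup>2" by (rule F_upper)
    also have "\<dots> \<le> (\<beta> * S powr (p - 1) + \<alpha> * S) * (norm (u x))\<^sup>2"
      using assms(2)[of x] \<alpha> \<beta> p1 by (intro mult_right_mono add_mono mult_left_mono powr_mono2) auto
    finally show "F (u x) \<le> (\<beta> * S powr (p - 1) + \<alpha> * S) * (norm (u x))\<^sup>2" .
  qed
  also have "\<dots> = (\<beta> * S powr (p - 1) + \<alpha> * S) * sqn u" by (simp add: sqn_def)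
  finally show ?thesis .
qed

lemma sublinear_powr:
  fixes a C :: real
  assumes "a < 1"
  shows "\<forall>\<^sub>F t in at_top. C * t powr a \<le> t / 8"
proof -
  have "((\<lambda>t. C * t powr (a - 1)) \<longlongrightarrow> C * 0) at_top"
    by (intro tendsto_mult tendsto_const tendsto_neg_powr filterlim_ident) (use assms in simp)
  then have "\<forall>\<^sub>F t in at_top. C * t powr (a - 1) < 1/8"
    by (rule order_tendstoD(2)) simp
  then show ?thesis using eventually_gt_at_top[of 0]
  proof eventually_elim
    case (elim t)
    then have "C * t powr (a - 1) * t \<le> 1/8 * t" by (intro mult_right_mono) auto
    moreover have "t powr (a - 1) * t = t powr a" using elim by (simp add: powr_diff)
    ultimately show ?case by (simp add: mult.assoc)
  qed
qed

text \<open>With the mass bounded, the maximum norm is of order G^(1/4), where G is the squared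
  gradient norm. The potential is therefore at most of order G^((p-1)/4) + G^(1/4), and both powers
  are sublinear because p < 5. For large G the gradient term G/2 thus keeps at least G/4.\<close>

lemma coercive:
  "\<exists>K. \<forall>u g. H1_pair u g \<longrightarrow> sqn u \<le> M \<longrightarrow> E u g \<le> B \<longrightarrow> sqn g \<le> K"
proof -
  define M' where "M' = max M 1"
  have M': "M' > 0" "M \<le> M'" by (auto simp: M'_def)
  define a where "a = (p - 1) / 4"
  define C1 where "C1 = \<beta> * (2 powr (p - 1) * M' powr a) * M'"
  define C2 where "C2 = \<alpha> * (2 * M' powr (1/4)) * M'"
  obtain T where T: "\<And>t. t \<ge> T \<Longrightarrow> C1 * t powr a \<le> t / 8 \<and> C2 * t powr (1/4) \<le> t / 8"
    using eventually_conj[OF sublinear_powr[of a C1] sublinear_powr[of "1/4" C2]] p5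
    unfolding a_def eventually_at_top_linorder by auto
  have "sqn g \<le> max (max T 1) (4 * B)" if u: "H1_pair u g" and uM: "sqn u \<le> M" and uE: "E u g \<le> B" for u g
  proof (cases "sqn g \<le> max T 1")
    case False
    then have G: "sqn g > 0" "sqn g \<ge> T" by auto
    define S where "S = 2 * (M' * sqn g) powr (1/4)"
    have "sqn u \<le> M'" using uM M' by linarith
    then have bd: "norm (u x) \<le> S" for x
      unfolding S_def by (rule sup_bound_quarter[OF u _ order.refl M'(1) G(1)])
    have S0: "0 \<le> S" by (simp add: S_def)
    have "potential u \<le> (\<beta> * S powr (p - 1) + \<alpha> * S) * sqn u"
      by (rule potential_upper[OF H1_pairD(1)[OF u] bd])
    also have "\<dots> \<le> (\<beta> * S powr (p - 1) + \<alpha> * S) * M'"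
      using \<open>sqn u \<le> M'\<close> \<alpha> \<beta> S0 by (intro mult_left_mono) auto
    also have "S powr (p - 1) = 2 powr (p - 1) * M' powr a * sqn g powr a"
      unfolding S_def a_def using M' G by (simp add: powr_mult powr_powr)
    also have "S = 2 * M' powr (1/4) * sqn g powr (1/4)"
      unfolding S_def using M' G by (simp add: powr_mult)
    also have "(\<beta> * (2 powr (p - 1) * M' powr a * sqn g powr a) + \<alpha> * (2 * M' powr (1/4) * sqn g powr (1/4))) * M'
      = C1 * sqn g powr a + C2 * sqn g powr (1/4)"
      unfolding C1_def C2_def by (simp add: algebra_simps)
    also have "\<dots> \<le> sqn g / 4" using T[OF G(2)] by linarith
    finally show ?thesis using uE unfolding E_def by linarith
  qed simp
  then show ?thesis by blast
qed

text \<open>Only nonpositive energies matter, and for these coercivity bounds the gradient, hence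
  the maximum norm, hence the potential.\<close>

lemma E_bounded_below: "\<exists>B. \<forall>u g. H1_pair u g \<longrightarrow> sqn u \<le> M \<longrightarrow> B \<le> E u g"
proof -
  obtain K where K: "\<And>u g. H1_pair u g \<Longrightarrow> sqn u \<le> M \<Longrightarrow> E u g \<le> 0 \<Longrightarrow> sqn g \<le> K"
    using coercive[of M 0] by blast
  define K' where "K' = max 0 (max M K)"
  have "- (lip (2 * sqrt K') * K') \<le> E u g" if u: "H1_pair u g" and uM: "sqn u \<le> M" for u g
  proof (cases "E u g \<le> 0")
    case True
    have k: "sqn u \<le> K'" "sqn g \<le> K'" using K[OF u uM True] uM by (auto simp: K'_def)
    have l: "0 \<le> lip (2 * sqrt K')" by (rule lip_nonneg) (simp add: K'_def)
    have "\<bar>potential u\<bar> \<le> lip (2 * sqrt K') * sqn u"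
      by (rule potential_bound[OF H1_pairD(1)[OF u] H1_pair_bdd[OF u k]])
    also have "\<dots> \<le> lip (2 * sqrt K') * K'" using k l by (intro mult_left_mono)
    finally show ?thesis unfolding E_def using sqn_nonneg[of g] by linarith
  next
    case False
    have "0 \<le> lip (2 * sqrt K') * K'" by (intro mult_nonneg_nonneg lip_nonneg) (auto simp: K'_def)
    then show ?thesis using False by linarith
  qed
  then show ?thesis by blast
qed

section \<open>Minimal energy as a function of the masses\<close>

text \<open>Also considered for zero masses: a profile that splits off may lack one of the first two
  masses altogether.\<close>

definition competitors :: "real \<Rightarrow> real \<Rightarrow> real set" where
  "competitors \<gamma> \<mu> = {E u g |u g. H1_pair u g \<and> mass1 u = \<gamma> \<and> mass2 u = \<mu>}"

definition Jmin :: "real \<Rightarrow> real \<Rightarrow> real" where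
  "Jmin \<gamma> \<mu> = Inf (competitors \<gamma> \<mu>)"

lemma competitors_bdd_below: "bdd_below (competitors \<gamma> \<mu>)"
proof -
  obtain B where "\<And>u g. H1_pair u g \<Longrightarrow> sqn u \<le> \<gamma> + \<mu> \<Longrightarrow> B \<le> E u g"
    using E_bounded_below[of "\<gamma> + \<mu>"] by blast
  then show ?thesis
    unfolding competitors_def using sqn_le_mass H1_pairD(1) by (intro bdd_belowI[of _ B]) blast
qed

lemma Jmin_le: "H1_pair u g \<Longrightarrow> Jmin (mass1 u) (mass2 u) \<le> E u g"
  unfolding Jmin_def by (rule cInf_lower[OF _ competitors_bdd_below]) (auto simp: competitors_def)

lemma mass_vec3:
  "mass1 (\<lambda>x. vec3 (a x) (b x) (c x)) = sqn a + sqn c"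
  "mass2 (\<lambda>x. vec3 (a x) (b x) (c x)) = sqn b + sqn c"
  by (simp_all add: mass1_def mass2_def)

lemma competitors_nonempty: "0 \<le> \<gamma> \<Longrightarrow> 0 \<le> \<mu> \<Longrightarrow> competitors \<gamma> \<mu> \<noteq> {}"
proof -
  assume nn: "0 \<le> \<gamma>" "0 \<le> \<mu>"
  let ?a = "\<lambda>c x. complex_of_real (c *\<^sub>R bump 1 x)" and ?a' = "\<lambda>c x. complex_of_real (c *\<^sub>R bump' 1 x)"
  have a: "H1_pair (?a c) (?a' c)" for c
    by (intro H1_pair_of_real H1_pair_scaleR bump_H1_pair) simp
  have s: "sqn (?a c) = c\<^sup>2" for c by (simp only: sqn_of_real sqn_scaleR bump_sqn)
  have "H1_pair (\<lambda>x. vec3 (?a (sqrt \<gamma>) x) (?a (sqrt \<mu>) x) 0) (\<lambda>x. vec3 (?a' (sqrt \<gamma>) x) (?a' (sqrt \<mu>) x) 0)"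
    by (intro H1_pair_vec3 a H1_pair_zero)
  moreover have "mass1 (\<lambda>x. vec3 (?a (sqrt \<gamma>) x) (?a (sqrt \<mu>) x) 0) = \<gamma>" "mass2 (\<lambda>x. vec3 (?a (sqrt \<gamma>) x) (?a (sqrt \<mu>) x) 0) = \<mu>"
    using nn unfolding mass_vec3 s by simp_all
  ultimately show ?thesis unfolding competitors_def by blast
qed

lemma Jmin_approx:
  assumes "0 \<le> \<gamma>" "0 \<le> \<mu>" "e > 0"
  obtains u g where "H1_pair u g" "mass1 u = \<gamma>" "mass2 u = \<mu>" "E u g < Jmin \<gamma> \<mu> + e"
proof -
  have "Jmin \<gamma> \<mu> < Jmin \<gamma> \<mu> + e" using assms(3) by simp
  then obtain y where "y \<in> competitors \<gamma> \<mu>" "y < Jmin \<gamma> \<mu> + e"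
    unfolding Jmin_def using cInf_lessD[OF competitors_nonempty[OF assms(1,2)]] by blast
  then show thesis using that by (auto simp: competitors_def)
qed

lemma Jmin_minimizing:
  assumes "0 \<le> \<gamma>" "0 \<le> \<mu>"
  obtains u g where "\<And>n. H1_pair (u n) (g n)" "\<And>n. mass1 (u n) = \<gamma>" "\<And>n. mass2 (u n) = \<mu>"
    "(\<lambda>n. E (u n) (g n)) \<longlonglongrightarrow> Jmin \<gamma> \<mu>"
proof -
  have "\<forall>n. \<exists>w. H1_pair (fst w) (snd w) \<and> mass1 (fst w) = \<gamma> \<and> mass2 (fst w) = \<mu> \<and> E (fst w) (snd w) < Jmin \<gamma> \<mu> + 1 / Suc n"
  proof
    fix n :: nat
    have "1 / real (Suc n) > 0" by simp
    then obtain u g where "H1_pair u g" "mass1 u = \<gamma>" "mass2 u = \<mu>" "E u g < Jmin \<gamma> \<mu> + 1 / Suc n"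
      using Jmin_approx[OF assms] by blast
    then show "\<exists>w. H1_pair (fst w) (snd w) \<and> mass1 (fst w) = \<gamma> \<and> mass2 (fst w) = \<mu> \<and> E (fst w) (snd w) < Jmin \<gamma> \<mu> + 1 / Suc n"
      by (intro exI[of _ "(u, g)"]) simp
  qed
  from choice[OF this]
  obtain w where w0: "\<forall>n. H1_pair (fst (w n)) (snd (w n)) \<and> mass1 (fst (w n)) = \<gamma> \<and> mass2 (fst (w n)) = \<mu>
      \<and> E (fst (w n)) (snd (w n)) < Jmin \<gamma> \<mu> + 1 / Suc n" by (rule exE)
  note w = w0[rule_format]
  have l1: "Jmin \<gamma> \<mu> \<le> E (fst (w n)) (snd (w n))" for n
    using Jmin_le[of "fst (w n)" "snd (w n)"] w[of n] by simp
  have l2: "E (fst (w n)) (snd (w n)) \<le> Jmin \<gamma> \<mu> + 1 / Suc n" for n using w[of n] by (simp add: less_imp_le)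
  have "(\<lambda>n. Jmin \<gamma> \<mu> + 1 / Suc n) \<longlonglongrightarrow> Jmin \<gamma> \<mu> + 0"
    by (intro tendsto_intros LIMSEQ_inverse_real_of_nat[unfolded inverse_eq_divide])
  then have l3: "(\<lambda>n. Jmin \<gamma> \<mu> + 1 / Suc n) \<longlonglongrightarrow> Jmin \<gamma> \<mu>" by simp
  have "(\<lambda>n. E (fst (w n)) (snd (w n))) \<longlonglongrightarrow> Jmin \<gamma> \<mu>"
    by (rule tendsto_sandwich[OF always_eventually[OF allI[OF l1]] always_eventually[OF allI[OF l2]] tendsto_const l3])
  with that[of "\<lambda>n. fst (w n)" "\<lambda>n. snd (w n)"] w show thesis by blast
qed

end

section \<open>Subadditivity and concentration\<close>

text \<open>In the sup bound only the term 2 L |g|^2 survives, and L is arbitrary.\<close>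

lemma H1_pair_zero_mass:
  assumes "H1_pair u g" "sqn u = 0"
  shows "u x = 0"
proof -
  have l: "(norm (u x))\<^sup>2 \<le> 2 * L * sqn g" if "L > 0" for L
    using H1_pair_sup_bound[OF assms(1) that, of x] assms(2) by simp
  have "(norm (u x))\<^sup>2 \<le> 2 * (e / (2 * sqn g + 1)) * sqn g" if "e > 0" for e
    by (rule l, rule divide_pos_pos[OF that]) (simp add: add_nonneg_pos)
  moreover have "2 * (e / (2 * sqn g + 1)) * sqn g \<le> e" if "e > 0" for e
  proof -
    have p: "2 * sqn g + 1 > 0" by (simp add: add_nonneg_pos)
    have "2 * (e / (2 * sqn g + 1)) * sqn g = e * (2 * sqn g) / (2 * sqn g + 1)" by simp
    also have "\<dots> \<le> e" using that p by (simp add: pos_divide_le_eq)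
    finally show ?thesis .
  qed
  ultimately have "(norm (u x))\<^sup>2 \<le> 0 + e" if "e > 0" for e using that order.trans by fastforce
  then have "(norm (u x))\<^sup>2 \<le> 0" by (rule field_le_epsilon)
  then show ?thesis by simp
qed

text \<open>With c the inner product of f and the unit vector s, adding a s changes the squared norm
  by (a + c)^2 - c^2, so the right a is a square root minus c. Its bound does not involve s, which
  allows s to vary along a sequence.\<close>

lemma solve_mass:
  fixes f s :: "real \<Rightarrow> complex"
  assumes "sq_int f" "sq_int s" "sqn s = 1" "0 \<le> d"
  obtains a :: real where "sqn (\<lambda>x. f x + a *\<^sub>R s x) = sqn f + d" "\<bar>a\<bar> \<le> 2 * sqrt (sqn f) + sqrt d"
proof -
  define c where "c = (\<integral>x. f x \<bullet> s x \<partial>lborel)"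
  define a where "a = sqrt (c\<^sup>2 + d) - c"
  have c: "\<bar>c\<bar> \<le> sqrt (sqn f)" using cauchy_schwarz_inner[OF assms(1,2)] assms(3) by (simp add: c_def)
  have "sqn (\<lambda>x. f x + a *\<^sub>R s x) = sqn f + 2 * (a * c) + a\<^sup>2"
    using sqn_add[OF assms(1) sq_int_scaleR[OF assms(2), of a]] assms(3) by (simp add: sqn_scaleR c_def)
  moreover have "2 * (a * c) + a\<^sup>2 = (a + c)\<^sup>2 - c\<^sup>2" by (simp add: power2_eq_square algebra_simps)
  moreover have "(a + c)\<^sup>2 = c\<^sup>2 + d" using assms(4) by (simp add: a_def)
  ultimately have 1: "sqn (\<lambda>x. f x + a *\<^sub>R s x) = sqn f + d" by linarith
  have "sqrt (c\<^sup>2 + d) \<le> \<bar>c\<bar> + sqrt d"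
    using sqrt_add_le_add_sqrt[of "c\<^sup>2" d] assms(4) by simp
  moreover have "0 \<le> sqrt (c\<^sup>2 + d)" using assms(4) by simp
  moreover have "0 \<le> sqrt d" using assms(4) by simp
  ultimately have "\<bar>a\<bar> \<le> 2 * sqrt (sqn f) + sqrt d" unfolding a_def using c by linarith
  with 1 that show thesis by blast
qed

lemma sqn_vec3:
  assumes "sq_int a" "sq_int b" "sq_int c"
  shows "sq_int (\<lambda>x. vec3 (a x) (b x) (c x))" "sqn (\<lambda>x. vec3 (a x) (b x) (c x)) = sqn a + sqn b + sqn c"
proof -
  have eq: "(norm (vec3 (a x) (b x) (c x)))\<^sup>2 = (cmod (a x))\<^sup>2 + (cmod (b x))\<^sup>2 + (cmod (c x))\<^sup>2" for x
    by (simp add: norm_vec3_sq)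
  have [measurable]: "(axis i :: complex \<Rightarrow> complex^3) \<in> borel_measurable borel" for i
    by (intro borel_measurable_continuous_onI linear_continuous_on bounded_linear_axis)
  have "(\<lambda>x. vec3 (a x) (b x) (c x)) \<in> borel_measurable borel"
    unfolding vec3_axis using assms[THEN sq_int_meas] by measurable
  then show "sq_int (\<lambda>x. vec3 (a x) (b x) (c x))"
    using assms[THEN sq_int_integrable] unfolding sq_int_def eq by simp
  show "sqn (\<lambda>x. vec3 (a x) (b x) (c x)) = sqn a + sqn b + sqn c"
    unfolding sqn_def eq using assms[THEN sq_int_integrable] by simp
qed

lemma norm_axis3: "norm (axis i z :: complex ^ 3) = cmod z"
  using exhaust_3[of i] by (auto simp: norm_vec_def L2_set_def sum_3 axis_def)

lemma norm_vec3_le: "norm (vec3 a b c) \<le> cmod a + cmod b + cmod c"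
  unfolding vec3_axis
  using norm_triangle_ineq[of "axis 1 a + axis 2 b" "axis 3 c :: complex^3"]
    norm_triangle_ineq[of "axis 1 a" "axis 2 b :: complex^3"]
  by (simp add: norm_axis3)

context three_wave
begin

text \<open>Both powers of K in \<open>lip\<close> are positive since p > 1. This makes vanishing
  sequences, and the wide bumps, energetically negligible.\<close>

lemma lip_tendsto:
  assumes "\<And>n. 0 \<le> K n" "K \<longlonglongrightarrow> 0"
  shows "(\<lambda>n. lip (K n)) \<longlonglongrightarrow> 0"
proof -
  have "(\<lambda>n. K n powr (p - 1)) \<longlonglongrightarrow> 0"
    by (rule tendsto_zero_powrI[OF assms(2) tendsto_const]) (use assms(1) p1 in auto)
  then have "(\<lambda>n. 3 * \<beta> * K n powr (p - 1) + 3 * \<alpha> * K n) \<longlonglongrightarrow> 3 * \<beta> * 0 + 3 * \<alpha> * 0"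
    by (intro tendsto_intros assms(2))
  then show ?thesis by (simp add: lip_def)
qed

lemma E_translate: "E (\<lambda>x. u (x + c)) (\<lambda>x. g (x + c)) = E u g"
  unfolding E_def potential_def sqn_translate using integral_translate[of "\<lambda>x. F (u x)" c] by simp

lemma mass_translate: "mass1 (\<lambda>x. u (x + c)) = mass1 u" "mass2 (\<lambda>x. u (x + c)) = mass2 u"
  using sqn_translate[of "\<lambda>x. u x $ i" c for i] unfolding mass1_def mass2_def by auto

text \<open>Missing mass is supplied by wide, flat bumps, whose energy tends to zero.\<close>

lemma Jmin_le_of_mass_le:
  assumes u: "H1_pair u g" and m: "mass1 u \<le> \<gamma>" "mass2 u \<le> \<mu>"
  shows "Jmin \<gamma> \<mu> \<le> E u g"
proof -
  define L where "L n = real n + 1" for n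
  have L: "L n > 0" for n by (simp add: L_def)
  define s where "s n x = complex_of_real (bump (L n) x)" for n x
  define s' where "s' n x = complex_of_real (bump' (L n) x)" for n x
  have s: "H1_pair (s n) (s' n)" for n
    unfolding s_def[abs_def] s'_def[abs_def] by (intro H1_pair_of_real bump_H1_pair L)
  note sq = H1_pairD(1)[OF s] and sq' = H1_pairD(2)[OF s]
  have s1: "sqn (s n) = 1" for n unfolding s_def[abs_def] sqn_of_real by (rule bump_sqn[OF L])
  have s2: "sqn (s' n) \<le> 8 / (L n)\<^sup>2" for n unfolding s'_def[abs_def] sqn_of_real by (rule bump'_sqn[OF L])
  have s3: "cmod (s n x) \<le> 2 / sqrt (L n)" for n x
    unfolding s_def using bump_upper[OF L, of n x] bump_nonneg[of "L n" x] by simp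
  note uq = H1_pairD(1)[OF u]
  define A where "A = 2 * sqrt (sqn u) + sqrt (\<gamma> + \<mu>)"
  have gm: "0 \<le> \<gamma>" "0 \<le> \<mu>" using m mass_nonneg[of u] by linarith+
  have A0: "0 \<le> A" using gm by (simp add: A_def)
  have "\<exists>a. sqn (\<lambda>x. u x $ i + a *\<^sub>R s n x) = sqn (\<lambda>x. u x $ i) + d \<and> \<bar>a\<bar> \<le> A"
    if d: "0 \<le> d" "d \<le> \<gamma> + \<mu>" for i n d
  proof -
    obtain a where a: "sqn (\<lambda>x. u x $ i + a *\<^sub>R s n x) = sqn (\<lambda>x. u x $ i) + d" "\<bar>a\<bar> \<le> 2 * sqrt (sqn (\<lambda>x. u x $ i)) + sqrt d"
      using solve_mass[OF sq_int_nth[OF uq] sq s1 d(1)] by blast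
    have "\<bar>a\<bar> \<le> A" unfolding A_def
      using a(2) real_sqrt_le_mono[OF sqn_nth_le[OF uq, of i]] real_sqrt_le_mono[OF d(2)] by linarith
    with a(1) show ?thesis by blast
  qed
  from this[of "\<gamma> - mass1 u" 1] this[of "\<mu> - mass2 u" 2]
  have "\<forall>n. \<exists>a. sqn (\<lambda>x. u x $ 1 + a *\<^sub>R s n x) = sqn (\<lambda>x. u x $ 1) + (\<gamma> - mass1 u) \<and> \<bar>a\<bar> \<le> A"
    "\<forall>n. \<exists>a. sqn (\<lambda>x. u x $ 2 + a *\<^sub>R s n x) = sqn (\<lambda>x. u x $ 2) + (\<mu> - mass2 u) \<and> \<bar>a\<bar> \<le> A"
    using m gm mass_nonneg[of u] by auto
  from choice[OF this(1)] choice[OF this(2)]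
  obtain a b where a0: "\<forall>n. sqn (\<lambda>x. u x $ 1 + a n *\<^sub>R s n x) = sqn (\<lambda>x. u x $ 1) + (\<gamma> - mass1 u) \<and> \<bar>a n\<bar> \<le> A"
    and b0: "\<forall>n. sqn (\<lambda>x. u x $ 2 + b n *\<^sub>R s n x) = sqn (\<lambda>x. u x $ 2) + (\<mu> - mass2 u) \<and> \<bar>b n\<bar> \<le> A" by blast
  note a = a0[rule_format] and b = b0[rule_format]
  \<comment> \<open>The deficits go into the first and the second component separately and leave the
    third alone. Each of these components enters only one of the two masses, so the two equations
    decouple.\<close>
  define \<psi> where "\<psi> n x = vec3 (a n *\<^sub>R s n x) (b n *\<^sub>R s n x) 0" for n x
  define \<psi>' where "\<psi>' n x = vec3 (a n *\<^sub>R s' n x) (b n *\<^sub>R s' n x) 0" for n x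
  have \<psi>: "H1_pair (\<psi> n) (\<psi>' n)" for n
    unfolding \<psi>_def[abs_def] \<psi>'_def[abs_def] by (intro H1_pair_vec3 H1_pair_scaleR s H1_pair_zero)
  have sqa: "(a n)\<^sup>2 \<le> A\<^sup>2" "(b n)\<^sup>2 \<le> A\<^sup>2" for n
    using a[of n] b[of n] A0 by (simp_all add: abs_le_square_iff[symmetric])
  have n1: "sqn (\<psi> n) \<le> 2 * A\<^sup>2" for n
  proof -
    have "sqn (\<psi> n) = (a n)\<^sup>2 + (b n)\<^sup>2"
      unfolding \<psi>_def[abs_def] by (subst sqn_vec3(2)) (auto intro: sq_int_scaleR sq simp: sqn_scaleR s1)
    then show ?thesis using sqa[of n] by simp
  qed
  have n2: "sqn (\<psi>' n) \<le> 16 * A\<^sup>2 / (L n)\<^sup>2" for n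
  proof -
    have "sqn (\<psi>' n) = (a n)\<^sup>2 * sqn (s' n) + (b n)\<^sup>2 * sqn (s' n)"
      unfolding \<psi>'_def[abs_def] by (subst sqn_vec3(2)) (auto intro: sq_int_scaleR sq' simp: sqn_scaleR)
    also have "\<dots> \<le> A\<^sup>2 * (8 / (L n)\<^sup>2) + A\<^sup>2 * (8 / (L n)\<^sup>2)"
      using sqa[of n] s2[of n] by (intro add_mono mult_mono) auto
    finally show ?thesis by simp
  qed
  have n3: "norm (\<psi> n x) \<le> 4 * A / sqrt (L n)" for n x
  proof -
    have "norm (\<psi> n x) \<le> cmod (\<psi> n x $ 1) + cmod (\<psi> n x $ 2) + cmod (\<psi> n x $ 3)"
      unfolding \<psi>_def by (rule order.trans[OF norm_vec3_le]) simp
    also have "\<dots> \<le> A * (2 / sqrt (L n)) + A * (2 / sqrt (L n)) + 0"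
    proof -
      have "\<bar>a n\<bar> * cmod (s n x) \<le> A * (2 / sqrt (L n))" "\<bar>b n\<bar> * cmod (s n x) \<le> A * (2 / sqrt (L n))"
        using a[of n] b[of n] A0 by (intro mult_mono s3; simp)+
      then show ?thesis by (simp add: \<psi>_def)
    qed
    finally show ?thesis by simp
  qed
  have Llim: "(\<lambda>n. 1 / L n) \<longlonglongrightarrow> 0"
    using LIMSEQ_inverse_real_of_nat unfolding L_def by (simp add: inverse_eq_divide add.commute)
  have k0: "(\<lambda>n. 4 * A / sqrt (L n)) \<longlonglongrightarrow> 0"
  proof -
    have "(\<lambda>n. 4 * A * sqrt (1 / L n)) \<longlonglongrightarrow> 4 * A * sqrt 0" by (intro tendsto_intros Llim)
    then show ?thesis by (simp add: real_sqrt_divide)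
  qed
  have Epsi: "(\<lambda>n. E (\<psi> n) (\<psi>' n)) \<longlonglongrightarrow> 0"
  proof (rule Lim_null_comparison[OF always_eventually], rule allI)
    fix n
    have kn: "0 \<le> 4 * A / sqrt (L n)" using A0 L[of n] by simp
    have "\<bar>potential (\<psi> n)\<bar> \<le> lip (4 * A / sqrt (L n)) * sqn (\<psi> n)"
      by (rule potential_bound[OF H1_pairD(1)[OF \<psi>] n3])
    also have "\<dots> \<le> lip (4 * A / sqrt (L n)) * (2 * A\<^sup>2)"
      by (intro mult_left_mono n1 lip_nonneg kn)
    finally show "norm (E (\<psi> n) (\<psi>' n)) \<le> 1/2 * (16 * A\<^sup>2 * (1 / L n)\<^sup>2) + lip (4 * A / sqrt (L n)) * (2 * A\<^sup>2)"
    proof -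
      assume pb: "\<bar>potential (\<psi> n)\<bar> \<le> lip (4 * A / sqrt (L n)) * (2 * A\<^sup>2)"
      have "16 * A\<^sup>2 * (1 / L n)\<^sup>2 = 16 * A\<^sup>2 / (L n)\<^sup>2" by (simp add: power_divide)
      then show ?thesis
        using n2[of n] sqn_nonneg[of "\<psi>' n"] pb unfolding E_def real_norm_def abs_le_iff by linarith
    qed
  next
    have "(\<lambda>n. 1/2 * (16 * A\<^sup>2 * (1 / L n)\<^sup>2) + lip (4 * A / sqrt (L n)) * (2 * A\<^sup>2)) \<longlonglongrightarrow> 1/2 * (16 * A\<^sup>2 * 0\<^sup>2) + 0 * (2 * A\<^sup>2)"
      by (intro tendsto_intros Llim lip_tendsto k0) (use A0 L in \<open>simp add: less_imp_le\<close>)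
    then show "(\<lambda>n. 1/2 * (16 * A\<^sup>2 * (1 / L n)\<^sup>2) + lip (4 * A / sqrt (L n)) * (2 * A\<^sup>2)) \<longlonglongrightarrow> 0" by simp
  qed
  define w where "w n x = u x + \<psi> n x" for n x
  define w' where "w' n x = g x + \<psi>' n x" for n x
  have w: "H1_pair (w n) (w' n)" for n
    unfolding w_def[abs_def] w'_def[abs_def] by (intro H1_pair_add u \<psi>)
  have mw: "mass1 (w n) = \<gamma>" "mass2 (w n) = \<mu>" for n
    using a[of n] b[of n] unfolding w_def[abs_def] \<psi>_def[abs_def] mass1_def mass2_def by simp_all
  define K where "K = 2 * sqn u + 2 * sqn g + 32 * A\<^sup>2"
  have "sqn (w n) \<le> K" for n
    using sqn_add_le[OF uq H1_pairD(1)[OF \<psi>[of n]]] n1[of n] sqn_nonneg[of g] zero_le_power2[of A]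
    unfolding w_def[abs_def] K_def by linarith
  moreover have "sqn (w' n) \<le> K" for n
  proof -
    have "1 \<le> (L n)\<^sup>2" by (simp add: L_def)
    then have "16 * A\<^sup>2 / (L n)\<^sup>2 \<le> 16 * A\<^sup>2" by (simp add: divide_le_eq mult_le_cancel_left1)
    then show ?thesis
      using sqn_add_le[OF H1_pairD(2)[OF u] H1_pairD(2)[OF \<psi>[of n]]] n2[of n] sqn_nonneg[of u]
      unfolding w'_def[abs_def] K_def by linarith
  qed
  moreover have "(\<lambda>n. w n x) \<longlonglongrightarrow> u x" for x
  proof -
    have "(\<lambda>n. \<psi> n x) \<longlonglongrightarrow> 0" by (rule Lim_null_comparison[OF always_eventually k0]) (use n3 in blast)
    from tendsto_add[OF tendsto_const[of "u x"] this] show ?thesis by (simp add: w_def)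
  qed
  \<comment> \<open>The corrected functions tend pointwise to u, since the bumps flatten. The
    splitting of the energy then applies with the bumps in the role of the escaping
    remainder.\<close>
  ultimately have "(\<lambda>n. E (w n) (w' n) - E (\<lambda>x. w n x - u x) (\<lambda>x. w' n x - g x)) \<longlonglongrightarrow> E u g"
    by (intro brezis_lieb(1)[OF w u, where K=K])
  moreover have "E (\<lambda>x. w n x - u x) (\<lambda>x. w' n x - g x) = E (\<psi> n) (\<psi>' n)" for n
    unfolding w_def w'_def by simp
  ultimately have "(\<lambda>n. (E (w n) (w' n) - E (\<psi> n) (\<psi>' n)) + E (\<psi> n) (\<psi>' n)) \<longlonglongrightarrow> E u g + 0"
    by (intro tendsto_add Epsi) simp
  then have lim: "(\<lambda>n. E (w n) (w' n)) \<longlonglongrightarrow> E u g" by simp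
  have "Jmin \<gamma> \<mu> \<le> E (w n) (w' n)" for n using Jmin_le[OF w[of n]] unfolding mw .
  then show ?thesis by (intro LIMSEQ_le_const[OF lim]) blast
qed

lemma F_axis: "F (axis i z) = \<beta> / (p + 1) * cmod z powr (p + 1)"
proof -
  have "(\<Sum>j\<in>UNIV. cmod (axis i z $ j) powr (p + 1)) = (\<Sum>j\<in>UNIV. if j = i then cmod z powr (p + 1) else 0)"
    by (rule sum.cong) (auto simp: axis_def)
  moreover have "axis i z $ 1 * axis i z $ 2 * cnj (axis i z $ 3) = 0" by (auto simp: axis_def)
  ultimately show ?thesis unfolding F_def by (simp only:) simp
qed

text \<open>Put the positive mass into one component as a bump of width L. The gradient costs order
  L^(-2), the power term gains order L^(-(p-1)/2), and p < 5 makes the gain dominate for large L.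
  Whatever mass is missing is supplied at no cost in the infimum.\<close>

lemma Jmin_neg:
  assumes "0 \<le> \<gamma>" "0 \<le> \<mu>" "0 < \<gamma> + \<mu>"
  shows "Jmin \<gamma> \<mu> < 0"
proof -
  obtain i :: 3 and m where i: "0 < m" "i = 1 \<and> m = \<gamma> \<or> i = 2 \<and> m = \<mu>"
    using assms by (cases "\<gamma> > 0") (fastforce)+
  define c where "c = \<beta> / (p + 1) * (sqrt m / 4) powr (p + 1)"
  have c: "c > 0" using \<beta> p1 i by (simp add: c_def)
  have "((\<lambda>L. 4 * m * L powr ((p - 5) / 2)) \<longlongrightarrow> 4 * m * 0) at_top"
    by (intro tendsto_mult tendsto_const tendsto_neg_powr filterlim_ident) (use p5 in simp)
  then have "\<forall>\<^sub>F L in at_top. 4 * m * L powr ((p - 5) / 2) < c" by (rule order_tendstoD(2)) (use c in simp)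
  then have "\<forall>\<^sub>F L in at_top. 4 * m * L powr ((p - 5) / 2) < c \<and> 0 < L"
    by (intro eventually_conj eventually_gt_at_top)
  then obtain L where L: "4 * m * L powr ((p - 5) / 2) < c" "0 < L"
    using eventually_happens'[OF trivial_limit_at_top_linorder] by blast
  define b where "b x = sqrt m *\<^sub>R bump L x" for x
  define b' where "b' x = sqrt m *\<^sub>R bump' L x" for x
  have b: "H1_pair b b'" unfolding b_def[abs_def] b'_def[abs_def] by (intro H1_pair_scaleR bump_H1_pair L)
  let ?u = "\<lambda>x. axis i (complex_of_real (b x)) :: complex^3" and ?g = "\<lambda>x. axis i (complex_of_real (b' x)) :: complex^3"
  have u: "H1_pair ?u ?g" by (intro H1_pair_bounded_linear[OF _ bounded_linear_axis] H1_pair_of_real b)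
  have nax: "norm (axis i z :: complex^3) = cmod z" for z by (rule norm_axis3)
  have sb: "sqn b = m" unfolding b_def[abs_def] sqn_scaleR bump_sqn[OF L(2)] using i by simp
  have sb': "sqn b' \<le> m * (8 / L\<^sup>2)" unfolding b'_def[abs_def] sqn_scaleR using mult_left_mono[OF bump'_sqn[OF L(2)], of m] i by simp
  have comp: "sqn (\<lambda>x. ?u x $ j) = (if j = i then m else 0)" for j
    by (auto simp: axis_def sqn_of_real sb)
  have mass: "mass1 ?u \<le> \<gamma>" "mass2 ?u \<le> \<mu>"
    unfolding mass1_def mass2_def comp using i(2) assms by auto
  have "sqn ?g = sqn b'" unfolding sqn_def nax by simp
  then have gr: "1/2 * sqn ?g \<le> 4 * m / L\<^sup>2" using sb' by (simp add: mult.commute)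
  have pot: "L * (c * L powr (- (p + 1) / 2)) \<le> potential ?u"
  proof -
    have bl: "sqrt m / 4 / sqrt L \<le> b x" if "\<bar>x\<bar> \<le> L/2" for x
      unfolding b_def using mult_left_mono[OF bump_lower[OF L(2) that], of "sqrt m"] i by simp
    have eqp: "(sqrt m / 4 / sqrt L) powr (p + 1) = (sqrt m / 4) powr (p + 1) * L powr (- (p + 1) / 2)"
    proof -
      have "(sqrt m / 4 / sqrt L) powr (p + 1) = (sqrt m / 4) powr (p + 1) / sqrt L powr (p + 1)"
        by (rule powr_divide)
      also have "sqrt L powr (p + 1) = L powr ((p + 1) / 2)"
        using L by (simp add: powr_half_sqrt[symmetric] powr_powr)
      also have "(sqrt m / 4) powr (p + 1) / L powr ((p + 1) / 2) = (sqrt m / 4) powr (p + 1) * L powr (- ((p + 1) / 2))"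
        by (simp add: powr_minus_divide)
      finally show ?thesis by (simp only: minus_divide_left)
    qed
    have "L * (c * L powr (- (p + 1) / 2)) = (\<integral>x. (c * L powr (- (p + 1) / 2)) * indicat_real {- (L/2)..L/2} x \<partial>lborel)"
      using L by simp
    also have "\<dots> \<le> potential ?u"
      unfolding potential_def
    proof (rule integral_mono)
      show "integrable lborel (\<lambda>x. (c * L powr (- (p + 1) / 2)) * indicat_real {- (L/2)..L/2} x)"
        by (intro integrable_mult_right integrable_indicator_Icc)
      show "integrable lborel (\<lambda>x. F (?u x))"
        by (rule F_integrable[OF H1_pairD(1)[OF u] H1_pair_bdd[OF u max.cobounded1 max.cobounded2]])
      fix x
      have F: "F (?u x) = \<beta> / (p + 1) * \<bar>b x\<bar> powr (p + 1)" unfolding F_axis by simp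
      show "(c * L powr (- (p + 1) / 2)) * indicat_real {- (L/2)..L/2} x \<le> F (?u x)"
      proof (cases "x \<in> {- (L/2)..L/2}")
        case True
        then have "\<bar>x\<bar> \<le> L/2" unfolding atLeastAtMost_iff by linarith
        from bl[OF this] have le: "sqrt m / 4 / sqrt L \<le> \<bar>b x\<bar>" by simp
        have "c * L powr (- (p + 1) / 2) = \<beta> / (p + 1) * (sqrt m / 4 / sqrt L) powr (p + 1)"
          unfolding c_def eqp by simp
        also have "\<dots> \<le> \<beta> / (p + 1) * \<bar>b x\<bar> powr (p + 1)"
          using le \<beta> p1 i L by (intro mult_left_mono powr_mono2) auto
        finally show ?thesis unfolding F using True by simp
      next
        case False
        then show ?thesis unfolding F using \<beta> p1 by simp
      qed
    qed
    finally show ?thesis .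
  qed
  have "4 * m / L\<^sup>2 < L * (c * L powr (- (p + 1) / 2))"
  proof -
    have e3: "4 * m * L powr ((p - 5) / 2) * L powr (- (p - 1) / 2) < c * L powr (- (p - 1) / 2)"
      using L by (intro mult_strict_right_mono) auto
    have e1: "L powr ((p - 5) / 2) * L powr (- (p - 1) / 2) = 1 / L\<^sup>2"
    proof -
      have "L powr ((p - 5) / 2) * L powr (- (p - 1) / 2) = L powr (- 2)"
        unfolding powr_add[symmetric] by (rule arg_cong[where f="\<lambda>t. L powr t"]) (simp add: field_simps)
      then show ?thesis using L by (simp add: powr_minus powr_numeral inverse_eq_divide)
    qed
    have e2: "L * L powr (- (p + 1) / 2) = L powr (- (p - 1) / 2)"
    proof -
      have "L * L powr (- (p + 1) / 2) = L powr (1 + - (p + 1) / 2)" using L by (simp add: powr_add)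
      also have "1 + - (p + 1) / 2 = - (p - 1) / 2" by (simp add: field_simps)
      finally show ?thesis .
    qed
    have "4 * m / L\<^sup>2 = 4 * m * L powr ((p - 5) / 2) * L powr (- (p - 1) / 2)"
      unfolding mult.assoc e1 by simp
    also note e3
    also have "c * L powr (- (p - 1) / 2) = L * (c * L powr (- (p + 1) / 2))"
      unfolding e2[symmetric] by (rule mult.left_commute)
    finally show ?thesis .
  qed
  then have "E ?u ?g < 0" unfolding E_def using gr pot by linarith
  then show ?thesis using Jmin_le_of_mass_le[OF u mass] by linarith
qed

text \<open>Excess mass is removed by shrinking the components.\<close>

lemma Jmin_le_of_mass_near:
  assumes u: "H1_pair u g" and K: "sqn u \<le> K" "sqn g \<le> K"
    and m: "mass1 u \<le> \<gamma> + \<delta>" "mass2 u \<le> \<mu> + \<delta>" and nn: "0 \<le> \<gamma>" "0 \<le> \<mu>" "0 \<le> \<delta>"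
  shows "Jmin \<gamma> \<mu> \<le> E u g + lip (2 * sqrt K) * (sqrt (3 * \<delta>) * (2 * sqrt K))"
proof -
  \<comment> \<open>The maximum in the denominator handles both cases: a positive target without
    excess mass gives the factor 1, excess gives the exact ratio. If both numbers vanish, division
    by zero yields 0, which is admissible as well.\<close>
  define q1 q2 where "q1 = \<gamma> / max \<gamma> (mass1 u)" and "q2 = \<mu> / max \<mu> (mass2 u)"
  have fac: "0 \<le> q \<and> q \<le> 1 \<and> q * M \<le> a \<and> (1 - q) * M \<le> \<delta>"
    if "q = a / max a M" "0 \<le> a" "0 \<le> M" "M \<le> a + \<delta>" for q a M :: real
  proof (cases "max a M = 0")
    case True
    then show ?thesis using that nn by (auto simp: max_def split: if_splits)
  next
    case False
    then have p: "max a M > 0" using that by (auto simp: max_def)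
    have "q * M \<le> a" using that p by (simp add: divide_le_eq mult_left_mono)
    moreover have "M - q * M \<le> \<delta>"
    proof (cases "M \<le> a")
      case True
      then have "q = 1" using that p by (simp add: max_def split: if_splits)
      then show ?thesis using nn by simp
    next
      case False
      then have "q * M = a" using that p by (simp add: max_def)
      then show ?thesis using that by simp
    qed
    ultimately show ?thesis using that p by (simp add: divide_le_eq algebra_simps)
  qed
  have q1: "0 \<le> q1" "q1 \<le> 1" "q1 * mass1 u \<le> \<gamma>" "(1 - q1) * mass1 u \<le> \<delta>"
    using fac[OF q1_def nn(1) mass_nonneg(1) m(1)] by auto
  have q2: "0 \<le> q2" "q2 \<le> 1" "q2 * mass2 u \<le> \<mu>" "(1 - q2) * mass2 u \<le> \<delta>"
    using fac[OF q2_def nn(2) mass_nonneg(2) m(2)] by auto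
  \<comment> \<open>The third component counts in both masses, so it obeys the stricter of the two
    reductions.\<close>
  define q3 where "q3 = min q1 q2"
  have q3: "0 \<le> q3" "q3 \<le> 1" "q3 \<le> q1" "q3 \<le> q2" using q1 q2 by (auto simp: q3_def)
  define w where "w x = vec3 (sqrt q1 *\<^sub>R u x $ 1) (sqrt q2 *\<^sub>R u x $ 2) (sqrt q3 *\<^sub>R u x $ 3)" for x
  define w' where "w' x = vec3 (sqrt q1 *\<^sub>R g x $ 1) (sqrt q2 *\<^sub>R g x $ 2) (sqrt q3 *\<^sub>R g x $ 3)" for x
  note uq = H1_pairD(1)[OF u] and gq = H1_pairD(2)[OF u]
  have w: "H1_pair w w'"
    unfolding w_def[abs_def] w'_def[abs_def] by (intro H1_pair_vec3 H1_pair_scaleR H1_pair_nth u)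
  have scl: "sqn (\<lambda>x. vec3 (sqrt q1 *\<^sub>R f x $ 1) (sqrt q2 *\<^sub>R f x $ 2) (sqrt q3 *\<^sub>R f x $ 3)) \<le> sqn f" if "sq_int f" for f :: "real \<Rightarrow> complex ^ 3"
  proof -
    have "sqn (\<lambda>x. vec3 (sqrt q1 *\<^sub>R f x $ 1) (sqrt q2 *\<^sub>R f x $ 2) (sqrt q3 *\<^sub>R f x $ 3))
      = q1 * sqn (\<lambda>x. f x $ 1) + q2 * sqn (\<lambda>x. f x $ 2) + q3 * sqn (\<lambda>x. f x $ 3)"
      unfolding sqn_vec3(2)[OF sq_int_scaleR[OF sq_int_nth[OF that]] sq_int_scaleR[OF sq_int_nth[OF that]] sq_int_scaleR[OF sq_int_nth[OF that]]] sqn_scaleR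
      using q1 q2 q3 by simp
    also have "\<dots> \<le> 1 * sqn (\<lambda>x. f x $ 1) + 1 * sqn (\<lambda>x. f x $ 2) + 1 * sqn (\<lambda>x. f x $ 3)"
      using q1 q2 q3 by (intro add_mono mult_right_mono) auto
    finally show ?thesis using sqn_components[OF that] by simp
  qed
  have wn: "sqn w \<le> sqn u" "sqn w' \<le> sqn g" unfolding w_def[abs_def] w'_def[abs_def] by (intro scl uq gq)+
  have mw: "mass1 w \<le> \<gamma>" "mass2 w \<le> \<mu>"
  proof -
    have "mass1 w = q1 * sqn (\<lambda>x. u x $ 1) + q3 * sqn (\<lambda>x. u x $ 3)" "mass2 w = q2 * sqn (\<lambda>x. u x $ 2) + q3 * sqn (\<lambda>x. u x $ 3)"
      unfolding w_def[abs_def] mass_vec3 using q1 q2 q3 by (simp_all add: sqn_scaleR)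
    moreover have "q3 * sqn (\<lambda>x. u x $ 3) \<le> q1 * sqn (\<lambda>x. u x $ 3)" "q3 * sqn (\<lambda>x. u x $ 3) \<le> q2 * sqn (\<lambda>x. u x $ 3)"
      using q3 by (auto intro: mult_right_mono)
    ultimately show "mass1 w \<le> \<gamma>" "mass2 w \<le> \<mu>"
      using q1(3) q2(3) unfolding mass1_def mass2_def by (auto simp: distrib_left)
  qed
  \<comment> \<open>Each component loses at most \<delta>, because (1 - sqrt q)^2 \<le> 1 -
    q.\<close>
  have diff: "sqn (\<lambda>x. u x - w x) \<le> 3 * \<delta>"
  proof -
    have eq: "(\<lambda>x. u x - w x) = (\<lambda>x. vec3 ((1 - sqrt q1) *\<^sub>R u x $ 1) ((1 - sqrt q2) *\<^sub>R u x $ 2) ((1 - sqrt q3) *\<^sub>R u x $ 3))"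
      by (simp add: fun_eq_iff w_def vec_eq_iff forall_3 scaleR_diff_left)
    have sq: "(1 - sqrt q)\<^sup>2 \<le> 1 - q" if "0 \<le> q" "q \<le> 1" for q :: real
    proof -
      have "q = sqrt q * sqrt q" using that by simp
      moreover have "sqrt q * sqrt q \<le> sqrt q * 1" using that by (intro mult_left_mono) auto
      ultimately show ?thesis unfolding power2_diff using that by simp
    qed
    have "sqn (\<lambda>x. u x - w x) = (1 - sqrt q1)\<^sup>2 * sqn (\<lambda>x. u x $ 1) + (1 - sqrt q2)\<^sup>2 * sqn (\<lambda>x. u x $ 2) + (1 - sqrt q3)\<^sup>2 * sqn (\<lambda>x. u x $ 3)"
      unfolding eq
      by (simp only: sqn_vec3(2)[OF sq_int_scaleR[OF sq_int_nth[OF uq]] sq_int_scaleR[OF sq_int_nth[OF uq]] sq_int_scaleR[OF sq_int_nth[OF uq]]] sqn_scaleR)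
    also have "\<dots> \<le> (1 - q1) * sqn (\<lambda>x. u x $ 1) + (1 - q2) * sqn (\<lambda>x. u x $ 2) + (1 - q3) * sqn (\<lambda>x. u x $ 3)"
      using q1 q2 q3 by (intro add_mono mult_right_mono sq) auto
    also have "\<dots> \<le> \<delta> + \<delta> + \<delta>"
    proof (intro add_mono)
      have c: "(1 - q1) * sqn (\<lambda>x. u x $ i) \<le> \<delta>" if "i = 1 \<or> i = 3" for i
      proof -
        have "sqn (\<lambda>x. u x $ i) \<le> mass1 u" using that by (auto simp: mass1_def)
        then show ?thesis using q1(2,4) mult_left_mono[of "sqn (\<lambda>x. u x $ i)" "mass1 u" "1 - q1"] by linarith
      qed
      have d: "(1 - q2) * sqn (\<lambda>x. u x $ i) \<le> \<delta>" if "i = 2 \<or> i = 3" for i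
      proof -
        have "sqn (\<lambda>x. u x $ i) \<le> mass2 u" using that by (auto simp: mass2_def)
        then show ?thesis using q2(2,4) mult_left_mono[of "sqn (\<lambda>x. u x $ i)" "mass2 u" "1 - q2"] by linarith
      qed
      show "(1 - q1) * sqn (\<lambda>x. u x $ 1) \<le> \<delta>" "(1 - q2) * sqn (\<lambda>x. u x $ 2) \<le> \<delta>"
        using c d by auto
      show "(1 - q3) * sqn (\<lambda>x. u x $ 3) \<le> \<delta>" using c[of 3] d[of 3] by (auto simp: q3_def min_def)
    qed
    finally show ?thesis by simp
  qed
  have K0: "0 \<le> K" using K(1) sqn_nonneg[of u] by linarith
  have wK: "sqn w \<le> K" "sqn w' \<le> K" using wn K by linarith+
  have "\<bar>potential u - potential w\<bar> \<le> lip (2 * sqrt K) * (sqrt (sqn (\<lambda>x. u x - w x)) * (sqrt (sqn u) + sqrt (sqn w)))"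
    by (rule potential_lipschitz[OF uq H1_pairD(1)[OF w] H1_pair_bdd[OF u K] H1_pair_bdd[OF w wK]])
  also have "\<dots> \<le> lip (2 * sqrt K) * (sqrt (3 * \<delta>) * (sqrt K + sqrt K))"
    using diff K wK K0 nn by (intro mult_left_mono mult_mono add_mono lip_nonneg) auto
  finally have "\<bar>potential u - potential w\<bar> \<le> lip (2 * sqrt K) * (sqrt (3 * \<delta>) * (2 * sqrt K))" by simp
  then show ?thesis using Jmin_le_of_mass_le[OF w mw] wn(2) unfolding E_def by linarith
qed

text \<open>Lower semicontinuity with respect to the masses. After a profile has been removed, the
  remainders have only convergent masses, not prescribed ones.\<close>

lemma Jmin_liminf:
  assumes u: "\<And>n. H1_pair (u n) (g n)" and K: "\<And>n. sqn (u n) \<le> K" "\<And>n. sqn (g n) \<le> K"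
    and m: "(\<lambda>n. mass1 (u n)) \<longlonglongrightarrow> \<gamma>" "(\<lambda>n. mass2 (u n)) \<longlonglongrightarrow> \<mu>"
    and e: "(\<lambda>n. E (u n) (g n)) \<longlonglongrightarrow> e"
  shows "Jmin \<gamma> \<mu> \<le> e"
proof -
  have nn: "0 \<le> \<gamma>" "0 \<le> \<mu>"
    by (rule LIMSEQ_le_const[OF m(1)], simp, rule LIMSEQ_le_const[OF m(2)], simp)
  let ?d = "\<lambda>n. \<bar>mass1 (u n) - \<gamma>\<bar> + \<bar>mass2 (u n) - \<mu>\<bar>"
  have "Jmin \<gamma> \<mu> \<le> E (u n) (g n) + lip (2 * sqrt K) * (sqrt (3 * ?d n) * (2 * sqrt K))" for n
    by (rule Jmin_le_of_mass_near[OF u K]) (use nn in auto)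
  moreover have "(\<lambda>n. E (u n) (g n) + lip (2 * sqrt K) * (sqrt (3 * ?d n) * (2 * sqrt K)))
    \<longlonglongrightarrow> e + lip (2 * sqrt K) * (sqrt (3 * (\<bar>\<gamma> - \<gamma>\<bar> + \<bar>\<mu> - \<mu>\<bar>)) * (2 * sqrt K))"
    by (intro tendsto_intros m e)
  ultimately have "Jmin \<gamma> \<mu> \<le> e + lip (2 * sqrt K) * (sqrt (3 * (\<bar>\<gamma> - \<gamma>\<bar> + \<bar>\<mu> - \<mu>\<bar>)) * (2 * sqrt K))"
    by (intro LIMSEQ_le_const) auto
  then show ?thesis by simp
qed

section \<open>Subadditivity and the extraction of a profile\<close>

text \<open>Move w to infinity. The sum tends pointwise to u, and the splitting lemma, with the
  translate of w as remainder, shows that masses and energies add up in the limit.\<close>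

lemma Jmin_add_le:
  assumes u: "H1_pair u g" and w: "H1_pair w k"
  shows "Jmin (mass1 u + mass1 w) (mass2 u + mass2 w) \<le> E u g + E w k"
proof -
  define z where "z n x = u x + w (x + real n)" for n x
  define z' where "z' n x = g x + k (x + real n)" for n x
  have t: "H1_pair (\<lambda>x. w (x + real n)) (\<lambda>x. k (x + real n))" for n by (rule H1_pair_translate[OF w])
  have z: "H1_pair (z n) (z' n)" for n unfolding z_def[abs_def] z'_def[abs_def] by (rule H1_pair_add[OF u t])
  define K where "K = 2 * sqn u + 2 * sqn g + 2 * sqn w + 2 * sqn k"
  have K: "sqn (z n) \<le> K" "sqn (z' n) \<le> K" for n
    using sqn_add_le[OF H1_pairD(1)[OF u] H1_pairD(1)[OF t[of n]]] sqn_add_le[OF H1_pairD(2)[OF u] H1_pairD(2)[OF t[of n]]]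
      sqn_nonneg[of u] sqn_nonneg[of g] sqn_nonneg[of w] sqn_nonneg[of k]
    unfolding z_def[abs_def] z'_def[abs_def] K_def sqn_translate by linarith+
  have lim: "(\<lambda>n. z n x) \<longlonglongrightarrow> u x" for x
  proof -
    have "(\<lambda>n. w (x + real n)) \<longlonglongrightarrow> 0"
    proof (rule H1_pair_tendsto_zero[OF w])
      fix M
      show "\<forall>\<^sub>F n in sequentially. M \<le> \<bar>x + real n\<bar>"
        using eventually_ge_at_top[of "nat \<lceil>M + \<bar>x\<bar>\<rceil>"] by eventually_elim linarith
    qed
    from tendsto_add[OF tendsto_const[of "u x"] this] show ?thesis by (simp add: z_def)
  qed
  have eq: "(\<lambda>x. z n x - u x) = (\<lambda>x. w (x + real n))" "(\<lambda>x. z' n x - g x) = (\<lambda>x. k (x + real n))" for n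
    by (simp_all add: z_def z'_def)
  note bl = brezis_lieb[OF z u K lim, unfolded eq E_translate mass_translate]
  show ?thesis
  proof (rule Jmin_liminf[OF z K])
    show "(\<lambda>n. mass1 (z n)) \<longlonglongrightarrow> mass1 u + mass1 w" using tendsto_add[OF bl(2) tendsto_const[of "mass1 w"]] by simp
    show "(\<lambda>n. mass2 (z n)) \<longlonglongrightarrow> mass2 u + mass2 w" using tendsto_add[OF bl(3) tendsto_const[of "mass2 w"]] by simp
    show "(\<lambda>n. E (z n) (z' n)) \<longlonglongrightarrow> E u g + E w k" using tendsto_add[OF bl(1) tendsto_const[of "E w k"]] by simp
  qed
qed

lemma Jmin_subadditive:
  assumes "0 \<le> \<gamma>" "0 \<le> \<mu>" "0 \<le> \<gamma>'" "0 \<le> \<mu>'"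
  shows "Jmin (\<gamma> + \<gamma>') (\<mu> + \<mu>') \<le> Jmin \<gamma> \<mu> + Jmin \<gamma>' \<mu>'"
proof (rule field_le_epsilon)
  fix e :: real assume e: "e > 0"
  obtain u g where u: "H1_pair u g" "mass1 u = \<gamma>" "mass2 u = \<mu>" "E u g < Jmin \<gamma> \<mu> + e/2"
    using Jmin_approx[OF assms(1,2), of "e/2"] e by auto
  obtain w k where w: "H1_pair w k" "mass1 w = \<gamma>'" "mass2 w = \<mu>'" "E w k < Jmin \<gamma>' \<mu>' + e/2"
    using Jmin_approx[OF assms(3,4), of "e/2"] e by auto
  show "Jmin (\<gamma> + \<gamma>') (\<mu> + \<mu>') \<le> Jmin \<gamma> \<mu> + Jmin \<gamma>' \<mu>' + e"
    using Jmin_add_le[OF u(1) w(1)] u w by simp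
qed

text \<open>Translate each function to a point where it is not small and pass to a pointwise limit
  v. Masses and energy split into those of v and of the remainder, and subadditivity forces v to be
  a minimizer for its own masses. If v takes all the mass, convergence is strong.\<close>

theorem profile:
  assumes u: "\<And>n. H1_pair (u n) (g n)"
    and m: "(\<lambda>n. mass1 (u n)) \<longlonglongrightarrow> \<gamma>" "(\<lambda>n. mass2 (u n)) \<longlonglongrightarrow> \<mu>"
    and e: "(\<lambda>n. E (u n) (g n)) \<longlonglongrightarrow> Jmin \<gamma> \<mu>" and pos: "0 < \<gamma> + \<mu>"
  obtains r y v h where "strict_mono (r :: nat \<Rightarrow> nat)" "H1_pair v h" "mass1 v \<le> \<gamma>" "mass2 v \<le> \<mu>"
    "0 < mass1 v + mass2 v" "E v h = Jmin (mass1 v) (mass2 v)"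
    "Jmin (mass1 v) (mass2 v) + Jmin (\<gamma> - mass1 v) (\<mu> - mass2 v) \<le> Jmin \<gamma> \<mu>"
    "mass1 v = \<gamma> \<Longrightarrow> mass2 v = \<mu> \<Longrightarrow>
       (\<lambda>n. sqn (\<lambda>x. u (r n) (x + y n) - v x) + sqn (\<lambda>x. g (r n) (x + y n) - h x)) \<longlonglongrightarrow> 0"
proof -
  have nn: "0 \<le> \<gamma>" "0 \<le> \<mu>"
    by (rule LIMSEQ_le_const[OF m(1)], simp, rule LIMSEQ_le_const[OF m(2)], simp)
  note uq = H1_pairD(1)[OF u]
  have Jn: "Jmin \<gamma> \<mu> < 0" by (rule Jmin_neg[OF nn pos])
  have bd: "\<exists>B. \<forall>n. f n \<le> B" if "f \<longlonglongrightarrow> (l::real)" for f l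
  proof -
    have "Bseq f" using that by (intro convergent_imp_Bseq) (auto simp: convergent_def)
    then obtain B where "\<And>n. norm (f n) \<le> B" by (auto simp: Bseq_def)
    then show ?thesis by (intro exI[of _ B]) (auto simp: abs_le_iff)
  qed
  obtain M1 M2 B where M: "\<And>n. mass1 (u n) \<le> M1" "\<And>n. mass2 (u n) \<le> M2" "\<And>n. E (u n) (g n) \<le> B"
    using bd[OF m(1)] bd[OF m(2)] bd[OF e] by blast
  have uM: "sqn (u n) \<le> M1 + M2" for n using sqn_le_mass[OF uq[of n]] M(1,2)[of n] by linarith
  obtain K1 where K1: "\<And>n. sqn (g n) \<le> K1" using coercive[of "M1 + M2" B] u uM M(3) by blast
  define K where "K = max (M1 + M2) K1"
  have K: "sqn (u n) \<le> K" "sqn (g n) \<le> K" for n using uM[of n] K1[of n] by (auto simp: K_def)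
  have K0: "0 \<le> K" using K(1)[of 0] sqn_nonneg[of "u 0"] by linarith
  text \<open>Vanishing is impossible, since the limit energy is negative.\<close>
  have "(\<lambda>n. lip (1 / Suc n) * K) \<longlonglongrightarrow> 0 * K"
    by (intro tendsto_mult tendsto_const lip_tendsto LIMSEQ_inverse_real_of_nat[unfolded inverse_eq_divide]) simp
  then have "\<forall>\<^sub>F n in sequentially. lip (1 / Suc n) * K < - Jmin \<gamma> \<mu> / 2"
    by (rule order_tendstoD(2)) (use Jn in simp)
  then obtain n0 where n0: "lip (1 / Suc n0) * K < - Jmin \<gamma> \<mu> / 2" by (auto simp: eventually_sequentially)
  \<comment> \<open>Functions bounded by this c with squared norm at most K have a potential below
    half of the absolute value of the infimum, too small for an energy below half of the
    infimum.\<close>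
  define c where "c = 1 / real (Suc n0)"
  have c: "c > 0" by (simp add: c_def)
  have "\<forall>\<^sub>F n in sequentially. E (u n) (g n) < Jmin \<gamma> \<mu> / 2"
    by (rule order_tendstoD(2)[OF e]) (use Jn in simp)
  then obtain N where N: "\<And>n. n \<ge> N \<Longrightarrow> E (u n) (g n) < Jmin \<gamma> \<mu> / 2" by (auto simp: eventually_sequentially)
  have "\<exists>z. norm (u (n + N) z) > c" for n
  proof (rule ccontr)
    assume "\<not> ?thesis"
    then have le: "norm (u (n + N) z) \<le> c" for z by (simp add: not_less)
    have "\<bar>potential (u (n + N))\<bar> \<le> lip c * sqn (u (n + N))" by (rule potential_bound[OF uq le])
    also have "\<dots> \<le> lip c * K" by (intro mult_left_mono K lip_nonneg) (use c in simp)
    finally have "\<bar>potential (u (n + N))\<bar> < - Jmin \<gamma> \<mu> / 2" using n0 unfolding c_def by linarith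
    then show False using N[OF le_add2[of N n]] sqn_nonneg[of "g (n + N)"] unfolding E_def by linarith
  qed
  then obtain y where y: "\<And>n. norm (u (n + N) (y n)) > c" by metis
  define U where "U n x = u (n + N) (x + y n)" for n x
  define G where "G n x = g (n + N) (x + y n)" for n x
  have U: "H1_pair (U n) (G n)" for n unfolding U_def[abs_def] G_def[abs_def] by (rule H1_pair_translate[OF u])
  have UK: "sqn (U n) \<le> K" "sqn (G n) \<le> K" for n
    unfolding U_def[abs_def] G_def[abs_def] sqn_translate by (rule K)+
  obtain r0 v h where r0: "strict_mono (r0 :: nat \<Rightarrow> nat)" and v: "H1_pair v h"
    and lim: "\<And>x. (\<lambda>n. U (r0 n) x) \<longlonglongrightarrow> v x" and vK: "sqn v \<le> K" "sqn h \<le> K"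
    by (rule H1_pair_subsequence[where u=U and g=G, OF U UK]) (rule that, assumption+)
  \<comment> \<open>The lower bound on the maximum holds only from N on, hence the shift of the
    index.\<close>
  define r where "r n = r0 n + N" for n
  have r: "strict_mono r" using r0 by (simp add: strict_mono_def r_def)
  have "c \<le> norm (v 0)"
  proof (rule LIMSEQ_le_const[OF tendsto_norm[OF lim[of 0]]])
    have "c \<le> norm (U (r0 n) 0)" for n using y[of "r0 n"] by (simp add: U_def)
    then show "\<exists>N. \<forall>n\<ge>N. c \<le> norm (U (r0 n) 0)" by blast
  qed
  then have v0: "sqn v \<noteq> 0" using H1_pair_zero_mass[OF v, of 0] c by auto
  have vpos: "0 < mass1 v + mass2 v"
    using sqn_le_mass[OF H1_pairD(1)[OF v]] v0 sqn_nonneg[of v] by linarith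
  note bl = brezis_lieb[OF U v UK lim] brezis_lieb(1)[where u="\<lambda>n. U (r0 n)", OF U v UK lim]
    brezis_lieb(2)[where u="\<lambda>n. U (r0 n)", OF U v UK lim] brezis_lieb(3)[where u="\<lambda>n. U (r0 n)", OF U v UK lim]
  let ?d = "\<lambda>n x. U (r0 n) x - v x" and ?k = "\<lambda>n x. G (r0 n) x - h x"
  have d: "H1_pair (?d n) (?k n)" for n by (rule H1_pair_diff[OF U v])
  have dK: "sqn (?d n) \<le> 4 * K" "sqn (?k n) \<le> 4 * K" for n
    using sqn_diff_le[OF H1_pairD(1)[OF U[of "r0 n"]] H1_pairD(1)[OF v]] sqn_diff_le[OF H1_pairD(2)[OF U[of "r0 n"]] H1_pairD(2)[OF v]]
      UK[of "r0 n"] vK by linarith+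
  have mU: "mass1 (U (r0 n)) = mass1 (u (r n))" "mass2 (U (r0 n)) = mass2 (u (r n))" "E (U (r0 n)) (G (r0 n)) = E (u (r n)) (g (r n))" for n
    unfolding U_def[abs_def] G_def[abs_def] mass_translate E_translate r_def by simp_all
  have lm1: "(\<lambda>n. mass1 (U (r0 n))) \<longlonglongrightarrow> \<gamma>" unfolding mU using LIMSEQ_subseq_LIMSEQ[OF m(1) r] by (simp add: o_def)
  have lm2: "(\<lambda>n. mass2 (U (r0 n))) \<longlonglongrightarrow> \<mu>" unfolding mU using LIMSEQ_subseq_LIMSEQ[OF m(2) r] by (simp add: o_def)
  have lE: "(\<lambda>n. E (U (r0 n)) (G (r0 n))) \<longlonglongrightarrow> Jmin \<gamma> \<mu>" unfolding mU using LIMSEQ_subseq_LIMSEQ[OF e r] by (simp add: o_def)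
  have dm1: "(\<lambda>n. mass1 (?d n)) \<longlonglongrightarrow> \<gamma> - mass1 v" using tendsto_diff[OF lm1 bl(5)] by simp
  have dm2: "(\<lambda>n. mass2 (?d n)) \<longlonglongrightarrow> \<mu> - mass2 v" using tendsto_diff[OF lm2 bl(6)] by simp
  have dE: "(\<lambda>n. E (?d n) (?k n)) \<longlonglongrightarrow> Jmin \<gamma> \<mu> - E v h" using tendsto_diff[OF lE bl(4)] by simp
  have rest: "Jmin (\<gamma> - mass1 v) (\<mu> - mass2 v) \<le> Jmin \<gamma> \<mu> - E v h"
    by (rule Jmin_liminf[OF d dK dm1 dm2 dE])
  have rn: "0 \<le> \<gamma> - mass1 v" "0 \<le> \<mu> - mass2 v"
    by (rule LIMSEQ_le_const[OF dm1], simp, rule LIMSEQ_le_const[OF dm2], simp)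
  have "Jmin \<gamma> \<mu> \<le> Jmin (mass1 v) (mass2 v) + Jmin (\<gamma> - mass1 v) (\<mu> - mass2 v)"
    using Jmin_subadditive[OF mass_nonneg(1)[of v] mass_nonneg(2)[of v] rn] by simp
  \<comment> \<open>The three inequalities form a closed chain from
    \<open>Jmin (mass1 v) (mass2 v)\<close> through \<open>E v h\<close> back to itself, so all of
    them are equalities.\<close>
  with rest Jmin_le[OF v] have Ev: "E v h = Jmin (mass1 v) (mass2 v)"
    and Js: "Jmin (mass1 v) (mass2 v) + Jmin (\<gamma> - mass1 v) (\<mu> - mass2 v) \<le> Jmin \<gamma> \<mu>" by linarith+
  \<comment> \<open>Without mass the remainder has vanishing potential; its energy tends to zero as
    well, and so must its gradient.\<close>
  have strong: "(\<lambda>n. sqn (\<lambda>x. u (r n) (x + y (r0 n)) - v x) + sqn (\<lambda>x. g (r n) (x + y (r0 n)) - h x)) \<longlonglongrightarrow> 0"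
    if "mass1 v = \<gamma>" "mass2 v = \<mu>"
  proof -
    have s0: "(\<lambda>n. sqn (?d n)) \<longlonglongrightarrow> 0"
    proof (rule Lim_null_comparison[OF always_eventually], rule allI)
      show "norm (sqn (?d n)) \<le> mass1 (?d n) + mass2 (?d n)" for n
        using sqn_le_mass[OF H1_pairD(1)[OF d[of n]]] by simp
      show "(\<lambda>n. mass1 (?d n) + mass2 (?d n)) \<longlonglongrightarrow> 0" using tendsto_add[OF dm1 dm2] that by simp
    qed
    have p0: "(\<lambda>n. potential (?d n)) \<longlonglongrightarrow> 0"
    proof (rule Lim_null_comparison[OF always_eventually], rule allI)
      show "norm (potential (?d n)) \<le> lip (2 * sqrt (4 * K)) * sqn (?d n)" for n
        using potential_bound[OF H1_pairD(1)[OF d] H1_pair_bdd[OF d dK]] by simp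
      show "(\<lambda>n. lip (2 * sqrt (4 * K)) * sqn (?d n)) \<longlonglongrightarrow> 0"
        using tendsto_mult[OF tendsto_const s0] by simp
    qed
    have "(\<lambda>n. sqn (?d n) + 2 * (E (?d n) (?k n) + potential (?d n))) \<longlonglongrightarrow> 0 + 2 * ((Jmin \<gamma> \<mu> - E v h) + 0)"
      by (intro tendsto_intros s0 dE p0)
    moreover have "0 + 2 * ((Jmin \<gamma> \<mu> - E v h) + 0) = 0" using Ev that by simp
    moreover have "sqn (?d n) + 2 * (E (?d n) (?k n) + potential (?d n)) = sqn (?d n) + sqn (?k n)" for n
      by (simp add: E_def)
    ultimately have "(\<lambda>n. sqn (?d n) + sqn (?k n)) \<longlonglongrightarrow> 0" by (simp only:)
    then show ?thesis by (simp add: U_def G_def r_def)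
  qed
  show thesis by (rule that[OF r v _ _ vpos Ev Js strong]) (use rn in auto)
qed

end

section \<open>Moduli, maxima and minima of Sobolev functions\<close>

definition vabs :: "complex ^ 3 \<Rightarrow> complex ^ 3" where
  "vabs z = (\<chi> i. complex_of_real (cmod (z $ i)))"

lemma vabs_nth[simp]: "vabs z $ i = complex_of_real (cmod (z $ i))"
  by (simp add: vabs_def)

lemma norm_vabs[simp]: "norm (vabs z) = norm z"
  by (simp add: norm_vec_def)

lemma vabs_contraction: "norm (vabs a - vabs b) \<le> norm (a - b)"
  unfolding norm_vec_def
proof (rule L2_set_mono)
  fix i
  have "cmod ((vabs a - vabs b) $ i) = \<bar>cmod (a $ i) - cmod (b $ i)\<bar>"
    by (simp flip: of_real_diff)
  also have "\<dots> \<le> cmod ((a - b) $ i)" by (simp add: norm_triangle_ineq3)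
  finally show "cmod ((vabs a - vabs b) $ i) \<le> cmod ((a - b) $ i)" .
qed simp

text \<open>Taking moduli is a contraction, so dyadic sums do not grow, and the Riesz criterion
  returns a derivative of no larger norm. No formula for the derivative of a modulus is
  involved.\<close>

lemma H1_pair_vabs:
  assumes u: "H1_pair u g"
  obtains k where "H1_pair (\<lambda>x. vabs (u x)) k" "sqn k \<le> sqn g"
proof -
  have hol: "norm (vabs (u y) - vabs (u x)) \<le> sqrt (\<bar>y - x\<bar> * sqn g)" for x y
    using order.trans[OF vabs_contraction H1_pair_holder[OF u]] .
  have cont: "isCont (\<lambda>x. vabs (u x)) x" for x by (rule holder_imp_continuous[OF hol])
  have m: "(\<lambda>x. vabs (u x)) \<in> borel_measurable borel"
    by (rule borel_measurable_continuous_onI) (simp add: continuous_at_imp_continuous_on cont)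
  have sq: "sq_int (\<lambda>x. vabs (u x))"
    using H1_pairD(1)[OF u] m by (simp add: sq_int_def)
  have D: "dyadic_bound (sqn g) (\<lambda>x. vabs (u x))"
    unfolding dyadic_bound_def
  proof (intro allI)
    fix n i j
    have "(\<Sum>k\<in>{i..<j}. 2 ^ n * (norm (dincr (\<lambda>x. vabs (u x)) n k))\<^sup>2) \<le> (\<Sum>k\<in>{i..<j}. 2 ^ n * (norm (dincr u n k))\<^sup>2)"
      unfolding dincr_def by (intro sum_mono mult_left_mono power_mono vabs_contraction) auto
    also have "\<dots> \<le> sqn g" using H1_pair_dyadic_bound[OF u] by (simp add: dyadic_bound_def)
    finally show "(\<Sum>k\<in>{i..<j}. 2 ^ n * (norm (dincr (\<lambda>x. vabs (u x)) n k))\<^sup>2) \<le> sqn g" .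
  qed
  obtain k where "H1_pair (\<lambda>x. vabs (u x)) k" "sqn k \<le> sqn g"
    by (rule riesz_dyadic[OF D cont sq])
  then show thesis by (rule that)
qed

text \<open>For vectors with real components; imaginary parts are discarded.\<close>

definition vmax :: "complex ^ 3 \<Rightarrow> complex ^ 3 \<Rightarrow> complex ^ 3" where
  "vmax a b = (\<chi> i. complex_of_real (max (Re (a $ i)) (Re (b $ i))))"

definition vmin :: "complex ^ 3 \<Rightarrow> complex ^ 3 \<Rightarrow> complex ^ 3" where
  "vmin a b = (\<chi> i. complex_of_real (min (Re (a $ i)) (Re (b $ i))))"

lemma vmax_nth[simp]: "vmax a b $ i = complex_of_real (max (Re (a $ i)) (Re (b $ i)))"
  and vmin_nth[simp]: "vmin a b $ i = complex_of_real (min (Re (a $ i)) (Re (b $ i)))"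
  by (simp_all add: vmax_def vmin_def)

lemma vabs_fixed_nth: "vabs a = a \<Longrightarrow> a $ i = complex_of_real (Re (a $ i)) \<and> 0 \<le> Re (a $ i)"
  by (metis Re_complex_of_real norm_ge_zero vabs_nth)

text \<open>Expresses lattice operations through moduli, which reduces the Sobolev regularity of
  maxima and minima to that of moduli.\<close>

lemma vmax_vmin_formula:
  assumes "vabs a = a" "vabs b = b"
  shows "vmax a b = (1/2) *\<^sub>R (a + b + vabs (a - b))" "vmin a b = (1/2) *\<^sub>R (a + b - vabs (a - b))"
proof -
  have *: "vmax a b $ i = ((1/2) *\<^sub>R (a + b + vabs (a - b))) $ i \<and> vmin a b $ i = ((1/2) *\<^sub>R (a + b - vabs (a - b))) $ i" for i
  proof -
    obtain x y where xy: "a $ i = complex_of_real x" "b $ i = complex_of_real y"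
      using vabs_fixed_nth[OF assms(1), of i] vabs_fixed_nth[OF assms(2), of i] by metis
    have n: "cmod (complex_of_real x - complex_of_real y) = \<bar>x - y\<bar>" by (simp flip: of_real_diff)
    show ?thesis
      by (cases "x \<le> y") (simp_all add: xy n complex_eq_iff max_def min_def)
  qed
  then show "vmax a b = (1/2) *\<^sub>R (a + b + vabs (a - b))" "vmin a b = (1/2) *\<^sub>R (a + b - vabs (a - b))"
    by (simp_all add: vec_eq_iff)
qed

text \<open>Assume b1 \<le> a1 by symmetry. If the orderings of the coordinates disagree, one of
  them stands against the other two, and the difference of the two sides is a product of two
  nonnegative factors. Nonnegativity of the entries is what orders the products of pairs.\<close>

lemma product_supermodular:
  fixes a1 a2 a3 b1 b2 b3 :: real
  assumes "0 \<le> a1" "0 \<le> a2" "0 \<le> a3" "0 \<le> b1" "0 \<le> b2" "0 \<le> b3"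
  shows "a1 * a2 * a3 + b1 * b2 * b3 \<le> max a1 b1 * max a2 b2 * max a3 b3 + min a1 b1 * min a2 b2 * min a3 b3"
proof -
  have *: "a1 * a2 * a3 + b1 * b2 * b3 \<le> max a1 b1 * max a2 b2 * max a3 b3 + min a1 b1 * min a2 b2 * min a3 b3"
    if "0 \<le> a1" "0 \<le> a2" "0 \<le> a3" "0 \<le> b1" "0 \<le> b2" "0 \<le> b3" "b1 \<le> a1" for a1 a2 a3 b1 b2 b3 :: real
  proof (cases "b2 \<le> a2")
    case True
    show ?thesis
    proof (cases "b3 \<le> a3")
      case False
      have "b1 * b2 \<le> a1 * a2" using True that by (intro mult_mono) auto
      then have "0 \<le> (a1 * a2 - b1 * b2) * (b3 - a3)" using False by (intro mult_nonneg_nonneg) auto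
      moreover have "max a1 b1 = a1" "min a1 b1 = b1" "max a2 b2 = a2" "min a2 b2 = b2" "max a3 b3 = b3" "min a3 b3 = a3"
        using False True that by simp_all
      ultimately show ?thesis by (simp only:) (simp add: algebra_simps)
    qed (use True that in \<open>simp add: max.absorb1 min.absorb2\<close>)
  next
    case F2: False
    show ?thesis
    proof (cases "b3 \<le> a3")
      case True
      have "b1 * b3 \<le> a1 * a3" using True that by (intro mult_mono) auto
      then have "0 \<le> (a1 * a3 - b1 * b3) * (b2 - a2)" using F2 by (intro mult_nonneg_nonneg) auto
      moreover have "max a1 b1 = a1" "min a1 b1 = b1" "max a2 b2 = b2" "min a2 b2 = a2" "max a3 b3 = a3" "min a3 b3 = b3"
        using F2 True that by simp_all
      ultimately show ?thesis by (simp only:) (simp add: algebra_simps)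
    next
      case False
      have "a2 * a3 \<le> b2 * b3" using F2 False that by (intro mult_mono) auto
      then have "0 \<le> (a1 - b1) * (b2 * b3 - a2 * a3)" using that by (intro mult_nonneg_nonneg) auto
      moreover have "max a1 b1 = a1" "min a1 b1 = b1" "max a2 b2 = b2" "min a2 b2 = a2" "max a3 b3 = b3" "min a3 b3 = a3"
        using F2 False that by simp_all
      ultimately show ?thesis by (simp only:) (simp add: algebra_simps)
    qed
  qed
  show ?thesis
  proof (cases "b1 \<le> a1")
    case True
    then show ?thesis using *[of a1 a2 a3 b1 b2 b3] assms by simp
  next
    case False
    then show ?thesis using *[of b1 b2 b3 a1 a2 a3] assms by (simp add: max.commute min.commute add.commute)
  qed
qed

lemma sqn_parallelogram:
  assumes "sq_int f" "sq_int g"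
  shows "sqn (\<lambda>x. f x + g x) + sqn (\<lambda>x. f x - g x) = 2 * sqn f + 2 * sqn g"
  using sqn_add[OF assms] sqn_diff[OF assms] by simp

section \<open>A convex kink is not compatible with a quadratic bound\<close>

text \<open>The set of points up to a where f is at least c is closed, and bounded below because f
  is small far to the left; its infimum is the point. Continuity excludes a jump above c.\<close>

lemma first_hitting:
  fixes f :: "real \<Rightarrow> real"
  assumes cont: "\<And>x. isCont f x" and far: "\<And>x. x \<le> B \<Longrightarrow> f x < c" and a: "c \<le> f a"
  obtains x where "x \<le> a" "f x = c" "\<And>y. y < x \<Longrightarrow> f y < c"
proof -
  define S where "S = {x. x \<le> a \<and> c \<le> f x}"
  have S: "S \<noteq> {}" "bdd_below S" "closed S"
  proof -
    show "S \<noteq> {}" using a by (auto simp: S_def)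
    show "bdd_below S"
    proof (rule bdd_belowI[of _ B])
      fix x assume "x \<in> S"
      then have "\<not> f x < c" by (simp add: S_def)
      then show "B \<le> x" using far[of x] by linarith
    qed
    have "continuous_on UNIV f" using cont by (simp add: continuous_at_imp_continuous_on)
    then have "closed {x. c \<le> f x}" by (intro closed_Collect_le) auto
    moreover have "S = {..a} \<inter> {x. c \<le> f x}" by (auto simp: S_def)
    ultimately show "closed S" by (auto intro: closed_Int)
  qed
  define x where "x = Inf S"
  have x: "x \<in> S" unfolding x_def by (rule closed_contains_Inf[OF S])
  have below: "f y < c" if "y < x" for y
  proof (rule ccontr)
    assume "\<not> f y < c"
    then have "y \<in> S" using that x by (auto simp: S_def)
    then show False using cInf_lower[OF _ S(2), of y] that by (simp add: x_def)
  qed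
  have "f x \<le> c"
  proof (rule ccontr)
    assume "\<not> f x \<le> c"
    then have "\<forall>\<^sub>F y in at x. c < f y" using cont[of x] unfolding isCont_def by (intro order_tendstoD(1)) auto
    then obtain d where d: "d > 0" "\<And>y. y \<noteq> x \<Longrightarrow> dist y x < d \<Longrightarrow> c < f y"
      unfolding eventually_at by auto
    have "c < f (x - d/2)" by (rule d(2)) (use d(1) in \<open>auto simp: dist_real_def\<close>)
    then show False using below[of "x - d/2"] d(1) by simp
  qed
  then have "f x = c" using x by (simp add: S_def)
  then show thesis using that[of x] x below by (simp add: S_def)
qed

text \<open>All hypotheses are finite second differences, so no slopes are needed. At an aligned
  crossing the maximum follows f to the right and g to the left, and the three bounds combine to
  show that f has dropped by at most 3 C h^2 one step to the left of its first hitting point.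
  Iteration contradicts the decay of f.\<close>

lemma no_transversal_crossing:
  fixes f g :: "real \<Rightarrow> real"
  assumes cont: "\<And>x. isCont f x" "\<And>x. isCont g x"
    and f0: "\<And>c. c > 0 \<Longrightarrow> \<exists>B. \<forall>x\<le>B. f x < c" and g0: "\<And>c. c > 0 \<Longrightarrow> \<exists>B. \<forall>x\<ge>B. g x < c"
    and pos: "0 < f a" "0 < g b"
    and low: "\<And>x h. 0 < h \<Longrightarrow> h \<le> 1 \<Longrightarrow> - (C * h\<^sup>2) \<le> f (x + h) + f (x - h) - 2 * f x"
      "\<And>x h. 0 < h \<Longrightarrow> h \<le> 1 \<Longrightarrow> - (C * h\<^sup>2) \<le> g (x + h) + g (x - h) - 2 * g x"
    and up: "\<And>r x h. 0 < h \<Longrightarrow> h \<le> 1 \<Longrightarrow>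
       max (f (x + h)) (g (x + h + r)) + max (f (x - h)) (g (x - h + r)) - 2 * max (f x) (g (x + r)) \<le> C * h\<^sup>2"
  shows False
proof -
  define c0 where "c0 = min (f a) (g b)"
  have c0: "c0 > 0" "c0 \<le> f a" "c0 \<le> g b" using pos by (auto simp: c0_def)
  \<comment> \<open>Needed for the accumulated losses to be monotone. At an aligned crossing with h
    = 1 the second difference of f is at least -C and at most that of the maximum, hence at most
    C.\<close>
  have C: "0 \<le> C"
  proof -
    obtain B1 where B1: "\<forall>x\<ge>B1. g x < c0" using g0[OF c0(1)] by blast
    \<comment> \<open>Reflection turns the last point where g attains the level into a first hitting
      point.\<close>
    have cg: "isCont (\<lambda>x. g (- x)) x" for x by (rule isCont_o2[where g=g and f=uminus]) (auto intro: cont)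
    obtain y where y: "y \<le> - b" "g (- y) = c0" "\<And>z. z < y \<Longrightarrow> g (- z) < c0"
      by (rule first_hitting[of "\<lambda>x. g (- x)" "- B1" c0 "- b", OF cg]) (use B1 c0 in auto)
    obtain B2 where B2: "\<forall>x\<le>B2. f x < c0" using f0[OF c0(1)] by blast
    obtain x where x: "x \<le> a" "f x = c0" "\<And>z. z < x \<Longrightarrow> f z < c0"
      by (rule first_hitting[of f B2 c0 a, OF cont(1)]) (use B2 c0 in auto)
    have e: "x + 1 + (- y - x) = 1 - y" "x - 1 + (- y - x) = - 1 - y" "x + (- y - x) = - y" by simp_all
    have "max (f (x + 1)) (g (1 - y)) + max (f (x - 1)) (g (- 1 - y)) - 2 * max (f x) (g (- y)) \<le> C * 1\<^sup>2"
      using up[of 1 x "- y - x"] unfolding e by simp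
    moreover have "max (f x) (g (- y)) = f x" using x(2) y(2) by simp
    moreover have "- (C * 1\<^sup>2) \<le> f (x + 1) + f (x - 1) - 2 * f x" by (rule low(1)) auto
    moreover have "f (x + 1) \<le> max (f (x + 1)) (g (1 - y))" "f (x - 1) \<le> max (f (x - 1)) (g (- 1 - y))" by simp_all
    ultimately show "0 \<le> C" by simp
  qed
  \<comment> \<open>To the right of y the function g is below c, so the lower bound at y makes g (y
    - h) at least c - C h^2. The upper bound for the maximum then limits f (x + h), and the lower
    bound at x turns this into a lower bound for f (x - h).\<close>
  have step: "\<exists>x\<le>t - h. c - 3 * C * h\<^sup>2 \<le> f x"
    if c: "0 < c" "c \<le> c0" and h: "0 < h" "h \<le> 1" and t: "\<exists>x\<le>t. c \<le> f x" for c h t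
  proof -
    obtain s where s: "s \<le> t" "c \<le> f s" using t by blast
    obtain B2 where B2: "\<forall>x\<le>B2. f x < c" using f0[OF c(1)] by blast
    obtain x where x: "x \<le> s" "f x = c" "\<And>z. z < x \<Longrightarrow> f z < c"
      by (rule first_hitting[of f B2 c s, OF cont(1)]) (use B2 s in auto)
    obtain B1 where B1: "\<forall>x\<ge>B1. g x < c" using g0[OF c(1)] by blast
    have cg: "isCont (\<lambda>x. g (- x)) x" for x by (rule isCont_o2[where g=g and f=uminus]) (auto intro: cont)
    obtain y' where y': "y' \<le> - b" "g (- y') = c" "\<And>z. z < y' \<Longrightarrow> g (- z) < c"
      by (rule first_hitting[of "\<lambda>x. g (- x)" "- B1" c "- b", OF cg]) (use B1 c c0 in auto)
    define y where "y = - y'"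
    have y: "g y = c" "g (y + h) < c" using y'(2) y'(3)[of "y' - h"] h by (auto simp: y_def)
    have e: "x + h + (y - x) = y + h" "x - h + (y - x) = y - h" "x + (y - x) = y" by simp_all
    have "max (f (x + h)) (g (y + h)) + max (f (x - h)) (g (y - h)) - 2 * max (f x) (g y) \<le> C * h\<^sup>2"
      using up[OF h, of x "y - x"] unfolding e .
    moreover have "max (f x) (g y) = c" using x(2) y(1) by simp
    moreover have "f (x + h) \<le> max (f (x + h)) (g (y + h))" "g (y - h) \<le> max (f (x - h)) (g (y - h))" by simp_all
    ultimately have "f (x + h) + g (y - h) - 2 * c \<le> C * h\<^sup>2" by linarith
    moreover have "- (C * h\<^sup>2) \<le> g (y + h) + g (y - h) - 2 * c" using low(2)[OF h, of y] y(1) by simp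
    moreover have "- (C * h\<^sup>2) \<le> f (x + h) + f (x - h) - 2 * c" using low(1)[OF h, of x] x(2) by simp
    ultimately have "c - 3 * C * h\<^sup>2 \<le> f (x - h)" using y(2) by (simp add: algebra_simps)
    then show ?thesis using x(1) s(1) by (intro exI[of _ "x - h"]) auto
  qed
  obtain B where B: "\<And>x. x \<le> B \<Longrightarrow> f x < c0 / 2" using f0[of "c0 / 2"] c0 by auto
  obtain T :: nat where T: "a - B \<le> real T" using real_arch_simple by blast
  \<comment> \<open>N T steps of length 1/N cover the distance T from a to below B. The total loss
    is 3 C T / N, and this N makes it less than c0/2.\<close>
  obtain N :: nat where N: "6 * C * real T / c0 < real N" using reals_Archimedean2 by blast
  have Np: "0 < real N"
  proof -
    have "0 \<le> 6 * C * real T / c0" using C c0 by simp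
    then show ?thesis using N by linarith
  qed
  define h where "h = 1 / real N"
  have h: "0 < h" "h \<le> 1" using Np by (auto simp: h_def)
  have small: "3 * C * h\<^sup>2 * real (N * T) < c0 / 2"
  proof -
    have "3 * C * h\<^sup>2 * real (N * T) = 3 * C * real T / real N"
      using Np by (simp add: h_def power2_eq_square)
    also have "\<dots> < c0 / 2" using N Np c0 by (simp add: field_simps)
    finally show ?thesis .
  qed
  have "\<exists>x\<le>a - real k * h. c0 - 3 * C * h\<^sup>2 * real k \<le> f x" if "k \<le> N * T" for k
    using that
  proof (induct k)
    case 0
    show ?case using c0 by auto
  next
    case (Suc k)
    have ex: "\<exists>x\<le>a - real k * h. c0 - 3 * C * h\<^sup>2 * real k \<le> f x" using Suc by simp
    have "3 * C * h\<^sup>2 * real k \<le> 3 * C * h\<^sup>2 * real (N * T)"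
      using C Suc(2) by (intro mult_left_mono) (auto simp del: of_nat_mult)
    then have c: "0 < c0 - 3 * C * h\<^sup>2 * real k" using small c0 by linarith
    have "0 \<le> 3 * C * h\<^sup>2 * real k" using C by simp
    then have c': "c0 - 3 * C * h\<^sup>2 * real k \<le> c0" by simp
    from step[OF c c' h ex]
    obtain x where "x \<le> a - real k * h - h" "c0 - 3 * C * h\<^sup>2 * real k - 3 * C * h\<^sup>2 \<le> f x" by blast
    then show ?case by (intro exI[of _ x]) (simp add: algebra_simps)
  qed
  from this[of "N * T"] obtain x where x: "x \<le> a - real (N * T) * h" "c0 - 3 * C * h\<^sup>2 * real (N * T) \<le> f x" by blast
  have "real (N * T) * h = real T" using Np by (simp add: h_def)
  then have "x \<le> B" using x(1) T by linarith
  then show False using B[of x] x(2) small by linarith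
qed

lemma H1_pair_small_far:
  assumes "H1_pair u g" "c > 0"
  shows "\<exists>B. \<forall>x\<le>B. norm (u x) < c" "\<exists>B. \<forall>x\<ge>B. norm (u x) < c"
proof -
  have *: False if z: "\<And>n::nat. real n \<le> \<bar>z n\<bar>" "\<And>n. c \<le> norm (u (z n))" for z
  proof -
    have "(\<lambda>n. u (z n)) \<longlonglongrightarrow> 0"
    proof (rule H1_pair_tendsto_zero[OF assms(1)])
      fix M
      show "\<forall>\<^sub>F n in sequentially. M \<le> \<bar>z n\<bar>"
        using eventually_ge_at_top[of "nat \<lceil>M\<rceil>"]
      proof eventually_elim
        case (elim n)
        then have "M \<le> real n" by linarith
        then show ?case using z(1)[of n] by linarith
      qed
    qed
    from LIMSEQ_le_const[OF tendsto_norm[OF this], of c] z(2) assms(2) show False by auto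
  qed
  show "\<exists>B. \<forall>x\<le>B. norm (u x) < c"
  proof (rule ccontr)
    assume "\<not> ?thesis"
    then have "\<forall>n::nat. \<exists>x. x \<le> - real n \<and> c \<le> norm (u x)" by (meson not_less)
    from choice[OF this] obtain z where "\<forall>n. z n \<le> - real n \<and> c \<le> norm (u (z n))" by blast
    then have z: "z n \<le> - real n" "c \<le> norm (u (z n))" for n by auto
    have "real n \<le> \<bar>z n\<bar>" for n using z(1)[of n] by linarith
    note this z(2)
    then show False by (rule *)
  qed
  show "\<exists>B. \<forall>x\<ge>B. norm (u x) < c"
  proof (rule ccontr)
    assume "\<not> ?thesis"
    then have "\<forall>n::nat. \<exists>x. x \<ge> real n \<and> c \<le> norm (u x)" by (meson not_less)
    from choice[OF this] obtain z where "\<forall>n. z n \<ge> real n \<and> c \<le> norm (u (z n))" by blast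
    then have z: "z n \<ge> real n" "c \<le> norm (u (z n))" for n by auto
    have "real n \<le> \<bar>z n\<bar>" for n using z(1)[of n] by linarith
    note this z(2)
    then show False by (rule *)
  qed
qed

section \<open>Strict subadditivity\<close>

context three_wave
begin

lemma H1_pair_F_integrable: "H1_pair u g \<Longrightarrow> integrable lborel (\<lambda>x. F (u x))"
  by (rule F_integrable[OF H1_pairD(1) H1_pair_bdd[OF _ max.cobounded1 max.cobounded2]])

lemma F_vabs_fixed:
  assumes "vabs z = z"
  shows "F z = \<beta> / (p + 1) * (\<Sum>i\<in>UNIV. Re (z $ i) powr (p + 1)) + \<alpha> * (Re (z $ 1) * Re (z $ 2) * Re (z $ 3))"
proof -
  have z: "z $ i = complex_of_real (Re (z $ i))" "0 \<le> Re (z $ i)" for i using vabs_fixed_nth[OF assms] by auto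
  have c: "cmod (z $ i) = Re (z $ i)" for i using assms by (metis Re_complex_of_real vabs_nth)
  have "Re (z $ 1 * z $ 2 * cnj (z $ 3)) = Re (z $ 1) * Re (z $ 2) * Re (z $ 3)"
    by (subst (1) z(1)[of 1], subst (1) z(1)[of 2], subst (1) z(1)[of 3]) simp
  then show ?thesis unfolding F_def c by simp
qed

text \<open>Only the coupling term sees the phases, and it is largest when they are trivial.\<close>

lemma F_vabs: "F z \<le> F (vabs z)"
proof -
  have "Re (z $ 1 * z $ 2 * cnj (z $ 3)) \<le> cmod (z $ 1) * cmod (z $ 2) * cmod (z $ 3)"
    by (metis complex_Re_le_cmod complex_mod_cnj norm_mult)
  also have "\<dots> = Re (vabs z $ 1 * vabs z $ 2 * cnj (vabs z $ 3))" by simp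
  finally have "\<alpha> * Re (z $ 1 * z $ 2 * cnj (z $ 3)) \<le> \<alpha> * Re (vabs z $ 1 * vabs z $ 2 * cnj (vabs z $ 3))"
    using \<alpha> by (intro mult_left_mono) auto
  then show ?thesis unfolding F_def by simp
qed

lemma potential_mono:
  assumes "H1_pair u g" "H1_pair v h" "\<And>x. F (u x) \<le> F (v x)"
  shows "potential u \<le> potential v"
  unfolding potential_def
  by (rule integral_mono[OF H1_pair_F_integrable[OF assms(1)] H1_pair_F_integrable[OF assms(2)] assms(3)])

lemma mass_vabs: "mass1 (\<lambda>x. vabs (u x)) = mass1 u" "mass2 (\<lambda>x. vabs (u x)) = mass2 u"
  by (simp_all add: mass1_def mass2_def sqn_def)

lemma minimizer_vabs:
  assumes u: "H1_pair u g" and min: "E u g = Jmin (mass1 u) (mass2 u)"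
  obtains k where "H1_pair (\<lambda>x. vabs (u x)) k"
    "E (\<lambda>x. vabs (u x)) k = Jmin (mass1 (\<lambda>x. vabs (u x))) (mass2 (\<lambda>x. vabs (u x)))"
proof -
  obtain k where k: "H1_pair (\<lambda>x. vabs (u x)) k" "sqn k \<le> sqn g" by (rule H1_pair_vabs[OF u])
  have "E (\<lambda>x. vabs (u x)) k \<le> E u g"
    using potential_mono[OF u k(1) F_vabs] k(2) unfolding E_def by linarith
  then have "E (\<lambda>x. vabs (u x)) k = Jmin (mass1 (\<lambda>x. vabs (u x))) (mass2 (\<lambda>x. vabs (u x)))"
    using Jmin_le[OF k(1)] min unfolding mass_vabs by linarith
  with k(1) that show thesis by blast
qed

text \<open>In each component maximum and minimum are the two given values in some order, so the
  power terms balance exactly. The coupling gains by supermodularity.\<close>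

lemma F_vmax_vmin:
  assumes a: "vabs a = a" and b: "vabs b = b"
  shows "F a + F b \<le> F (vmax a b) + F (vmin a b)"
proof -
  have an: "0 \<le> Re (a $ i)" and bn: "0 \<le> Re (b $ i)" for i
    using vabs_fixed_nth[OF a, of i] vabs_fixed_nth[OF b, of i] by auto
  have fx: "vabs (vmax a b) = vmax a b" "vabs (vmin a b) = vmin a b"
    using an bn by (simp_all add: vec_eq_iff le_max_iff_disj)
  have pw: "(\<Sum>i\<in>UNIV. Re (vmax a b $ i) powr (p + 1)) + (\<Sum>i\<in>UNIV. Re (vmin a b $ i) powr (p + 1))
    = (\<Sum>i\<in>UNIV. Re (a $ i) powr (p + 1)) + (\<Sum>i\<in>UNIV. Re (b $ i) powr (p + 1))"
    unfolding sum.distrib[symmetric] by (rule sum.cong) (auto simp: max_def min_def)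
  have pr: "Re (a $ 1) * Re (a $ 2) * Re (a $ 3) + Re (b $ 1) * Re (b $ 2) * Re (b $ 3)
    \<le> Re (vmax a b $ 1) * Re (vmax a b $ 2) * Re (vmax a b $ 3) + Re (vmin a b $ 1) * Re (vmin a b $ 2) * Re (vmin a b $ 3)"
    using product_supermodular[OF an[of 1] an[of 2] an[of 3] bn[of 1] bn[of 2] bn[of 3]] by simp
  have "\<beta> / (p + 1) * ((\<Sum>i\<in>UNIV. Re (a $ i) powr (p + 1)) + (\<Sum>i\<in>UNIV. Re (b $ i) powr (p + 1)))
     + \<alpha> * (Re (a $ 1) * Re (a $ 2) * Re (a $ 3) + Re (b $ 1) * Re (b $ 2) * Re (b $ 3))
    \<le> \<beta> / (p + 1) * ((\<Sum>i\<in>UNIV. Re (vmax a b $ i) powr (p + 1)) + (\<Sum>i\<in>UNIV. Re (vmin a b $ i) powr (p + 1)))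
     + \<alpha> * (Re (vmax a b $ 1) * Re (vmax a b $ 2) * Re (vmax a b $ 3) + Re (vmin a b $ 1) * Re (vmin a b $ 2) * Re (vmin a b $ 3))"
    unfolding pw using \<alpha> by (intro add_left_mono mult_left_mono pr) auto
  then show ?thesis
    unfolding F_vabs_fixed[OF a] F_vabs_fixed[OF b] F_vabs_fixed[OF fx(1)] F_vabs_fixed[OF fx(2)] distrib_left by linarith
qed

text \<open>Maximum and minimum are half of the sum plus or minus the modulus of the difference. The
  parallelogram law, used once for them and once for the original pair, shows that the gradients
  together do not increase. The separate bound for k provides constants independent of
  translations.\<close>

lemma lattice:
  assumes v: "H1_pair v g" and w: "H1_pair w h" and pos: "\<And>x. vabs (v x) = v x" "\<And>x. vabs (w x) = w x"
  obtains k l where "H1_pair (\<lambda>x. vmax (v x) (w x)) k" "H1_pair (\<lambda>x. vmin (v x) (w x)) l"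
    "E (\<lambda>x. vmax (v x) (w x)) k + E (\<lambda>x. vmin (v x) (w x)) l \<le> E v g + E w h" "sqn k \<le> sqn g + sqn h"
proof -
  note gq = H1_pairD(2)[OF v] and hq = H1_pairD(2)[OF w]
  obtain d where d: "H1_pair (\<lambda>x. vabs (v x - w x)) d" "sqn d \<le> sqn (\<lambda>x. g x - h x)"
    by (rule H1_pair_vabs[OF H1_pair_diff[OF v w]])
  note dq = H1_pairD(2)[OF d(1)]
  define k where "k x = (1/2) *\<^sub>R (g x + h x + d x)" for x
  define l where "l x = (1/2) *\<^sub>R (g x + h x - d x)" for x
  have k: "H1_pair (\<lambda>x. vmax (v x) (w x)) k"
    unfolding vmax_vmin_formula(1)[OF pos] k_def[abs_def] by (intro H1_pair_scaleR H1_pair_add d v w)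
  have l: "H1_pair (\<lambda>x. vmin (v x) (w x)) l"
    unfolding vmax_vmin_formula(2)[OF pos] l_def[abs_def] by (intro H1_pair_scaleR H1_pair_diff H1_pair_add d v w)
  have "sqn k + sqn l = (1/4) * (sqn (\<lambda>x. (g x + h x) + d x) + sqn (\<lambda>x. (g x + h x) - d x))"
    unfolding k_def[abs_def] l_def[abs_def] sqn_scaleR by (simp add: power2_eq_square)
  also have "\<dots> = 1/2 * sqn (\<lambda>x. g x + h x) + 1/2 * sqn d"
    unfolding sqn_parallelogram[OF sq_int_add[OF gq hq] dq] by simp
  also have "\<dots> \<le> 1/2 * (sqn (\<lambda>x. g x + h x) + sqn (\<lambda>x. g x - h x))" using d(2) by simp
  also have "\<dots> = sqn g + sqn h" unfolding sqn_parallelogram[OF gq hq] by simp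
  finally have kl: "sqn k + sqn l \<le> sqn g + sqn h" .
  have "potential v + potential w \<le> potential (\<lambda>x. vmax (v x) (w x)) + potential (\<lambda>x. vmin (v x) (w x))"
  proof -
    note i = H1_pair_F_integrable[OF v] H1_pair_F_integrable[OF w] H1_pair_F_integrable[OF k] H1_pair_F_integrable[OF l]
    have "(\<integral>x. F (v x) + F (w x) \<partial>lborel) \<le> (\<integral>x. F (vmax (v x) (w x)) + F (vmin (v x) (w x)) \<partial>lborel)"
      by (rule integral_mono) (intro Bochner_Integration.integrable_add i F_vmax_vmin pos)+
    then show ?thesis unfolding potential_def using i by simp
  qed
  then have "E (\<lambda>x. vmax (v x) (w x)) k + E (\<lambda>x. vmin (v x) (w x)) l \<le> E v g + E w h"
    using kl unfolding E_def by linarith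
  moreover have "sqn k \<le> sqn g + sqn h" using kl sqn_nonneg[of l] by linarith
  ultimately show thesis using that k l by blast
qed

lemma lattice_mass:
  assumes v: "H1_pair v g" and w: "H1_pair w h" and pos: "\<And>x. vabs (v x) = v x" "\<And>x. vabs (w x) = w x"
  shows "sqn (\<lambda>x. vmax (v x) (w x) $ i) + sqn (\<lambda>x. vmin (v x) (w x) $ i) = sqn (\<lambda>x. v x $ i) + sqn (\<lambda>x. w x $ i)"
    "sqn (\<lambda>x. v x $ i) \<le> sqn (\<lambda>x. vmax (v x) (w x) $ i)"
proof -
  obtain k l where k: "H1_pair (\<lambda>x. vmax (v x) (w x)) k" and l: "H1_pair (\<lambda>x. vmin (v x) (w x)) l"
    by (rule lattice[OF v w pos])
  note i = sq_int_integrable[OF sq_int_nth[OF H1_pairD(1)[OF v]], of i] sq_int_integrable[OF sq_int_nth[OF H1_pairD(1)[OF w]], of i]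
    sq_int_integrable[OF sq_int_nth[OF H1_pairD(1)[OF k]], of i] sq_int_integrable[OF sq_int_nth[OF H1_pairD(1)[OF l]], of i]
  have vn: "(cmod (v x $ i))\<^sup>2 = (Re (v x $ i))\<^sup>2" "0 \<le> Re (v x $ i)" for x
    using vabs_fixed_nth[OF pos(1), of x i] by (metis norm_of_real power2_abs, blast)
  have wn: "(cmod (w x $ i))\<^sup>2 = (Re (w x $ i))\<^sup>2" "0 \<le> Re (w x $ i)" for x
    using vabs_fixed_nth[OF pos(2), of x i] by (metis norm_of_real power2_abs, blast)
  have "(\<integral>x. (cmod (vmax (v x) (w x) $ i))\<^sup>2 + (cmod (vmin (v x) (w x) $ i))\<^sup>2 \<partial>lborel)
    = (\<integral>x. (cmod (v x $ i))\<^sup>2 + (cmod (w x $ i))\<^sup>2 \<partial>lborel)"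
    by (rule Bochner_Integration.integral_cong) (auto simp: vn(1) wn(1) max_def min_def)
  then show "sqn (\<lambda>x. vmax (v x) (w x) $ i) + sqn (\<lambda>x. vmin (v x) (w x) $ i) = sqn (\<lambda>x. v x $ i) + sqn (\<lambda>x. w x $ i)"
    unfolding sqn_def using i by simp
  show "sqn (\<lambda>x. v x $ i) \<le> sqn (\<lambda>x. vmax (v x) (w x) $ i)"
    unfolding sqn_def
  proof (rule integral_mono[OF i(1) i(3)])
    fix x
    have "(Re (v x $ i))\<^sup>2 \<le> (max (Re (v x $ i)) (Re (w x $ i)))\<^sup>2" using vn(2)[of x] by (intro power_mono) auto
    then show "(cmod (v x $ i))\<^sup>2 \<le> (cmod (vmax (v x) (w x) $ i))\<^sup>2" unfolding vn(1) by simp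
  qed
qed

text \<open>Scaling all components by the same factor sqrt q costs only order 1 - q, whereas the
  earlier correction of excess mass costs the square root of the excess. The linear rate is
  essential where mass errors of order h^3 or \<kappa>^2 must stay negligible. It rests on q \<le>
  sqrt q.\<close>

lemma Jmin_rescale:
  assumes w: "H1_pair w k" and K: "sqn w \<le> K" "sqn k \<le> K" and q: "0 \<le> q" "q \<le> 1"
    and m: "q * mass1 w \<le> \<gamma>" "q * mass2 w \<le> \<mu>"
  shows "Jmin \<gamma> \<mu> \<le> E w k + lip (2 * sqrt K) * (2 * (1 - q) * K)"
proof -
  define s where "s = sqrt q"
  have s: "0 \<le> s" "s \<le> 1" "s * s = q" using q by (auto simp: s_def)
  let ?z = "\<lambda>x. s *\<^sub>R w x" and ?z' = "\<lambda>x. s *\<^sub>R k x"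
  have z: "H1_pair ?z ?z'" by (rule H1_pair_scaleR[OF w])
  have nz: "sqn ?z = q * sqn w" "sqn ?z' = q * sqn k" unfolding sqn_scaleR using s by (simp_all add: power2_eq_square)
  have "q * sqn w \<le> sqn w" "q * sqn k \<le> sqn k" using q by (simp_all add: mult_left_le_one_le)
  then have zK: "sqn ?z \<le> K" "sqn ?z' \<le> K" "sqn ?z \<le> sqn w" "sqn ?z' \<le> sqn k" using K unfolding nz by linarith+
  have K0: "0 \<le> K" using K(1) sqn_nonneg[of w] by linarith
  have mz: "mass1 ?z = q * mass1 w" "mass2 ?z = q * mass2 w"
    unfolding mass1_def mass2_def vector_scaleR_component sqn_scaleR using s by (simp_all add: power2_eq_square distrib_left)
  have dif: "sqrt (sqn (\<lambda>x. w x - ?z x)) = (1 - s) * sqrt (sqn w)"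
  proof -
    have "(\<lambda>x. w x - ?z x) = (\<lambda>x. (1 - s) *\<^sub>R w x)" by (simp add: scaleR_diff_left)
    then show ?thesis using s by (simp add: sqn_scaleR real_sqrt_mult)
  qed
  have "\<bar>potential w - potential ?z\<bar> \<le> lip (2 * sqrt K) * (sqrt (sqn (\<lambda>x. w x - ?z x)) * (sqrt (sqn w) + sqrt (sqn ?z)))"
    by (rule potential_lipschitz[OF H1_pairD(1)[OF w] H1_pairD(1)[OF z] H1_pair_bdd[OF w K] H1_pair_bdd[OF z zK(1,2)]])
  also have "\<dots> \<le> lip (2 * sqrt K) * (((1 - q) * sqrt K) * (sqrt K + sqrt K))"
  proof (intro mult_left_mono lip_nonneg)
    have "q \<le> s" using mult_left_mono[OF s(2) s(1)] s(3) by simp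
    then show "sqrt (sqn (\<lambda>x. w x - ?z x)) * (sqrt (sqn w) + sqrt (sqn ?z)) \<le> ((1 - q) * sqrt K) * (sqrt K + sqrt K)"
      unfolding dif using K(1) zK(1) q K0 by (intro mult_mono add_mono) auto
  qed (use K0 in simp)
  also have "((1 - q) * sqrt K) * (sqrt K + sqrt K) = 2 * (1 - q) * K"
  proof -
    have "((1 - q) * r) * (r + r) = 2 * (1 - q) * (r * r)" for r :: real by (simp add: algebra_simps)
    from this[of "sqrt K"] show ?thesis using K0 by simp
  qed
  finally show ?thesis using Jmin_le_of_mass_le[OF z, of \<gamma> \<mu>] m zK(4) unfolding mz E_def by linarith
qed

text \<open>Testing minimality with a tent of height and width of order \<open>h\<close> bounds the second differences of a
  minimizer, uniformly over bounded families; a convex kink would make them of order \<open>h\<close>.\<close>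

lemma second_difference:
  assumes "0 < \<gamma>0"
  shows "\<exists>C. \<forall>u g x h. H1_pair u g \<longrightarrow> sqn u \<le> K \<longrightarrow> sqn g \<le> K \<longrightarrow> \<gamma>0 \<le> mass1 u \<longrightarrow>
    E u g = Jmin (mass1 u) (mass2 u) \<longrightarrow> 0 < h \<longrightarrow> h \<le> 1 \<longrightarrow>
    \<bar>Re (u (x + h) $ 1) + Re (u (x - h) $ 1) - 2 * Re (u x $ 1)\<bar> \<le> C * h\<^sup>2"
proof -
  \<comment> \<open>Bounds the perturbed function and its derivative: the tent and its slope have
    squared norms at most 2, and the square of a sum is estimated with factors 2.\<close>
  define K' where "K' = 2 * K + 4"
  define S where "S = 2 * sqrt K'"
  \<comment> \<open>Change of the first mass in units of h^3: 4 S from the cross term with u, 2 from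
    the tent itself.\<close>
  define B where "B = 4 * S + 2"
  \<comment> \<open>The three summands are the costs in gradient, in potential and in restoring the
    mass.\<close>
  define C where "C = 1 + lip S * (4 * S) + lip S * (2 * (B / \<gamma>0) * K')"
  \<comment> \<open>The sign s selects an upward or a downward tent and thus one side of the final
    bound.\<close>
  have main: "s * (Re (u (x + h) $ 1) + Re (u (x - h) $ 1) - 2 * Re (u x $ 1)) \<le> C * h\<^sup>2"
    if u: "H1_pair u g" and uK: "sqn u \<le> K" "sqn g \<le> K" and gm: "\<gamma>0 \<le> mass1 u"
      and mn: "E u g = Jmin (mass1 u) (mass2 u)" and h: "0 < h" "h \<le> 1" and s: "s = 1 \<or> s = -1"
    for u g x h and s :: real
  proof -
    define \<Delta> where "\<Delta> = Re (u (x + h) $ 1) + Re (u (x - h) $ 1) - 2 * Re (u x $ 1)"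
    define \<kappa> where "\<kappa> = s * h"
    have \<kappa>: "\<bar>\<kappa>\<bar> = h" "\<kappa>\<^sup>2 = h\<^sup>2" using s h by (auto simp: \<kappa>_def)
    have K0: "0 \<le> K" using uK(1) sqn_nonneg[of u] by linarith
    have K'0: "0 \<le> K'" "K \<le> K'" using K0 by (auto simp: K'_def)
    have S0: "0 \<le> S" using K'0 by (simp add: S_def)
    \<comment> \<open>A tent of height h^2 and slope h. The gradient term changes to first order by
      h times the second difference, all other changes are of order h^3; division by h leaves the
      bound C h^2.\<close>
    define t where "t y = \<kappa> *\<^sub>R tent h x y" for y
    define t' where "t' y = \<kappa> *\<^sub>R tent' h x y" for y
    have t: "H1_pair t t'" unfolding t_def[abs_def] t'_def[abs_def] using h by (intro H1_pair_scaleR tent_H1_pair) simp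
    let ?\<psi> = "\<lambda>y. axis 1 (complex_of_real (t y)) :: complex^3" and ?\<psi>' = "\<lambda>y. axis 1 (complex_of_real (t' y)) :: complex^3"
    have \<psi>: "H1_pair ?\<psi> ?\<psi>'" by (intro H1_pair_bounded_linear[OF _ bounded_linear_axis] H1_pair_of_real t)
    have n\<psi>: "sqn ?\<psi> = sqn t" "sqn ?\<psi>' = sqn t'" by (simp_all add: sqn_def norm_axis3)
    have nt: "sqn t \<le> 2 * (h * h\<^sup>2)" "sqn t \<le> 2"
    proof -
      have "sqn t = h\<^sup>2 * sqn (tent h x)" unfolding t_def[abs_def] sqn_scaleR \<kappa> ..
      also have "\<dots> \<le> h\<^sup>2 * (2 * h ^ 3)" using tent_sqn_upper[of h x] h by (intro mult_left_mono) auto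
      also have "\<dots> = 2 * (h * h\<^sup>2) * h\<^sup>2" by (simp add: power2_eq_square power3_eq_cube)
      also have "\<dots> \<le> 2 * (h * h\<^sup>2) * 1" using h by (intro mult_left_mono) (auto simp: power_le_one)
      finally show 1: "sqn t \<le> 2 * (h * h\<^sup>2)" by simp
      have "h * h\<^sup>2 \<le> 1 * 1" using h by (intro mult_mono) (auto simp: power_le_one)
      then show "sqn t \<le> 2" using 1 by simp
    qed
    have nt': "sqn t' \<le> 2 * (h * h\<^sup>2)" "sqn t' \<le> 2"
    proof -
      have "sqn t' = h\<^sup>2 * sqn (tent' h x)" unfolding t'_def[abs_def] sqn_scaleR \<kappa> ..
      also have "\<dots> \<le> h\<^sup>2 * (2 * h)" using tent'_sqn[of h x] h by (intro mult_left_mono) auto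
      finally show 1: "sqn t' \<le> 2 * (h * h\<^sup>2)" by (simp add: mult_ac)
      have "h * h\<^sup>2 \<le> 1 * 1" using h by (intro mult_mono) (auto simp: power_le_one)
      then show "sqn t' \<le> 2" using 1 by simp
    qed
    define w where "w y = u y + ?\<psi> y" for y
    define w' where "w' y = g y + ?\<psi>' y" for y
    have w: "H1_pair w w'" unfolding w_def[abs_def] w'_def[abs_def] by (rule H1_pair_add[OF u \<psi>])
    have wK: "sqn w \<le> K'" "sqn w' \<le> K'"
      using sqn_add_le[OF H1_pairD(1)[OF u] H1_pairD(1)[OF \<psi>]] sqn_add_le[OF H1_pairD(2)[OF u] H1_pairD(2)[OF \<psi>]]
        nt(2) nt'(2) uK unfolding w_def[abs_def] w'_def[abs_def] n\<psi> K'_def by linarith+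
    have uK': "sqn u \<le> K'" "sqn g \<le> K'" using uK K'0 by linarith+
    have bd: "norm (u y) \<le> S" "norm (w y) \<le> S" for y
      unfolding S_def by (rule H1_pair_bdd[OF u uK'] H1_pair_bdd[OF w wK])+
    have ti: "integrable lborel (tent h x)" "(\<integral>y. tent h x y \<partial>lborel) \<le> 2 * h\<^sup>2"
    proof -
      have hi: "integrable lborel (\<lambda>y. h * indicat_real {x - h..x + h} y)"
        by (intro integrable_mult_right integrable_indicator_Icc)
      show i: "integrable lborel (tent h x)"
        by (rule Bochner_Integration.integrable_bound[OF hi])
           (use tent_bounds(1)[of h x] tent_bounds(3)[of h x] h in \<open>auto intro!: AE_I2\<close>)
      have "(\<integral>y. tent h x y \<partial>lborel) \<le> (\<integral>y. h * indicat_real {x - h..x + h} y \<partial>lborel)"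
        by (rule integral_mono[OF i hi tent_bounds(3)]) (use h in simp)
      also have "\<dots> = 2 * h\<^sup>2" using h by (simp add: power2_eq_square)
      finally show "(\<integral>y. tent h x y \<partial>lborel) \<le> 2 * h\<^sup>2" .
    qed
    have ta: "\<bar>t y\<bar> = h * tent h x y" for y using \<kappa>(1) tent_bounds(1)[of h x y] by (simp add: t_def abs_mult)
    have pot: "\<bar>potential w - potential u\<bar> \<le> lip S * (4 * S) * (h * h\<^sup>2)"
    proof -
      note i = H1_pair_F_integrable[OF w] H1_pair_F_integrable[OF u]
      have "\<bar>potential w - potential u\<bar> \<le> (\<integral>y. \<bar>F (w y) - F (u y)\<bar> \<partial>lborel)"
        unfolding potential_def using integral_abs_bound[of lborel "\<lambda>y. F (w y) - F (u y)"] i by simp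
      also have "\<dots> \<le> (\<integral>y. (lip S * (2 * S) * h) * tent h x y \<partial>lborel)"
      proof (rule integral_mono)
        show "integrable lborel (\<lambda>y. \<bar>F (w y) - F (u y)\<bar>)" by (intro integrable_abs Bochner_Integration.integrable_diff i)
        show "integrable lborel (\<lambda>y. (lip S * (2 * S) * h) * tent h x y)" by (intro integrable_mult_right ti)
        fix y
        have "\<bar>F (w y) - F (u y)\<bar> \<le> lip S * (norm (w y - u y) * (norm (w y) + norm (u y)))"
          by (rule F_lipschitz[OF bd(2,1)])
        also have "norm (w y - u y) = h * tent h x y" by (simp add: w_def norm_axis3 ta)
        also have "lip S * (h * tent h x y * (norm (w y) + norm (u y))) \<le> lip S * (h * tent h x y * (S + S))"
          using bd h tent_bounds(1)[of h x y] by (intro mult_left_mono add_mono lip_nonneg S0) auto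
        finally show "\<bar>F (w y) - F (u y)\<bar> \<le> (lip S * (2 * S) * h) * tent h x y" by (simp add: mult_ac)
      qed
      also have "\<dots> = (lip S * (2 * S) * h) * (\<integral>y. tent h x y \<partial>lborel)" by simp
      also have "\<dots> \<le> (lip S * (2 * S) * h) * (2 * h\<^sup>2)"
        using ti(2) h S0 lip_nonneg[OF S0] by (intro mult_left_mono) auto
      finally show ?thesis by (simp add: mult_ac)
    qed
    \<comment> \<open>The derivative of the tent is a difference of two indicators, so pairing it
      with g yields increments of u over the two halves, which combine to minus \<kappa> times the
      second difference.\<close>
    have grad: "sqn w' \<le> sqn g - 2 * \<kappa> * \<Delta> + 2 * (h * h\<^sup>2)"
    proof -
      let ?U = "\<lambda>y. Re (u y $ 1)" and ?G = "\<lambda>y. Re (g y $ 1)"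
      have U: "H1_pair ?U ?G" by (rule H1_pair_bounded_linear[OF H1_pair_nth[OF u] bounded_linear_Re])
      have Gi: "set_integrable lborel {a..b} ?G" for a b by (rule sq_int_interval_integrable[OF H1_pairD(2)[OF U]])
      have "(\<integral>y. g y \<bullet> ?\<psi>' y \<partial>lborel) = (\<integral>y. \<kappa> * (indicat_real {x - h..x} y *\<^sub>R ?G y - indicat_real {x..x + h} y *\<^sub>R ?G y) \<partial>lborel)"
        by (rule Bochner_Integration.integral_cong)
           (auto simp: inner_axis t'_def tent'_def inner_complex_def algebra_simps)
      also have "\<dots> = \<kappa> * ((LINT y:{x - h..x}|lborel. ?G y) - (LINT y:{x..x + h}|lborel. ?G y))"
        unfolding set_lebesgue_integral_def using Gi by (simp add: set_integrable_def)
      also have "(LINT y:{x - h..x}|lborel. ?G y) = ?U x - ?U (x - h)" using H1_pairD(3)[OF U, of "x - h" x] h by simp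
      also have "(LINT y:{x..x + h}|lborel. ?G y) = ?U (x + h) - ?U x" using H1_pairD(3)[OF U, of x "x + h"] h by simp
      finally have "(\<integral>y. g y \<bullet> ?\<psi>' y \<partial>lborel) = - \<kappa> * \<Delta>" by (simp add: \<Delta>_def algebra_simps)
      then show ?thesis
        unfolding w'_def[abs_def] sqn_add[OF H1_pairD(2)[OF u] H1_pairD(2)[OF \<psi>]] n\<psi> using nt'(1) by simp
    qed
    have mass: "mass1 w \<le> mass1 u + B * (h * h\<^sup>2)" "mass2 w = mass2 u"
    proof -
      have c: "(\<lambda>y. w y $ 1) = (\<lambda>y. u y $ 1 + complex_of_real (t y))" "(\<lambda>y. w y $ 2) = (\<lambda>y. u y $ 2)" "(\<lambda>y. w y $ 3) = (\<lambda>y. u y $ 3)"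
        by (simp_all add: w_def axis_def fun_eq_iff)
      have tq: "sq_int (\<lambda>y. complex_of_real (t y))" by (rule H1_pairD(1)[OF H1_pair_of_real[OF t]])
      have u1: "sq_int (\<lambda>y. u y $ 1)" by (rule sq_int_nth[OF H1_pairD(1)[OF u]])
      have "(\<integral>y. u y $ 1 \<bullet> complex_of_real (t y) \<partial>lborel) \<le> (\<integral>y. (S * h) * tent h x y \<partial>lborel)"
      proof (rule integral_mono[OF sq_int_inner[OF u1 tq]])
        show "integrable lborel (\<lambda>y. (S * h) * tent h x y)" by (intro integrable_mult_right ti)
        fix y
        have "u y $ 1 \<bullet> complex_of_real (t y) \<le> cmod (u y $ 1) * \<bar>t y\<bar>"
          using norm_cauchy_schwarz[of "u y $ 1" "complex_of_real (t y)"] by simp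
        also have "\<dots> \<le> S * (h * tent h x y)"
          unfolding ta using order.trans[OF Finite_Cartesian_Product.norm_nth_le bd(1)] h tent_bounds(1)[of h x y]
          by (intro mult_right_mono) auto
        finally show "u y $ 1 \<bullet> complex_of_real (t y) \<le> (S * h) * tent h x y" by (simp add: mult_ac)
      qed
      also have "\<dots> = (S * h) * (\<integral>y. tent h x y \<partial>lborel)" by simp
      also have "\<dots> \<le> (S * h) * (2 * h\<^sup>2)" using ti(2) h S0 by (intro mult_left_mono) auto
      finally have "2 * (\<integral>y. u y $ 1 \<bullet> complex_of_real (t y) \<partial>lborel) \<le> (4 * S) * (h * h\<^sup>2)" by (simp add: mult_ac)
      then show "mass1 w \<le> mass1 u + B * (h * h\<^sup>2)"
        unfolding mass1_def c sqn_add[OF u1 tq] sqn_of_real B_def distrib_right using nt(1) by linarith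
      show "mass2 w = mass2 u" unfolding mass2_def c ..
    qed
    \<comment> \<open>Removes excess first mass by scaling. The lower bound \<gamma>0 on the mass
      keeps 1 - q of order h^3 uniformly; without excess q is 1.\<close>
    define q where "q = mass1 u / max (mass1 u) (mass1 w)"
    have mp: "0 < mass1 u" using gm assms by linarith
    have B0: "0 \<le> B * (h * h\<^sup>2)" using S0 h by (simp add: B_def)
    have q: "0 \<le> q" "q \<le> 1" "q * mass1 w \<le> mass1 u" "1 - q \<le> B / \<gamma>0 * (h * h\<^sup>2)"
    proof -
      show "0 \<le> q" "q \<le> 1" using mp by (auto simp: q_def divide_le_eq)
      show "q * mass1 w \<le> mass1 u" using mp by (simp add: q_def divide_le_eq mult_left_mono)
      show "1 - q \<le> B / \<gamma>0 * (h * h\<^sup>2)"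
      proof (cases "mass1 w \<le> mass1 u")
        case True
        then have "q = 1" using mp by (simp add: q_def max_absorb1)
        then show ?thesis using B0 assms by simp
      next
        case False
        then have "1 - q = (mass1 w - mass1 u) / mass1 w" using mp by (simp add: q_def max_absorb2 diff_divide_distrib)
        also have "\<dots> \<le> (B * (h * h\<^sup>2)) / \<gamma>0"
          using False mass(1) gm assms B0 by (intro frac_le) auto
        finally show ?thesis by simp
      qed
    qed
    have m2: "q * mass2 w \<le> mass2 u" unfolding mass(2) using q by (simp add: mult_left_le_one_le)
    have "E u g \<le> E w w' + lip S * (2 * (1 - q) * K')"
      unfolding mn S_def by (rule Jmin_rescale[OF w wK q(1,2,3) m2])
    also have "lip S * (2 * (1 - q) * K') \<le> lip S * (2 * (B / \<gamma>0 * (h * h\<^sup>2)) * K')"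
      using q(4) K'0 by (intro mult_left_mono mult_right_mono lip_nonneg S0) auto
    finally have "1/2 * sqn g - potential u \<le> 1/2 * sqn w' - potential w + lip S * (2 * (B / \<gamma>0) * K') * (h * h\<^sup>2)"
      unfolding E_def by (simp add: mult_ac)
    with grad pot have "\<kappa> * \<Delta> \<le> h * h\<^sup>2 + lip S * (4 * S) * (h * h\<^sup>2) + lip S * (2 * (B / \<gamma>0) * K') * (h * h\<^sup>2)"
      by linarith
    also have "\<dots> = h * (C * h\<^sup>2)" unfolding C_def by (simp add: algebra_simps)
    finally have "h * (s * \<Delta>) \<le> h * (C * h\<^sup>2)" by (simp add: \<kappa>_def mult_ac)
    then show ?thesis using h by (simp add: \<Delta>_def)
  qed
  show ?thesis
  proof (intro exI[of _ C] allI impI)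
    fix u g and x h :: real
    assume a: "H1_pair u g" "sqn u \<le> K" "sqn g \<le> K" "\<gamma>0 \<le> mass1 u" "E u g = Jmin (mass1 u) (mass2 u)" "0 < h" "h \<le> 1"
    show "\<bar>Re (u (x + h) $ 1) + Re (u (x - h) $ 1) - 2 * Re (u x $ 1)\<bar> \<le> C * h\<^sup>2"
      using main[OF a, of 1 x] main[OF a, of "-1" x] by (simp add: abs_le_iff)
  qed
qed

text \<open>Without a first component the coupling is zero, and the mass B of the third component
  can be carried by the first one at equal energy. This frees B units of second mass, whose minimal
  energy is negative, so by subadditivity the state was not minimal.\<close>

lemma minimizer_first_component:
  assumes v: "H1_pair v g" and mn: "E v g = Jmin (mass1 v) (mass2 v)" and m: "0 < mass1 v"
  shows "0 < sqn (\<lambda>x. v x $ 1)"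
proof (rule ccontr)
  assume "\<not> ?thesis"
  then have s1: "sqn (\<lambda>x. v x $ 1) = 0" using sqn_nonneg[of "\<lambda>x. v x $ 1"] by linarith
  have v1: "v x $ 1 = 0" for x by (rule H1_pair_zero_mass[OF H1_pair_nth[OF v] s1])
  let ?a = "\<lambda>x. axis 2 (v x $ 2) :: complex^3" and ?a' = "\<lambda>x. axis 2 (g x $ 2) :: complex^3"
  let ?b = "\<lambda>x. axis 1 (v x $ 3) :: complex^3" and ?b' = "\<lambda>x. axis 1 (g x $ 3) :: complex^3"
  have a: "H1_pair ?a ?a'" and b: "H1_pair ?b ?b'"
    by (intro H1_pair_bounded_linear[OF _ bounded_linear_axis] H1_pair_nth v)+
  define A B where "A = sqn (\<lambda>x. v x $ 2)" and "B = sqn (\<lambda>x. v x $ 3)"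
  have mv: "mass1 v = B" "mass2 v = A + B" by (simp_all add: mass1_def mass2_def s1 A_def B_def)
  have z: "sqn (\<lambda>x. 0 :: complex) = 0" by simp
  have ma: "mass1 ?a = 0" "mass2 ?a = A" "mass1 ?b = B" "mass2 ?b = 0"
    by (simp_all add: mass1_def mass2_def axis_def A_def B_def z)
  have F: "F (v x) = F (?a x) + F (?b x)" for x
    unfolding F_axis by (simp add: F_def sum_3 v1 distrib_left)
  have "potential v = potential ?a + potential ?b"
    unfolding potential_def F using H1_pair_F_integrable[OF a] H1_pair_F_integrable[OF b] by simp
  moreover have "sqn ?a' + sqn ?b' \<le> sqn g"
  proof -
    have "sqn ?a' = sqn (\<lambda>x. g x $ 2)" "sqn ?b' = sqn (\<lambda>x. g x $ 3)" by (simp_all add: sqn_def norm_axis3)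
    then show ?thesis using sqn_components[OF H1_pairD(2)[OF v]] by simp
  qed
  ultimately have "E ?a ?a' + E ?b ?b' \<le> E v g" unfolding E_def by linarith
  then have "Jmin 0 A + Jmin B 0 \<le> Jmin B (A + B)"
    using Jmin_le[OF a] Jmin_le[OF b] mn unfolding ma mv by linarith
  moreover have "Jmin (B + 0) (0 + (A + B)) \<le> Jmin B 0 + Jmin 0 (A + B)"
    by (rule Jmin_subadditive) (simp_all add: A_def B_def)
  moreover have "Jmin (0 + 0) (A + B) \<le> Jmin 0 A + Jmin 0 B"
    by (rule Jmin_subadditive) (simp_all add: A_def B_def)
  moreover have "Jmin 0 B < 0" by (rule Jmin_neg) (use m mv in simp_all)
  ultimately show False by simp
qed

lemma sqn_pos_point:
  assumes "0 < sqn (\<lambda>x. f x)"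
  shows "\<exists>x. f x \<noteq> 0"
proof (rule ccontr)
  assume "\<not> ?thesis"
  then have "f = (\<lambda>x. 0)" by auto
  then show False using assms by simp
qed

text \<open>If both profiles carry the first mass, all maxima of translates are minimizers, although some of
  them have a convex kink.\<close>

lemma no_splitting_common_component:
  assumes v: "H1_pair v g" and w: "H1_pair w h" and pos: "\<And>x. vabs (v x) = v x" "\<And>x. vabs (w x) = w x"
    and mv: "E v g = Jmin (mass1 v) (mass2 v)" and mw: "E w h = Jmin (mass1 w) (mass2 w)"
    and m: "0 < mass1 v" "0 < mass1 w"
    and J: "Jmin (mass1 v) (mass2 v) + Jmin (mass1 w) (mass2 w) \<le> Jmin (mass1 v + mass1 w) (mass2 v + mass2 w)"
  shows False
proof -
  \<comment> \<open>Chosen to bound also the maximum with any translate, as well as its derivative.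
    The constant obtained from it is therefore the same for all translations.\<close>
  define K where "K = sqn v + sqn w + sqn g + sqn h"
  define \<gamma>0 where "\<gamma>0 = min (mass1 v) (mass1 w)"
  have \<gamma>0: "0 < \<gamma>0" "\<gamma>0 \<le> mass1 v" "\<gamma>0 \<le> mass1 w" using m by (auto simp: \<gamma>0_def)
  obtain C where C0: "\<forall>u g x h. H1_pair u g \<longrightarrow> sqn u \<le> K \<longrightarrow> sqn g \<le> K \<longrightarrow> \<gamma>0 \<le> mass1 u \<longrightarrow>
    E u g = Jmin (mass1 u) (mass2 u) \<longrightarrow> 0 < h \<longrightarrow> h \<le> 1 \<longrightarrow>
    \<bar>Re (u (x + h) $ 1) + Re (u (x - h) $ 1) - 2 * Re (u x $ 1)\<bar> \<le> C * h\<^sup>2"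
    using second_difference[OF \<gamma>0(1), of K] by (rule exE)
  note C = C0[rule_format]
  let ?f = "\<lambda>x. Re (v x $ 1)" and ?g = "\<lambda>x. Re (w x $ 1)"
  have fp: "H1_pair ?f (\<lambda>x. Re (g x $ 1))" by (rule H1_pair_bounded_linear[OF H1_pair_nth[OF v] bounded_linear_Re])
  have gp: "H1_pair ?g (\<lambda>x. Re (h x $ 1))" by (rule H1_pair_bounded_linear[OF H1_pair_nth[OF w] bounded_linear_Re])
  have fn: "0 \<le> ?f x" "v x $ 1 = complex_of_real (?f x)" for x using vabs_fixed_nth[OF pos(1), of x 1] by auto
  have gn: "0 \<le> ?g x" "w x $ 1 = complex_of_real (?g x)" for x using vabs_fixed_nth[OF pos(2), of x 1] by auto
  obtain a where "v a $ 1 \<noteq> 0" using sqn_pos_point[OF minimizer_first_component[OF v mv m(1)]] by blast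
  then have a: "0 < ?f a" using fn[of a] by (metis of_real_0 order_le_less)
  obtain b where "w b $ 1 \<noteq> 0" using sqn_pos_point[OF minimizer_first_component[OF w mw m(2)]] by blast
  then have b: "0 < ?g b" using gn[of b] by (metis of_real_0 order_le_less)
  have vK: "sqn v \<le> K" "sqn g \<le> K" and wK: "sqn w \<le> K" "sqn h \<le> K"
    using sqn_nonneg[of v] sqn_nonneg[of g] sqn_nonneg[of w] sqn_nonneg[of h] unfolding K_def by linarith+
  show False
  proof (rule no_transversal_crossing[of ?f ?g a b C])
    show "isCont ?f x" "isCont ?g x" for x by (rule H1_pair_isCont[OF fp] H1_pair_isCont[OF gp])+
    show "\<exists>B. \<forall>x\<le>B. ?f x < c" if "c > 0" for c
      using H1_pair_small_far(1)[OF fp that] fn by auto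
    show "\<exists>B. \<forall>x\<ge>B. ?g x < c" if "c > 0" for c
      using H1_pair_small_far(2)[OF gp that] gn by auto
    show "- (C * h\<^sup>2) \<le> ?f (x + h) + ?f (x - h) - 2 * ?f x" if "0 < h" "h \<le> 1" for x h
      using C[OF v vK \<gamma>0(2) mv that, of x] by (simp add: abs_le_iff)
    show "- (C * h\<^sup>2) \<le> ?g (x + h) + ?g (x - h) - 2 * ?g x" if "0 < h" "h \<le> 1" for x h
      using C[OF w wK \<gamma>0(3) mw that, of x] by (simp add: abs_le_iff)
    fix r x d :: real assume d: "0 < d" "d \<le> 1"
    let ?w = "\<lambda>x. w (x + r)" and ?h = "\<lambda>x. h (x + r)"
    let ?M = "\<lambda>x. vmax (v x) (w (x + r))" and ?m = "\<lambda>x. vmin (v x) (w (x + r))"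
    have w': "H1_pair ?w ?h" by (rule H1_pair_translate[OF w])
    have pos': "vabs (?w x) = ?w x" for x by (rule pos(2))
    obtain k l where k: "H1_pair ?M k" and l: "H1_pair ?m l" and Ekl: "E ?M k + E ?m l \<le> E v g + E ?w ?h" and sk: "sqn k \<le> sqn g + sqn ?h"
      by (rule lattice[OF v w' pos(1) pos'])
    note lm = lattice_mass[OF v w' pos(1) pos']
    have ms: "mass1 ?M + mass1 ?m = mass1 v + mass1 w" "mass2 ?M + mass2 ?m = mass2 v + mass2 w"
      using lm(1)[of 1] lm(1)[of 2] lm(1)[of 3] mass_translate(1)[of w r] mass_translate(2)[of w r]
      unfolding mass1_def mass2_def by linarith+
    \<comment> \<open>Additivity of the infimum bounds the energies of maximum and minimum by the
      infimum for their total masses, and subadditivity bounds that by the sum of their own infima.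
      Hence both attain them.\<close>
    have "E ?M k + E ?m l \<le> Jmin (mass1 ?M + mass1 ?m) (mass2 ?M + mass2 ?m)"
      using Ekl J mv mw unfolding ms E_translate by linarith
    also have "\<dots> \<le> Jmin (mass1 ?M) (mass2 ?M) + Jmin (mass1 ?m) (mass2 ?m)"
      by (rule Jmin_subadditive) simp_all
    finally have EM: "E ?M k = Jmin (mass1 ?M) (mass2 ?M)"
      using Jmin_le[OF k] Jmin_le[OF l] by linarith
    have gM: "\<gamma>0 \<le> mass1 ?M" using lm(2)[of 1] lm(2)[of 3] \<gamma>0(2) unfolding mass1_def by linarith
    have MK: "sqn ?M \<le> K"
    proof -
      have "sqn ?M + sqn ?m = sqn v + sqn ?w"
        using lm(1)[of 1] lm(1)[of 2] lm(1)[of 3] unfolding sqn_components[OF H1_pairD(1)[OF k]] sqn_components[OF H1_pairD(1)[OF l]]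
          sqn_components[OF H1_pairD(1)[OF v]] sqn_components[OF H1_pairD(1)[OF w']] by linarith
      then show ?thesis using sqn_nonneg[of ?m] sqn_nonneg[of g] sqn_nonneg[of h] unfolding sqn_translate K_def by linarith
    qed
    have kK: "sqn k \<le> K" using sk sqn_nonneg[of v] sqn_nonneg[of w] unfolding sqn_translate K_def by linarith
    show "max (?f (x + d)) (?g (x + d + r)) + max (?f (x - d)) (?g (x - d + r)) - 2 * max (?f x) (?g (x + r)) \<le> C * d\<^sup>2"
      using C[OF k MK kK gM EM d, of x] by simp
  qed (use a b in auto)
qed

end

lemma integral_pos_at_point:
  fixes f :: "real \<Rightarrow> real"
  assumes "integrable lborel f" "\<And>x. 0 \<le> f x" "isCont f a" "0 < f a"
  shows "0 < (\<integral>x. f x \<partial>lborel)"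
proof -
  have "\<forall>\<^sub>F y in at a. f a / 2 < f y"
    using assms(3,4) unfolding isCont_def by (intro order_tendstoD(1)) auto
  then obtain d where d: "d > 0" "\<And>y. y \<noteq> a \<Longrightarrow> dist y a < d \<Longrightarrow> f a / 2 < f y"
    unfolding eventually_at by auto
  have "f a / 2 * (d / 2) = (\<integral>x. f a / 2 * indicat_real {a..a + d/2} x \<partial>lborel)" using d(1) by simp
  also have "\<dots> \<le> (\<integral>x. f x \<partial>lborel)"
  proof (rule integral_mono)
    show "integrable lborel (\<lambda>x. f a / 2 * indicat_real {a..a + d/2} x)"
      by (intro integrable_mult_right integrable_indicator_Icc)
    fix x
    show "f a / 2 * indicat_real {a..a + d/2} x \<le> f x"
    proof (cases "x \<in> {a..a + d/2}")
      case True
      have "f a / 2 \<le> f x"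
      proof (cases "x = a")
        case False
        then show ?thesis using d True by (intro less_imp_le d(2)) (auto simp: dist_real_def)
      qed (use assms(4) in simp)
      then show ?thesis using True by simp
    qed (use assms(2) in simp)
  qed (rule assms(1))
  finally show ?thesis using d(1) assms(4) by (smt (verit) divide_pos_pos mult_pos_pos)
qed

context three_wave
begin

text \<open>If the first two components live in different profiles, transferring a fraction \<open>\<kappa>\<^sup>2\<close> of mass into
  the third component costs \<open>O(\<kappa>\<^sup>2)\<close> and gains a term of order \<open>\<kappa>\<close> from the coupling.\<close>

lemma no_splitting_separate:
  assumes v: "H1_pair v g" and w0: "H1_pair w h" and pos: "\<And>x. vabs (v x) = v x" "\<And>x. vabs (w x) = w x"
    and m0: "mass2 v = 0" "mass1 w = 0" and m: "0 < mass1 v" "0 < mass2 w"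
  shows "Jmin (mass1 v) (mass2 w) < E v g + E w h"
proof -
  have sv: "sqn (\<lambda>x. v x $ 2) = 0" "sqn (\<lambda>x. v x $ 3) = 0"
    using m0(1) sqn_nonneg[of "\<lambda>x. v x $ 2"] sqn_nonneg[of "\<lambda>x. v x $ 3"] unfolding mass2_def by linarith+
  have sw: "sqn (\<lambda>x. w x $ 1) = 0" "sqn (\<lambda>x. w x $ 3) = 0"
    using m0(2) sqn_nonneg[of "\<lambda>x. w x $ 1"] sqn_nonneg[of "\<lambda>x. w x $ 3"] unfolding mass1_def by linarith+
  have vz: "v x $ 2 = 0" "v x $ 3 = 0" for x
    by (rule H1_pair_zero_mass[OF H1_pair_nth[OF v] sv(1)], rule H1_pair_zero_mass[OF H1_pair_nth[OF v] sv(2)])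
  have wz: "w x $ 1 = 0" "w x $ 3 = 0" for x
    by (rule H1_pair_zero_mass[OF H1_pair_nth[OF w0] sw(1)], rule H1_pair_zero_mass[OF H1_pair_nth[OF w0] sw(2)])
  define G where "G = mass1 v"
  define M where "M = mass2 w"
  have GM: "0 < G" "0 < M" using m by (auto simp: G_def M_def)
  have Gv: "sqn (\<lambda>x. v x $ 1) = G" using sv by (simp add: G_def mass1_def)
  have Mw: "sqn (\<lambda>x. w x $ 2) = M" using sw by (simp add: M_def mass2_def)
  obtain x1 where x1: "v x1 $ 1 \<noteq> 0" using sqn_pos_point[of "\<lambda>x. v x $ 1"] Gv GM by auto
  obtain x2 where x2: "w x2 $ 2 \<noteq> 0" using sqn_pos_point[of "\<lambda>x. w x $ 2"] Mw GM by auto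
  \<comment> \<open>The translation brings a positive value of the second component over one of the
    first, so that the coupling integral I becomes positive.\<close>
  define c where "c = x2 - x1"
  define a where "a x = Re (v x $ 1)" for x
  define b where "b x = Re (w (x + c) $ 2)" for x
  have w: "H1_pair (\<lambda>x. w (x + c)) (\<lambda>x. h (x + c))" by (rule H1_pair_translate[OF w0])
  have a: "v x $ 1 = complex_of_real (a x)" "0 \<le> a x" for x
    using vabs_fixed_nth[OF pos(1), of x 1] by (auto simp: a_def)
  have b: "w (x + c) $ 2 = complex_of_real (b x)" "0 \<le> b x" for x
    using vabs_fixed_nth[OF pos(2), of "x + c" 2] by (auto simp: b_def)
  have ap: "0 < a x1" using x1 a[of x1] by (metis of_real_0 order_le_less)
  have bp: "0 < b x1" using x2 b[of x1] by (auto simp: c_def order_le_less)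
  have aH: "H1_pair a (\<lambda>x. Re (g x $ 1))"
    unfolding a_def[abs_def] by (rule H1_pair_bounded_linear[OF H1_pair_nth[OF v] bounded_linear_Re])
  have bH: "H1_pair b (\<lambda>x. Re (h (x + c) $ 2))"
    unfolding b_def[abs_def] by (rule H1_pair_bounded_linear[OF H1_pair_nth[OF w] bounded_linear_Re])
  define I where "I = (\<integral>x. (a x)\<^sup>2 * b x \<partial>lborel)"
  have Ii: "integrable lborel (\<lambda>x. (a x)\<^sup>2 * b x)"
  proof -
    define S where "S = 2 * sqrt (max (sqn b) (sqn (\<lambda>x. Re (h (x + c) $ 2))))"
    have bS: "norm (b x) \<le> S" for x unfolding S_def by (rule H1_pair_bdd[OF bH max.cobounded1 max.cobounded2])
    show ?thesis
    proof (rule Bochner_Integration.integrable_bound)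
      show "integrable lborel (\<lambda>x. S * (norm (a x))\<^sup>2)" using sq_int_integrable[OF H1_pairD(1)[OF aH]] by simp
      show "(\<lambda>x. (a x)\<^sup>2 * b x) \<in> borel_measurable lborel"
        using sq_int_meas[OF H1_pairD(1)[OF aH]] sq_int_meas[OF H1_pairD(1)[OF bH]] by measurable
      show "AE x in lborel. norm ((a x)\<^sup>2 * b x) \<le> norm (S * (norm (a x))\<^sup>2)"
      proof (rule AE_I2)
        fix x
        have "(a x)\<^sup>2 * b x \<le> (a x)\<^sup>2 * S" using bS[of x] b(2)[of x] by (intro mult_left_mono) auto
        moreover have "0 \<le> S" using bS[of x] by (rule order.trans[OF norm_ge_zero])
        ultimately show "norm ((a x)\<^sup>2 * b x) \<le> norm (S * (norm (a x))\<^sup>2)"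
          using b(2)[of x] by (simp add: mult.commute)
      qed
    qed
  qed
  have I: "0 < I"
    unfolding I_def
  proof (rule integral_pos_at_point[OF Ii])
    show "isCont (\<lambda>x. (a x)\<^sup>2 * b x) x1"
      by (intro continuous_intros H1_pair_isCont[OF aH] H1_pair_isCont[OF bH])
  qed (use ap bp b(2) in auto)
  define K where "K = 2 * G + M + 2 * sqn g + sqn h"
  \<comment> \<open>One factor 1 / (1 + \<kappa>^2 d) must restore both masses: the first grows by
    \<kappa>^2 G, which needs d \<ge> 1, the second by the same amount, which needs d \<ge> G /
    M.\<close>
  define d where "d = max 1 (G / M)"
  \<comment> \<open>Coefficient of \<kappa>^2 in the total cost: the gradient of the new third
    component and the rescaling.\<close>
  define D where "D = 1/2 * sqn g + lip (2 * sqrt K) * (2 * d * K)"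
  have K0: "0 \<le> K" using GM sqn_nonneg[of g] sqn_nonneg[of h] by (simp add: K_def)
  have d1: "1 \<le> d" "G \<le> d * M" using GM by (auto simp: d_def max_def field_simps)
  have D0: "0 \<le> D" using K0 d1 lip_nonneg[of "2 * sqrt K"] by (simp add: D_def)
  \<comment> \<open>Small enough for the gain \<alpha> \<kappa> I to beat the cost \<kappa>^2 D, and
    at most 1 so that K bounds all states considered.\<close>
  define \<kappa> where "\<kappa> = min 1 (\<alpha> * I / (2 * (D + 1)))"
  have \<kappa>: "0 < \<kappa>" "\<kappa> \<le> 1" using I \<alpha> D0 by (auto simp: \<kappa>_def)
  have \<kappa>D: "\<kappa> * D < \<alpha> * I"
  proof -
    have "\<kappa> * D \<le> \<alpha> * I / (2 * (D + 1)) * (D + 1)" using \<kappa> D0 by (intro mult_mono) (auto simp: \<kappa>_def)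
    also have "\<dots> = \<alpha> * I / 2" using D0 by (simp add: field_simps)
    also have "\<dots> < \<alpha> * I" using I \<alpha> by simp
    finally show ?thesis .
  qed
  \<comment> \<open>The third component is a multiple of the first, which makes the coupling density
    \<kappa> a^2 b, nonnegative and positive near x1.\<close>
  define z where "z x = vec3 (v x $ 1) (w (x + c) $ 2) (\<kappa> *\<^sub>R v x $ 1)" for x
  define k where "k x = vec3 (g x $ 1) (h (x + c) $ 2) (\<kappa> *\<^sub>R g x $ 1)" for x
  have z: "H1_pair z k"
    unfolding z_def[abs_def] k_def[abs_def]
    by (rule H1_pair_vec3[OF H1_pair_nth[OF v] H1_pair_nth[OF w] H1_pair_scaleR[OF H1_pair_nth[OF v]]])
  have \<kappa>2: "0 \<le> \<kappa>\<^sup>2" "\<kappa>\<^sup>2 \<le> 1" using \<kappa> by (auto simp: power_le_one)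
  have sk: "sqn k \<le> sqn g + sqn h + \<kappa>\<^sup>2 * sqn g"
  proof -
    have gq: "sq_int (\<lambda>x. g x $ 1)" by (rule sq_int_nth[OF H1_pairD(2)[OF v]])
    have hq: "sq_int (\<lambda>x. h (x + c) $ 2)" by (rule sq_int_nth[OF H1_pairD(2)[OF w]])
    have "sqn k = sqn (\<lambda>x. g x $ 1) + sqn (\<lambda>x. h (x + c) $ 2) + \<kappa>\<^sup>2 * sqn (\<lambda>x. g x $ 1)"
      unfolding k_def[abs_def] sqn_vec3(2)[OF gq hq sq_int_scaleR[OF gq]] sqn_scaleR ..
    also have "\<dots> \<le> sqn g + sqn (\<lambda>x. h (x + c)) + \<kappa>\<^sup>2 * sqn g"
      by (intro add_mono mult_left_mono sqn_nth_le H1_pairD(2)[OF v] H1_pairD(2)[OF w] \<kappa>2)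
    finally show ?thesis unfolding sqn_translate .
  qed
  have Mw': "sqn (\<lambda>x. w (x + c) $ 2) = M" using sqn_translate[of "\<lambda>x. w x $ 2" c] Mw by simp
  have mz: "mass1 z = G + \<kappa>\<^sup>2 * G" "mass2 z = M + \<kappa>\<^sup>2 * G"
    unfolding z_def[abs_def] mass_vec3 sqn_scaleR Gv Mw' by simp_all
  have sz: "sqn z \<le> K"
  proof -
    have "sqn z \<le> mass1 z + M"
      using sqn_components[OF H1_pairD(1)[OF z]] Mw' unfolding mass1_def by (simp add: z_def)
    moreover have "\<kappa>\<^sup>2 * G \<le> 1 * G" using \<kappa>2 GM by (intro mult_right_mono) auto
    ultimately show ?thesis unfolding mz K_def using sqn_nonneg[of g] sqn_nonneg[of h] by linarith
  qed
  have skK: "sqn k \<le> K"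
  proof -
    have "\<kappa>\<^sup>2 * sqn g \<le> 1 * sqn g" using \<kappa>2 by (intro mult_right_mono) auto
    then show ?thesis using sk GM unfolding K_def by linarith
  qed
  have pot: "potential v + potential (\<lambda>x. w (x + c)) + \<alpha> * \<kappa> * I \<le> potential z"
  proof -
    note i = H1_pair_F_integrable[OF v] H1_pair_F_integrable[OF w] H1_pair_F_integrable[OF z]
    have Fz: "F (v x) + F (w (x + c)) + \<alpha> * \<kappa> * ((a x)\<^sup>2 * b x) \<le> F (z x)" for x
    proof -
      have f1: "F (v x) = \<beta> / (p + 1) * a x powr (p + 1)"
        using a(2)[of x] by (simp add: F_def sum_3 vz a(1))
      have f2: "F (w (x + c)) = \<beta> / (p + 1) * b x powr (p + 1)"
        using b(2)[of x] by (simp add: F_def sum_3 wz b(1))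
      have f3: "F (z x) = \<beta> / (p + 1) * (a x powr (p + 1) + b x powr (p + 1) + (\<kappa> * a x) powr (p + 1)) + \<alpha> * (a x * b x * (\<kappa> * a x))"
        using a(2)[of x] b(2)[of x] \<kappa> by (simp add: F_def sum_3 z_def a(1) b(1) norm_mult)
      have "0 \<le> \<beta> / (p + 1) * (\<kappa> * a x) powr (p + 1)" using \<beta> p1 by simp
      then show ?thesis unfolding f1 f2 f3 by (simp add: distrib_left power2_eq_square mult_ac)
    qed
    have "(\<integral>x. F (v x) + F (w (x + c)) + \<alpha> * \<kappa> * ((a x)\<^sup>2 * b x) \<partial>lborel) \<le> potential z"
      unfolding potential_def
      by (rule integral_mono[OF _ i(3) Fz]) (intro Bochner_Integration.integrable_add i integrable_mult_right Ii)
    also have "(\<integral>x. F (v x) + F (w (x + c)) + \<alpha> * \<kappa> * ((a x)\<^sup>2 * b x) \<partial>lborel)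
       = potential v + potential (\<lambda>x. w (x + c)) + \<alpha> * \<kappa> * I"
      unfolding potential_def I_def using i Ii by simp
    finally show ?thesis .
  qed
  have Ez: "E z k \<le> E v g + E w h + 1/2 * (\<kappa>\<^sup>2 * sqn g) - \<alpha> * \<kappa> * I"
  proof -
    have "E w h = 1/2 * sqn h - potential (\<lambda>x. w (x + c))"
      using E_translate[of w c h] sqn_translate[of h c] unfolding E_def by simp
    then show ?thesis using sk pot unfolding E_def[of z] E_def[of v] by linarith
  qed
  define q where "q = 1 / (1 + \<kappa>\<^sup>2 * d)"
  have pd: "0 < 1 + \<kappa>\<^sup>2 * d" using \<kappa>2 d1 by (simp add: add_pos_nonneg)
  have q: "0 \<le> q" "q \<le> 1" "1 - q \<le> \<kappa>\<^sup>2 * d"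
  proof -
    have p0: "0 \<le> \<kappa>\<^sup>2 * d" using \<kappa>2 d1 by simp
    show "0 \<le> q" "q \<le> 1" using pd p0 by (auto simp: q_def)
    have "1 - q = \<kappa>\<^sup>2 * d / (1 + \<kappa>\<^sup>2 * d)" using pd by (simp add: q_def field_simps)
    also have "\<dots> \<le> \<kappa>\<^sup>2 * d / 1" using p0 by (intro divide_left_mono) auto
    finally show "1 - q \<le> \<kappa>\<^sup>2 * d" by simp
  qed
  have qm: "q * mass1 z \<le> G" "q * mass2 z \<le> M"
  proof -
    have "\<kappa>\<^sup>2 * G * 1 \<le> \<kappa>\<^sup>2 * G * d" using \<kappa>2 GM d1 by (intro mult_left_mono) auto
    then have "mass1 z \<le> G * (1 + \<kappa>\<^sup>2 * d)" unfolding mz by (simp add: algebra_simps)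
    then show "q * mass1 z \<le> G" using pd by (simp add: q_def divide_le_eq)
    have "\<kappa>\<^sup>2 * G \<le> \<kappa>\<^sup>2 * (d * M)" using \<kappa>2 d1 by (intro mult_left_mono) auto
    then have "mass2 z \<le> M * (1 + \<kappa>\<^sup>2 * d)" unfolding mz by (simp add: algebra_simps)
    then show "q * mass2 z \<le> M" using pd by (simp add: q_def divide_le_eq)
  qed
  have "Jmin G M \<le> E z k + lip (2 * sqrt K) * (2 * (1 - q) * K)"
    by (rule Jmin_rescale[OF z sz skK q(1,2) qm])
  also have "lip (2 * sqrt K) * (2 * (1 - q) * K) \<le> lip (2 * sqrt K) * (2 * (\<kappa>\<^sup>2 * d) * K)"
    using q(3) K0 by (intro mult_left_mono mult_right_mono lip_nonneg) auto
  finally have "Jmin G M \<le> E v g + E w h + \<kappa> * (\<kappa> * D - \<alpha> * I)"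
    using Ez by (simp add: D_def algebra_simps power2_eq_square)
  moreover have "\<kappa> * (\<kappa> * D - \<alpha> * I) < 0" using \<kappa> \<kappa>D by (intro mult_pos_neg) auto
  ultimately show ?thesis unfolding G_def M_def by linarith
qed

section \<open>Symmetry of the first two components, exclusion of splitting, compactness\<close>

definition swap :: "complex ^ 3 \<Rightarrow> complex ^ 3" where
  "swap z = vec3 (z $ 2) (z $ 1) (z $ 3)"

lemma F_swap: "F (swap z) = F z"
  by (simp add: F_def swap_def sum_3 mult.commute add.commute)

lemma H1_pair_swap: "H1_pair u g \<Longrightarrow> H1_pair (\<lambda>x. swap (u x)) (\<lambda>x. swap (g x))"
  unfolding swap_def by (intro H1_pair_vec3 H1_pair_nth)

lemma mass_swap: "mass1 (\<lambda>x. swap (u x)) = mass2 u" "mass2 (\<lambda>x. swap (u x)) = mass1 u"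
  by (simp_all add: swap_def mass1_def mass2_def)

lemma E_swap: "E (\<lambda>x. swap (u x)) (\<lambda>x. swap (g x)) = E u g"
proof -
  have "sqn (\<lambda>x. swap (g x)) = sqn g" by (simp add: sqn_def norm_vec3_sq swap_def add.commute add.left_commute)
  then show ?thesis by (simp add: E_def potential_def F_swap)
qed

lemma Jmin_swap: "Jmin \<gamma> \<mu> = Jmin \<mu> \<gamma>"
proof -
  have *: "competitors \<gamma> \<mu> \<subseteq> competitors \<mu> \<gamma>" for \<gamma> \<mu>
  proof
    fix y assume "y \<in> competitors \<gamma> \<mu>"
    then obtain u g where u: "y = E u g" "H1_pair u g" "mass1 u = \<gamma>" "mass2 u = \<mu>" by (auto simp: competitors_def)
    then show "y \<in> competitors \<mu> \<gamma>"
      unfolding competitors_def using H1_pair_swap[OF u(2)] mass_swap[of u] E_swap[of u g] by (intro CollectI exI conjI) auto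
  qed
  show ?thesis unfolding Jmin_def using *[of \<gamma> \<mu>] *[of \<mu> \<gamma>] by (simp add: subset_antisym)
qed

lemma vabs_swap: "vabs (swap z) = swap (vabs z)"
  by (simp add: swap_def vec_eq_iff forall_3)

text \<open>Each profile carries some mass. Either both share the first mass, or both share the
  second (the same case after exchanging the first two components), or each has exactly one of the
  two masses and not the same one. Moduli are taken beforehand since the lattice argument needs
  nonnegative components.\<close>

theorem no_splitting:
  assumes v: "H1_pair v g" and w: "H1_pair w h"
    and mv: "E v g = Jmin (mass1 v) (mass2 v)" and mw: "E w h = Jmin (mass1 w) (mass2 w)"
    and m: "0 < mass1 v + mass2 v" "0 < mass1 w + mass2 w"
    and J: "Jmin (mass1 v) (mass2 v) + Jmin (mass1 w) (mass2 w) \<le> Jmin (mass1 v + mass1 w) (mass2 v + mass2 w)"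
  shows False
proof -
  have nn: "vabs (vabs z) = vabs z" for z by (simp add: vec_eq_iff)
  let ?v = "\<lambda>x. vabs (v x)" and ?w = "\<lambda>x. vabs (w x)"
  obtain g' where v': "H1_pair ?v g'" and mv': "E ?v g' = Jmin (mass1 ?v) (mass2 ?v)"
    by (rule minimizer_vabs[OF v mv])
  obtain h' where w': "H1_pair ?w h'" and mw': "E ?w h' = Jmin (mass1 ?w) (mass2 ?w)"
    by (rule minimizer_vabs[OF w mw])
  note J' = J[folded mass_vabs(1)[of v] mass_vabs(2)[of v] mass_vabs(1)[of w] mass_vabs(2)[of w]]
  note m' = m[folded mass_vabs(1)[of v] mass_vabs(2)[of v] mass_vabs(1)[of w] mass_vabs(2)[of w]]
  consider "0 < mass1 ?v" "0 < mass1 ?w" | "0 < mass2 ?v" "0 < mass2 ?w"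
    | "0 < mass1 ?v" "mass2 ?v = 0" "mass1 ?w = 0" "0 < mass2 ?w"
    | "0 < mass1 ?w" "mass2 ?w = 0" "mass1 ?v = 0" "0 < mass2 ?v"
    using m' mass_nonneg[of ?v] mass_nonneg[of ?w] by linarith
  then show False
  proof cases
    case 1
    show False by (rule no_splitting_common_component[OF v' w' nn nn mv' mw' 1 J'])
  next
    case 2
    show False
    proof (rule no_splitting_common_component[OF H1_pair_swap[OF v'] H1_pair_swap[OF w']])
      show "E (\<lambda>x. swap (?v x)) (\<lambda>x. swap (g' x)) = Jmin (mass1 (\<lambda>x. swap (?v x))) (mass2 (\<lambda>x. swap (?v x)))"
        unfolding E_swap mass_swap mv' by (rule Jmin_swap)
      show "E (\<lambda>x. swap (?w x)) (\<lambda>x. swap (h' x)) = Jmin (mass1 (\<lambda>x. swap (?w x))) (mass2 (\<lambda>x. swap (?w x)))"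
        unfolding E_swap mass_swap mw' by (rule Jmin_swap)
      show "0 < mass1 (\<lambda>x. swap (?v x))" "0 < mass1 (\<lambda>x. swap (?w x))" using 2 unfolding mass_swap by auto
      show "Jmin (mass1 (\<lambda>x. swap (?v x))) (mass2 (\<lambda>x. swap (?v x))) + Jmin (mass1 (\<lambda>x. swap (?w x))) (mass2 (\<lambda>x. swap (?w x)))
        \<le> Jmin (mass1 (\<lambda>x. swap (?v x)) + mass1 (\<lambda>x. swap (?w x))) (mass2 (\<lambda>x. swap (?v x)) + mass2 (\<lambda>x. swap (?w x)))"
        unfolding mass_swap using J' Jmin_swap[of "mass1 ?v" "mass2 ?v"] Jmin_swap[of "mass1 ?w" "mass2 ?w"]
          Jmin_swap[of "mass1 ?v + mass1 ?w" "mass2 ?v + mass2 ?w"] by linarith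
    qed (simp_all add: vabs_swap nn)
  next
    case 3
    from no_splitting_separate[OF v' w' nn nn 3(2,3,1,4)] show False using J' 3 mv' mw' by simp
  next
    case 4
    from no_splitting_separate[OF w' v' nn nn 4(2,3,1,4)] show False using J' 4 mv' mw' by simp
  qed
qed

text \<open>If the profile v leaves mass behind, a second profile is extracted from a minimizing
  sequence for the leftover masses, not from the remainder itself. The two then violate the
  exclusion of splitting.\<close>

theorem minimizing_compact:
  assumes u: "\<And>n. H1_pair (u n) (g n)"
    and m: "(\<lambda>n. mass1 (u n)) \<longlonglongrightarrow> \<gamma>" "(\<lambda>n. mass2 (u n)) \<longlonglongrightarrow> \<mu>"
    and e: "(\<lambda>n. E (u n) (g n)) \<longlonglongrightarrow> Jmin \<gamma> \<mu>" and pos: "0 < \<gamma> + \<mu>"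
  shows "\<exists>r y v h. strict_mono (r :: nat \<Rightarrow> nat) \<and> H1_pair v h \<and> mass1 v = \<gamma> \<and> mass2 v = \<mu> \<and> E v h = Jmin \<gamma> \<mu> \<and>
     (\<lambda>n. sqn (\<lambda>x. u (r n) (x + y n) - v x) + sqn (\<lambda>x. g (r n) (x + y n) - h x)) \<longlonglongrightarrow> 0"
proof (rule profile[OF u m e pos])
  fix r y v h
  assume r: "strict_mono (r :: nat \<Rightarrow> nat)" and v: "H1_pair v h" and le: "mass1 v \<le> \<gamma>" "mass2 v \<le> \<mu>"
    and vp: "0 < mass1 v + mass2 v" and Ev: "E v h = Jmin (mass1 v) (mass2 v)"
    and J: "Jmin (mass1 v) (mass2 v) + Jmin (\<gamma> - mass1 v) (\<mu> - mass2 v) \<le> Jmin \<gamma> \<mu>"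
    and conv: "mass1 v = \<gamma> \<Longrightarrow> mass2 v = \<mu> \<Longrightarrow>
       (\<lambda>n. sqn (\<lambda>x. u (r n) (x + y n) - v x) + sqn (\<lambda>x. g (r n) (x + y n) - h x)) \<longlonglongrightarrow> 0"
  have full: "mass1 v = \<gamma> \<and> mass2 v = \<mu>"
  proof (rule ccontr)
    assume n: "\<not> (mass1 v = \<gamma> \<and> mass2 v = \<mu>)"
    define \<gamma>' \<mu>' where "\<gamma>' = \<gamma> - mass1 v" and "\<mu>' = \<mu> - mass2 v"
    have p': "0 \<le> \<gamma>'" "0 \<le> \<mu>'" "0 < \<gamma>' + \<mu>'" using le n by (auto simp: \<gamma>'_def \<mu>'_def)
    show False
    proof (rule Jmin_minimizing[OF p'(1,2)])
      fix U G
      assume U: "\<And>n. H1_pair (U n) (G n)" "\<And>n. mass1 (U n) = \<gamma>'" "\<And>n. mass2 (U n) = \<mu>'"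
        and UE: "(\<lambda>n. E (U n) (G n)) \<longlonglongrightarrow> Jmin \<gamma>' \<mu>'"
      have mU: "(\<lambda>n. mass1 (U n)) \<longlonglongrightarrow> \<gamma>'" "(\<lambda>n. mass2 (U n)) \<longlonglongrightarrow> \<mu>'" unfolding U(2,3) by auto
      show False
      proof (rule profile[OF U(1) mU UE p'(3)])
        fix r' :: "nat \<Rightarrow> nat" and y' w k
        assume w: "H1_pair w k" and lw: "mass1 w \<le> \<gamma>'" "mass2 w \<le> \<mu>'" and wp: "0 < mass1 w + mass2 w"
          and Ew: "E w k = Jmin (mass1 w) (mass2 w)"
          and Jw: "Jmin (mass1 w) (mass2 w) + Jmin (\<gamma>' - mass1 w) (\<mu>' - mass2 w) \<le> Jmin \<gamma>' \<mu>'"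
        \<comment> \<open>The second profile need not exhaust the leftover masses. Subadditivity
          splits off what remains, and the same term then cancels against the one in the inequality
          for w.\<close>
        have "Jmin ((mass1 v + mass1 w) + (\<gamma>' - mass1 w)) ((mass2 v + mass2 w) + (\<mu>' - mass2 w))
          \<le> Jmin (mass1 v + mass1 w) (mass2 v + mass2 w) + Jmin (\<gamma>' - mass1 w) (\<mu>' - mass2 w)"
          by (rule Jmin_subadditive) (use lw in simp_all)
        then have "Jmin \<gamma> \<mu> \<le> Jmin (mass1 v + mass1 w) (mass2 v + mass2 w) + Jmin (\<gamma>' - mass1 w) (\<mu>' - mass2 w)"
          by (simp add: \<gamma>'_def \<mu>'_def)
        with J Jw have "Jmin (mass1 v) (mass2 v) + Jmin (mass1 w) (mass2 w) \<le> Jmin (mass1 v + mass1 w) (mass2 v + mass2 w)"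
          unfolding \<gamma>'_def[symmetric] \<mu>'_def[symmetric] by linarith
        then show False by (rule no_splitting[OF v w Ev Ew vp wp])
      qed
    qed
  qed
  show ?thesis
    using r v full Ev conv by (intro exI[of _ r] exI[of _ y] exI[of _ v] exI[of _ h]) simp
qed

end

section \<open>Smooth functions\<close>

definition smooth :: "(real \<Rightarrow> real) \<Rightarrow> bool" where
  "smooth f \<longleftrightarrow> (\<forall>n x. (deriv ^^ n) f field_differentiable (at x))"

text \<open>Any class of differentiable functions closed under derivatives consists of smooth
  functions. This avoids formulas for higher derivatives.\<close>

lemma smooth_coinduct:
  assumes "P f" "\<And>g x. P g \<Longrightarrow> g field_differentiable (at x)" "\<And>g. P g \<Longrightarrow> P (deriv g)"
  shows "smooth f"
proof -
  have "P ((deriv ^^ n) f)" for n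
    by (induct n) (use assms in auto)
  then show ?thesis using assms(2) by (auto simp: smooth_def)
qed

lemma smooth_differentiable: "smooth f \<Longrightarrow> f field_differentiable (at x)"
  unfolding smooth_def by (metis funpow_0)

lemma smooth_deriv: "smooth f \<Longrightarrow> smooth (deriv f)"
  unfolding smooth_def
proof (intro allI)
  fix n x
  assume "\<forall>n x. (deriv ^^ n) f field_differentiable at x"
  then have "(deriv ^^ Suc n) f field_differentiable at x" by blast
  then show "(deriv ^^ n) (deriv f) field_differentiable at x" by (simp add: funpow_swap1)
qed

lemma smooth_has_deriv: "smooth f \<Longrightarrow> (f has_field_derivative deriv f x) (at x)"
  using smooth_differentiable DERIV_deriv_iff_field_differentiable by blast

lemma smooth_of_deriv:
  assumes "\<And>x. f field_differentiable (at x)" "smooth (deriv f)"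
  shows "smooth f"
  unfolding smooth_def
proof (intro allI)
  fix n x
  show "(deriv ^^ n) f field_differentiable at x"
  proof (cases n)
    case (Suc m)
    have "(deriv ^^ n) f = (deriv ^^ m) (deriv f)" unfolding Suc by (simp add: funpow_swap1)
    then show ?thesis using assms(2) by (simp add: smooth_def)
  qed (use assms(1) in simp)
qed

lemma smooth_isCont: "smooth f \<Longrightarrow> isCont f x"
  using smooth_has_deriv DERIV_isCont by blast

lemma smooth_lincomb:
  assumes "smooth f" "smooth g"
  shows "smooth (\<lambda>x. f x + c * g x)"
proof (rule smooth_coinduct[where P="\<lambda>h. \<exists>f g. smooth f \<and> smooth g \<and> h = (\<lambda>x. f x + c * g x)"])
  fix h x assume "\<exists>f g. smooth f \<and> smooth g \<and> h = (\<lambda>x. f x + c * g x)"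
  then obtain f g where h: "smooth f" "smooth g" "h = (\<lambda>x. f x + c * g x)" by blast
  show "h field_differentiable at x"
    unfolding h(3) field_differentiable_def
    by (rule exI, rule DERIV_add[OF smooth_has_deriv[OF h(1)] DERIV_cmult[OF smooth_has_deriv[OF h(2)]]])
next
  fix h assume "\<exists>f g. smooth f \<and> smooth g \<and> h = (\<lambda>x. f x + c * g x)"
  then obtain f g where h: "smooth f" "smooth g" "h = (\<lambda>x. f x + c * g x)" by blast
  have "deriv h = (\<lambda>x. deriv f x + c * deriv g x)"
    unfolding h(3)
    by (intro ext DERIV_imp_deriv, rule DERIV_add[OF smooth_has_deriv[OF h(1)] DERIV_cmult[OF smooth_has_deriv[OF h(2)]]])
  then show "\<exists>f g. smooth f \<and> smooth g \<and> deriv h = (\<lambda>x. f x + c * g x)" using h smooth_deriv by blast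
qed (use assms in blast)

lemma smooth_affine:
  assumes "smooth f"
  shows "smooth (\<lambda>x. f (a * x + b))"
proof (rule smooth_coinduct[where P="\<lambda>h. \<exists>c f. smooth f \<and> h = (\<lambda>x. c * f (a * x + b))"])
  have d: "((\<lambda>x. c * f (a * x + b)) has_field_derivative (c * a) * deriv f (a * x + b)) (at x)" if "smooth f" for c f x
    by (rule derivative_eq_intros DERIV_chain2[OF smooth_has_deriv[OF that]] refl | simp)+
  fix h x assume "\<exists>c f. smooth f \<and> h = (\<lambda>x. c * f (a * x + b))"
  then show "h field_differentiable at x"
    using d unfolding field_differentiable_def by blast
next
  have d: "((\<lambda>x. c * f (a * x + b)) has_field_derivative (c * a) * deriv f (a * x + b)) (at x)" if "smooth f" for c f x
    by (rule derivative_eq_intros DERIV_chain2[OF smooth_has_deriv[OF that]] refl | simp)+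
  fix h assume "\<exists>c f. smooth f \<and> h = (\<lambda>x. c * f (a * x + b))"
  then obtain c f where h: "smooth f" "h = (\<lambda>x. c * f (a * x + b))" by blast
  have "deriv h = (\<lambda>x. (c * a) * deriv f (a * x + b))"
    unfolding h(2) by (intro ext DERIV_imp_deriv d h)
  then show "\<exists>c f. smooth f \<and> deriv h = (\<lambda>x. c * f (a * x + b))" using h smooth_deriv by blast
next
  show "\<exists>c g. smooth g \<and> (\<lambda>x. f (a * x + b)) = (\<lambda>x. c * g (a * x + b))"
    by (rule exI[of _ 1], rule exI[of _ f]) (simp add: assms)
qed

text \<open>Finite sums of products of smooth functions: the smallest class around a product that
  Leibniz' rule does not leave.\<close>

inductive product_span :: "(real \<Rightarrow> real) \<Rightarrow> bool" where
  mult: "smooth f \<Longrightarrow> smooth g \<Longrightarrow> product_span (\<lambda>x. f x * g x)"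
| add: "product_span h \<Longrightarrow> product_span k \<Longrightarrow> product_span (\<lambda>x. h x + k x)"

lemma product_span_deriv:
  "product_span h \<Longrightarrow> \<exists>h'. (\<forall>x. (h has_field_derivative h' x) (at x)) \<and> product_span h'"
proof (induct rule: product_span.induct)
  case (mult f g)
  have "\<forall>x. ((\<lambda>x. f x * g x) has_field_derivative deriv f x * g x + f x * deriv g x) (at x)"
    using DERIV_mult[OF smooth_has_deriv[OF mult(1)] smooth_has_deriv[OF mult(2)]] by (simp add: add.commute mult.commute)
  moreover have "product_span (\<lambda>x. deriv f x * g x + f x * deriv g x)"
    by (intro product_span.intros smooth_deriv mult)
  ultimately show ?case by (intro exI conjI)
next
  case (add h k)
  then obtain h' k' where *: "\<And>x. (h has_field_derivative h' x) (at x)" "product_span h'"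
    "\<And>x. (k has_field_derivative k' x) (at x)" "product_span k'" by blast
  have "\<forall>x. ((\<lambda>x. h x + k x) has_field_derivative h' x + k' x) (at x)"
    using DERIV_add[OF *(1) *(3)] by blast
  moreover have "product_span (\<lambda>x. h' x + k' x)" by (intro product_span.intros *)
  ultimately show ?case by (intro exI conjI)
qed

lemma smooth_mult:
  assumes "smooth f" "smooth g"
  shows "smooth (\<lambda>x. f x * g x)"
proof (rule smooth_coinduct[where P=product_span])
  fix h x assume "product_span h"
  then obtain h' where h': "\<And>x. (h has_field_derivative h' x) (at x)" "product_span h'" using product_span_deriv by blast
  then show "h field_differentiable at x" by (auto simp: field_differentiable_def)
  have "deriv h = h'" by (intro ext DERIV_imp_deriv h')
  then show "product_span (deriv h)" using h' by simp
qed (use product_span.mult[OF assms] in simp)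

section \<open>A flat function and smooth cut-offs\<close>

text \<open>For k = 0 the standard function exp(-1/x), extended by zero. The powers of 1/x are
  included because differentiation produces them.\<close>

definition flat_term :: "nat \<Rightarrow> real \<Rightarrow> real" where
  "flat_term k x = (if x > 0 then (1/x) ^ k * exp (- (1/x)) else 0)"

lemma flat_term_tendsto: "((flat_term k) \<longlongrightarrow> 0) (at 0)"
proof -
  have "((\<lambda>x. (1/x) ^ k / exp (1/x)) \<longlongrightarrow> 0) (at_right (0::real))"
    using filterlim_compose[OF tendsto_power_div_exp_0 filterlim_inverse_at_top_right, of k]
    by (simp add: inverse_eq_divide)
  moreover have "\<forall>\<^sub>F x in at_right (0::real). (1/x) ^ k / exp (1/x) = flat_term k x"
    unfolding eventually_at_filter by (rule always_eventually) (auto simp: flat_term_def exp_minus divide_inverse)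
  ultimately have r: "((flat_term k) \<longlongrightarrow> 0) (at_right 0)" by (rule Lim_transform_eventually)
  have "\<forall>\<^sub>F x in at_left (0::real). 0 = flat_term k x"
    unfolding eventually_at_filter by (rule always_eventually) (auto simp: flat_term_def)
  then have "((flat_term k) \<longlongrightarrow> 0) (at_left 0)" by (rule Lim_transform_eventually[OF tendsto_const])
  with r show ?thesis by (simp add: filterlim_split_at)
qed

text \<open>Away from zero this is calculus. At zero the difference quotient is the flat term with
  exponent k + 1, which tends to zero.\<close>

lemma flat_term_deriv: "(flat_term k has_field_derivative flat_term (k + 2) x - real k * flat_term (k + 1) x) (at x)"
proof -
  consider "x > 0" | "x < 0" | "x = 0" by linarith
  then show ?thesis
  proof cases
    case 1
    have "((\<lambda>x. (1/x) ^ k * exp (- (1/x))) has_field_derivative flat_term (k + 2) x - real k * flat_term (k + 1) x) (at x)"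
    proof -
      have d: "((\<lambda>x. 1/x) has_field_derivative - ((1/x)\<^sup>2)) (at x)"
        using 1 by (auto intro!: derivative_eq_intros simp: power2_eq_square)
      have e: "((\<lambda>x. exp (- (1/x))) has_field_derivative exp (- (1/x)) * (1/x)\<^sup>2) (at x)"
        using DERIV_chain2[OF DERIV_exp DERIV_minus[OF d]] by simp
      have "real k * (- ((1/x)\<^sup>2) * (1/x) ^ (k - Suc 0)) = - (real k * (1/x) ^ (k + 1))"
        by (cases k) (simp_all add: power2_eq_square)
      note pw = this
      have ft: "flat_term j x = (1/x) ^ j * exp (- (1/x))" for j using 1 by (simp add: flat_term_def)
      have alg: "- (real k * r ^ (k + 1)) * t + t * r\<^sup>2 * r ^ k = r ^ (k + 2) * t - real k * (r ^ (k + 1) * t)" for r t :: real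
        by (simp add: power_add power2_eq_square algebra_simps)
      show ?thesis
        by (rule DERIV_cong[OF DERIV_mult[OF DERIV_power[OF d, of k] e]]) (simp only: pw ft alg)
    qed
    then show ?thesis
      by (rule DERIV_cong_ev[THEN iffD1, OF refl _ refl, rotated])
         (use eventually_nhds_in_open[of "{0<..}" x] 1 in \<open>auto elim!: eventually_mono simp: flat_term_def\<close>)
  next
    case 2
    have "((\<lambda>x. 0) has_field_derivative flat_term (k + 2) x - real k * flat_term (k + 1) x) (at x)"
      using 2 by (simp add: flat_term_def)
    then show ?thesis
      by (rule DERIV_cong_ev[THEN iffD1, OF refl _ refl, rotated])
         (use eventually_nhds_in_open[of "{..<0}" x] 2 in \<open>auto elim!: eventually_mono simp: flat_term_def\<close>)
  next
    case 3
    have "(flat_term k y - flat_term k 0) / (y - 0) = flat_term (k + 1) y" if "y \<noteq> 0" for y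
      using that by (simp add: flat_term_def field_simps)
    then have "\<forall>\<^sub>F y in at 0. flat_term (k + 1) y = (flat_term k y - flat_term k 0) / (y - 0)"
      by (auto simp: eventually_at_filter)
    then have "((\<lambda>y. (flat_term k y - flat_term k 0) / (y - 0)) \<longlongrightarrow> 0) (at 0)"
      by (rule Lim_transform_eventually[OF flat_term_tendsto])
    then show ?thesis unfolding 3 by (simp add: has_field_derivative_iff flat_term_def)
  qed
qed

inductive flat_span :: "(real \<Rightarrow> real) \<Rightarrow> bool" where
  base: "flat_span (\<lambda>x. c * flat_term k x)"
| add: "flat_span h \<Longrightarrow> flat_span k \<Longrightarrow> flat_span (\<lambda>x. h x + k x)"

lemma flat_span_deriv:
  "flat_span h \<Longrightarrow> \<exists>h'. (\<forall>x. (h has_field_derivative h' x) (at x)) \<and> flat_span h'"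
proof (induct rule: flat_span.induct)
  case (base c k)
  have "\<forall>x. ((\<lambda>x. c * flat_term k x) has_field_derivative c * flat_term (k + 2) x + (- c * real k) * flat_term (k + 1) x) (at x)"
    using DERIV_cmult[OF flat_term_deriv, of c] by (simp add: algebra_simps)
  moreover have "flat_span (\<lambda>x. c * flat_term (k + 2) x + (- c * real k) * flat_term (k + 1) x)"
    by (intro flat_span.intros)
  ultimately show ?case by (intro exI conjI)
next
  case (add h k)
  then obtain h' k' where *: "\<And>x. (h has_field_derivative h' x) (at x)" "flat_span h'"
    "\<And>x. (k has_field_derivative k' x) (at x)" "flat_span k'" by blast
  have "\<forall>x. ((\<lambda>x. h x + k x) has_field_derivative h' x + k' x) (at x)"
    using DERIV_add[OF *(1) *(3)] by blast
  moreover have "flat_span (\<lambda>x. h' x + k' x)" by (intro flat_span.intros *)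
  ultimately show ?case by (intro exI conjI)
qed

lemma smooth_flat: "smooth (flat_term 0)"
proof (rule smooth_coinduct[where P=flat_span])
  fix h x assume "flat_span h"
  then obtain h' where h': "\<And>x. (h has_field_derivative h' x) (at x)" "flat_span h'" using flat_span_deriv by blast
  then show "h field_differentiable at x" by (auto simp: field_differentiable_def)
  have "deriv h = h'" by (intro ext DERIV_imp_deriv h')
  then show "flat_span (deriv h)" using h' by simp
qed (use flat_span.base[of 1 0] in simp)

lemma test_function_smooth: "test_function \<phi> \<longleftrightarrow> smooth \<phi> \<and> (\<exists>R. \<forall>x. R < \<bar>x\<bar> \<longrightarrow> \<phi> x = 0)"
  by (simp add: test_function_def smooth_def)

text \<open>Product of a rising step at a and a falling step at b, both steepened by the factor n +
  1: test functions below the indicator of [a, b] that tend to it off the endpoints.\<close>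

definition plateau :: "nat \<Rightarrow> real \<Rightarrow> real \<Rightarrow> real \<Rightarrow> real" where
  "plateau n a b x = flat_term 0 (real (Suc n) * x + - real (Suc n) * a) * flat_term 0 (- real (Suc n) * x + real (Suc n) * b)"

lemma flat_term_0_bounds: "0 \<le> flat_term 0 x" "flat_term 0 x \<le> 1"
  by (auto simp: flat_term_def)

lemma plateau_arg: "real (Suc n) * x + - real (Suc n) * a = real (Suc n) * (x - a)"
  "- real (Suc n) * x + real (Suc n) * b = real (Suc n) * (b - x)"
  by (simp_all add: algebra_simps)

lemma plateau_bounds: "0 \<le> plateau n a b x" "plateau n a b x \<le> indicator {a..b} x"
proof -
  show "0 \<le> plateau n a b x" by (simp add: plateau_def flat_term_0_bounds)
  show "plateau n a b x \<le> indicator {a..b} x"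
  proof (cases "x \<in> {a..b}")
    case True
    then show ?thesis
      using mult_mono[OF flat_term_0_bounds(2) flat_term_0_bounds(2)] by (simp add: plateau_def flat_term_0_bounds)
  next
    case False
    then have "x - a < 0 \<or> b - x < 0" by auto
    then have "\<not> 0 < real (Suc n) * (x - a) \<or> \<not> 0 < real (Suc n) * (b - x)"
      by (auto simp: zero_less_mult_iff simp del: of_nat_Suc)
    then show ?thesis using False unfolding plateau_def plateau_arg by (auto simp: flat_term_def simp del: of_nat_Suc)
  qed
qed

lemma plateau_test: "test_function (plateau n a b)"
  unfolding test_function_smooth
proof (intro conjI exI allI impI)
  show "smooth (plateau n a b)"
    unfolding plateau_def[abs_def] by (intro smooth_mult smooth_affine smooth_flat)
  fix x assume "\<bar>a\<bar> + \<bar>b\<bar> < \<bar>x\<bar>"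
  then have "x \<notin> {a..b}" by auto
  then show "plateau n a b x = 0" using plateau_bounds[of n a b x] by simp
qed

lemma plateau_tendsto:
  assumes "x \<noteq> a" "x \<noteq> b"
  shows "(\<lambda>n. plateau n a b x) \<longlonglongrightarrow> indicator {a..b} x"
proof -
  have l: "(\<lambda>n. flat_term 0 (real (Suc n) * t)) \<longlonglongrightarrow> 1" if "t > 0" for t
  proof -
    have "(\<lambda>n. exp (- ((1 / t) * inverse (real (Suc n))))) \<longlonglongrightarrow> exp (- ((1 / t) * 0))"
      by (intro tendsto_intros LIMSEQ_inverse_real_of_nat)
    moreover have "flat_term 0 (real (Suc n) * t) = exp (- ((1 / t) * inverse (real (Suc n))))" for n
      using that by (simp add: flat_term_def field_simps del: of_nat_Suc)
    ultimately show ?thesis by simp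
  qed
  show ?thesis
  proof (cases "x \<in> {a..b}")
    case True
    have "(\<lambda>n. flat_term 0 (real (Suc n) * (x - a)) * flat_term 0 (real (Suc n) * (b - x))) \<longlonglongrightarrow> 1 * 1"
      by (intro tendsto_mult l) (use True assms in auto)
    then show ?thesis using True unfolding plateau_def plateau_arg by simp
  next
    case False
    then have "plateau n a b x = 0" for n using plateau_bounds[of n a b x] by simp
    then show ?thesis using False by simp
  qed
qed

lemma test_function_bounded:
  assumes "test_function \<phi>"
  obtains C R where "0 \<le> R" "0 \<le> C" "\<And>x. \<bar>\<phi> x\<bar> \<le> C * indicator {- R..R} x"
proof -
  obtain R0 where R0: "\<And>x. R0 < \<bar>x\<bar> \<Longrightarrow> \<phi> x = 0" and s: "smooth \<phi>" using assms by (auto simp: test_function_smooth)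
  define R where "R = max 0 R0"
  have "continuous_on {- R..R} \<phi>" using smooth_isCont[OF s] by (simp add: continuous_at_imp_continuous_on)
  then have "compact (\<phi> ` {- R..R})" by (rule compact_continuous_image) simp
  then have "bounded (\<phi> ` {- R..R})" by (rule compact_imp_bounded)
  then obtain C where C': "\<forall>x\<in>{- R..R}. \<bar>\<phi> x\<bar> \<le> C" unfolding bounded_iff by auto
  then have C: "\<bar>\<phi> x\<bar> \<le> C" if "x \<in> {- R..R}" for x using that by blast
  have C0: "0 \<le> C" using C[of 0] by (simp add: R_def)
  have "\<bar>\<phi> x\<bar> \<le> C * indicator {- R..R} x" for x
  proof (cases "x \<in> {- R..R}")
    case False
    then have "R0 < \<bar>x\<bar>" by (auto simp: R_def)
    then show ?thesis using R0 False by simp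
  qed (use C in simp)
  with C0 that[of R C] show thesis by (simp add: R_def)
qed

lemma test_function_deriv: "test_function \<phi> \<Longrightarrow> test_function (deriv \<phi>)"
  unfolding test_function_smooth
proof (elim conjE exE, intro conjI)
  fix R assume s: "smooth \<phi>" and R: "\<forall>x. R < \<bar>x\<bar> \<longrightarrow> \<phi> x = 0"
  show "smooth (deriv \<phi>)" by (rule smooth_deriv[OF s])
  have "deriv \<phi> x = 0" if "R < \<bar>x\<bar>" for x
  proof (rule DERIV_imp_deriv)
    have "((\<lambda>x. 0) has_field_derivative 0) (at x)" by simp
    moreover have "open {x. R < \<bar>x\<bar>}" by (intro open_Collect_less continuous_intros)
    then have "\<forall>\<^sub>F y in nhds x. 0 = \<phi> y"
      using eventually_nhds_in_open[of "{x. R < \<bar>x\<bar>}" x] that R by (auto elim!: eventually_mono)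
    ultimately show "(\<phi> has_field_derivative 0) (at x)" by (subst (asm) DERIV_cong_ev[OF refl _ refl]) auto
  qed
  then show "\<exists>R. \<forall>x. R < \<bar>x\<bar> \<longrightarrow> deriv \<phi> x = 0" by blast
qed

lemma test_function_measurable: "test_function \<phi> \<Longrightarrow> \<phi> \<in> borel_measurable borel"
proof (rule borel_measurable_continuous_onI)
  assume "test_function \<phi>"
  then have "smooth \<phi>" by (simp add: test_function_smooth)
  then show "continuous_on UNIV \<phi>"
    by (intro continuous_at_imp_continuous_on ballI) (rule smooth_isCont)
qed

text \<open>The common class of square integrable functions and of their primitives, which are
  continuous but need not be square integrable.\<close>

definition locally_integrable :: "(real \<Rightarrow> complex) \<Rightarrow> bool" where
  "locally_integrable f \<longleftrightarrow> f \<in> borel_measurable borel \<and> (\<forall>a b. set_integrable lborel {a..b} f)"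

lemma pairing_integrable:
  assumes "locally_integrable f" "test_function \<phi>"
  shows "integrable lborel (\<lambda>x. f x * complex_of_real (\<phi> x))"
proof -
  obtain C R where CR: "0 \<le> R" "0 \<le> C" "\<And>x. \<bar>\<phi> x\<bar> \<le> C * indicator {- R..R} x" 
    by (rule test_function_bounded[OF assms(2)]) (rule that, assumption+)
  show ?thesis
  proof (rule Bochner_Integration.integrable_bound)
    show "integrable lborel (\<lambda>x. C *\<^sub>R (indicat_real {- R..R} x *\<^sub>R f x))"
      using assms(1) by (intro integrable_scaleR_right) (simp add: locally_integrable_def set_integrable_def)
    show "(\<lambda>x. f x * complex_of_real (\<phi> x)) \<in> borel_measurable lborel"
    proof -
      have [measurable]: "f \<in> borel_measurable borel" using assms(1) by (simp add: locally_integrable_def)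
      have [measurable]: "\<phi> \<in> borel_measurable borel" by (rule test_function_measurable[OF assms(2)])
      show ?thesis by measurable
    qed
    show "AE x in lborel. norm (f x * complex_of_real (\<phi> x)) \<le> norm (C *\<^sub>R (indicat_real {- R..R} x *\<^sub>R f x))"
    proof (rule AE_I2)
      fix x
      have "cmod (f x) * \<bar>\<phi> x\<bar> \<le> cmod (f x) * (C * indicator {- R..R} x)" by (intro mult_left_mono CR) simp
      then show "norm (f x * complex_of_real (\<phi> x)) \<le> norm (C *\<^sub>R (indicat_real {- R..R} x *\<^sub>R f x))"
        using CR(2) by (simp add: norm_mult abs_mult mult_ac)
    qed
  qed
qed

text \<open>Plateaus approximate the indicator of an interval boundedly, so all interval integrals
  of f vanish.\<close>

lemma fundamental_lemma:
  assumes f: "locally_integrable f" and z: "\<And>\<phi>. test_function \<phi> \<Longrightarrow> pairing f \<phi> = 0"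
  shows "AE x in lborel. f x = 0"
proof (rule AE_zero_of_interval_integrals)
  have [measurable]: "f \<in> borel_measurable borel" using f by (simp add: locally_integrable_def)
  have [measurable]: "plateau n a b \<in> borel_measurable borel" for n a b
    by (rule test_function_measurable[OF plateau_test])
  show fi: "set_integrable lborel {x..y} f" for x y using f by (simp add: locally_integrable_def)
  fix a b :: real
  have "(\<lambda>n. \<integral>x. f x * complex_of_real (plateau n a b x) \<partial>lborel) \<longlonglongrightarrow> (\<integral>x. indicat_real {a..b} x *\<^sub>R f x \<partial>lborel)"
  proof (rule integral_dominated_convergence[where w="\<lambda>x. norm (indicat_real {a..b} x *\<^sub>R f x)"])
    show "(\<lambda>x. indicat_real {a..b} x *\<^sub>R f x) \<in> borel_measurable lborel"
      by measurable
    show "(\<lambda>x. f x * complex_of_real (plateau n a b x)) \<in> borel_measurable lborel" for n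
      by measurable
    show "integrable lborel (\<lambda>x. norm (indicat_real {a..b} x *\<^sub>R f x))"
      using fi[of a b] unfolding set_integrable_def by (rule integrable_norm)
    have "AE x in lborel. x \<noteq> a \<and> x \<noteq> b"
      using AE_lborel_singleton[of a] AE_lborel_singleton[of b] by eventually_elim auto
    then show "AE x in lborel. (\<lambda>n. f x * complex_of_real (plateau n a b x)) \<longlonglongrightarrow> indicat_real {a..b} x *\<^sub>R f x"
    proof eventually_elim
      case (elim x)
      then have "(\<lambda>n. f x * complex_of_real (plateau n a b x)) \<longlonglongrightarrow> f x * complex_of_real (indicator {a..b} x)"
        by (intro tendsto_intros plateau_tendsto) auto
      then show ?case by (simp add: scaleR_conv_of_real mult.commute)
    qed
    show "AE x in lborel. norm (f x * complex_of_real (plateau n a b x)) \<le> norm (indicat_real {a..b} x *\<^sub>R f x)" for n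
    proof (rule AE_I2)
      fix x
      have "cmod (f x) * plateau n a b x \<le> cmod (f x) * indicator {a..b} x"
        by (intro mult_left_mono plateau_bounds) simp
      then show "norm (f x * complex_of_real (plateau n a b x)) \<le> norm (indicat_real {a..b} x *\<^sub>R f x)"
        using plateau_bounds(1)[of n a b x] by (simp add: norm_mult mult.commute)
    qed
  qed
  moreover have "(\<integral>x. f x * complex_of_real (plateau n a b x) \<partial>lborel) = 0" for n
    using z[OF plateau_test[of n a b]] by (simp add: pairing_def)
  ultimately show "(LINT s:{a..b}|lborel. f s) = 0"
    by (simp add: LIMSEQ_const_iff set_lebesgue_integral_def)
qed

section \<open>Weak derivatives and primitives\<close>

lemma test_function_FTC:
  assumes "test_function \<phi>" "a \<le> b"
  shows "(LINT s:{a..b}|lborel. deriv \<phi> s) = \<phi> b - \<phi> a"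
proof -
  have s: "smooth \<phi>" using assms(1) by (simp add: test_function_smooth)
  have "integral\<^sup>L lborel (\<lambda>x. indicat_real {a..b} x *\<^sub>R deriv \<phi> x) = \<phi> b - \<phi> a"
  proof (rule integral_FTC_atLeastAtMost[OF assms(2)])
    fix x
    have "(\<phi> has_vector_derivative deriv \<phi> x) (at x)"
      using smooth_has_deriv[OF s] by (simp add: has_real_derivative_iff_has_vector_derivative)
    then show "(\<phi> has_vector_derivative deriv \<phi> x) (at x within {a..b})"
      by (rule has_vector_derivative_at_within)
  next
    show "continuous_on {a..b} (deriv \<phi>)"
      by (intro continuous_at_imp_continuous_on ballI) (rule smooth_isCont[OF smooth_deriv[OF s]])
  qed
  then show ?thesis by (simp add: set_lebesgue_integral_def)
qed

lemma test_function_integrable: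
  assumes "test_function \<phi>"
  shows "integrable lborel \<phi>"
proof -
  obtain C R where CR: "0 \<le> R" "0 \<le> C" "\<And>x. \<bar>\<phi> x\<bar> \<le> C * indicator {- R..R} x"
    by (rule test_function_bounded[OF assms]) (rule that, assumption+)
  show ?thesis
  proof (rule Bochner_Integration.integrable_bound)
    show "integrable lborel (\<lambda>x. C * indicat_real {- R..R} x)"
      by (intro integrable_mult_right integrable_indicator_Icc)
    show "\<phi> \<in> borel_measurable lborel" using test_function_measurable[OF assms] by simp
    show "AE x in lborel. norm (\<phi> x) \<le> norm (C * indicat_real {- R..R} x)"
      using CR by (intro AE_I2) (simp add: abs_mult)
  qed
qed

lemma locally_integrable_sq_int: "sq_int f \<Longrightarrow> locally_integrable f"
  using sq_int_interval_integrable(1) sq_int_meas by (auto simp: locally_integrable_def)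

lemma locally_integrable_cont:
  assumes "\<And>x. isCont f x"
  shows "locally_integrable f"
proof -
  have c: "continuous_on S f" for S by (intro continuous_at_imp_continuous_on ballI) (rule assms)
  have "f \<in> borel_measurable borel" by (rule borel_measurable_continuous_onI[OF c])
  then show ?thesis unfolding locally_integrable_def using borel_integrable_atLeastAtMost'[OF c] by blast
qed

lemma locally_integrable_diff:
  assumes "locally_integrable f" "locally_integrable g"
  shows "locally_integrable (\<lambda>x. f x - g x)"
  using assms unfolding locally_integrable_def by (auto intro: set_integral_diff(1))

lemma pairing_diff:
  assumes "locally_integrable f" "locally_integrable g" "test_function \<phi>"
  shows "pairing (\<lambda>x. f x - g x) \<phi> = pairing f \<phi> - pairing g \<phi>"
  using pairing_integrable[OF assms(1,3)] pairing_integrable[OF assms(2,3)]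
  unfolding pairing_def by (simp add: left_diff_distrib)

lemma pairing_cong_AE:
  assumes "f \<in> borel_measurable borel" "g \<in> borel_measurable borel" "AE x in lborel. f x = g x" "test_function \<phi>"
  shows "pairing f \<phi> = pairing g \<phi>"
proof -
  note [measurable] = assms(1,2) test_function_measurable[OF assms(4)]
  show ?thesis unfolding pairing_def by (rule integral_cong_AE) (use assms(3) in auto)
qed

text \<open>Fubini for the product of the derivative of the test function at x and g at s over the
  region s \<le> x. The function u is only assumed to be a primitive of g, since the lemma must also
  apply before square integrability is known.\<close>

lemma integral_by_parts_test:
  assumes g: "sq_int g" and u: "\<And>x y. x \<le> y \<Longrightarrow> u y - u x = (LINT s:{x..y}|lborel. g s)"
    and ul: "locally_integrable u" and \<phi>: "test_function \<phi>"
  shows "pairing u (deriv \<phi>) = - pairing g \<phi>"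
proof -
  obtain R0 where R0: "\<And>x. R0 < \<bar>x\<bar> \<Longrightarrow> \<phi> x = 0" using \<phi> by (auto simp: test_function_smooth)
  obtain R1 where R1: "\<And>x. R1 < \<bar>x\<bar> \<Longrightarrow> deriv \<phi> x = 0"
    using test_function_deriv[OF \<phi>] by (auto simp: test_function_smooth)
  \<comment> \<open>One unit beyond the supports, so that the test function and its derivative
    vanish at the endpoints as well.\<close>
  define R where "R = max 0 (max R0 R1) + 1"
  have R: "0 < R" "\<And>x. R \<le> \<bar>x\<bar> \<Longrightarrow> \<phi> x = 0" "\<And>x. R \<le> \<bar>x\<bar> \<Longrightarrow> deriv \<phi> x = 0"
    using R0 R1 by (auto simp: R_def)
  define h where "h x = complex_of_real (deriv \<phi> x)" for x
  define k where "k s = indicat_real {- R..R} s *\<^sub>R g s" for s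
  have hi: "integrable lborel h"
    unfolding h_def[abs_def] using test_function_integrable[OF test_function_deriv[OF \<phi>]] by simp
  have ki: "integrable lborel k"
    using sq_int_interval_integrable(1)[OF g, of "- R" R] by (simp add: k_def[abs_def] set_integrable_def)
  have hm[measurable]: "h \<in> borel_measurable borel" and km[measurable]: "k \<in> borel_measurable borel"
    using hi ki by (auto dest: borel_measurable_integrable)
  let ?f = "\<lambda>x s. indicat_real {s..} x *\<^sub>R (h x * k s)"
  have "integrable (lborel \<Otimes>\<^sub>M lborel) (\<lambda>(x, s). h x * k s)"
  proof (rule lborel_pair.Fubini_integrable)
    show "(\<lambda>(x, s). h x * k s) \<in> borel_measurable (lborel \<Otimes>\<^sub>M lborel)" by measurable
    have "(\<lambda>x. \<integral>s. norm (case (x, s) of (x, s) \<Rightarrow> h x * k s) \<partial>lborel) = (\<lambda>x. norm (h x) * (\<integral>s. norm (k s) \<partial>lborel))"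
      by (simp add: norm_mult)
    then show "integrable lborel (\<lambda>x. \<integral>s. norm (case (x, s) of (x, s) \<Rightarrow> h x * k s) \<partial>lborel)"
      using hi by simp
    show "AE x in lborel. integrable lborel (\<lambda>s. case (x, s) of (x, s) \<Rightarrow> h x * k s)"
      using ki by simp
  qed
  then have fi: "integrable (lborel \<Otimes>\<^sub>M lborel) (\<lambda>(x, s). ?f x s)"
  proof (rule Bochner_Integration.integrable_bound)
    have "{z::real \<times> real. snd z \<le> fst z} \<in> sets borel"
      by (intro borel_closed closed_Collect_le continuous_intros)
    then have S: "{z::real \<times> real. snd z \<le> fst z} \<in> sets (lborel \<Otimes>\<^sub>M lborel)"
      unfolding lborel_prod sets_lborel .
    have [measurable]: "(\<lambda>z::real \<times> real. indicat_real {z. snd z \<le> fst z} z) \<in> borel_measurable (lborel \<Otimes>\<^sub>M lborel)"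
      by (rule borel_measurable_indicator[OF S])
    have eq: "(\<lambda>(x, s). ?f x s) = (\<lambda>z. indicat_real {z. snd z \<le> fst z} z *\<^sub>R (h (fst z) * k (snd z)))"
      by (auto simp: indicator_def fun_eq_iff)
    show "(\<lambda>(x, s). ?f x s) \<in> borel_measurable (lborel \<Otimes>\<^sub>M lborel)" unfolding eq by measurable
    show "AE z in lborel \<Otimes>\<^sub>M lborel. norm (case z of (x, s) \<Rightarrow> ?f x s) \<le> norm (case z of (x, s) \<Rightarrow> h x * k s)"
      by (intro AE_I2) (auto simp: indicator_def)
  qed
  have inner1: "(\<integral>s. ?f x s \<partial>lborel) = h x * u x - h x * u (- R)" for x
  proof (cases "R \<le> \<bar>x\<bar>")
    case True
    then show ?thesis using R(3) by (simp add: h_def)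
  next
    case False
    then have x: "- R \<le> x" "x \<le> R" by linarith+
    have "(\<integral>s. ?f x s \<partial>lborel) = (\<integral>s. h x * (indicat_real {- R..x} s *\<^sub>R g s) \<partial>lborel)"
      by (rule Bochner_Integration.integral_cong) (use x in \<open>auto simp: k_def indicator_def\<close>)
    also have "\<dots> = h x * (LINT s:{- R..x}|lborel. g s)"
      unfolding set_lebesgue_integral_def by (rule integral_mult_right_zero)
    also have "\<dots> = h x * (u x - u (- R))" using u[OF x(1)] by simp
    finally show ?thesis by (simp add: right_diff_distrib)
  qed
  have inner2: "(\<integral>x. ?f x s \<partial>lborel) = - (g s * complex_of_real (\<phi> s))" for s
  proof (cases "R \<le> \<bar>s\<bar>")
    case True
    show ?thesis
    proof (cases "s \<in> {- R..R}")
      case F: False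
      then show ?thesis using True R(2) by (simp add: k_def)
    next
      case T: True
      then have "s = R \<or> s = - R" using True by (auto simp: abs_if split: if_splits)
      then show ?thesis
      proof
        assume s: "s = R"
        have "(\<integral>x. ?f x s \<partial>lborel) = (\<integral>x. 0 \<partial>(lborel::real measure))"
          by (rule Bochner_Integration.integral_cong) (use s R in \<open>auto simp: h_def indicator_def\<close>)
        then show ?thesis using True R(2) by simp
      next
        assume s: "s = - R"
        have "(\<integral>x. ?f x s \<partial>lborel) = (\<integral>x. complex_of_real (indicat_real {- R..R} x *\<^sub>R deriv \<phi> x) * k s \<partial>lborel)"
          by (rule Bochner_Integration.integral_cong) (use s R in \<open>auto simp: h_def indicator_def\<close>)
        also have "\<dots> = complex_of_real (LINT x:{- R..R}|lborel. deriv \<phi> x) * k s"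
          unfolding set_lebesgue_integral_def by (simp only: integral_mult_left_zero integral_complex_of_real)
        also have "(LINT x:{- R..R}|lborel. deriv \<phi> x) = 0"
          using test_function_FTC[OF \<phi>, of "- R" R] R(1) R(2)[of R] R(2)[of "- R"] by simp
        finally show ?thesis using True R(2) by simp
      qed
    qed
  next
    case False
    then have s: "- R \<le> s" "s \<le> R" by linarith+
    have "(\<integral>x. ?f x s \<partial>lborel) = (\<integral>x. complex_of_real (indicat_real {s..R} x *\<^sub>R deriv \<phi> x) * k s \<partial>lborel)"
      by (rule Bochner_Integration.integral_cong) (use s R in \<open>auto simp: h_def indicator_def\<close>)
    also have "\<dots> = complex_of_real (LINT x:{s..R}|lborel. deriv \<phi> x) * k s"
      unfolding set_lebesgue_integral_def by (simp only: integral_mult_left_zero integral_complex_of_real)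
    also have "(LINT x:{s..R}|lborel. deriv \<phi> x) = - \<phi> s"
      using test_function_FTC[OF \<phi> s(2)] R(1) R(2)[of R] by simp
    also have "complex_of_real (- \<phi> s) * k s = - (g s * complex_of_real (\<phi> s))"
      using s by (simp add: k_def mult.commute)
    finally show ?thesis .
  qed
  have "(\<integral>s. (\<integral>x. ?f x s \<partial>lborel) \<partial>lborel) = (\<integral>x. (\<integral>s. ?f x s \<partial>lborel) \<partial>lborel)"
    by (rule lborel_pair.Fubini_integral[OF fi])
  then have "- (\<integral>s. g s * complex_of_real (\<phi> s) \<partial>lborel) = (\<integral>x. h x * u x - h x * u (- R) \<partial>lborel)"
    unfolding inner1 inner2 by simp
  also have "\<dots> = (\<integral>x. h x * u x \<partial>lborel) - (\<integral>x. h x * u (- R) \<partial>lborel)"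
  proof (rule Bochner_Integration.integral_diff)
    show "integrable lborel (\<lambda>x. h x * u x)"
      using pairing_integrable[OF ul test_function_deriv[OF \<phi>]] by (simp add: h_def mult.commute)
    show "integrable lborel (\<lambda>x. h x * u (- R))" using hi by simp
  qed
  also have "(\<integral>x. h x * u (- R) \<partial>lborel) = 0"
  proof -
    have "(\<integral>x. deriv \<phi> x \<partial>lborel) = (LINT x:{- R..R}|lborel. deriv \<phi> x)"
      unfolding set_lebesgue_integral_def
    proof (rule Bochner_Integration.integral_cong)
      fix x show "deriv \<phi> x = indicat_real {- R..R} x *\<^sub>R deriv \<phi> x"
        using R(3)[of x] by (cases "x \<in> {- R..R}") auto
    qed simp
    also have "\<dots> = 0" using test_function_FTC[OF \<phi>, of "- R" R] R(1) R(2)[of R] R(2)[of "- R"] by simp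
    finally show ?thesis by (simp add: h_def)
  qed
  finally show ?thesis unfolding pairing_def h_def by (simp add: mult.commute)
qed

text \<open>Subtracting a suitable multiple of a fixed test function \<theta> of positive integral
  gives any test function mean zero, hence makes it the derivative of a test function, which H
  annihilates. So H acts like the constant c.\<close>

lemma du_bois_reymond:
  assumes H: "locally_integrable H" and z: "\<And>\<phi>. test_function \<phi> \<Longrightarrow> pairing H (deriv \<phi>) = 0"
  obtains c where "AE x in lborel. H x = c"
proof -
  define I where "I = (\<integral>x. plateau 0 0 1 x \<partial>lborel)"
  have I: "0 < I"
    unfolding I_def
  proof (rule integral_pos_at_point)
    show "integrable lborel (plateau 0 0 1)" by (rule test_function_integrable[OF plateau_test])
    show "isCont (plateau 0 0 1) (1/2)" using plateau_test[of 0 0 1] by (intro smooth_isCont) (simp add: test_function_smooth)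
    show "0 < plateau 0 0 1 (1/2)" by (simp add: plateau_def flat_term_def)
  qed (rule plateau_bounds)
  define \<theta> where "\<theta> = plateau 0 0 1"
  have \<theta>: "test_function \<theta>" unfolding \<theta>_def by (rule plateau_test)
  define c where "c = pairing H \<theta> / complex_of_real I"
  have cl: "locally_integrable (\<lambda>x. c)" by (rule locally_integrable_cont) simp
  have "AE x in lborel. H x - c = 0"
  proof (rule fundamental_lemma[OF locally_integrable_diff[OF H cl]])
    fix \<psi> assume \<psi>: "test_function \<psi>"
    define m where "m = (\<integral>x. \<psi> x \<partial>lborel)"
    define \<sigma> where "\<sigma> x = \<psi> x + (- m / I) * \<theta> x" for x
    have s\<sigma>: "smooth \<sigma>" unfolding \<sigma>_def[abs_def] using \<psi> \<theta> by (intro smooth_lincomb) (auto simp: test_function_smooth)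
    obtain R1 R2 where R12: "\<And>x. R1 < \<bar>x\<bar> \<Longrightarrow> \<psi> x = 0" "\<And>x. R2 < \<bar>x\<bar> \<Longrightarrow> \<theta> x = 0"
      using \<psi> \<theta> by (auto simp: test_function_smooth)
    define R where "R = max 0 (max R1 R2)"
    have R: "\<sigma> x = 0" if "R < \<bar>x\<bar>" for x using R12 that by (simp add: \<sigma>_def R_def)
    have R0: "0 \<le> R" by (simp add: R_def)
    have t\<sigma>: "test_function \<sigma>" using s\<sigma> R by (auto simp: test_function_smooth)
    have i\<sigma>: "(\<integral>x. \<sigma> x \<partial>lborel) = 0"
    proof -
      have "(\<integral>x. \<sigma> x \<partial>lborel) = m + (- m / I) * I"
        unfolding \<sigma>_def m_def I_def \<theta>_def[symmetric]
        using test_function_integrable[OF \<psi>] test_function_integrable[OF \<theta>] by simp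
      then show ?thesis using I by simp
    qed
    have "\<exists>F. \<forall>x::real. - \<infinity> < ereal x \<longrightarrow> ereal x < \<infinity> \<longrightarrow> (F has_vector_derivative \<sigma> x) (at x)"
      by (rule einterval_antiderivative) (auto intro: smooth_isCont[OF s\<sigma>])
    then obtain \<Phi> where \<Phi>: "\<And>x. (\<Phi> has_vector_derivative \<sigma> x) (at x)" by auto
    have ftc: "\<Phi> b - \<Phi> a = (LINT x:{a..b}|lborel. \<sigma> x)" if "a \<le> b" for a b
    proof -
      have "integral\<^sup>L lborel (\<lambda>x. indicat_real {a..b} x *\<^sub>R \<sigma> x) = \<Phi> b - \<Phi> a"
      proof (rule integral_FTC_atLeastAtMost[OF that])
        show "(\<Phi> has_vector_derivative \<sigma> x) (at x within {a..b})" for x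
          by (rule has_vector_derivative_at_within[OF \<Phi>])
        show "continuous_on {a..b} \<sigma>"
          by (intro continuous_at_imp_continuous_on ballI) (rule smooth_isCont[OF s\<sigma>])
      qed
      then show ?thesis by (simp add: set_lebesgue_integral_def)
    qed
    \<comment> \<open>Normalized to vanish at -R and therefore to the left of it; to the right of R
      it vanishes because \<sigma> has integral zero.\<close>
    define \<phi> where "\<phi> x = \<Phi> x - \<Phi> (- R)" for x
    have d\<phi>: "(\<phi> has_field_derivative \<sigma> x) (at x)" for x
    proof -
      have "(\<Phi> has_field_derivative \<sigma> x) (at x)" using \<Phi> by (simp add: has_real_derivative_iff_has_vector_derivative)
      from DERIV_diff[OF this DERIV_const[of "\<Phi> (- R)"]] show ?thesis by (simp add: \<phi>_def[abs_def])
    qed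
    have deriv\<phi>: "deriv \<phi> = \<sigma>" by (intro ext DERIV_imp_deriv d\<phi>)
    have "test_function \<phi>"
      unfolding test_function_smooth
    proof (intro conjI exI allI impI)
      show "smooth \<phi>"
        by (rule smooth_of_deriv) (use d\<phi> s\<sigma> in \<open>auto simp: field_differentiable_def deriv\<phi>\<close>)
      fix x assume x: "R < \<bar>x\<bar>"
      show "\<phi> x = 0"
      proof (cases "x < - R")
        case True
        have "\<Phi> (- R) - \<Phi> x = (LINT x:{x..- R}|lborel. \<sigma> x)" using True by (intro ftc) simp
        also have "\<dots> = (\<integral>y. 0 \<partial>(lborel :: real measure))"
          unfolding set_lebesgue_integral_def
        proof (rule integral_cong_AE)
          have "AE y in lborel. y \<noteq> - R" by (rule AE_lborel_singleton)
          then show "AE y in lborel. indicat_real {x..- R} y *\<^sub>R \<sigma> y = 0"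
          proof eventually_elim
            case (elim y)
            then show ?case using R[of y] R0 by (cases "y \<in> {x..- R}") auto
          qed
          show "(\<lambda>y. indicat_real {x..- R} y *\<^sub>R \<sigma> y) \<in> borel_measurable lborel"
            using test_function_measurable[OF t\<sigma>] by measurable
        qed simp
        finally show ?thesis by (simp add: \<phi>_def)
      next
        case False
        then have x': "R < x" using x by linarith
        have "\<Phi> x - \<Phi> (- R) = (LINT y:{- R..x}|lborel. \<sigma> y)" using x' R0 by (intro ftc) simp
        also have "\<dots> = (\<integral>y. \<sigma> y \<partial>lborel)"
          unfolding set_lebesgue_integral_def
        proof (rule Bochner_Integration.integral_cong)
          fix y
          show "indicat_real {- R..x} y *\<^sub>R \<sigma> y = \<sigma> y"
            using R[of y] x' by (cases "y \<in> {- R..x}") auto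
        qed simp
        finally show ?thesis using i\<sigma> by (simp add: \<phi>_def)
      qed
    qed
    then have "pairing H \<sigma> = 0" using z deriv\<phi> by metis
    moreover have "pairing H \<sigma> = pairing H \<psi> - complex_of_real (m / I) * pairing H \<theta>"
    proof -
      have "pairing H \<sigma> = (\<integral>x. H x * complex_of_real (\<psi> x) - complex_of_real (m / I) * (H x * complex_of_real (\<theta> x)) \<partial>lborel)"
        unfolding pairing_def \<sigma>_def by (rule Bochner_Integration.integral_cong) (auto simp: algebra_simps)
      then show ?thesis
        unfolding pairing_def using pairing_integrable[OF H \<psi>] pairing_integrable[OF H \<theta>] by simp
    qed
    moreover have "pairing (\<lambda>x. c) \<psi> = complex_of_real (m / I) * pairing H \<theta>"
    proof -
      have "pairing (\<lambda>x. c) \<psi> = c * complex_of_real m" unfolding pairing_def m_def by simp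
      then show ?thesis by (simp add: c_def)
    qed
    ultimately show "pairing (\<lambda>x. H x - c) \<psi> = 0"
      using pairing_diff[OF H cl \<psi>] by simp
  qed
  then have "AE x in lborel. H x = c" by simp
  then show thesis by (rule that)
qed

text \<open>The same Hoelder estimate as for Sobolev functions, for a primitive that is not known to
  be square integrable.\<close>

lemma primitive_isCont:
  assumes g: "sq_int g" and u: "\<And>x y. x \<le> y \<Longrightarrow> u y - u x = (LINT s:{x..y}|lborel. g s)"
  shows "isCont u x"
proof (rule holder_imp_continuous)
  have *: "norm (u y - u x) \<le> sqrt (\<bar>y - x\<bar> * sqn g)" if "x \<le> y" for x y
  proof (rule real_le_rsqrt)
    have "(norm (u y - u x))\<^sup>2 \<le> (y - x) * sqn (\<lambda>s. indicator {x..y} s *\<^sub>R g s)"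
      using set_integral_norm_le[OF g, of "{x..y}"] u[OF that] that by simp
    also have "\<dots> \<le> (y - x) * sqn g"
      using that by (intro mult_left_mono sqn_indicator_le g) auto
    finally show "(norm (u y - u x))\<^sup>2 \<le> \<bar>y - x\<bar> * sqn g" using that by simp
  qed
  show "norm (u y - u x) \<le> sqrt (\<bar>y - x\<bar> * sqn g)" for x y
    using *[of x y] *[of y x] by (cases "x \<le> y") (auto simp: norm_minus_commute abs_minus_commute)
qed

lemma ex_primitive:
  assumes g: "sq_int (g :: real \<Rightarrow> complex)"
  obtains u where "\<And>x y. x \<le> y \<Longrightarrow> u y - u x = (LINT s:{x..y}|lborel. g s)"
proof -
  define u where "u t = (if 0 \<le> t then (LINT s:{0..t}|lborel. g s) else - (LINT s:{t..0}|lborel. g s))" for t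
  have gi: "set_integrable lborel {x..y} g" for x y by (rule sq_int_interval_integrable[OF g])
  have split: "(LINT s:{x..z}|lborel. g s) = (LINT s:{x..y}|lborel. g s) + (LINT s:{y..z}|lborel. g s)"
    if "x \<le> y" "y \<le> z" for x y z
  proof -
    have "AE s in lborel. indicat_real {x..z} s *\<^sub>R g s = indicat_real {x..y} s *\<^sub>R g s + indicat_real {y..z} s *\<^sub>R g s"
      using AE_lborel_singleton[of y] by eventually_elim (use that in \<open>auto simp: indicator_def\<close>)
    then have "(\<integral>s. indicat_real {x..z} s *\<^sub>R g s \<partial>lborel) = (\<integral>s. indicat_real {x..y} s *\<^sub>R g s + indicat_real {y..z} s *\<^sub>R g s \<partial>lborel)"
      using sq_int_meas[OF g] by (intro integral_cong_AE) auto
    also have "\<dots> = (\<integral>s. indicat_real {x..y} s *\<^sub>R g s \<partial>lborel) + (\<integral>s. indicat_real {y..z} s *\<^sub>R g s \<partial>lborel)"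
      by (rule Bochner_Integration.integral_add) (use gi in \<open>auto simp: set_integrable_def\<close>)
    finally show ?thesis by (simp add: set_lebesgue_integral_def)
  qed
  have "u y - u x = (LINT s:{x..y}|lborel. g s)" if "x \<le> y" for x y
  proof -
    consider "0 \<le> x" | "x < 0" "0 \<le> y" | "y < 0" by linarith
    then show ?thesis
    proof cases
      case 1
      then show ?thesis using split[of 0 x y] that by (simp add: u_def)
    next
      case 2
      then show ?thesis using split[of x 0 y] by (simp add: u_def)
    next
      case 3
      then show ?thesis using split[of x y 0] that by (simp add: u_def)
    qed
  qed
  then show thesis by (rule that)
qed

lemma H1_pair_weak_deriv:
  assumes "H1_pair (u :: real \<Rightarrow> complex) g"
  shows "has_weak_deriv u g"
  unfolding has_weak_deriv_def
  using integral_by_parts_test[OF H1_pairD(2)[OF assms] H1_pairD(3)[OF assms] locally_integrable_sq_int[OF H1_pairD(1)[OF assms]]]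
  by blast

text \<open>The difference of f and any primitive of its weak derivative has weak derivative zero
  and is constant almost everywhere. Adding the constant to the primitive gives the continuous
  representative.\<close>

lemma weak_deriv_H1_pair:
  assumes f: "sq_int f" and g: "sq_int g" and w: "has_weak_deriv f g"
  obtains v where "H1_pair v g" "AE x in lborel. f x = v x"
proof -
  obtain u where u: "\<And>x y. x \<le> y \<Longrightarrow> u y - u x = (LINT s:{x..y}|lborel. g s)"
    using ex_primitive[OF g] by metis
  have ul: "locally_integrable u" by (rule locally_integrable_cont[OF primitive_isCont[OF g u]])
  have fl: "locally_integrable f" by (rule locally_integrable_sq_int[OF f])
  obtain c where c: "AE x in lborel. f x - u x = c"
  proof (rule du_bois_reymond[OF locally_integrable_diff[OF fl ul]])
    fix \<phi> assume \<phi>: "test_function \<phi>"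
    show "pairing (\<lambda>x. f x - u x) (deriv \<phi>) = 0"
      using pairing_diff[OF fl ul test_function_deriv[OF \<phi>]] w \<phi> integral_by_parts_test[OF g u ul \<phi>]
      by (simp add: has_weak_deriv_def)
  qed
  define v where "v x = u x + c" for x
  have AE: "AE x in lborel. f x = v x" using c by eventually_elim (auto simp: v_def)
  have vm: "v \<in> borel_measurable borel"
    using ul unfolding v_def[abs_def] locally_integrable_def by (auto intro: borel_measurable_add)
  have "sq_int v"
    unfolding sq_int_def
  proof
    have "integrable lborel (\<lambda>x. (norm (f x))\<^sup>2) \<longleftrightarrow> integrable lborel (\<lambda>x. (norm (v x))\<^sup>2)"
      by (rule integrable_cong_AE) (use AE vm sq_int_meas[OF f] in auto)
    then show "integrable lborel (\<lambda>x. (norm (v x))\<^sup>2)" using sq_int_integrable[OF f] by simp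
  qed (rule vm)
  then have "H1_pair v g" unfolding H1_pair_def using g u by (simp add: v_def)
  then show thesis using AE by (rule that)
qed

text \<open>Makes the choice operator in \<open>weak_deriv\<close> harmless: all candidates agree
  almost everywhere.\<close>

lemma weak_deriv_unique:
  assumes "sq_int g" "sq_int h" "has_weak_deriv f g" "has_weak_deriv f h"
  shows "AE x in lborel. g x = h x"
proof -
  have gl: "locally_integrable g" "locally_integrable h" using assms by (auto intro: locally_integrable_sq_int)
  have "AE x in lborel. g x - h x = 0"
  proof (rule fundamental_lemma[OF locally_integrable_diff[OF gl]])
    fix \<phi> assume "test_function \<phi>"
    then show "pairing (\<lambda>x. g x - h x) \<phi> = 0"
      using pairing_diff[OF gl] assms(3,4) by (simp add: has_weak_deriv_def)
  qed
  then show ?thesis by simp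
qed

lemma L2_sq_int: "L2 f \<longleftrightarrow> sq_int f"
  by (simp add: L2_def sq_int_def)

lemma L2_sq_sqn: "L2_sq f = sqn f"
  by (simp add: L2_sq_def sqn_def)

lemma has_weak_deriv_cong_AE:
  assumes "f \<in> borel_measurable borel" "f' \<in> borel_measurable borel" "AE x in lborel. f x = f' x"
  shows "has_weak_deriv f g \<longleftrightarrow> has_weak_deriv f' g"
  unfolding has_weak_deriv_def using pairing_cong_AE[OF assms test_function_deriv] by simp

section \<open>Triples and their continuous representatives\<close>

text \<open>\<open>v\<close> collects the continuous representatives of the components of \<open>u\<close>.\<close>

definition represents :: "triple \<Rightarrow> (real \<Rightarrow> complex ^ 3) \<Rightarrow> (real \<Rightarrow> complex ^ 3) \<Rightarrow> bool" where
  "represents u v g \<longleftrightarrow> H1_pair v g \<and> (\<forall>i. u $ i \<in> borel_measurable borel) \<and> (\<forall>i. AE x in lborel. (u $ i) x = v x $ i)"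

lemma representsD:
  assumes "represents u v g"
  shows "H1_pair v g" "u $ i \<in> borel_measurable borel" "AE x in lborel. (u $ i) x = v x $ i"
  using assms by (auto simp: represents_def)

lemma represents_component:
  assumes r: "represents u v g"
  shows "sq_int (u $ i)" "has_weak_deriv (u $ i) (\<lambda>x. g x $ i)" "u $ i \<in> H1"
    "AE x in lborel. weak_deriv (u $ i) x = g x $ i" "weak_deriv (u $ i) \<in> borel_measurable borel"
proof -
  note v = H1_pair_nth[OF representsD(1)[OF r], of i]
  note vi = H1_pairD(1)[OF v] and gi = H1_pairD(2)[OF v]
  note [measurable] = representsD(2)[OF r, of i] sq_int_meas[OF vi]
  have "integrable lborel (\<lambda>x. (norm ((u $ i) x))\<^sup>2) \<longleftrightarrow> integrable lborel (\<lambda>x. (norm (v x $ i))\<^sup>2)"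
    by (rule integrable_cong_AE) (use representsD(3)[OF r, of i] in auto)
  then show sq: "sq_int (u $ i)" using sq_int_integrable[OF vi] representsD(2)[OF r, of i] by (simp add: sq_int_def)
  show wd: "has_weak_deriv (u $ i) (\<lambda>x. g x $ i)"
    using has_weak_deriv_cong_AE[OF representsD(2)[OF r] sq_int_meas[OF vi] representsD(3)[OF r]] H1_pair_weak_deriv[OF v] by simp
  show "u $ i \<in> H1" unfolding H1_def L2_sq_int using sq wd gi by blast
  have "L2 (weak_deriv (u $ i)) \<and> has_weak_deriv (u $ i) (weak_deriv (u $ i))"
    unfolding weak_deriv_def by (rule someI[of "\<lambda>g. L2 g \<and> has_weak_deriv (u $ i) g" "\<lambda>x. g x $ i"]) (use gi wd L2_sq_int in blast)
  then have w: "sq_int (weak_deriv (u $ i))" "has_weak_deriv (u $ i) (weak_deriv (u $ i))" by (auto simp: L2_sq_int)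
  show "AE x in lborel. weak_deriv (u $ i) x = g x $ i" by (rule weak_deriv_unique[OF w(1) gi w(2) wd])
  show "weak_deriv (u $ i) \<in> borel_measurable borel" by (rule sq_int_meas[OF w(1)])
qed

lemma represents_sqn:
  assumes r: "represents u v g"
  shows "L2_sq (u $ i) = sqn (\<lambda>x. v x $ i)" "L2_sq (weak_deriv (u $ i)) = sqn (\<lambda>x. g x $ i)"
proof -
  note v = H1_pair_nth[OF representsD(1)[OF r], of i]
  show "L2_sq (u $ i) = sqn (\<lambda>x. v x $ i)"
    unfolding L2_sq_sqn by (rule sqn_cong_AE[OF representsD(2)[OF r] sq_int_meas[OF H1_pairD(1)[OF v]] representsD(3)[OF r]])
  show "L2_sq (weak_deriv (u $ i)) = sqn (\<lambda>x. g x $ i)"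
    unfolding L2_sq_sqn by (rule sqn_cong_AE[OF represents_component(5)[OF r] sq_int_meas[OF H1_pairD(2)[OF v]] represents_component(4)[OF r]])
qed

lemma represents_norm:
  assumes r: "represents u v g"
  shows "H1_3_norm u = sqrt (sqn v + sqn g)" "Q1 u = mass1 v" "Q2 u = mass2 v" "u \<in> H1_3"
proof -
  note v = representsD(1)[OF r]
  show "H1_3_norm u = sqrt (sqn v + sqn g)"
    unfolding H1_3_norm_def represents_sqn[OF r] sqn_components[OF H1_pairD(1)[OF v]] sqn_components[OF H1_pairD(2)[OF v]]
    by (simp add: sum_3 algebra_simps)
  show "Q1 u = mass1 v" "Q2 u = mass2 v" unfolding Q1_def Q2_def mass1_def mass2_def represents_sqn[OF r] by simp_all
  show "u \<in> H1_3" unfolding H1_3_def using represents_component(3)[OF r] by simp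
qed

lemma represents_diff:
  assumes "represents u v g" "represents w z h"
  shows "represents (u - w) (\<lambda>x. v x - z x) (\<lambda>x. g x - h x)"
  unfolding represents_def
proof (intro conjI allI)
  show "H1_pair (\<lambda>x. v x - z x) (\<lambda>x. g x - h x)" by (rule H1_pair_diff[OF representsD(1)[OF assms(1)] representsD(1)[OF assms(2)]])
  fix i
  have e: "(u - w) $ i = (\<lambda>x. (u $ i) x - (w $ i) x)" by (simp add: fun_eq_iff)
  show "(u - w) $ i \<in> borel_measurable borel"
    unfolding e using representsD(2)[OF assms(1)] representsD(2)[OF assms(2)] by (intro borel_measurable_diff)
  show "AE x in lborel. ((u - w) $ i) x = (v x - z x) $ i"
    using representsD(3)[OF assms(1), of i] representsD(3)[OF assms(2), of i] by eventually_elim (simp add: e)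
qed

lemma represents_exists:
  assumes "u \<in> H1_3"
  obtains v g where "represents u v g"
proof -
  have "\<exists>v g. sq_int (u $ i) \<and> H1_pair v g \<and> (AE x in lborel. (u $ i) x = v x)" for i
  proof -
    have "u $ i \<in> H1" using assms by (simp add: H1_3_def)
    then obtain g where g: "sq_int (u $ i)" "sq_int g" "has_weak_deriv (u $ i) g" by (auto simp: H1_def L2_sq_int)
    obtain v where "H1_pair v g" "AE x in lborel. (u $ i) x = v x" by (rule weak_deriv_H1_pair[OF g]) (rule that, assumption+)
    then show ?thesis using g(1) by blast
  qed
  then obtain v g where vg: "\<And>i. sq_int (u $ i)" "\<And>i. H1_pair (v i) (g i)" "\<And>i. AE x in lborel. (u $ i) x = v i x" by metis
  have "H1_pair (\<lambda>x. vec3 (v 1 x) (v 2 x) (v 3 x)) (\<lambda>x. vec3 (g 1 x) (g 2 x) (g 3 x))"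
    by (intro H1_pair_vec3 vg)
  moreover have "AE x in lborel. (u $ i) x = vec3 (v 1 x) (v 2 x) (v 3 x) $ i" for i
    using exhaust_3[of i] vg(3)[of 1] vg(3)[of 2] vg(3)[of 3] by auto
  ultimately have "represents u (\<lambda>x. vec3 (v 1 x) (v 2 x) (v 3 x)) (\<lambda>x. vec3 (g 1 x) (g 2 x) (g 3 x))"
    using sq_int_meas[OF vg(1)] by (simp add: represents_def)
  then show thesis by (rule that)
qed

lemma represents_triple:
  assumes "H1_pair v g"
  shows "represents (\<chi> i. (\<lambda>x. v x $ i)) v g"
  unfolding represents_def using assms sq_int_meas[OF sq_int_nth[OF H1_pairD(1)[OF assms]]] by simp

text \<open>Almost everywhere equal triples share their representative, hence all norms, masses and
  energies.\<close>

lemma represents_ae_eq: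
  assumes "represents u v g" "ae_eq w u" "w \<in> H1_3"
  shows "represents w v g"
  unfolding represents_def
proof (intro conjI allI)
  show "H1_pair v g" by (rule representsD(1)[OF assms(1)])
  fix i
  have "w $ i \<in> H1" using assms(3) by (simp add: H1_3_def)
  then show "w $ i \<in> borel_measurable borel" by (auto simp: H1_def L2_sq_int dest: sq_int_meas)
  have "AE x in lborel. (w $ i) x = (u $ i) x" using assms(2) by (simp add: ae_eq_def)
  then show "AE x in lborel. (w $ i) x = v x $ i" using representsD(3)[OF assms(1), of i] by eventually_elim simp
qed

context three_wave
begin

text \<open>One side integrates the sum of the power and coupling terms, the other integrates them
  separately. Each term is integrable because the representative is bounded and square
  integrable.\<close>

lemma represents_energy:
  assumes r: "represents u v g"
  shows "energy \<alpha> \<beta> p u = E v g"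
proof -
  note v = representsD(1)[OF r]
  note vq = H1_pairD(1)[OF v]
  have [measurable]: "u $ i \<in> borel_measurable borel" for i by (rule representsD(2)[OF r])
  have [measurable]: "(\<lambda>x. v x $ i) \<in> borel_measurable borel" for i by (rule sq_int_meas[OF sq_int_nth[OF vq]])
  have cm[measurable]: "(\<lambda>x. cnj (f x)) \<in> borel_measurable borel" if "f \<in> borel_measurable borel" for f :: "real \<Rightarrow> complex"
    by (rule borel_measurable_continuous_on[OF _ that]) (intro continuous_intros)
  define S where "S = 2 * sqrt (max (sqn v) (sqn g))"
  have bd: "norm (v x) \<le> S" for x unfolding S_def by (rule H1_pair_bdd[OF v max.cobounded1 max.cobounded2])
  have S0: "0 \<le> S" using bd[of 0] norm_ge_zero order.trans by blast
  have pw: "(\<integral>x. cmod ((u $ i) x) powr (p + 1) \<partial>lborel) = (\<integral>x. cmod (v x $ i) powr (p + 1) \<partial>lborel)" for i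
    by (rule integral_cong_AE) (use representsD(3)[OF r, of i] in auto)
  have tr: "(\<integral>x. (u $ 1) x * (u $ 2) x * cnj ((u $ 3) x) \<partial>lborel) = (\<integral>x. v x $ 1 * v x $ 2 * cnj (v x $ 3) \<partial>lborel)"
  proof (rule integral_cong_AE)
    show "(\<lambda>x. (u $ 1) x * (u $ 2) x * cnj ((u $ 3) x)) \<in> borel_measurable lborel"
      using cm[of "u $ 3"] by measurable
    show "(\<lambda>x. v x $ 1 * v x $ 2 * cnj (v x $ 3)) \<in> borel_measurable lborel"
      using cm[of "\<lambda>x. v x $ 3"] by measurable
    show "AE x in lborel. (u $ 1) x * (u $ 2) x * cnj ((u $ 3) x) = v x $ 1 * v x $ 2 * cnj (v x $ 3)"
      using representsD(3)[OF r, of 1] representsD(3)[OF r, of 2] representsD(3)[OF r, of 3] by eventually_elim simp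
  qed
  have sqi: "integrable lborel (\<lambda>x. (norm (v x))\<^sup>2)" by (rule sq_int_integrable[OF vq])
  have pi: "integrable lborel (\<lambda>x. cmod (v x $ i) powr (p + 1))" for i
  proof (rule Bochner_Integration.integrable_bound)
    show "integrable lborel (\<lambda>x. S powr (p - 1) * (norm (v x))\<^sup>2)" using sqi by simp
    show "AE x in lborel. norm (cmod (v x $ i) powr (p + 1)) \<le> norm (S powr (p - 1) * (norm (v x))\<^sup>2)"
    proof (rule AE_I2)
      fix x
      have "cmod (v x $ i) powr (p + 1) \<le> norm (v x) powr (p + 1)"
        using p1 by (intro powr_mono2 Finite_Cartesian_Product.norm_nth_le) auto
      also have "\<dots> = norm (v x) powr (p - 1) * (norm (v x))\<^sup>2"
        using powr_add[of "norm (v x)" "p - 1" 2] by (cases "v x = 0") (simp_all add: powr_numeral add.commute)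
      also have "\<dots> \<le> S powr (p - 1) * (norm (v x))\<^sup>2"
        using p1 bd by (intro mult_right_mono powr_mono2) auto
      finally show "norm (cmod (v x $ i) powr (p + 1)) \<le> norm (S powr (p - 1) * (norm (v x))\<^sup>2)" by simp
    qed
  qed measurable
  have ti: "integrable lborel (\<lambda>x. v x $ 1 * v x $ 2 * cnj (v x $ 3))"
  proof (rule Bochner_Integration.integrable_bound)
    show "integrable lborel (\<lambda>x. S * (norm (v x))\<^sup>2)" using sqi by simp
    show "(\<lambda>x. v x $ 1 * v x $ 2 * cnj (v x $ 3)) \<in> borel_measurable lborel"
      using cm[of "\<lambda>x. v x $ 3"] by measurable
    show "AE x in lborel. norm (v x $ 1 * v x $ 2 * cnj (v x $ 3)) \<le> norm (S * (norm (v x))\<^sup>2)"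
    proof (rule AE_I2)
      fix x
      have "cmod (v x $ 1) * cmod (v x $ 2) * cmod (v x $ 3) \<le> S * norm (v x) * norm (v x)"
        using S0 by (intro mult_mono order.trans[OF Finite_Cartesian_Product.norm_nth_le bd] Finite_Cartesian_Product.norm_nth_le) auto
      then show "norm (v x $ 1 * v x $ 2 * cnj (v x $ 3)) \<le> norm (S * (norm (v x))\<^sup>2)"
        using S0 by (simp add: norm_mult power2_eq_square mult.assoc)
    qed
  qed
  have "potential v = \<beta> / (p + 1) * (\<Sum>i\<in>UNIV. \<integral>x. cmod (v x $ i) powr (p + 1) \<partial>lborel)
    + \<alpha> * Re (\<integral>x. v x $ 1 * v x $ 2 * cnj (v x $ 3) \<partial>lborel)"
  proof -
    have s: "integrable lborel (\<lambda>x. \<Sum>i\<in>UNIV. cmod (v x $ i) powr (p + 1))"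
      by (rule Bochner_Integration.integrable_sum[OF pi])
    have t: "integrable lborel (\<lambda>x. Re (v x $ 1 * v x $ 2 * cnj (v x $ 3)))"
      by (rule integrable_bounded_linear[OF bounded_linear_Re ti])
    have "potential v = (\<integral>x. \<beta> / (p + 1) * (\<Sum>i\<in>UNIV. cmod (v x $ i) powr (p + 1)) \<partial>lborel)
       + (\<integral>x. \<alpha> * Re (v x $ 1 * v x $ 2 * cnj (v x $ 3)) \<partial>lborel)"
      unfolding potential_def F_def
      by (rule Bochner_Integration.integral_add[OF integrable_mult_right[OF s] integrable_mult_right[OF t]])
    also have "(\<integral>x. \<beta> / (p + 1) * (\<Sum>i\<in>UNIV. cmod (v x $ i) powr (p + 1)) \<partial>lborel)
      = \<beta> / (p + 1) * (\<Sum>i\<in>UNIV. \<integral>x. cmod (v x $ i) powr (p + 1) \<partial>lborel)"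
      by (simp only: integral_mult_right_zero Bochner_Integration.integral_sum[OF pi])
    also have "(\<integral>x. \<alpha> * Re (v x $ 1 * v x $ 2 * cnj (v x $ 3)) \<partial>lborel) = \<alpha> * Re (\<integral>x. v x $ 1 * v x $ 2 * cnj (v x $ 3) \<partial>lborel)"
      by (simp only: integral_mult_right_zero integral_bounded_linear[OF bounded_linear_Re ti])
    finally show ?thesis .
  qed
  then show ?thesis
    unfolding energy_def E_def pw tr represents_sqn[OF r] sqn_components[OF H1_pairD(2)[OF v]]
    by (simp add: sum_3 distrib_left algebra_simps)
qed

lemma J_Jmin: "J \<alpha> \<beta> p \<gamma> \<mu> = Jmin \<gamma> \<mu>"
proof -
  have "energy \<alpha> \<beta> p ` admissible \<gamma> \<mu> = competitors \<gamma> \<mu>"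
  proof
    show "energy \<alpha> \<beta> p ` admissible \<gamma> \<mu> \<subseteq> competitors \<gamma> \<mu>"
    proof
      fix y assume "y \<in> energy \<alpha> \<beta> p ` admissible \<gamma> \<mu>"
      then obtain u where u: "y = energy \<alpha> \<beta> p u" "u \<in> H1_3" "Q1 u = \<gamma>" "Q2 u = \<mu>" by (auto simp: admissible_def)
      obtain v g where r: "represents u v g" by (rule represents_exists[OF u(2)])
      show "y \<in> competitors \<gamma> \<mu>"
        unfolding competitors_def using u represents_norm[OF r] represents_energy[OF r] representsD(1)[OF r]
        by (intro CollectI exI[of _ v] exI[of _ g]) simp
    qed
    show "competitors \<gamma> \<mu> \<subseteq> energy \<alpha> \<beta> p ` admissible \<gamma> \<mu>"
    proof
      fix y assume "y \<in> competitors \<gamma> \<mu>"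
      then obtain v g where v: "y = E v g" "H1_pair v g" "mass1 v = \<gamma>" "mass2 v = \<mu>" by (auto simp: competitors_def)
      note r = represents_triple[OF v(2)]
      show "y \<in> energy \<alpha> \<beta> p ` admissible \<gamma> \<mu>"
        unfolding admissible_def using v represents_norm[OF r] represents_energy[OF r]
        by (intro image_eqI[of _ _ "\<chi> i. (\<lambda>x. v x $ i)"]) simp_all
    qed
  qed
  then show ?thesis by (simp add: J_def Jmin_def)
qed

lemma minimizer_represents:
  assumes "represents u v g"
  shows "u \<in> minimizers \<alpha> \<beta> p \<gamma> \<mu> \<longleftrightarrow> mass1 v = \<gamma> \<and> mass2 v = \<mu> \<and> E v g = Jmin \<gamma> \<mu>"
  using represents_norm[OF assms] represents_energy[OF assms] by (auto simp: minimizers_def admissible_def J_Jmin)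

text \<open>A finite distance already implies that M is nonempty, because the infimum is taken in
  the extended nonnegative reals.\<close>

lemma H1_3_dist_less_imp:
  assumes "H1_3_dist u M < ennreal \<delta>"
  obtains \<phi> where "\<phi> \<in> M" "H1_3_norm (u - \<phi>) < \<delta>"
proof -
  have "\<exists>\<phi>\<in>M. ennreal (H1_3_norm (u - \<phi>)) < ennreal \<delta>"
    using assms unfolding H1_3_dist_def INF_less_iff by blast
  then obtain \<phi> where \<phi>: "\<phi> \<in> M" "ennreal (H1_3_norm (u - \<phi>)) < ennreal \<delta>" by blast
  have "0 \<le> H1_3_norm (u - \<phi>)"
    unfolding H1_3_norm_def by (intro real_sqrt_ge_zero sum_nonneg add_nonneg_nonneg) (simp_all add: L2_sq_sqn)
  then have "H1_3_norm (u - \<phi>) < \<delta>" using \<phi>(2) by (simp add: ennreal_less_iff)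
  then show thesis using \<phi>(1) that by blast
qed

lemma H1_3_dist_le: "\<phi> \<in> M \<Longrightarrow> H1_3_dist u M \<le> ennreal (H1_3_norm (u - \<phi>))"
  unfolding H1_3_dist_def by (rule INF_lower)

text \<open>On bounded sets the squared norm is Lipschitz with constant 2 sqrt K, since |a^2 - b^2|
  = |a - b| |a + b|. Each mass consists of two such terms; the gradient enters the energy with
  factor 1/2.\<close>

lemma E_close:
  assumes u: "H1_pair u g" "sqn u \<le> K" "sqn g \<le> K" and v: "H1_pair v h" "sqn v \<le> K" "sqn h \<le> K"
    and d: "sqrt (sqn (\<lambda>x. u x - v x) + sqn (\<lambda>x. g x - h x)) \<le> \<delta>"
  shows "\<bar>E u g - E v h\<bar> \<le> (sqrt K + lip (2 * sqrt K) * (2 * sqrt K)) * \<delta>"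
    "\<bar>mass1 u - mass1 v\<bar> \<le> 4 * sqrt K * \<delta>" "\<bar>mass2 u - mass2 v\<bar> \<le> 4 * sqrt K * \<delta>"
proof -
  note uq = H1_pairD(1)[OF u(1)] and gq = H1_pairD(2)[OF u(1)] and vq = H1_pairD(1)[OF v(1)] and hq = H1_pairD(2)[OF v(1)]
  have K0: "0 \<le> K" using u(2) sqn_nonneg[of u] by linarith
  have d1: "sqrt (sqn (\<lambda>x. u x - v x)) \<le> \<delta>" "sqrt (sqn (\<lambda>x. g x - h x)) \<le> \<delta>"
    using d by (auto intro!: order.trans[OF real_sqrt_le_mono d])
  have d0: "0 \<le> \<delta>" using d1(1) real_sqrt_ge_zero[OF sqn_nonneg] order.trans by blast
  have sq: "\<bar>sqn f - sqn k\<bar> \<le> 2 * sqrt K * \<delta>"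
    if "sq_int f" "sq_int k" "sqn f \<le> K" "sqn k \<le> K" "sqrt (sqn (\<lambda>x. f x - k x)) \<le> \<delta>" for f k :: "real \<Rightarrow> 'c::euclidean_space"
  proof -
    have "sqrt (sqn f) \<le> sqrt (sqn (\<lambda>x. f x - k x)) + sqrt (sqn k)" "sqrt (sqn k) \<le> sqrt (sqn (\<lambda>x. f x - k x)) + sqrt (sqn f)"
      using sqrt_sqn_add[OF sq_int_diff[OF that(1,2)] that(2)] sqrt_sqn_diff[OF that(1) sq_int_diff[OF that(1,2)]] by simp_all
    then have a: "\<bar>sqrt (sqn f) - sqrt (sqn k)\<bar> \<le> \<delta>" using that(5) by linarith
    have "sqrt (sqn f) + sqrt (sqn k) \<le> 2 * sqrt K"
      using real_sqrt_le_mono[OF that(3)] real_sqrt_le_mono[OF that(4)] by linarith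
    then have b: "\<bar>sqrt (sqn f) + sqrt (sqn k)\<bar> \<le> 2 * sqrt K" by (subst abs_of_nonneg) simp_all
    have "sqn f - sqn k = (sqrt (sqn f) - sqrt (sqn k)) * (sqrt (sqn f) + sqrt (sqn k))"
      by (simp add: algebra_simps)
    then have "\<bar>sqn f - sqn k\<bar> = \<bar>sqrt (sqn f) - sqrt (sqn k)\<bar> * \<bar>sqrt (sqn f) + sqrt (sqn k)\<bar>" by (simp only: abs_mult)
    also have "\<dots> \<le> \<delta> * (2 * sqrt K)" using a b d0 by (intro mult_mono) auto
    finally show ?thesis by (simp add: mult_ac)
  qed
  have "\<bar>potential u - potential v\<bar> \<le> lip (2 * sqrt K) * (sqrt (sqn (\<lambda>x. u x - v x)) * (sqrt (sqn u) + sqrt (sqn v)))"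
    by (rule potential_lipschitz[OF uq vq H1_pair_bdd[OF u] H1_pair_bdd[OF v]])
  also have "\<dots> \<le> lip (2 * sqrt K) * (\<delta> * (sqrt K + sqrt K))"
    using d1(1) d0 u v K0 by (intro mult_left_mono mult_mono add_mono lip_nonneg) auto
  finally have P: "\<bar>potential u - potential v\<bar> \<le> lip (2 * sqrt K) * (2 * sqrt K) * \<delta>" by (simp add: mult_ac)
  have "\<bar>sqn g - sqn h\<bar> \<le> 2 * sqrt K * \<delta>" by (rule sq[OF gq hq u(3) v(3) d1(2)])
  with P show "\<bar>E u g - E v h\<bar> \<le> (sqrt K + lip (2 * sqrt K) * (2 * sqrt K)) * \<delta>"
    unfolding E_def distrib_right by linarith
  have c: "\<bar>sqn (\<lambda>x. u x $ i) - sqn (\<lambda>x. v x $ i)\<bar> \<le> 2 * sqrt K * \<delta>" for i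
  proof (rule sq[OF sq_int_nth[OF uq] sq_int_nth[OF vq]])
    show "sqn (\<lambda>x. u x $ i) \<le> K" "sqn (\<lambda>x. v x $ i) \<le> K" using sqn_nth_le[OF uq, of i] sqn_nth_le[OF vq, of i] u v by linarith+
    have "sqrt (sqn (\<lambda>x. (u x - v x) $ i)) \<le> sqrt (sqn (\<lambda>x. u x - v x))"
      by (intro real_sqrt_le_mono sqn_nth_le sq_int_diff uq vq)
    from order.trans[OF this d1(1)] show "sqrt (sqn (\<lambda>x. u x $ i - v x $ i)) \<le> \<delta>" by simp
  qed
  show "\<bar>mass1 u - mass1 v\<bar> \<le> 4 * sqrt K * \<delta>" "\<bar>mass2 u - mass2 v\<bar> \<le> 4 * sqrt K * \<delta>"
    using c[of 1] c[of 2] c[of 3] unfolding mass1_def mass2_def by linarith+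
qed

end

section \<open>From compactness to stability\<close>

text \<open>Well-posedness provides one solution obeying the conservation laws. Any other solution
  with the same data agrees with it almost everywhere at each time and so inherits them through the
  common representative.\<close>

lemma global_solution_conserves:
  assumes wp: "globally_well_posed \<alpha> \<beta> p" and loc: "three_wave \<alpha> \<beta> p"
    and u0: "u0 \<in> H1_3" and u: "global_solution \<alpha> \<beta> p u0 u" and t: "0 \<le> t"
  shows "u t \<in> H1_3" "energy \<alpha> \<beta> p (u t) = energy \<alpha> \<beta> p u0" "Q1 (u t) = Q1 u0" "Q2 (u t) = Q2 u0"
proof -
  interpret three_wave \<alpha> \<beta> p by (rule loc)
  obtain w where w: "global_solution \<alpha> \<beta> p u0 w" "\<And>v. global_solution \<alpha> \<beta> p u0 v \<Longrightarrow> (\<forall>t\<ge>0. ae_eq (v t) (w t))"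
    "\<forall>t\<ge>0. energy \<alpha> \<beta> p (w t) = energy \<alpha> \<beta> p u0 \<and> Q1 (w t) = Q1 u0 \<and> Q2 (w t) = Q2 u0"
    using wp u0 unfolding globally_well_posed_def by blast
  have ut: "u t \<in> H1_3" and wt: "w t \<in> H1_3"
    using u w(1) t by (auto simp: global_solution_def continuous_into_H1_3_def)
  have ae: "ae_eq (u t) (w t)" using w(2)[OF u] t by blast
  obtain v g where r: "represents (w t) v g" by (rule represents_exists[OF wt])
  have r': "represents (u t) v g" by (rule represents_ae_eq[OF r ae ut])
  have eq: "energy \<alpha> \<beta> p (w t) = energy \<alpha> \<beta> p u0" "Q1 (w t) = Q1 u0" "Q2 (w t) = Q2 u0" using w(3) t by auto
  show "u t \<in> H1_3" by (rule ut)
  show "energy \<alpha> \<beta> p (u t) = energy \<alpha> \<beta> p u0" using represents_energy[OF r] represents_energy[OF r'] eq(1) by simp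
  show "Q1 (u t) = Q1 u0" using represents_norm(2)[OF r] represents_norm(2)[OF r'] eq(2) by simp
  show "Q2 (u t) = Q2 u0" using represents_norm(3)[OF r] represents_norm(3)[OF r'] eq(3) by simp
qed

context three_wave
begin

text \<open>The states z n inherit energy and masses from data approaching the set of minimizers, so
  they form a minimizing sequence with convergent masses. By compactness some z n is close to a
  translate of a minimizer, which is a minimizer itself.\<close>

lemma minimizers_stable_along_sequence:
  assumes pos: "\<gamma> > 0" "\<mu> > 0"
    and z: "\<And>n. z n \<in> H1_3" and u0: "\<And>n. u0 n \<in> H1_3"
    and cons: "\<And>n. energy \<alpha> \<beta> p (z n) = energy \<alpha> \<beta> p (u0 n)" "\<And>n. Q1 (z n) = Q1 (u0 n)" "\<And>n. Q2 (z n) = Q2 (u0 n)"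
    and near: "\<And>n. H1_3_dist (u0 n) (minimizers \<alpha> \<beta> p \<gamma> \<mu>) < ennreal (1 / Suc n)" and \<epsilon>: "\<epsilon> > 0"
  shows "\<exists>n. H1_3_dist (z n) (minimizers \<alpha> \<beta> p \<gamma> \<mu>) < ennreal \<epsilon>"
proof -
  obtain K1 where K1: "\<And>u g. H1_pair u g \<Longrightarrow> sqn u \<le> \<gamma> + \<mu> \<Longrightarrow> E u g \<le> Jmin \<gamma> \<mu> \<Longrightarrow> sqn g \<le> K1"
    using coercive[of "\<gamma> + \<mu>" "Jmin \<gamma> \<mu>"] by blast
  obtain M where mx: "\<gamma> + \<mu> \<le> M" "K1 \<le> M" "0 \<le> M"
    using pos by (rule_tac that[of "max (\<gamma> + \<mu>) K1"]) (auto simp: le_max_iff_disj)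
  \<comment> \<open>The data lie within distance 1 of a minimizer whose squared norms are at most M,
    hence the bound 2 + 2 M.\<close>
  define K where "K = 2 + 2 * M"
  define C where "C = (sqrt K + lip (2 * sqrt K) * (2 * sqrt K)) + 4 * sqrt K"
  have K0: "0 \<le> K" using mx by (simp add: K_def)
  have l0: "0 \<le> lip (2 * sqrt K) * (2 * sqrt K)" using K0 by (intro mult_nonneg_nonneg lip_nonneg) auto
  have "\<exists>Z G. represents (z n) Z G \<and> \<bar>E Z G - Jmin \<gamma> \<mu>\<bar> \<le> C * (1 / Suc n) \<and> \<bar>mass1 Z - \<gamma>\<bar> \<le> C * (1 / Suc n) \<and> \<bar>mass2 Z - \<mu>\<bar> \<le> C * (1 / Suc n)" for n
  proof -
    obtain \<phi> where \<phi>: "\<phi> \<in> minimizers \<alpha> \<beta> p \<gamma> \<mu>" "H1_3_norm (u0 n - \<phi>) < 1 / Suc n"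
      by (rule H1_3_dist_less_imp[OF near])
    have "\<phi> \<in> H1_3" using \<phi>(1) by (simp add: minimizers_def admissible_def)
    then obtain v h where r\<phi>: "represents \<phi> v h" by (rule represents_exists)
    obtain w k where ru: "represents (u0 n) w k" by (rule represents_exists[OF u0])
    obtain Z G where rz: "represents (z n) Z G" by (rule represents_exists[OF z])
    have mv: "mass1 v = \<gamma>" "mass2 v = \<mu>" "E v h = Jmin \<gamma> \<mu>" using \<phi>(1) minimizer_represents[OF r\<phi>] by auto
    note v = representsD(1)[OF r\<phi>] and w = representsD(1)[OF ru]
    have sv: "sqn v \<le> \<gamma> + \<mu>" using sqn_le_mass[OF H1_pairD(1)[OF v]] mv by simp
    have sh: "sqn h \<le> K1" using K1[OF v sv] mv by simp
    have vK: "sqn v \<le> K" "sqn h \<le> K" using sv sh mx unfolding K_def by linarith+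
    have d: "sqrt (sqn (\<lambda>x. w x - v x) + sqn (\<lambda>x. k x - h x)) \<le> 1 / Suc n"
      using \<phi>(2) represents_norm(1)[OF represents_diff[OF ru r\<phi>]] by simp
    have "sqrt (sqn (\<lambda>x. w x - v x) + sqn (\<lambda>x. k x - h x)) \<le> 1"
      by (rule order.trans[OF d]) simp
    then have d1: "sqn (\<lambda>x. w x - v x) + sqn (\<lambda>x. k x - h x) \<le> 1" by simp
    have wK: "sqn w \<le> K" "sqn k \<le> K"
    proof -
      have "sqn w \<le> 2 * sqn (\<lambda>x. w x - v x) + 2 * sqn v"
        using sqn_add_le[OF sq_int_diff[OF H1_pairD(1)[OF w] H1_pairD(1)[OF v]] H1_pairD(1)[OF v]] by simp
      then show "sqn w \<le> K" using d1 sv mx sqn_nonneg[of "\<lambda>x. k x - h x"] unfolding K_def by linarith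
      have "sqn k \<le> 2 * sqn (\<lambda>x. k x - h x) + 2 * sqn h"
        using sqn_add_le[OF sq_int_diff[OF H1_pairD(2)[OF w] H1_pairD(2)[OF v]] H1_pairD(2)[OF v]] by simp
      then show "sqn k \<le> K" using d1 sh mx sqn_nonneg[of "\<lambda>x. w x - v x"] unfolding K_def by linarith
    qed
    note cl = E_close[OF w wK v vK d]
    have mono: "(sqrt K + lip (2 * sqrt K) * (2 * sqrt K)) * (1 / Suc n) \<le> C * (1 / Suc n)" "4 * sqrt K * (1 / Suc n) \<le> C * (1 / Suc n)"
      using K0 l0 unfolding C_def by (intro mult_right_mono; simp)+
    have eqs: "E Z G = E w k" "mass1 Z = mass1 w" "mass2 Z = mass2 w"
      using cons[of n] represents_energy[OF rz] represents_energy[OF ru] represents_norm[OF rz] represents_norm[OF ru] by simp_all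
    show ?thesis
      using rz cl mono mv unfolding eqs[symmetric] by (intro exI[of _ Z] exI[of _ G]) auto
  qed
  then obtain Z G where ZG: "\<And>n. represents (z n) (Z n) (G n)"
    and cE: "\<And>n. \<bar>E (Z n) (G n) - Jmin \<gamma> \<mu>\<bar> \<le> C * (1 / Suc n)"
    and c1: "\<And>n. \<bar>mass1 (Z n) - \<gamma>\<bar> \<le> C * (1 / Suc n)" and c2: "\<And>n. \<bar>mass2 (Z n) - \<mu>\<bar> \<le> C * (1 / Suc n)"
    by metis
  have "(\<lambda>n. C * (1 / Suc n)) \<longlonglongrightarrow> C * 0"
    by (intro tendsto_intros LIMSEQ_inverse_real_of_nat[unfolded inverse_eq_divide])
  then have cz: "(\<lambda>n. C * (1 / Suc n)) \<longlonglongrightarrow> 0" by simp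
  have conv: "f \<longlonglongrightarrow> l" if "\<And>n. \<bar>f n - l\<bar> \<le> C * (1 / Suc n)" for f l
    by (rule LIM_zero_cancel, rule Lim_null_comparison[OF always_eventually cz]) (use that in simp)
  note Zp = representsD(1)[OF ZG]
  obtain r y v h where v: "H1_pair v h" and mv: "mass1 v = \<gamma>" "mass2 v = \<mu>" "E v h = Jmin \<gamma> \<mu>"
    and lim: "(\<lambda>n. sqn (\<lambda>x. Z (r n) (x + y n) - v x) + sqn (\<lambda>x. G (r n) (x + y n) - h x)) \<longlonglongrightarrow> 0"
    using minimizing_compact[OF Zp conv[OF c1] conv[OF c2] conv[OF cE]] pos by auto
  have "0 < \<epsilon>\<^sup>2" using \<epsilon> by simp
  from order_tendstoD(2)[OF lim this] obtain n where
    n: "sqn (\<lambda>x. Z (r n) (x + y n) - v x) + sqn (\<lambda>x. G (r n) (x + y n) - h x) < \<epsilon>\<^sup>2"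
    by (auto simp: eventually_sequentially)
  let ?v = "\<lambda>x. v (x + (- y n))" and ?h = "\<lambda>x. h (x + (- y n))"
  \<comment> \<open>The limit is translated back, so that it is compared with z (r n)
    itself.\<close>
  define \<phi> where "\<phi> = (\<chi> i. (\<lambda>x. ?v x $ i))"
  have r\<phi>: "represents \<phi> ?v ?h" unfolding \<phi>_def by (rule represents_triple[OF H1_pair_translate[OF v]])
  have \<phi>M: "\<phi> \<in> minimizers \<alpha> \<beta> p \<gamma> \<mu>"
    unfolding minimizer_represents[OF r\<phi>] mass_translate E_translate using mv by simp
  have "H1_3_norm (z (r n) - \<phi>) = sqrt (sqn (\<lambda>x. Z (r n) x - ?v x) + sqn (\<lambda>x. G (r n) x - ?h x))"
    by (rule represents_norm(1)[OF represents_diff[OF ZG r\<phi>]])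
  also have "sqn (\<lambda>x. Z (r n) x - ?v x) = sqn (\<lambda>x. Z (r n) (x + y n) - v x)"
    using sqn_translate[of "\<lambda>x. Z (r n) x - ?v x" "y n"] by simp
  also have "sqn (\<lambda>x. G (r n) x - ?h x) = sqn (\<lambda>x. G (r n) (x + y n) - h x)"
    using sqn_translate[of "\<lambda>x. G (r n) x - ?h x" "y n"] by simp
  also have "sqrt (sqn (\<lambda>x. Z (r n) (x + y n) - v x) + sqn (\<lambda>x. G (r n) (x + y n) - h x)) < \<epsilon>"
    using real_sqrt_less_mono[OF n] \<epsilon> by simp
  finally have "ennreal (H1_3_norm (z (r n) - \<phi>)) < ennreal \<epsilon>" using \<epsilon> by (simp add: ennreal_lessI)
  then show ?thesis using H1_3_dist_le[OF \<phi>M, of "z (r n)"] by (intro exI[of _ "r n"]) (rule order.strict_trans1)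
qed

end

theorem corollary1p5:
  fixes \<alpha> \<beta> p \<gamma> \<mu> :: real
  assumes "\<alpha> > 0" and "\<beta> > 0" and "\<gamma> > 0" and "\<mu> > 0" and "1 < p" and "p < 5"
    and "globally_well_posed \<alpha> \<beta> p"
  shows "\<forall>\<epsilon>>0. \<exists>\<delta>>0. \<forall>u0\<in>H1_3.
           H1_3_dist u0 (minimizers \<alpha> \<beta> p \<gamma> \<mu>) < ennreal \<delta> \<longrightarrow>
           (\<forall>u. global_solution \<alpha> \<beta> p u0 u \<longrightarrow>
              (\<forall>t\<ge>0. H1_3_dist (u t) (minimizers \<alpha> \<beta> p \<gamma> \<mu>) < ennreal \<epsilon>))"
proof (intro allI impI, rule ccontr)
  fix \<epsilon> :: real
  assume \<epsilon>: "\<epsilon> > 0"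
    and neg: "\<not> (\<exists>\<delta>>0. \<forall>u0\<in>H1_3. H1_3_dist u0 (minimizers \<alpha> \<beta> p \<gamma> \<mu>) < ennreal \<delta> \<longrightarrow>
      (\<forall>u. global_solution \<alpha> \<beta> p u0 u \<longrightarrow> (\<forall>t\<ge>0. H1_3_dist (u t) (minimizers \<alpha> \<beta> p \<gamma> \<mu>) < ennreal \<epsilon>)))"
  let ?M = "minimizers \<alpha> \<beta> p \<gamma> \<mu>"
  have loc: "three_wave \<alpha> \<beta> p" using assms by unfold_locales
  interpret three_wave \<alpha> \<beta> p by (rule loc)
  \<comment> \<open>The counterexample for \<delta> = 1/(n+1) is reduced to its data and its state
    at one bad time; of the dynamics only the conserved quantities are kept.\<close>
  have "\<exists>z u0. z \<in> H1_3 \<and> u0 \<in> H1_3 \<and> energy \<alpha> \<beta> p z = energy \<alpha> \<beta> p u0 \<and> Q1 z = Q1 u0 \<and> Q2 z = Q2 u0 \<and>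
      H1_3_dist u0 ?M < ennreal (1 / Suc n) \<and> \<not> H1_3_dist z ?M < ennreal \<epsilon>" for n
  proof -
    have "1 / real (Suc n) > 0" by simp
    with neg have "\<not> (\<forall>u0\<in>H1_3. H1_3_dist u0 ?M < ennreal (1 / Suc n) \<longrightarrow>
        (\<forall>u. global_solution \<alpha> \<beta> p u0 u \<longrightarrow> (\<forall>t\<ge>0. H1_3_dist (u t) ?M < ennreal \<epsilon>)))" by blast
    then obtain u0 u t where u: "u0 \<in> H1_3" "H1_3_dist u0 ?M < ennreal (1 / Suc n)"
      "global_solution \<alpha> \<beta> p u0 u" "0 \<le> t" "\<not> H1_3_dist (u t) ?M < ennreal \<epsilon>" by auto
    note c = global_solution_conserves[OF assms(7) loc u(1,3,4)]
    show ?thesis by (intro exI[of _ "u t"] exI[of _ u0] conjI c u)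
  qed
  then obtain z u0 where zu: "\<And>n. z n \<in> H1_3" "\<And>n. u0 n \<in> H1_3" "\<And>n. energy \<alpha> \<beta> p (z n) = energy \<alpha> \<beta> p (u0 n)"
    "\<And>n. Q1 (z n) = Q1 (u0 n)" "\<And>n. Q2 (z n) = Q2 (u0 n)" "\<And>n. H1_3_dist (u0 n) ?M < ennreal (1 / Suc n)"
    and far: "\<And>n. \<not> H1_3_dist (z n) ?M < ennreal \<epsilon>"
    by metis
  from minimizers_stable_along_sequence[OF assms(3,4) zu \<epsilon>] far show False by blast
qed

end
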